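(* Given a flat affine manifold $(M,\nabla)$, there exists a connected Lie group $G$ endowed with a flat affine bi-invariant structure and containing a connected Lie subgroup $H$ locally isomorphic to $\mathsf{Aff}(M,\nabla)$.
   Context: $M$ is a connected paracompact real $n$-dimensional manifold. $(M,\nabla)$ is flat affine if the curvature and torsion tensors of the linear connection $\nabla$ both vanish. $\mathsf{Aff}(M,\nabla)$ is the Lie group of affine transformations of $(M,\nabla)$, i.e. diffeomorphisms of $M$ preserving $\nabla$. A flat affine bi-invariant structure on a Lie group is a linear connection on it that is invariant under left and right translations and has vanishing curvature and torsion. Two Lie groups are locally isomorphic if their Lie algebras are isomorphic. *)

theory Defs
  imports "HOL-Analysis.Analysis" "HOL-Algebra.Bij"
begin

section \<open>Smooth functions on open subsets of Euclidean space\<close>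

text \<open>
  Dimensions are ordinary natural numbers (0 included), so real n-space is the library's
  \<^const>\<open>Euclidean_space\<close> \<open>n\<close>: sequences of reals vanishing from index \<open>n\<close> on.
  In \<open>smooth_on n U f\<close>, \<open>U\<close> is meant to be open in that space. The values of \<open>f\<close> outside \<open>U\<close>
  are then irrelevant.
\<close>

definition pderiv_at :: "nat \<Rightarrow> ((nat \<Rightarrow> real) \<Rightarrow> real) \<Rightarrow> (nat \<Rightarrow> real) \<Rightarrow> real"
  where "pderiv_at i f x = deriv (\<lambda>t. f (x(i := t))) (x i)"

primrec Ck_on :: "nat \<Rightarrow> nat \<Rightarrow> (nat \<Rightarrow> real) set \<Rightarrow> ((nat \<Rightarrow> real) \<Rightarrow> real) \<Rightarrow> bool"
  where
    "Ck_on 0 n U f \<longleftrightarrow>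
       continuous_map (subtopology (Euclidean_space n) U) euclideanreal f"
  | "Ck_on (Suc k) n U f \<longleftrightarrow>
       continuous_map (subtopology (Euclidean_space n) U) euclideanreal f \<and>
       (\<forall>i<n. (\<forall>x\<in>U. (\<lambda>t. f (x(i := t))) differentiable (at (x i))) \<and>
              Ck_on k n U (pderiv_at i f))"

definition smooth_on :: "nat \<Rightarrow> (nat \<Rightarrow> real) set \<Rightarrow> ((nat \<Rightarrow> real) \<Rightarrow> real) \<Rightarrow> bool"
  where "smooth_on n U f \<longleftrightarrow> (\<forall>k. Ck_on k n U f)"

section \<open>Manifolds\<close>

record 'a mfd =
  mtop :: "'a topology"
  mdim :: nat
  matlas :: "('a set \<times> ('a \<Rightarrow> nat \<Rightarrow> real)) set"

abbreviation mpoints :: "'a mfd \<Rightarrow> 'a set"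
  where "mpoints M \<equiv> topspace (mtop M)"

text \<open>
  The atlas need not be maximal. Paracompactness is a separate predicate: it is a hypothesis
  on the affine manifold, and it is automatic for Lie groups.
\<close>

definition smooth_manifold :: "'a mfd \<Rightarrow> bool"
  where "smooth_manifold M \<longleftrightarrow>
    Hausdorff_space (mtop M) \<and>
    (\<Union>(U, \<phi>)\<in>matlas M. U) = mpoints M \<and>
    (\<forall>(U, \<phi>)\<in>matlas M.
       openin (mtop M) U \<and>
       openin (Euclidean_space (mdim M)) (\<phi> ` U) \<and>
       homeomorphic_map (subtopology (mtop M) U)
         (subtopology (Euclidean_space (mdim M)) (\<phi> ` U)) \<phi>) \<and>
    (\<forall>(U, \<phi>)\<in>matlas M. \<forall>(V, \<psi>)\<in>matlas M. \<forall>i<mdim M.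
       smooth_on (mdim M) (\<phi> ` (U \<inter> V)) (\<lambda>x. \<psi> (inv_into U \<phi> x) i))"

definition paracompact_space :: "'a topology \<Rightarrow> bool"
  where "paracompact_space X \<longleftrightarrow>
    (\<forall>\<U>. (\<forall>U\<in>\<U>. openin X U) \<and> \<Union>\<U> = topspace X \<longrightarrow>
       (\<exists>\<V>. (\<forall>V\<in>\<V>. openin X V \<and> (\<exists>U\<in>\<U>. V \<subseteq> U)) \<and> \<Union>\<V> = topspace X \<and>
             locally_finite_in X \<V>))"

definition smooth_map :: "'a mfd \<Rightarrow> 'b mfd \<Rightarrow> ('a \<Rightarrow> 'b) \<Rightarrow> bool"
  where "smooth_map M N F \<longleftrightarrow>
    continuous_map (mtop M) (mtop N) F \<and>
    (\<forall>(U, \<phi>)\<in>matlas M. \<forall>(V, \<psi>)\<in>matlas N. \<forall>i<mdim N.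
       smooth_on (mdim M) (\<phi> ` {p \<in> U. F p \<in> V}) (\<lambda>x. \<psi> (F (inv_into U \<phi> x)) i))"

definition prod_mfd :: "'a mfd \<Rightarrow> 'b mfd \<Rightarrow> ('a \<times> 'b) mfd"
  where "prod_mfd M N =
    \<lparr>mtop = prod_topology (mtop M) (mtop N),
     mdim = mdim M + mdim N,
     matlas = {(U \<times> V, \<lambda>(p, q) i. if i < mdim M then \<phi> p i else \<psi> q (i - mdim M)) | U \<phi> V \<psi>.
                 (U, \<phi>) \<in> matlas M \<and> (V, \<psi>) \<in> matlas N}\<rparr>"

section \<open>Functions, vector fields and tangent vectors\<close>

text \<open>
  Smooth functions are extended by 0 outside the manifold, so that equality of functions
  is equality on the manifold. Vector fields are derivations of the algebra of smooth functions,
  and tangent vectors are point derivations. Both are extended by 0 outside that algebra.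
\<close>

definition smooth_funs :: "'a mfd \<Rightarrow> ('a \<Rightarrow> real) set"
  where "smooth_funs M =
    {f. (\<forall>p. p \<notin> mpoints M \<longrightarrow> f p = 0) \<and>
        (\<forall>(U, \<phi>)\<in>matlas M. smooth_on (mdim M) (\<phi> ` U) (\<lambda>x. f (inv_into U \<phi> x)))}"

type_synonym 'a vfield = "('a \<Rightarrow> real) \<Rightarrow> 'a \<Rightarrow> real"

definition vector_fields :: "'a mfd \<Rightarrow> 'a vfield set"
  where "vector_fields M =
    {X. (\<forall>f. f \<notin> smooth_funs M \<longrightarrow> X f = (\<lambda>p. 0)) \<and>
        (\<forall>f\<in>smooth_funs M. X f \<in> smooth_funs M) \<and>
        (\<forall>f\<in>smooth_funs M. \<forall>g\<in>smooth_funs M. \<forall>a.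
           X (\<lambda>p. a * f p + g p) = (\<lambda>p. a * X f p + X g p)) \<and>
        (\<forall>f\<in>smooth_funs M. \<forall>g\<in>smooth_funs M.
           X (\<lambda>p. f p * g p) = (\<lambda>p. X f p * g p + f p * X g p))}"

definition lie_bracket :: "'a vfield \<Rightarrow> 'a vfield \<Rightarrow> 'a vfield"
  where "lie_bracket X Y = (\<lambda>f p. X (Y f) p - Y (X f) p)"

definition tangent_space :: "'a mfd \<Rightarrow> 'a \<Rightarrow> (('a \<Rightarrow> real) \<Rightarrow> real) set"
  where "tangent_space M p =
    {v. (\<forall>f. f \<notin> smooth_funs M \<longrightarrow> v f = 0) \<and>
        (\<forall>f\<in>smooth_funs M. \<forall>g\<in>smooth_funs M. \<forall>a.
           v (\<lambda>q. a * f q + g q) = a * v f + v g) \<and>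
        (\<forall>f\<in>smooth_funs M. \<forall>g\<in>smooth_funs M.
           v (\<lambda>q. f q * g q) = v f * g p + f p * v g)}"

definition pullback :: "'a mfd \<Rightarrow> ('a \<Rightarrow> 'b) \<Rightarrow> ('b \<Rightarrow> real) \<Rightarrow> 'a \<Rightarrow> real"
  where "pullback M F f = (\<lambda>p. if p \<in> mpoints M then f (F p) else 0)"

definition differential ::
    "'a mfd \<Rightarrow> 'b mfd \<Rightarrow> ('a \<Rightarrow> 'b) \<Rightarrow> (('a \<Rightarrow> real) \<Rightarrow> real) \<Rightarrow> ('b \<Rightarrow> real) \<Rightarrow> real"
  where "differential M N F v = (\<lambda>f. if f \<in> smooth_funs N then v (pullback M F f) else 0)"

definition immersion :: "'a mfd \<Rightarrow> 'b mfd \<Rightarrow> ('a \<Rightarrow> 'b) \<Rightarrow> bool"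
  where "immersion M N F \<longleftrightarrow>
    smooth_map M N F \<and> (\<forall>p\<in>mpoints M. inj_on (differential M N F) (tangent_space M p))"

text \<open>Self-diffeomorphisms are elements of \<^const>\<open>Bij\<close>, i.e. undefined outside the manifold.\<close>

definition inverse_on :: "'a set \<Rightarrow> ('a \<Rightarrow> 'a) \<Rightarrow> 'a \<Rightarrow> 'a"
  where "inverse_on S F = (\<lambda>p\<in>S. inv_into S F p)"

definition diffeos :: "'a mfd \<Rightarrow> ('a \<Rightarrow> 'a) set"
  where "diffeos M =
    {F \<in> Bij (mpoints M). smooth_map M M F \<and> smooth_map M M (inverse_on (mpoints M) F)}"

definition pushforward :: "'a mfd \<Rightarrow> ('a \<Rightarrow> 'a) \<Rightarrow> 'a vfield \<Rightarrow> 'a vfield"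
  where "pushforward M F X =
    (\<lambda>f. if f \<in> smooth_funs M
         then pullback M (inverse_on (mpoints M) F) (X (pullback M F f)) else (\<lambda>p. 0))"

section \<open>Linear connections and affine transformations\<close>

type_synonym 'a connection = "'a vfield \<Rightarrow> 'a vfield \<Rightarrow> 'a vfield"

definition linear_connection :: "'a mfd \<Rightarrow> 'a connection \<Rightarrow> bool"
  where "linear_connection M D \<longleftrightarrow>
    (\<forall>X\<in>vector_fields M. \<forall>Y\<in>vector_fields M. D X Y \<in> vector_fields M) \<and>
    (\<forall>X\<in>vector_fields M. \<forall>Y\<in>vector_fields M. \<forall>Z\<in>vector_fields M.
       \<forall>f\<in>smooth_funs M. \<forall>g\<in>smooth_funs M.
       D (\<lambda>h p. f p * X h p + g p * Y h p) Z = (\<lambda>h p. f p * D X Z h p + g p * D Y Z h p)) \<and>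
    (\<forall>X\<in>vector_fields M. \<forall>Y\<in>vector_fields M. \<forall>Z\<in>vector_fields M.
       D X (\<lambda>h p. Y h p + Z h p) = (\<lambda>h p. D X Y h p + D X Z h p)) \<and>
    (\<forall>X\<in>vector_fields M. \<forall>Y\<in>vector_fields M. \<forall>f\<in>smooth_funs M.
       D X (\<lambda>h p. f p * Y h p) = (\<lambda>h p. X f p * Y h p + f p * D X Y h p))"

definition torsion :: "'a connection \<Rightarrow> 'a vfield \<Rightarrow> 'a vfield \<Rightarrow> 'a vfield"
  where "torsion D X Y = (\<lambda>h p. D X Y h p - D Y X h p - lie_bracket X Y h p)"

definition curvature :: "'a connection \<Rightarrow> 'a vfield \<Rightarrow> 'a vfield \<Rightarrow> 'a vfield \<Rightarrow> 'a vfield"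
  where "curvature D X Y Z =
    (\<lambda>h p. D X (D Y Z) h p - D Y (D X Z) h p - D (lie_bracket X Y) Z h p)"

definition flat_affine :: "'a mfd \<Rightarrow> 'a connection \<Rightarrow> bool"
  where "flat_affine M D \<longleftrightarrow>
    linear_connection M D \<and>
    (\<forall>X\<in>vector_fields M. \<forall>Y\<in>vector_fields M. torsion D X Y = (\<lambda>h p. 0)) \<and>
    (\<forall>X\<in>vector_fields M. \<forall>Y\<in>vector_fields M. \<forall>Z\<in>vector_fields M.
       curvature D X Y Z = (\<lambda>h p. 0))"

definition affine_transformations :: "'a mfd \<Rightarrow> 'a connection \<Rightarrow> ('a \<Rightarrow> 'a) set"
  where "affine_transformations M D =
    {F \<in> diffeos M. \<forall>X\<in>vector_fields M. \<forall>Y\<in>vector_fields M.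
       pushforward M F (D X Y) = D (pushforward M F X) (pushforward M F Y)}"

definition affine_group :: "'a mfd \<Rightarrow> 'a connection \<Rightarrow> ('a \<Rightarrow> 'a) monoid"
  where "affine_group M D = BijGroup (mpoints M)\<lparr>carrier := affine_transformations M D\<rparr>"

section \<open>Lie groups\<close>

definition lie_group :: "'a monoid \<Rightarrow> 'a mfd \<Rightarrow> bool"
  where "lie_group G M \<longleftrightarrow>
    group G \<and> smooth_manifold M \<and> mpoints M = carrier G \<and>
    smooth_map (prod_mfd M M) M (\<lambda>(x, y). x \<otimes>\<^bsub>G\<^esub> y) \<and>
    smooth_map M M (\<lambda>x. inv\<^bsub>G\<^esub> x)"

definition left_translation :: "'a monoid \<Rightarrow> 'a \<Rightarrow> 'a \<Rightarrow> 'a"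
  where "left_translation G g = (\<lambda>x\<in>carrier G. g \<otimes>\<^bsub>G\<^esub> x)"

definition right_translation :: "'a monoid \<Rightarrow> 'a \<Rightarrow> 'a \<Rightarrow> 'a"
  where "right_translation G g = (\<lambda>x\<in>carrier G. x \<otimes>\<^bsub>G\<^esub> g)"

definition lie_algebra :: "'a monoid \<Rightarrow> 'a mfd \<Rightarrow> 'a vfield set"
  where "lie_algebra G M =
    {X \<in> vector_fields M. \<forall>g\<in>carrier G. pushforward M (left_translation G g) X = X}"

definition locally_isomorphic :: "'a monoid \<Rightarrow> 'a mfd \<Rightarrow> 'b monoid \<Rightarrow> 'b mfd \<Rightarrow> bool"
  where "locally_isomorphic G M H N \<longleftrightarrow>
    (\<exists>\<Phi>. bij_betw \<Phi> (lie_algebra G M) (lie_algebra H N) \<and>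
         (\<forall>X\<in>lie_algebra G M. \<forall>Y\<in>lie_algebra G M. \<forall>a.
            \<Phi> (\<lambda>f p. a * X f p + Y f p) = (\<lambda>f p. a * \<Phi> X f p + \<Phi> Y f p)) \<and>
         (\<forall>X\<in>lie_algebra G M. \<forall>Y\<in>lie_algebra G M.
            \<Phi> (lie_bracket X Y) = lie_bracket (\<Phi> X) (\<Phi> Y)))"

text \<open>
  A Lie subgroup is an immersed one: it carries its own manifold structure \<open>N\<close>, whose topology
  may be finer than the subspace topology.
\<close>

definition lie_subgroup :: "'a set \<Rightarrow> 'a mfd \<Rightarrow> 'a monoid \<Rightarrow> 'a mfd \<Rightarrow> bool"
  where "lie_subgroup H N G M \<longleftrightarrow>
    subgroup H G \<and> lie_group (G\<lparr>carrier := H\<rparr>) N \<and> immersion N M (\<lambda>x. x)"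

definition flat_affine_biinvariant :: "'a monoid \<Rightarrow> 'a mfd \<Rightarrow> 'a connection \<Rightarrow> bool"
  where "flat_affine_biinvariant G M D \<longleftrightarrow>
    flat_affine M D \<and>
    (\<forall>g\<in>carrier G. left_translation G g \<in> affine_transformations M D \<and>
                   right_translation G g \<in> affine_transformations M D)"

section \<open>The Lie group of affine transformations\<close>

definition compact_open_topology :: "'a topology \<Rightarrow> ('a \<Rightarrow> 'a) set \<Rightarrow> ('a \<Rightarrow> 'a) topology"
  where "compact_open_topology X S =
    topology_generated_by {{F \<in> S. F ` K \<subseteq> U} | K U. compactin X K \<and> openin X U}"

text \<open>
  \<open>A\<close> is the manifold structure making the group of affine transformations a Lie transformation
  group with respect to the compact-open topology (Kobayashi--Nomizu, Foundations of
  Differential Geometry I, Ch. VI). For connected \<open>M\<close> it exists, and it is unique up to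
  equivalence of atlases because a topological group carries at most one Lie group structure.
\<close>

definition affine_lie_group :: "'a mfd \<Rightarrow> 'a connection \<Rightarrow> ('a \<Rightarrow> 'a) mfd \<Rightarrow> bool"
  where "affine_lie_group M D A \<longleftrightarrow>
    lie_group (affine_group M D) A \<and>
    mtop A = compact_open_topology (mtop M) (affine_transformations M D) \<and>
    smooth_map (prod_mfd A M) M (\<lambda>(F, p). F p)"

end

theory Submission
  imports Defs "HOL-Algebra.Generated_Groups" "Jordan_Normal_Form.Determinant"
begin

text \<open>
  Near a point \<open>p\<close> the flatness equations are the integrability conditions of a linear system whose solutions are the
  affine functions, so there is an affine chart \<open>y\<close>, and every affine function near \<open>p\<close> is a combination of \<open>1\<close> and
  the coordinates of \<open>y\<close>. An affine transformation \<open>F\<close> close to the identity pulls the functions \<open>y j\<close> back to affine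
  functions. The matrix of coefficients is a smooth local homomorphism \<open>\<rho>\<close> from the affine group to the general linear
  group, and it is injective because an affine transformation of a connected manifold is determined near one point.

  Let \<open>G\<close> be the identity component of the general linear group with the flat connection of the ambient matrix space,
  which is invariant under left and right multiplication because these are linear maps. The subgroup \<open>H\<close> generated by
  \<open>\<rho> ` V\<close>, for a small connected neighbourhood \<open>V\<close> of the identity, becomes a Lie group with the charts
  \<open>h \<rho>(x) \<mapsto> \<phi>(x)\<close>, and \<open>\<rho>\<close> is a local isomorphism onto it. Working with a local homomorphism avoids integrating
  a Lie subalgebra to a subgroup.
\<close>

text \<open>The matrices have size \<open>Suc n\<close>: the constant function \<open>1\<close>
  together with the \<open>n\<close> coordinates spans the affine functions near \<open>p\<close>,
  so the translation part of a transformation becomes linear too. The representation is only local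
  because a transformation must keep a compact neighbourhood of \<open>p\<close> inside the domain
  of a single affine chart; in the compact-open topology this is an open condition. Three
  difficulties shape the rest. A flat system is first solved along rays from the centre of a cube,
  by a Neumann series with geometric bounds; flatness then turns the radial solution into a solution
  of all the equations. Multiplication on \<open>H\<close> has to be smooth for the copied charts
  although \<open>H\<close> is only generated by a small piece: for every \<open>h\<close> in
  \<open>H\<close>, conjugation by \<open>h\<close> near the unit comes from a smooth map of the
  affine group, by induction on words. Finally, injectivity of \<open>\<rho>\<close> does not by
  itself exclude a kernel of its differential at the unit; such a kernel would make high powers of
  one element move in the affine group while their images stay near the unit matrix.\<close>

section \<open>Open cubes and partial derivatives in coordinates\<close>

definition euc :: "nat \<Rightarrow> (nat \<Rightarrow> real) set"
  where "euc n = {x. \<forall>i\<ge>n. x i = 0}"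

text \<open>Cubes replace balls because membership is tested coordinate by coordinate and splits
  over products. For \<open>n = 0\<close> the cube is the one-point space \<open>euc 0\<close>,
  whatever \<open>e\<close> is.\<close>

definition ebox :: "nat \<Rightarrow> (nat \<Rightarrow> real) \<Rightarrow> real \<Rightarrow> (nat \<Rightarrow> real) set"
  where "ebox n x e = {y \<in> euc n. \<forall>i<n. \<bar>y i - x i\<bar> < e}"

abbreviation eopen :: "nat \<Rightarrow> (nat \<Rightarrow> real) set \<Rightarrow> bool"
  where "eopen n U \<equiv> openin (Euclidean_space n) U"

text \<open>Unlike \<open>pderiv_at\<close>, which takes an arbitrary value where no derivative
  exists, this relation also asserts existence, so that the rules for one-variable derivatives carry
  over directly.\<close>

definition has_pderiv :: "nat \<Rightarrow> ((nat \<Rightarrow> real) \<Rightarrow> real) \<Rightarrow> (nat \<Rightarrow> real) \<Rightarrow> real \<Rightarrow> bool"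
  where "has_pderiv i f x D \<longleftrightarrow> ((\<lambda>t. f (x(i := t))) has_real_derivative D) (at (x i))"

lemma Euclidean_space_eq: "Euclidean_space n = top_of_set (euc n)"
  by (simp add: Euclidean_space_def euc_def euclidean_product_topology)

lemma topspace_eucl [simp]: "topspace (Euclidean_space n) = euc n"
  by (simp add: topspace_Euclidean_space euc_def)

lemma ebox_subset: "ebox n x e \<subseteq> euc n"
  by (auto simp: ebox_def)

lemma ebox_self: "x \<in> euc n \<Longrightarrow> 0 < e \<Longrightarrow> x \<in> ebox n x e"
  by (auto simp: ebox_def)

lemma ebox_mono: "d \<le> e \<Longrightarrow> ebox n x d \<subseteq> ebox n x e"
  by (auto simp: ebox_def intro: less_le_trans)

lemma eopen_ebox: "eopen n (ebox n x e)"
proof -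
  have "open (\<Inter>i\<in>{..<n}. {y :: nat \<Rightarrow> real. \<bar>y i - x i\<bar> < e})"
    by (intro open_INT ballI open_Collect_less continuous_intros) auto
  moreover have "ebox n x e = euc n \<inter> (\<Inter>i\<in>{..<n}. {y. \<bar>y i - x i\<bar> < e})"
    by (auto simp: ebox_def)
  ultimately show ?thesis
    unfolding Euclidean_space_eq openin_open by blast
qed

lemma eopen_iff: "eopen n U \<longleftrightarrow> U \<subseteq> euc n \<and> (\<forall>x\<in>U. \<exists>e>0. ebox n x e \<subseteq> U)"
proof (intro iffI conjI ballI)
  assume U: "eopen n U"
  show "U \<subseteq> euc n"
    using openin_subset[OF U] by simp
  fix x assume x: "x \<in> U"
  obtain T where T: "open T" "U = euc n \<inter> T"
    using U unfolding Euclidean_space_eq openin_open by blast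
  have *: "openin (product_topology (\<lambda>i. euclidean) UNIV) T"
    using T open_fun_def by auto
  have "x \<in> T"
    using x T by auto
  then obtain X where X: "Pi\<^sub>E UNIV X \<subseteq> T" "\<And>i. openin euclidean (X i)" "x \<in> Pi\<^sub>E UNIV X"
    using product_topology_open_contains_basis[OF *] by metis
  have "\<forall>i. \<exists>e>0. ball (x i) e \<subseteq> X i"
    using X(2,3) open_contains_ball by (metis PiE_E UNIV_I open_openin)
  then obtain e where e: "\<And>i. e i > 0" "\<And>i. ball (x i) (e i) \<subseteq> X i"
    by metis
  \<comment> \<open>Inserting \<open>1\<close> keeps the minimum defined for \<open>n = 0\<close>.
    Coordinates from \<open>n\<close> on need no radius, since they vanish at both points.\<close>
  define m where "m = Min (insert 1 (e ` {..<n}))"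
  have m: "m > 0" "\<And>i. i < n \<Longrightarrow> m \<le> e i"
    unfolding m_def using e(1) by auto
  have "ebox n x m \<subseteq> U"
  proof
    fix y assume y: "y \<in> ebox n x m"
    have "y i \<in> X i" for i
    proof (cases "i < n")
      case True
      then show ?thesis
        using y m(2)[OF True] e(2)[of i] by (fastforce simp: ebox_def dist_real_def)
    next
      case False
      then have "y i = x i"
        using x y T by (auto simp: ebox_def euc_def)
      then show ?thesis
        using X(3) by auto
    qed
    then show "y \<in> U"
      using X(1) y T(2) ebox_subset by (fastforce simp: PiE_def)
  qed
  then show "\<exists>e>0. ebox n x e \<subseteq> U"
    using m by blast
next
  assume U: "U \<subseteq> euc n \<and> (\<forall>x\<in>U. \<exists>e>0. ebox n x e \<subseteq> U)"
  show "eopen n U"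
  proof (subst openin_subopen, intro ballI)
    fix x assume "x \<in> U"
    then show "\<exists>T. eopen n T \<and> x \<in> T \<and> T \<subseteq> U"
      using U eopen_ebox ebox_self by (metis subsetD)
  qed
qed

lemma eopen_subset: "eopen n U \<Longrightarrow> U \<subseteq> euc n"
  by (simp add: eopen_iff)

lemma euc_upd: "x \<in> euc n \<Longrightarrow> i < n \<Longrightarrow> x(i := t) \<in> euc n"
  by (auto simp: euc_def)

lemma eventually_upd:
  assumes "eopen n U" "x \<in> U" "i < n"
  shows "eventually (\<lambda>t. x(i := t) \<in> U) (nhds (x i))"
proof -
  obtain e where e: "e > 0" "ebox n x e \<subseteq> U"
    using assms by (auto simp: eopen_iff)
  have "eventually (\<lambda>t. \<bar>t - x i\<bar> < e) (nhds (x i))"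
    using e(1) by (auto simp: eventually_nhds_metric dist_real_def)
  then show ?thesis
  proof eventually_elim
    case (elim t)
    have "x \<in> euc n"
      using assms eopen_subset by blast
    then have "x(i := t) \<in> ebox n x e"
      using elim e(1) assms(3) by (auto simp: ebox_def euc_upd)
    then show ?case
      using e by auto
  qed
qed

lemma has_pderiv_cong:
  assumes "eopen n U" "x \<in> U" "i < n" "\<And>y. y \<in> U \<Longrightarrow> f y = g y" "has_pderiv i f x D"
  shows "has_pderiv i g x D"
proof -
  have "eventually (\<lambda>t. f (x(i := t)) = g (x(i := t))) (nhds (x i))"
    using eventually_upd[OF assms(1-3)] by eventually_elim (use assms(4) in auto)
  then show ?thesis
    using assms(5) unfolding has_pderiv_def by (subst (asm) DERIV_cong_ev[OF refl _ refl])
qed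

lemma pderiv_at_eq: "has_pderiv i f x D \<Longrightarrow> pderiv_at i f x = D"
  by (simp add: has_pderiv_def pderiv_at_def DERIV_imp_deriv)

lemma has_pderiv_unique: "has_pderiv i f x D \<Longrightarrow> has_pderiv i f x D' \<Longrightarrow> D = D'"
  using pderiv_at_eq by blast

lemma differentiable_has_pderiv:
  "(\<lambda>t. f (x(i := t))) differentiable (at (x i)) \<longleftrightarrow> (\<exists>D. has_pderiv i f x D)"
  by (simp add: has_pderiv_def real_differentiable_def)

lemma continuous_map_sub_Euclidean:
  "U \<subseteq> euc n \<Longrightarrow> continuous_map (subtopology (Euclidean_space n) U) euclideanreal f \<longleftrightarrow> continuous_on U f"
  by (simp add: Euclidean_space_eq subtopology_subtopology Int_absorb1)

lemma continuous_on_box: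
  assumes "eopen n U" "continuous_on U f" "x \<in> U" "e > (0::real)"
  obtains d where "d > 0" "ebox n x d \<subseteq> U" "\<And>y. y \<in> ebox n x d \<Longrightarrow> \<bar>f y - f x\<bar> < e"
proof -
  have U: "U \<subseteq> euc n"
    using assms(1) eopen_subset by blast
  have "openin (top_of_set U) (U \<inter> f -` ball (f x) e)"
    using assms(2) continuous_openin_preimage_gen by blast
  moreover have "openin (top_of_set (euc n)) U"
    using assms(1) by (simp add: Euclidean_space_eq)
  ultimately have "openin (Euclidean_space n) (U \<inter> f -` ball (f x) e)"
    unfolding Euclidean_space_eq using openin_trans by blast
  moreover have "x \<in> U \<inter> f -` ball (f x) e"
    using assms by auto
  ultimately obtain d where d: "d > 0" "ebox n x d \<subseteq> U \<inter> f -` ball (f x) e"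
    by (meson eopen_iff)
  have "\<bar>f y - f x\<bar> < e" if "y \<in> ebox n x d" for y
    using d(2) that by (auto simp: dist_real_def)
  then show ?thesis
    using that d by blast
qed

lemma continuous_on_box_family:
  assumes A: "finite A" and U: "eopen n U" and f: "\<And>a. a \<in> A \<Longrightarrow> continuous_on U (f a)" and x: "x \<in> U" and e: "e > (0::real)"
  obtains d where "d > 0" "ebox n x d \<subseteq> U" "\<And>a y. a \<in> A \<Longrightarrow> y \<in> ebox n x d \<Longrightarrow> \<bar>f a y - f a x\<bar> < e"
proof -
  \<comment> \<open>The sum of all deviations dominates each of them, so one radius serves every
    \<open>a\<close> at once.\<close>
  define g where "g y = (\<Sum>a\<in>A. \<bar>f a y - f a x\<bar>)" for y
  have "continuous_on U g"
    unfolding g_def by (intro continuous_intros f)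
  then obtain d where d: "d > 0" "ebox n x d \<subseteq> U" "\<And>y. y \<in> ebox n x d \<Longrightarrow> \<bar>g y - g x\<bar> < e"
    using continuous_on_box[OF U _ x e, of g] by blast
  have "\<bar>f a y - f a x\<bar> < e" if "a \<in> A" "y \<in> ebox n x d" for a y
    using member_le_sum[OF that(1), of "\<lambda>a. \<bar>f a y - f a x\<bar>"] A d(3)[OF that(2)] by (simp add: g_def)
  then show thesis
    using that d(1,2) by blast
qed

lemma continuous_on_locally:
  assumes "eopen n U" and "\<And>x. x \<in> U \<Longrightarrow> \<exists>V. eopen n V \<and> x \<in> V \<and> continuous_on V f"
  shows "continuous_on U f"
proof (clarsimp simp: continuous_on_eq_continuous_within)
  fix x assume x: "x \<in> U"
  obtain V where V: "eopen n V" "x \<in> V" "continuous_on V f"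
    using assms(2)[OF x] by blast
  obtain T where T: "open T" "V = euc n \<inter> T"
    using V(1) unfolding Euclidean_space_eq openin_open by blast
  have "continuous (at x within T \<inter> euc n) f"
    using V T continuous_on_eq_continuous_within by (metis Int_commute)
  moreover have "at x within T \<inter> euc n = at x within euc n"
    using T V by (intro at_within_nhd[of _ T]) auto
  ultimately have "continuous (at x within euc n) f"
    by simp
  then show "continuous (at x within U) f"
    using eopen_subset[OF assms(1)] continuous_within_subset by blast
qed

lemma has_pderiv_ex: "(\<exists>D. has_pderiv i f x D) \<longleftrightarrow> has_pderiv i f x (pderiv_at i f x)"
  by (auto dest: pderiv_at_eq)

section \<open>Functions with continuous partial derivatives up to order k\<close>

lemma Ck_on_0: "eopen n U \<Longrightarrow> Ck_on 0 n U f \<longleftrightarrow> continuous_on U f"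
  by (simp add: continuous_map_sub_Euclidean eopen_subset)

text \<open>On an open set the recursive clause can be expressed by \<open>has_pderiv\<close>; this
  form replaces the raw unfolding from here on.\<close>

lemma Ck_on_Suc:
  assumes "eopen n U"
  shows "Ck_on (Suc k) n U f \<longleftrightarrow> continuous_on U f \<and>
    (\<forall>i<n. (\<forall>x\<in>U. has_pderiv i f x (pderiv_at i f x)) \<and> Ck_on k n U (pderiv_at i f))"
  using eopen_subset[OF assms]
  by (simp add: continuous_map_sub_Euclidean differentiable_has_pderiv has_pderiv_ex)

declare Ck_on.simps(2) [simp del]

lemma Ck_on_cong:
  assumes "eopen n U" "\<And>x. x \<in> U \<Longrightarrow> f x = g x" "Ck_on k n U f"
  shows "Ck_on k n U g"
  using assms(2,3)
proof (induction k arbitrary: f g)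
  case 0
  then show ?case
    using continuous_on_cong[OF refl, of U f g] by (simp only: Ck_on_0[OF assms(1)])
next
  case (Suc k)
  have 1: "continuous_on U g"
    using Suc.prems continuous_on_cong[OF refl, of U f g] by (simp add: Ck_on_Suc[OF assms(1)])
  have pd: "has_pderiv i g x (pderiv_at i f x)" if "i < n" "x \<in> U" for i x
    using has_pderiv_cong[OF assms(1) that(2,1) Suc.prems(1)] Suc.prems(2) that
    by (simp add: Ck_on_Suc[OF assms(1)])
  have "Ck_on k n U (pderiv_at i g)" if "i < n" for i
  proof (rule Suc.IH)
    show "pderiv_at i f x = pderiv_at i g x" if "x \<in> U" for x
      using pderiv_at_eq[OF pd[OF \<open>i < n\<close> that]] by simp
    show "Ck_on k n U (pderiv_at i f)"
      using Suc.prems(2) that by (simp add: Ck_on_Suc[OF assms(1)])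
  qed
  then show ?case
    using 1 pd pderiv_at_eq[OF pd] by (simp add: Ck_on_Suc[OF assms(1)])
qed

text \<open>The derivatives may be supplied as any family that is correct on \<open>U\<close>. The
  function \<open>pderiv_at i f\<close> itself, whose values off \<open>U\<close> are unknown, never
  has to be computed.\<close>

lemma Ck_on_SucI:
  assumes "eopen n U" "continuous_on U f" "\<And>i. i < n \<Longrightarrow> Ck_on k n U (g i)"
    "\<And>i x. i < n \<Longrightarrow> x \<in> U \<Longrightarrow> has_pderiv i f x (g i x)"
  shows "Ck_on (Suc k) n U f"
proof -
  have "Ck_on k n U (pderiv_at i f)" if "i < n" for i
    using pderiv_at_eq[OF assms(4)[OF that]] by (intro Ck_on_cong[OF assms(1) _ assms(3)[OF that]]) simp
  then show ?thesis
    using assms(2) pderiv_at_eq[OF assms(4)] assms(4) by (simp add: Ck_on_Suc[OF assms(1)])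
qed

lemma Ck_on_continuous: "eopen n U \<Longrightarrow> Ck_on k n U f \<Longrightarrow> continuous_on U f"
  by (cases k) (simp_all add: Ck_on_Suc continuous_map_sub_Euclidean eopen_subset)

lemma Ck_on_SucD: "eopen n U \<Longrightarrow> Ck_on (Suc k) n U f \<Longrightarrow> Ck_on k n U f"
proof (induction k arbitrary: f)
  case 0
  then show ?case
    by (simp add: Ck_on_Suc continuous_map_sub_Euclidean eopen_subset)
next
  case (Suc k)
  then have "Ck_on k n U (pderiv_at i f)" if "i < n" for i
    using that by (simp add: Ck_on_Suc)
  then show ?case
    using Suc.prems by (simp add: Ck_on_Suc)
qed

lemma Ck_on_has_pderiv:
  "eopen n U \<Longrightarrow> Ck_on (Suc k) n U f \<Longrightarrow> i < n \<Longrightarrow> x \<in> U \<Longrightarrow> has_pderiv i f x (pderiv_at i f x)"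
  by (simp add: Ck_on_Suc)

lemma Ck_on_pderiv_at: "eopen n U \<Longrightarrow> Ck_on (Suc k) n U f \<Longrightarrow> i < n \<Longrightarrow> Ck_on k n U (pderiv_at i f)"
  by (simp add: Ck_on_Suc)

lemma Ck_on_subset:
  assumes "eopen n U" "eopen n V" "V \<subseteq> U" "Ck_on k n U f"
  shows "Ck_on k n V f"
  using assms(4)
proof (induction k arbitrary: f)
  case 0
  then show ?case
    using continuous_on_subset[of U f V] assms(3) by (simp only: Ck_on_0[OF assms(1)] Ck_on_0[OF assms(2)])
next
  case (Suc k)
  then show ?case
    using assms(3) continuous_on_subset[of U f V]
    by (auto simp: Ck_on_Suc[OF assms(1)] Ck_on_Suc[OF assms(2)])
qed

lemma Ck_on_locally:
  assumes "eopen n U" and "\<And>x. x \<in> U \<Longrightarrow> \<exists>V. eopen n V \<and> x \<in> V \<and> Ck_on k n V f"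
  shows "Ck_on k n U f"
  using assms(2)
proof (induction k arbitrary: f)
  case 0
  have "\<exists>V. eopen n V \<and> x \<in> V \<and> continuous_on V f" if "x \<in> U" for x
    using 0[OF that] Ck_on_0 by blast
  then show ?case
    unfolding Ck_on_0[OF assms(1)] by (rule continuous_on_locally[OF assms(1)])
next
  case (Suc k)
  have *: "\<exists>V. eopen n V \<and> x \<in> V \<and> continuous_on V f \<and> has_pderiv i f x (pderiv_at i f x) \<and> Ck_on k n V (pderiv_at i f)"
    if x: "x \<in> U" and i: "i < n" for x i
  proof -
    obtain V where "eopen n V" "x \<in> V" "Ck_on (Suc k) n V f"
      using Suc.prems[OF x] by blast
    then show ?thesis
      using i by (intro exI[of _ V]) (simp add: Ck_on_Suc)
  qed
  have "\<exists>V. eopen n V \<and> x \<in> V \<and> continuous_on V f" if "x \<in> U" for x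
    using Suc.prems[OF that] Ck_on_continuous by blast
  then have "continuous_on U f"
    by (rule continuous_on_locally[OF assms(1)])
  moreover have "Ck_on k n U (pderiv_at i f)" if "i < n" for i
    using * that by (intro Suc.IH) blast
  ultimately show ?case
    unfolding Ck_on_Suc[OF assms(1)] using * by blast
qed

lemma has_pderiv_const: "has_pderiv i (\<lambda>x. c) x 0"
  by (simp add: has_pderiv_def)

lemma has_pderiv_coord: "has_pderiv i (\<lambda>x. x j) x (if i = j then 1 else 0)"
  by (auto simp: has_pderiv_def)

lemma has_pderiv_add:
  "has_pderiv i f x a \<Longrightarrow> has_pderiv i g x b \<Longrightarrow> has_pderiv i (\<lambda>x. f x + g x) x (a + b)"
  by (auto simp: has_pderiv_def intro: DERIV_add)

lemma has_pderiv_diff: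
  "has_pderiv i f x a \<Longrightarrow> has_pderiv i g x b \<Longrightarrow> has_pderiv i (\<lambda>x. f x - g x) x (a - b)"
  by (auto simp: has_pderiv_def intro: DERIV_diff)

lemma has_pderiv_mult:
  "has_pderiv i f x a \<Longrightarrow> has_pderiv i g x b \<Longrightarrow> has_pderiv i (\<lambda>x. f x * g x) x (a * g x + f x * b)"
  unfolding has_pderiv_def by (drule (1) DERIV_mult) (simp add: algebra_simps)

lemma has_pderiv_sum:
  "(\<And>j. j \<in> J \<Longrightarrow> has_pderiv i (f j) x (D j)) \<Longrightarrow> has_pderiv i (\<lambda>x. \<Sum>j\<in>J. f j x) x (\<Sum>j\<in>J. D j)"
  unfolding has_pderiv_def by (rule DERIV_sum) auto

text \<open>The derivative is again a polynomial in the inverse, which closes the induction for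
  \<open>Ck_on_inverse\<close>. It is written with the factor \<open>- 1\<close> so that it is
  literally built from products and constants.\<close>

lemma has_pderiv_inverse:
  "has_pderiv i f x a \<Longrightarrow> f x \<noteq> 0 \<Longrightarrow> has_pderiv i (\<lambda>x. inverse (f x)) x (- 1 * (a * inverse (f x) * inverse (f x)))"
  unfolding has_pderiv_def
  using DERIV_inverse'[of "\<lambda>t. f (x(i := t))" a "x i" UNIV] by (simp add: algebra_simps)

lemma Ck_on_const: "eopen n U \<Longrightarrow> Ck_on k n U (\<lambda>x. c)"
proof (induction k arbitrary: c)
  case (Suc k)
  then show ?case
    using Suc.IH[of 0] by (intro Ck_on_SucI[where g = "\<lambda>i x. 0"]) (auto simp: has_pderiv_const)
qed simp

lemma continuous_on_coord: "continuous_on U (\<lambda>x :: nat \<Rightarrow> real. x j)"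
  by (rule continuous_on_subset[OF continuous_on_product_coordinates subset_UNIV])

lemma Ck_on_coord:
  assumes "eopen n U"
  shows "Ck_on k n U (\<lambda>x. x j)"
proof (cases k)
  case 0
  then show ?thesis
    by (simp only: Ck_on_0[OF assms] continuous_on_coord)
next
  case (Suc l)
  show ?thesis
    unfolding Suc
    by (rule Ck_on_SucI[where g = "\<lambda>i x. if i = j then 1 else 0"])
      (simp_all add: assms continuous_on_coord has_pderiv_coord Ck_on_const)
qed

lemma Ck_on_add:
  assumes "eopen n U"
  shows "Ck_on k n U f \<Longrightarrow> Ck_on k n U g \<Longrightarrow> Ck_on k n U (\<lambda>x. f x + g x)"
proof (induction k arbitrary: f g)
  case 0
  then show ?case
    by (simp only: Ck_on_0[OF assms]) (intro continuous_intros)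
next
  case (Suc k)
  show ?case
    using Suc.prems
    by (intro Ck_on_SucI[where g = "\<lambda>i x. pderiv_at i f x + pderiv_at i g x"] assms Suc.IH
        continuous_on_add has_pderiv_add) (simp_all add: Ck_on_Suc[OF assms])
qed

lemma Ck_on_mult:
  assumes "eopen n U"
  shows "Ck_on k n U f \<Longrightarrow> Ck_on k n U g \<Longrightarrow> Ck_on k n U (\<lambda>x. f x * g x)"
proof (induction k arbitrary: f g)
  case 0
  then show ?case
    by (simp only: Ck_on_0[OF assms]) (intro continuous_intros)
next
  case (Suc k)
  show ?case
    using Suc.prems Suc.prems[THEN Ck_on_SucD[OF assms]]
    by (intro Ck_on_SucI[where g = "\<lambda>i x. pderiv_at i f x * g x + f x * pderiv_at i g x"] assms Suc.IH
        Ck_on_add continuous_on_mult has_pderiv_mult) (simp_all add: Ck_on_Suc[OF assms])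
qed

lemma Ck_on_sum:
  assumes "eopen n U" "\<And>j. j \<in> J \<Longrightarrow> Ck_on k n U (f j)"
  shows "Ck_on k n U (\<lambda>x. \<Sum>j\<in>J. f j x)"
proof (cases "finite J")
  case True
  then show ?thesis
    using assms(2)
    by (induction J) (auto intro: Ck_on_const Ck_on_add assms(1))
qed (simp add: Ck_on_const assms(1))

lemma Ck_on_inverse:
  assumes "eopen n U" "\<And>x. x \<in> U \<Longrightarrow> f x \<noteq> 0"
  shows "Ck_on k n U f \<Longrightarrow> Ck_on k n U (\<lambda>x. inverse (f x))"
proof (induction k)
  case 0
  then show ?case
    using assms(2) by (simp only: Ck_on_0[OF assms(1)]) (intro continuous_on_inverse, auto)
next
  case (Suc k)
  show ?case
    using Suc.prems Suc.IH[OF Suc.prems[THEN Ck_on_SucD[OF assms(1)]]] assms(2)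
    by (intro Ck_on_SucI[where g = "\<lambda>i x. - 1 * (pderiv_at i f x * inverse (f x) * inverse (f x))"] assms(1)
        Ck_on_mult Ck_on_const continuous_on_inverse has_pderiv_inverse) (simp_all add: Ck_on_Suc[OF assms(1)])
qed

section \<open>Mean values and the chain rule\<close>

lemma mvt_between:
  assumes "\<And>s. min a b \<le> s \<Longrightarrow> s \<le> max a b \<Longrightarrow> (\<phi> has_real_derivative \<phi>' s) (at s)"
  obtains s where "min a b \<le> s" "s \<le> max a b" "\<phi> b - \<phi> a = \<phi>' s * (b - a)"
proof (cases a b rule: linorder_cases)
  case less
  then obtain z where "z > a" "z < b" "\<phi> b - \<phi> a = (b - a) * \<phi>' z"
    using MVT2[of a b \<phi> \<phi>'] assms by force
  then show ?thesis
    using that[of z] less by (auto simp: algebra_simps)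
next
  case equal
  then show ?thesis
    using that[of a] by simp
next
  case greater
  then obtain z where "z > b" "z < a" "\<phi> a - \<phi> b = (a - b) * \<phi>' z"
    using MVT2[of b a \<phi> \<phi>'] assms by force
  then show ?thesis
    using that[of z] greater by (auto simp: algebra_simps)
qed

text \<open>The increment of \<open>f\<close> along \<open>c\<close> is telescoped by switching one coordinate at a time, which
  leaves only one-variable mean values.\<close>

lemma chain_rule:
  assumes V: "eopen n V" "c t0 \<in> V"
    and euc: "eventually (\<lambda>t. c t \<in> euc n) (nhds t0)"
    and f': "\<And>j y. j < n \<Longrightarrow> y \<in> V \<Longrightarrow> has_pderiv j f y (f' j y)"
    and cont: "\<And>j. j < n \<Longrightarrow> continuous_on V (f' j)"
    and c': "\<And>j. j < n \<Longrightarrow> ((\<lambda>t. c t j) has_real_derivative c' j) (at t0)"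
  shows "((\<lambda>t. f (c t)) has_real_derivative (\<Sum>j<n. f' j (c t0) * c' j)) (at t0)"
proof -
  \<comment> \<open>In \<open>z m t\<close> the first \<open>m\<close> coordinates have moved from
    \<open>c t0\<close> to \<open>c t\<close>. Thus \<open>z 0\<close> is constant, and
    \<open>z n\<close> agrees with \<open>c\<close> wherever \<open>c\<close> stays in
    \<open>euc n\<close>.\<close>
  define z where "z m t = (\<lambda>i. if i < m then c t i else c t0 i)" for m t
  have c0: "c t0 \<in> euc n"
    using V eopen_subset by blast
  have near: "eventually (\<lambda>t. \<forall>j\<in>{..<n}. \<bar>c t j - c t0 j\<bar> < d) (nhds t0)" if "d > 0" for d
  proof (intro eventually_ball_finite ballI)
    fix j assume "j \<in> {..<n}"
    then have "isCont (\<lambda>t. c t j) t0"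
      using c' DERIV_isCont by blast
    then have "((\<lambda>t. c t j) \<longlongrightarrow> c t0 j) (nhds t0)"
      using tendsto_at_iff_tendsto_nhds[of "\<lambda>t. c t j" t0] by (simp add: isCont_def)
    then show "eventually (\<lambda>t. \<bar>c t j - c t0 j\<bar> < d) (nhds t0)"
      using that by (simp add: tendsto_iff dist_real_def)
  qed simp
  have step: "((\<lambda>t. f (z m t)) has_real_derivative (\<Sum>j<m. f' j (c t0) * c' j)) (at t0)" if "m \<le> n" for m
    using that
  proof (induction m)
    case 0
    then show ?case
      by (simp add: z_def)
  next
    case (Suc m)
    then have m: "m < n"
      by simp
    define D where "D t = f (z (Suc m) t) - f (z m t)" for t
    obtain d0 where d0: "d0 > 0" "ebox n (c t0) d0 \<subseteq> V"
      using V by (meson eopen_iff)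
    define good where "good t \<longleftrightarrow> (\<forall>j\<in>{..<n}. \<bar>c t j - c t0 j\<bar> < d0)" for t
    \<comment> \<open>The condition \<open>good t\<close> stands inside the existential so that one
      function of intermediate points can be chosen for all \<open>t\<close>.\<close>
    have "\<exists>\<xi>. good t \<longrightarrow> \<xi> \<in> euc n \<and> (\<forall>i<n. \<bar>\<xi> i - c t0 i\<bar> \<le> \<bar>c t i - c t0 i\<bar>) \<and>
                D t = f' m \<xi> * (c t m - c t0 m)" for t
    proof (cases "good t")
      case True
      have zb: "(z m t)(m := s) \<in> euc n \<and> (\<forall>i<n. \<bar>((z m t)(m := s)) i - c t0 i\<bar> \<le> \<bar>c t i - c t0 i\<bar>)"
        if "min (c t0 m) (c t m) \<le> s" "s \<le> max (c t0 m) (c t m)" for s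
        using that c0 m by (auto simp: z_def euc_def)
      have zb': "(z m t)(m := s) \<in> V"
        if "min (c t0 m) (c t m) \<le> s" "s \<le> max (c t0 m) (c t m)" for s
      proof -
        have "(z m t)(m := s) \<in> ebox n (c t0) d0"
          using conjunct1[OF zb[OF that]] le_less_trans[OF conjunct2[OF zb[OF that], rule_format]] True
          unfolding ebox_def good_def by blast
        then show ?thesis
          using d0 by blast
      qed
      have "((\<lambda>s. f ((z m t)(m := s))) has_real_derivative f' m ((z m t)(m := s))) (at s)"
        if "min (c t0 m) (c t m) \<le> s" "s \<le> max (c t0 m) (c t m)" for s
        using f'[OF m zb'[OF that]] by (simp add: has_pderiv_def)
      from mvt_between[of "c t0 m" "c t m" "\<lambda>s. f ((z m t)(m := s))", OF this]
      obtain s where s: "min (c t0 m) (c t m) \<le> s" "s \<le> max (c t0 m) (c t m)"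
        "f ((z m t)(m := c t m)) - f ((z m t)(m := c t0 m)) = f' m ((z m t)(m := s)) * (c t m - c t0 m)"
        by blast
      have "(z m t)(m := c t m) = z (Suc m) t" "(z m t)(m := c t0 m) = z m t"
        by (auto simp: z_def)
      then show ?thesis
        using s zb D_def by metis
    qed simp
    then obtain \<xi> where \<xi>: "\<And>t. good t \<Longrightarrow> \<xi> t \<in> euc n \<and> (\<forall>i<n. \<bar>\<xi> t i - c t0 i\<bar> \<le> \<bar>c t i - c t0 i\<bar>) \<and>
                D t = f' m (\<xi> t) * (c t m - c t0 m)"
      by metis
    have evg: "eventually good (nhds t0)"
      unfolding good_def using near[OF d0(1)] .
    have lim: "((\<lambda>t. f' m (\<xi> t)) \<longlongrightarrow> f' m (c t0)) (at t0)"
    proof (rule tendstoI)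
      fix e :: real assume "e > 0"
      then obtain d where d: "d > 0" "ebox n (c t0) d \<subseteq> V" "\<And>y. y \<in> ebox n (c t0) d \<Longrightarrow> \<bar>f' m y - f' m (c t0)\<bar> < e"
        using continuous_on_box[OF V(1) cont[OF m] V(2)] by blast
      have "eventually (\<lambda>t. \<bar>f' m (\<xi> t) - f' m (c t0)\<bar> < e) (nhds t0)"
        using near[OF d(1)] evg
      proof eventually_elim
        case (elim t)
        then have "\<xi> t \<in> ebox n (c t0) d"
          using \<xi>[OF elim(2)] le_less_trans unfolding ebox_def by blast
        then show ?case
          using d(3) by blast
      qed
      then show "eventually (\<lambda>t. dist (f' m (\<xi> t)) (f' m (c t0)) < e) (at t0)"
        by (simp add: dist_real_def eventually_nhds_conv_at)
    qed
    have D0: "D t0 = 0"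
      by (simp add: D_def z_def)
    have "((\<lambda>t. f' m (\<xi> t) * ((c t m - c t0 m) / (t - t0))) \<longlongrightarrow> f' m (c t0) * c' m) (at t0)"
      using c'[OF m] by (intro tendsto_mult lim) (simp add: has_field_derivative_iff)
    moreover have "eventually (\<lambda>t. f' m (\<xi> t) * ((c t m - c t0 m) / (t - t0)) = (D t - D t0) / (t - t0)) (at t0)"
    proof -
      have "eventually good (at t0)"
        using evg by (simp add: eventually_nhds_conv_at)
      then show ?thesis
        by eventually_elim (simp add: \<xi> D0)
    qed
    ultimately have "(D has_real_derivative f' m (c t0) * c' m) (at t0)"
      unfolding has_field_derivative_iff by (rule Lim_transform_eventually)
    with Suc.IH m have "((\<lambda>t. f (z m t) + D t) has_real_derivative (\<Sum>j<m. f' j (c t0) * c' j) + f' m (c t0) * c' m) (at t0)"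
      by (intro DERIV_add) auto
    then show ?case
      by (simp add: D_def)
  qed
  have "eventually (\<lambda>t. f (z n t) = f (c t)) (nhds t0)"
    using euc
  proof eventually_elim
    case (elim t)
    then have "z n t = c t"
      using c0 by (auto simp: z_def euc_def fun_eq_iff)
    then show ?case
      by simp
  qed
  then show ?thesis
    using step[of n] by (simp add: DERIV_cong_ev)
qed

lemma mean_value_segment:
  assumes V: "eopen n V" and x: "x \<in> euc n" and y: "y \<in> euc n"
    and seg: "\<And>t. 0 \<le> t \<Longrightarrow> t \<le> 1 \<Longrightarrow> (\<lambda>i. x i + t * (y i - x i)) \<in> V"
    and f': "\<And>j z. j < n \<Longrightarrow> z \<in> V \<Longrightarrow> has_pderiv j f z (f' j z)"
    and cont: "\<And>j. j < n \<Longrightarrow> continuous_on V (f' j)"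
  obtains t where "0 \<le> t" "t \<le> 1" "f y - f x = (\<Sum>j<n. f' j (\<lambda>i. x i + t * (y i - x i)) * (y j - x j))"
proof -
  let ?c = "\<lambda>t i. x i + t * (y i - x i)"
  have "((\<lambda>t. f (?c t)) has_real_derivative (\<Sum>j<n. f' j (?c t) * (y j - x j))) (at t)"
    if "min 0 1 \<le> t" "t \<le> max 0 1" for t
  proof (rule chain_rule[where c' = "\<lambda>j. y j - x j", OF V seg _ f' cont])
    show "\<forall>\<^sub>F t in nhds t. ?c t \<in> euc n"
      using x y by (intro always_eventually) (auto simp: euc_def)
    show "((\<lambda>t. ?c t j) has_real_derivative y j - x j) (at t)" for j
      by (auto intro!: derivative_eq_intros)
  qed (use that in auto)
  from mvt_between[of 0 1, OF this] show thesis
    using that by auto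
qed

lemma ebox_segment:
  assumes "x \<in> ebox n z r" "y \<in> ebox n z r" "0 \<le> t" "t \<le> 1"
  shows "(\<lambda>i. x i + t * (y i - x i)) \<in> ebox n z r"
proof -
  have "\<bar>x i + t * (y i - x i) - z i\<bar> < r" if "\<bar>x i - z i\<bar> < r" "\<bar>y i - z i\<bar> < r" for i
    using convex_bound_lt[of "x i - z i" r "y i - z i" "1 - t" t] convex_bound_lt[of "z i - x i" r "z i - y i" "1 - t" t]
      assms(3,4) that by (auto simp: abs_less_iff algebra_simps)
  then show ?thesis
    using assms(1,2) by (auto simp: ebox_def euc_def)
qed

lemma continuous_on_into_euc:
  assumes "\<And>j. j < n \<Longrightarrow> continuous_on U (\<lambda>x. g x j)" "\<And>x. x \<in> U \<Longrightarrow> g x \<in> euc n"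
  shows "continuous_on U g"
proof (rule continuous_on_coordinatewise_then_product)
  fix j
  show "continuous_on U (\<lambda>x. g x j)"
  proof (cases "j < n")
    case False
    then have "continuous_on U (\<lambda>x. g x j) \<longleftrightarrow> continuous_on U (\<lambda>x. 0::real)"
      using assms(2) by (intro continuous_on_cong) (auto simp: euc_def)
    then show ?thesis
      by simp
  qed (use assms in auto)
qed

lemma has_pderiv_compose:
  assumes U: "eopen m U" "x \<in> U" "i < m"
    and V: "eopen n V" "\<And>y. y \<in> U \<Longrightarrow> g y \<in> V"
    and f': "\<And>j y. j < n \<Longrightarrow> y \<in> V \<Longrightarrow> has_pderiv j f y (f' j y)"
    and cont: "\<And>j. j < n \<Longrightarrow> continuous_on V (f' j)"
    and g': "\<And>j. j < n \<Longrightarrow> has_pderiv i (\<lambda>x. g x j) x (g' j)"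
  shows "has_pderiv i (\<lambda>x. f (g x)) x (\<Sum>j<n. f' j (g x) * g' j)"
proof -
  have "eventually (\<lambda>t. g (x(i := t)) \<in> euc n) (nhds (x i))"
    using eventually_upd[OF U] by eventually_elim (use V eopen_subset in blast)
  from chain_rule[of n V "\<lambda>t. g (x(i := t))" "x i" f f' g', OF V(1) _ this f' cont] show ?thesis
    using g' V(2) U(2) by (simp add: has_pderiv_def)
qed

lemma Ck_on_compose:
  assumes V: "eopen n V" and U: "eopen m U" "\<And>x. x \<in> U \<Longrightarrow> g x \<in> V"
  shows "Ck_on k n V f \<Longrightarrow> (\<And>j. j < n \<Longrightarrow> Ck_on k m U (\<lambda>x. g x j)) \<Longrightarrow> Ck_on k m U (\<lambda>x. f (g x))"
proof (induction k arbitrary: f)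
  case 0
  have "continuous_on U g"
    using 0(2) U(2) eopen_subset[OF V] unfolding Ck_on_0[OF U(1)]
    by (intro continuous_on_into_euc[of n]) blast+
  then show ?case
    using continuous_on_compose2[of V f U g] 0(1) U(2) unfolding Ck_on_0[OF U(1)] Ck_on_0[OF V] by blast
next
  case (Suc k)
  note f' = Ck_on_pderiv_at[OF V Suc.prems(1)]
  note g = Suc.prems(2)[THEN Ck_on_SucD[OF U(1)]]
  have cg: "continuous_on U g"
    using U(2) eopen_subset[OF V] Ck_on_continuous[OF U(1) g] by (intro continuous_on_into_euc[of n]) blast+
  show ?case
  proof (rule Ck_on_SucI[where g = "\<lambda>i x. \<Sum>j<n. pderiv_at j f (g x) * pderiv_at i (\<lambda>x. g x j) x"])
    show "continuous_on U (\<lambda>x. f (g x))"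
      using continuous_on_compose2[OF Ck_on_continuous[OF V Suc.prems(1)] cg] U(2) by blast
    show "Ck_on k m U (\<lambda>x. \<Sum>j<n. pderiv_at j f (g x) * pderiv_at i (\<lambda>x. g x j) x)" if "i < m" for i
      by (rule Ck_on_sum[OF U(1) Ck_on_mult[OF U(1) Suc.IH[OF f' g] Ck_on_pderiv_at[OF U(1) Suc.prems(2) that]]])
        simp_all
    show "has_pderiv i (\<lambda>x. f (g x)) x (\<Sum>j<n. pderiv_at j f (g x) * pderiv_at i (\<lambda>x. g x j) x)"
      if "i < m" "x \<in> U" for i x
      by (intro has_pderiv_compose[OF U(1) that(2,1) V U(2)] Ck_on_continuous[OF V f']
          Ck_on_has_pderiv[OF V Suc.prems(1)] Ck_on_has_pderiv[OF U(1) Suc.prems(2)] that)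
  qed (rule U(1))
qed

section \<open>Smooth functions of several variables\<close>

lemma smooth_on_cong: "eopen n U \<Longrightarrow> (\<And>x. x \<in> U \<Longrightarrow> f x = g x) \<Longrightarrow> smooth_on n U f \<Longrightarrow> smooth_on n U g"
  unfolding smooth_on_def using Ck_on_cong[of n U f g] by blast

lemma smooth_on_subset: "eopen n U \<Longrightarrow> eopen n V \<Longrightarrow> V \<subseteq> U \<Longrightarrow> smooth_on n U f \<Longrightarrow> smooth_on n V f"
  unfolding smooth_on_def using Ck_on_subset[of n U V] by blast

lemma smooth_on_locally:
  assumes "eopen n U" and "\<And>x. x \<in> U \<Longrightarrow> \<exists>V. eopen n V \<and> x \<in> V \<and> smooth_on n V f"
  shows "smooth_on n U f"
  unfolding smooth_on_def
proof
  fix k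
  have "\<exists>V. eopen n V \<and> x \<in> V \<and> Ck_on k n V f" if "x \<in> U" for x
    using assms(2)[OF that] by (auto simp: smooth_on_def)
  then show "Ck_on k n U f"
    by (rule Ck_on_locally[OF assms(1)])
qed

lemma smooth_on_const: "eopen n U \<Longrightarrow> smooth_on n U (\<lambda>x. c)"
  by (simp add: smooth_on_def Ck_on_const)

lemma smooth_on_coord: "eopen n U \<Longrightarrow> smooth_on n U (\<lambda>x. x j)"
  by (simp add: smooth_on_def Ck_on_coord)

lemma smooth_on_add: "eopen n U \<Longrightarrow> smooth_on n U f \<Longrightarrow> smooth_on n U g \<Longrightarrow> smooth_on n U (\<lambda>x. f x + g x)"
  by (simp add: smooth_on_def Ck_on_add)

lemma smooth_on_mult: "eopen n U \<Longrightarrow> smooth_on n U f \<Longrightarrow> smooth_on n U g \<Longrightarrow> smooth_on n U (\<lambda>x. f x * g x)"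
  by (simp add: smooth_on_def Ck_on_mult)

lemma smooth_on_sum: "eopen n U \<Longrightarrow> (\<And>j. j \<in> J \<Longrightarrow> smooth_on n U (f j)) \<Longrightarrow> smooth_on n U (\<lambda>x. \<Sum>j\<in>J. f j x)"
  by (simp add: smooth_on_def Ck_on_sum)

lemma smooth_on_prod: "eopen n U \<Longrightarrow> (\<And>j. j \<in> J \<Longrightarrow> smooth_on n U (f j)) \<Longrightarrow> smooth_on n U (\<lambda>x. \<Prod>j\<in>J. f j x)"
  by (induction J rule: infinite_finite_induct) (auto intro: smooth_on_const smooth_on_mult)

lemma smooth_on_diff:
  assumes "eopen n U" "smooth_on n U f" "smooth_on n U g"
  shows "smooth_on n U (\<lambda>x. f x - g x)"
  using smooth_on_add[OF assms(1,2) smooth_on_mult[OF assms(1) smooth_on_const[OF assms(1), of "-1"] assms(3)]]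
  by simp

lemma smooth_on_inverse:
  "eopen n U \<Longrightarrow> (\<And>x. x \<in> U \<Longrightarrow> f x \<noteq> 0) \<Longrightarrow> smooth_on n U f \<Longrightarrow> smooth_on n U (\<lambda>x. inverse (f x))"
  by (simp add: smooth_on_def Ck_on_inverse)

lemma smooth_on_compose:
  assumes "eopen n V" "eopen m U" "\<And>x. x \<in> U \<Longrightarrow> g x \<in> V"
    "smooth_on n V f" "\<And>j. j < n \<Longrightarrow> smooth_on m U (\<lambda>x. g x j)"
  shows "smooth_on m U (\<lambda>x. f (g x))"
  unfolding smooth_on_def
proof
  fix k
  show "Ck_on k m U (\<lambda>x. f (g x))"
    by (rule Ck_on_compose[OF assms(1-3)]) (use assms(4,5) in \<open>simp_all add: smooth_on_def\<close>)
qed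

lemma smooth_on_continuous: "eopen n U \<Longrightarrow> smooth_on n U f \<Longrightarrow> continuous_on U f"
  using Ck_on_continuous by (auto simp: smooth_on_def)

lemma smooth_on_has_pderiv:
  "eopen n U \<Longrightarrow> smooth_on n U f \<Longrightarrow> i < n \<Longrightarrow> x \<in> U \<Longrightarrow> has_pderiv i f x (pderiv_at i f x)"
  using Ck_on_has_pderiv[of n U 0] by (auto simp: smooth_on_def)

lemma smooth_on_pderiv_at: "eopen n U \<Longrightarrow> smooth_on n U f \<Longrightarrow> i < n \<Longrightarrow> smooth_on n U (pderiv_at i f)"
  using Ck_on_pderiv_at by (auto simp: smooth_on_def)

text \<open>The system expresses every first derivative through the unknowns themselves, so a
  differentiability class known for all unknowns at once improves by one. This is how the continuous
  solutions of flat systems become smooth.\<close>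

lemma Ck_on_bootstrap:
  assumes U: "eopen n U" and "finite B"
    and cont: "\<And>a. a \<in> B \<Longrightarrow> continuous_on U (u a)"
    and A: "\<And>i a b. i < n \<Longrightarrow> a \<in> B \<Longrightarrow> b \<in> B \<Longrightarrow> smooth_on n U (A i a b)"
    and pd: "\<And>i a x. i < n \<Longrightarrow> a \<in> B \<Longrightarrow> x \<in> U \<Longrightarrow> has_pderiv i (u a) x (\<Sum>b\<in>B. A i a b x * u b x)"
  shows "a \<in> B \<Longrightarrow> Ck_on k n U (u a)"
proof (induction k arbitrary: a)
  case 0
  then show ?case
    unfolding Ck_on_0[OF U] by (rule cont)
next
  case (Suc k)
  have "Ck_on k n U (A i a b)" if "i < n" "b \<in> B" for i b
    using A[OF that(1) Suc.prems that(2)] by (simp add: smooth_on_def)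
  then show ?case
    by (intro Ck_on_SucI[OF U cont[OF Suc.prems] _ pd[OF _ Suc.prems]] Ck_on_sum[OF U] Ck_on_mult[OF U] Suc.IH)
qed

section \<open>Radial integrals\<close>

text \<open>Each differentiation under the integral sign produces one factor \<open>t\<close>. The
  weight \<open>t ^ p\<close> makes the family of these operators closed under partial
  derivatives.\<close>

definition radial :: "nat \<Rightarrow> ((nat \<Rightarrow> real) \<Rightarrow> real) \<Rightarrow> (nat \<Rightarrow> real) \<Rightarrow> real"
  where "radial p f x = integral {0..1} (\<lambda>t. t ^ p * f (\<lambda>i. t * x i))"

text \<open>The centre is always the origin; other centres are reached by translating the
  function.\<close>

definition star_shaped :: "(nat \<Rightarrow> real) set \<Rightarrow> bool"
  where "star_shaped Q \<longleftrightarrow> (\<forall>x\<in>Q. \<forall>t\<in>{0..1}. (\<lambda>i. t * x i) \<in> Q)"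

lemma star_shapedD: "star_shaped Q \<Longrightarrow> x \<in> Q \<Longrightarrow> 0 \<le> t \<Longrightarrow> t \<le> 1 \<Longrightarrow> (\<lambda>i. t * x i) \<in> Q"
  by (auto simp: star_shaped_def)

lemma star_shaped_ebox: "star_shaped (ebox n (\<lambda>_. 0) e)"
proof -
  have "\<bar>t * x\<bar> < e" if "\<bar>x\<bar> < e" "0 \<le> t" "t \<le> 1" for t x :: real
    using that mult_left_le_one_le[of "\<bar>x\<bar>" t] by (simp add: abs_mult)
  then show ?thesis
    by (auto simp: star_shaped_def ebox_def euc_def)
qed

lemma continuous_on_radial_integrand:
  assumes Q: "star_shaped Q" and f: "continuous_on Q f"
  shows "continuous_on (Q \<times> {0..1}) (\<lambda>(x, t). t ^ p * f (\<lambda>i. t * x i))"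
proof -
  have g: "continuous_on (Q \<times> {0..1}) (\<lambda>z. (\<lambda>i. snd z * fst z i) :: nat \<Rightarrow> real)"
    by (intro continuous_on_coordinatewise_then_product continuous_on_mult continuous_on_snd continuous_on_id
        continuous_on_product_then_coordinatewise[OF continuous_on_fst[OF continuous_on_id]])
  have "continuous_on (Q \<times> {0..1}) (\<lambda>z. f (\<lambda>i. snd z * fst z i))"
    by (rule continuous_on_compose2[OF f g]) (auto intro: star_shapedD[OF Q])
  then have "continuous_on (Q \<times> {0..1}) (\<lambda>z. snd z ^ p * f (\<lambda>i. snd z * fst z i))"
    by (intro continuous_on_mult continuous_on_power continuous_on_snd continuous_on_id)
  then show ?thesis
    by (simp add: case_prod_beta)
qed

lemma continuous_on_radial:
  assumes "star_shaped Q" "continuous_on Q f"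
  shows "continuous_on Q (radial p f)"
proof -
  have "continuous_on Q (\<lambda>x. integral (cbox 0 1) (\<lambda>t. t ^ p * f (\<lambda>i. t * x i)))"
    by (rule integral_continuous_on_param) (unfold cbox_interval, rule continuous_on_radial_integrand[OF assms])
  then show ?thesis
    unfolding radial_def cbox_interval .
qed

lemma radial_integrable:
  assumes "star_shaped Q" "continuous_on Q f" "x \<in> Q"
  shows "(\<lambda>t. t ^ p * f (\<lambda>i. t * x i)) integrable_on {0..1}"
proof -
  have "continuous_on {0..1} (\<lambda>t. case (x, t) of (x, t) \<Rightarrow> t ^ p * f (\<lambda>i. t * x i))"
    by (rule continuous_on_compose2[OF continuous_on_radial_integrand[OF assms(1,2)]])
      (use assms(3) in \<open>auto intro!: continuous_intros\<close>)
  then show ?thesis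
    by (auto intro: integrable_continuous_real)
qed

text \<open>Differentiation under the integral sign on an interval around \<open>x i\<close>. The
  inner scaling contributes the factor \<open>t\<close> that raises the weight to
  \<open>Suc p\<close>.\<close>

lemma has_pderiv_radial:
  assumes Q: "star_shaped Q" "eopen n Q" and x: "x \<in> Q" and i: "i < n"
    and f: "continuous_on Q f" and f': "continuous_on Q f'"
    and pd: "\<And>y. y \<in> Q \<Longrightarrow> has_pderiv i f y (f' y)"
  shows "has_pderiv i (radial p f) x (radial (Suc p) f' x)"
proof -
  obtain e where e: "e > 0" "ebox n x e \<subseteq> Q"
    using Q(2) x by (meson eopen_iff)
  define U where "U = ball (x i) e"
  have xe: "x \<in> euc n"
    using eopen_subset[OF Q(2)] x by blast
  have U: "x(i := s) \<in> Q" if "s \<in> U" for s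
  proof -
    have "x(i := s) \<in> ebox n x e"
      using that e(1) i euc_upd[OF xe i] by (auto simp: U_def ebox_def dist_real_def)
    then show ?thesis
      using e(2) by blast
  qed
  have eq: "(\<lambda>j. t * (x(i := s)) j) = (\<lambda>j. t * x j)(i := t * s)" for s t :: real
    by auto
  have "((\<lambda>s. integral (cbox 0 1) (\<lambda>t. t ^ p * f (\<lambda>j. t * (x(i := s)) j))) has_field_derivative
      integral (cbox 0 1) (\<lambda>t. t ^ Suc p * f' (\<lambda>j. t * (x(i := x i)) j))) (at (x i) within U)"
  proof (rule leibniz_rule_field_derivative)
    fix s t :: real
    assume st: "s \<in> U" "t \<in> cbox 0 1"
    define y where "y = (\<lambda>j. t * (x(i := s)) j)"
    have y: "y \<in> Q"
      unfolding y_def using star_shapedD[OF Q(1) U[OF st(1)]] st(2) by simp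
    have "((\<lambda>r. f (y(i := r))) has_real_derivative f' y) (at (t * s))"
      using pd[OF y] by (simp add: has_pderiv_def y_def)
    moreover have "((\<lambda>s. t * s) has_real_derivative t) (at s within U)"
      using DERIV_cmult_Id DERIV_subset by blast
    ultimately have "((\<lambda>s. f (y(i := t * s))) has_real_derivative f' y * t) (at s within U)"
      by (rule DERIV_chain2)
    then have "((\<lambda>s. t ^ p * f (y(i := t * s))) has_real_derivative t ^ p * (f' y * t)) (at s within U)"
      by (rule DERIV_cmult)
    moreover have "y(i := t * r) = (\<lambda>j. t * (x(i := r)) j)" for r
      by (auto simp: y_def)
    ultimately show "((\<lambda>s. t ^ p * f (\<lambda>j. t * (x(i := s)) j)) has_field_derivative
        t ^ Suc p * f' (\<lambda>j. t * (x(i := s)) j)) (at s within U)"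
      by (simp add: y_def algebra_simps)
  next
    fix s assume "s \<in> U"
    then show "(\<lambda>t. t ^ p * f (\<lambda>j. t * (x(i := s)) j)) integrable_on cbox 0 1"
      using radial_integrable[OF Q(1) f U] by (simp add: cbox_interval)
  next
    have upd: "continuous_on U (\<lambda>s. x(i := s))"
    proof (rule continuous_on_coordinatewise_then_product)
      show "continuous_on U (\<lambda>s. (x(i := s)) j)" for j
        by (cases "j = i") (auto intro: continuous_intros)
    qed
    have "continuous_on (U \<times> {0..1}) (\<lambda>z. (x(i := fst z), snd z))"
      by (intro continuous_on_Pair continuous_on_compose2[OF upd] continuous_on_fst continuous_on_snd continuous_on_id)
        auto
    then have "continuous_on (U \<times> {0..1}) (\<lambda>z. case (x(i := fst z), snd z) of (x, t) \<Rightarrow> t ^ Suc p * f' (\<lambda>j. t * x j))"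
      by (rule continuous_on_compose2[OF continuous_on_radial_integrand[OF Q(1) f']]) (use U in auto)
    then show "continuous_on (U \<times> cbox 0 1) (\<lambda>(s, t). t ^ Suc p * f' (\<lambda>j. t * (x(i := s)) j))"
      by (simp add: case_prod_beta cbox_interval)
  qed (auto simp: U_def e)
  moreover have "at (x i) within U = at (x i)"
    unfolding U_def by (rule at_within_open) (use e in auto)
  ultimately show ?thesis
    by (simp add: has_pderiv_def radial_def cbox_interval)
qed

lemma Ck_on_radial:
  assumes "star_shaped Q" "eopen n Q"
  shows "Ck_on k n Q f \<Longrightarrow> Ck_on k n Q (radial p f)"
proof (induction k arbitrary: p f)
  case 0
  then show ?case
    unfolding Ck_on_0[OF assms(2)] by (rule continuous_on_radial[OF assms(1)])
next
  case (Suc k)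
  note f = Ck_on_continuous[OF assms(2) Suc.prems]
  show ?case
    by (intro Ck_on_SucI[where g = "\<lambda>i. radial (Suc p) (pderiv_at i f)"] assms(2) Suc.IH
        continuous_on_radial[OF assms(1) f] has_pderiv_radial[OF assms(1,2) _ _ f]
        Ck_on_pderiv_at[OF assms(2) Suc.prems] Ck_on_has_pderiv[OF assms(2) Suc.prems]
        Ck_on_continuous[OF assms(2) Ck_on_pderiv_at[OF assms(2) Suc.prems]])
qed

lemma smooth_on_radial: "star_shaped Q \<Longrightarrow> eopen n Q \<Longrightarrow> smooth_on n Q f \<Longrightarrow> smooth_on n Q (radial p f)"
  by (simp add: smooth_on_def Ck_on_radial)

lemma radial_derivative:
  assumes Q: "star_shaped Q" "eopen n Q" and x: "x \<in> Q" and t: "0 \<le> t" "t \<le> 1"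
    and pd: "\<And>i y. i < n \<Longrightarrow> y \<in> Q \<Longrightarrow> has_pderiv i f y (f' i y)"
    and cont: "\<And>i. i < n \<Longrightarrow> continuous_on Q (f' i)"
  shows "((\<lambda>t. f (\<lambda>i. t * x i)) has_real_derivative (\<Sum>i<n. f' i (\<lambda>i. t * x i) * x i)) (at t)"
proof (rule chain_rule[OF Q(2) _ _ pd cont])
  show "(\<lambda>i. t * x i) \<in> Q"
    using star_shapedD[OF Q(1) x] t by simp
  have "x \<in> euc n"
    using eopen_subset[OF Q(2)] x by blast
  then have "(\<lambda>i. s * x i) \<in> euc n" for s
    by (auto simp: euc_def)
  then show "eventually (\<lambda>s. (\<lambda>i. s * x i) \<in> euc n) (nhds t)"
    by simp
  show "((\<lambda>t. t * x j) has_real_derivative x j) (at t)" for j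
    by (auto intro!: derivative_eq_intros)
qed

text \<open>Integrate the derivative of \<open>f\<close> along the segment from the origin to
  \<open>x\<close>. The factors \<open>radial 0 (f' i)\<close> inherit the regularity of
  \<open>f' i\<close>, which is what the expansion of tangent vectors in coordinates relies
  on.\<close>

lemma hadamard:
  assumes Q: "star_shaped Q" "eopen n Q" and x: "x \<in> Q"
    and pd: "\<And>i y. i < n \<Longrightarrow> y \<in> Q \<Longrightarrow> has_pderiv i f y (f' i y)"
    and cont: "\<And>i. i < n \<Longrightarrow> continuous_on Q (f' i)"
  shows "f x - f (\<lambda>_. 0) = (\<Sum>i<n. x i * radial 0 (f' i) x)"
proof -
  have "((\<lambda>t. \<Sum>i<n. f' i (\<lambda>i. t * x i) * x i) has_integral f (\<lambda>i. 1 * x i) - f (\<lambda>i. 0 * x i)) {0..1}"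
    using radial_derivative[OF Q x _ _ pd cont]
    by (intro fundamental_theorem_of_calculus)
      (auto simp flip: has_real_derivative_iff_has_vector_derivative intro: has_field_derivative_at_within)
  moreover have "((\<lambda>t. \<Sum>i<n. f' i (\<lambda>i. t * x i) * x i) has_integral (\<Sum>i<n. radial 0 (f' i) x * x i)) {0..1}"
    using radial_integrable[OF Q(1) cont x, of _ 0]
    by (intro has_integral_sum has_integral_mult_left) (auto simp: radial_def)
  ultimately have "f (\<lambda>i. 1 * x i) - f (\<lambda>i. 0 * x i) = (\<Sum>i<n. radial 0 (f' i) x * x i)"
    by (rule has_integral_unique)
  then show ?thesis
    by (simp add: mult.commute)
qed

section \<open>Cutoff functions\<close>

text \<open>For \<open>m = 0\<close> this is the classical smooth function that is flat at
  \<open>0\<close>. The poles \<open>t ^ m\<close> are included because the linear span of the whole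
  family is closed under differentiation.\<close>

definition flat_exp :: "nat \<Rightarrow> real \<Rightarrow> real"
  where "flat_exp m t = (if t > 0 then exp (- 1 / t) / t ^ m else 0)"

text \<open>Raising \<open>1 / (t k) \<le> exp (1 / (t k))\<close> to the power
  \<open>k = Suc m\<close> beats the pole \<open>t ^ m\<close> with one factor \<open>t\<close> to
  spare. This gives the limit \<open>0\<close> at the origin for every member of the family.\<close>

lemma flat_exp_bound: "\<bar>flat_exp m t\<bar> \<le> real (Suc m) ^ Suc m * \<bar>t\<bar>"
proof (cases "t > 0")
  case True
  define k where "k = real (Suc m)"
  have "1 / t / k \<le> exp (1 / t / k)"
    using exp_ge_add_one_self[of "1 / t / k"] by linarith
  then have "(1 / t / k) ^ Suc m \<le> exp (1 / t / k) ^ Suc m"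
    using True by (intro power_mono) (auto simp: k_def)
  also have "\<dots> = exp (real (Suc m) * (1 / t / k))"
    by (rule exp_of_nat_mult[symmetric])
  also have "\<dots> = exp (1 / t)"
    by (simp add: k_def del: of_nat_Suc)
  finally have *: "1 \<le> exp (1 / t) * (t * k) ^ Suc m"
    using True by (simp add: k_def field_simps del: power_Suc of_nat_Suc)
  have "exp (- 1 / t) / t ^ m * 1 \<le> exp (- 1 / t) / t ^ m * (exp (1 / t) * (t * k) ^ Suc m)"
    using * True by (intro mult_left_mono) auto
  also have "\<dots> = (exp (- 1 / t) * exp (1 / t)) * (k ^ Suc m * t)"
    using True by (simp add: field_simps power_mult_distrib)
  also have "\<dots> = k ^ Suc m * t"
    by (simp flip: exp_add)
  finally show ?thesis
    using True by (simp add: flat_exp_def k_def)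
next
  case False
  then have "flat_exp m t = 0"
    by (simp add: flat_exp_def)
  then show ?thesis
    by (simp only: abs_zero) (intro mult_nonneg_nonneg zero_le_power; simp)
qed

lemma DERIV_flat_exp: "(flat_exp m has_real_derivative flat_exp (m + 2) t - m * flat_exp (Suc m) t) (at t)"
proof (cases t "0::real" rule: linorder_cases)
  case less
  have "eventually (\<lambda>s. s < 0) (nhds t)"
    using less eventually_nhds_in_open[of "{..<0}" t] by simp
  then have "eventually (\<lambda>s. flat_exp m s = 0) (nhds t)"
    by eventually_elim (simp add: flat_exp_def)
  then have "(flat_exp m has_real_derivative 0) (at t)"
    by (subst DERIV_cong_ev[OF refl _ refl, where g = "\<lambda>_. 0"]) auto
  then show ?thesis
    using less by (simp add: flat_exp_def)
next
  case equal
  have "((\<lambda>h. flat_exp (Suc m) h) \<longlongrightarrow> 0) (at 0)"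
  proof (rule Lim_null_comparison)
    show "eventually (\<lambda>h. norm (flat_exp (Suc m) h) \<le> real (Suc (Suc m)) ^ Suc (Suc m) * \<bar>h\<bar>) (at 0)"
      by (rule always_eventually) (use flat_exp_bound[of "Suc m"] in auto)
    show "((\<lambda>h. real (Suc (Suc m)) ^ Suc (Suc m) * \<bar>h\<bar>) \<longlongrightarrow> 0) (at 0)"
      by (rule tendsto_eq_intros refl | simp)+
  qed
  \<comment> \<open>Division by \<open>h\<close> only raises the order of the pole, so the
    difference quotient at \<open>0\<close> is another member of the family.\<close>
  moreover have "(flat_exp m (0 + h) - flat_exp m 0) / h = flat_exp (Suc m) h" for h
    by (auto simp: flat_exp_def)
  ultimately show ?thesis
    using equal by (simp add: DERIV_def flat_exp_def)
next
  case greater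
  have "((\<lambda>s. exp (- 1 / s) / s ^ m) has_real_derivative
      exp (- 1 / t) / t ^ (m + 2) - m * (exp (- 1 / t) / t ^ Suc m)) (at t)"
  proof -
    have "((\<lambda>s. exp (- 1 / s)) has_real_derivative exp (- 1 / t) * (1 / t\<^sup>2)) (at t)"
      using greater by (auto intro!: derivative_eq_intros simp: power2_eq_square)
    from DERIV_divide[OF this DERIV_pow[of m t]] greater
    have "((\<lambda>s. exp (- 1 / s) / s ^ m) has_real_derivative
        (exp (- 1 / t) * (1 / t\<^sup>2) * t ^ m - exp (- 1 / t) * (real m * t ^ (m - Suc 0))) / (t ^ m * t ^ m)) (at t)"
      by simp
    moreover have "(exp (- 1 / t) * (1 / t\<^sup>2) * t ^ m - exp (- 1 / t) * (real m * t ^ (m - Suc 0))) / (t ^ m * t ^ m)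
        = exp (- 1 / t) / t ^ (m + 2) - m * (exp (- 1 / t) / t ^ Suc m)"
      using greater by (cases m) (simp_all add: field_simps power2_eq_square)
    ultimately show ?thesis
      by simp
  qed
  moreover have "eventually (\<lambda>s. s > 0) (nhds t)"
    using greater eventually_nhds_in_open[of "{0<..}" t] by simp
  then have "eventually (\<lambda>s. exp (- 1 / s) / s ^ m = flat_exp m s) (nhds t)"
    by eventually_elim (simp add: flat_exp_def)
  ultimately have "(flat_exp m has_real_derivative
      exp (- 1 / t) / t ^ (m + 2) - m * (exp (- 1 / t) / t ^ Suc m)) (at t)"
    by (subst (asm) DERIV_cong_ev[OF refl _ refl]) auto
  then show ?thesis
    using greater by (simp add: flat_exp_def)
qed

lemma Ck_on_flat_exp:
  assumes U: "eopen n U"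
  shows "Ck_on k n U f \<Longrightarrow> Ck_on k n U (\<lambda>x. flat_exp m (f x))"
proof (induction k arbitrary: m)
  case 0
  have "continuous_on UNIV (flat_exp m)"
    using DERIV_flat_exp DERIV_isCont continuous_at_imp_continuous_on by blast
  then show ?case
    using 0 continuous_on_compose2[of UNIV "flat_exp m" U f] unfolding Ck_on_0[OF U] by simp
next
  case (Suc k)
  have c: "continuous_on UNIV (flat_exp m)"
    using DERIV_flat_exp DERIV_isCont continuous_at_imp_continuous_on by blast
  note IH = Suc.IH[OF Ck_on_SucD[OF U Suc.prems]]
  show ?case
  proof (rule Ck_on_SucI[where g = "\<lambda>i x. (flat_exp (m + 2) (f x) + (- real m) * flat_exp (Suc m) (f x)) * pderiv_at i f x"])
    show "continuous_on U (\<lambda>x. flat_exp m (f x))"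
      using continuous_on_compose2[OF c Ck_on_continuous[OF U Suc.prems]] by simp
    show "Ck_on k n U (\<lambda>x. (flat_exp (m + 2) (f x) + (- real m) * flat_exp (Suc m) (f x)) * pderiv_at i f x)"
      if "i < n" for i
      by (intro Ck_on_mult[OF U] Ck_on_add[OF U] IH Ck_on_const[OF U] Ck_on_pderiv_at[OF U Suc.prems that])
    show "has_pderiv i (\<lambda>x. flat_exp m (f x)) x
        ((flat_exp (m + 2) (f x) + (- real m) * flat_exp (Suc m) (f x)) * pderiv_at i f x)"
      if "i < n" "x \<in> U" for i x
    proof -
      have "(flat_exp m has_real_derivative flat_exp (m + 2) (f x) - m * flat_exp (Suc m) (f x)) (at (f (x(i := x i))))"
        using DERIV_flat_exp by simp
      from DERIV_chain2[OF this Ck_on_has_pderiv[OF U Suc.prems that, unfolded has_pderiv_def]] show ?thesis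
        by (simp add: has_pderiv_def)
    qed
  qed (rule U)
qed

text \<open>The quotient \<open>f / (f + g)\<close> of two flat functions of the squared Euclidean
  distance \<open>q\<close>: \<open>f\<close> vanishes from radius \<open>r\<close> on and
  \<open>g\<close> vanishes up to radius \<open>r / 2\<close>, never both. The squared distance is
  used because the maximum norm is not smooth.\<close>

lemma cutoff_exists:
  assumes "r > 0"
  obtains b :: "(nat \<Rightarrow> real) \<Rightarrow> real" and d where "smooth_on n (euc n) b" "d > 0" "d \<le> r"
    "\<And>x. x \<in> ebox n x0 d \<Longrightarrow> b x = 1" "\<And>x. x \<in> euc n - ebox n x0 r \<Longrightarrow> b x = 0"
proof -
  define q where "q x = (\<Sum>i<n. (x i + - x0 i) * (x i + - x0 i))" for x :: "nat \<Rightarrow> real"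
  define f where "f x = flat_exp 0 (r\<^sup>2 + - 1 * q x)" for x
  define g where "g x = flat_exp 0 (q x + - (r\<^sup>2 / 4))" for x
  define b where "b x = f x * inverse (f x + g x)" for x
  \<comment> \<open>The cube of half-width \<open>d\<close> lies in the Euclidean ball of radius
    \<open>r / 2\<close>, because \<open>n d^2 \<le> r^2 / 4\<close>. The added \<open>1\<close>
    also covers \<open>n = 0\<close>.\<close>
  define d where "d = r / (2 * (real n + 1))"
  have E: "eopen n (euc n)"
    by (metis openin_topspace topspace_eucl)
  have pos: "f x + g x > 0" for x
  proof (cases "q x < r\<^sup>2")
    case True
    then show ?thesis
      by (auto simp: f_def g_def flat_exp_def intro!: add_pos_nonneg)
  next
    case False
    then have "q x - r\<^sup>2 / 4 > 0"
      using assms zero_less_power2[of r] by linarith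
    then show ?thesis
      by (auto simp: f_def g_def flat_exp_def intro!: add_nonneg_pos)
  qed
  have "smooth_on n (euc n) q"
    unfolding q_def
    by (intro smooth_on_sum[OF E] smooth_on_mult[OF E] smooth_on_add[OF E] smooth_on_coord[OF E] smooth_on_const[OF E])
  then have "smooth_on n (euc n) f" "smooth_on n (euc n) g"
    unfolding f_def g_def smooth_on_def
    by (intro allI Ck_on_flat_exp[OF E] Ck_on_add[OF E] Ck_on_mult[OF E] Ck_on_const[OF E], simp)+
  then have "smooth_on n (euc n) b"
    unfolding b_def using pos by (intro smooth_on_mult[OF E] smooth_on_inverse[OF E] smooth_on_add[OF E])
      (auto simp: less_le)
  moreover have d: "d > 0" "d \<le> r"
    using assms by (auto simp: d_def field_simps)
  moreover have "b x = 1" if "x \<in> ebox n x0 d" for x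
  proof -
    have "(x i + - x0 i) * (x i + - x0 i) \<le> d * d" if "i < n" for i
      using \<open>x \<in> ebox n x0 d\<close> that abs_le_square_iff[of "x i - x0 i" d] d(1)
      by (auto simp: ebox_def power2_eq_square)
    then have "q x \<le> (\<Sum>i<n. d * d)"
      unfolding q_def by (intro sum_mono) simp
    also have "\<dots> = (r\<^sup>2 / 4) * (real n / (real n + 1)\<^sup>2)"
      by (simp add: d_def power2_eq_square field_simps)
    also have "real n / (real n + 1)\<^sup>2 \<le> 1"
      by (subst divide_le_eq_1_pos) (auto simp: power2_eq_square algebra_simps intro: add_pos_nonneg)
    then have "(r\<^sup>2 / 4) * (real n / (real n + 1)\<^sup>2) \<le> (r\<^sup>2 / 4) * 1"
      by (intro mult_left_mono) auto
    finally have "g x = 0"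
      by (simp add: g_def flat_exp_def)
    then show ?thesis
      using pos[of x] by (simp add: b_def)
  qed
  moreover have "b x = 0" if "x \<in> euc n - ebox n x0 r" for x
  proof -
    have "\<exists>i<n. \<bar>x i - x0 i\<bar> \<ge> r"
      using that by (auto simp: ebox_def not_less)
    then obtain i where i: "i < n" "\<bar>x i - x0 i\<bar> \<ge> r"
      by blast
    have "r\<^sup>2 \<le> (x i + - x0 i) * (x i + - x0 i)"
      using i(2) assms abs_le_square_iff[of r "x i - x0 i"] by (simp add: power2_eq_square)
    also have "\<dots> \<le> q x"
      unfolding q_def using i(1) by (intro member_le_sum) auto
    finally show ?thesis
      by (simp add: b_def f_def flat_exp_def)
  qed
  ultimately show ?thesis
    using that by blast
qed

section \<open>Compact cubes\<close>

definition cebox :: "nat \<Rightarrow> (nat \<Rightarrow> real) \<Rightarrow> real \<Rightarrow> (nat \<Rightarrow> real) set"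
  where "cebox n x e = {y \<in> euc n. \<forall>i<n. \<bar>y i - x i\<bar> \<le> e}"

text \<open>Tychonoff's theorem for a product of closed intervals, with the factor
  \<open>{0}\<close> in every coordinate from \<open>n\<close> on.\<close>

lemma compact_cebox: "compactin (Euclidean_space n) (cebox n x e)"
proof -
  define C where "C = PiE UNIV (\<lambda>i. if i < n then {x i - e..x i + e} else {0})"
  have "compactin (powertop_real UNIV) C"
    unfolding C_def compactin_PiE by auto
  moreover have "y \<in> C \<longleftrightarrow> y \<in> cebox n x e" for y
  proof -
    have *: "y i \<in> (if i < n then {x i - e..x i + e} else {0}) \<longleftrightarrow> (i < n \<longrightarrow> \<bar>y i - x i\<bar> \<le> e) \<and> (n \<le> i \<longrightarrow> y i = 0)" for i
      by (auto simp: abs_le_iff)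
    show ?thesis
      unfolding C_def PiE_UNIV_domain Pi_iff * cebox_def euc_def by blast
  qed
  then have "C = cebox n x e"
    by blast
  ultimately have "compactin (powertop_real UNIV) (cebox n x e)"
    by simp
  then show ?thesis
    by (auto simp: Euclidean_space_def compactin_subtopology cebox_def euc_def)
qed

lemma ebox_subset_cebox: "ebox n x e \<subseteq> cebox n x e"
  by (auto simp: ebox_def cebox_def intro: less_imp_le)

lemma cebox_subset_ebox: "d < e \<Longrightarrow> cebox n x d \<subseteq> ebox n x e"
  by (auto simp: ebox_def cebox_def intro: le_less_trans)

section \<open>Charts, and functions that are smooth on open subsets of a manifold\<close>

abbreviation mopen :: "'a mfd \<Rightarrow> 'a set \<Rightarrow> bool"
  where "mopen M \<equiv> openin (mtop M)"

lemma manifold_chartD: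
  assumes M: "smooth_manifold M" and c: "(U, \<phi>) \<in> matlas M"
  shows chart_open: "mopen M U"
    and chart_inj: "inj_on \<phi> U"
    and chart_image_open: "mopen M W \<Longrightarrow> eopen (mdim M) (\<phi> ` (U \<inter> W))"
    and chart_preimage_open: "eopen (mdim M) V \<Longrightarrow> mopen M {p \<in> U. \<phi> p \<in> V}"
    and chart_transition: "(V', \<psi>) \<in> matlas M \<Longrightarrow> i < mdim M \<Longrightarrow>
      smooth_on (mdim M) (\<phi> ` (U \<inter> V')) (\<lambda>x. \<psi> (inv_into U \<phi> x) i)"
proof -
  show U: "mopen M U"
    using M c by (auto simp: smooth_manifold_def)
  have oi: "eopen (mdim M) (\<phi> ` U)"
    using M c by (auto simp: smooth_manifold_def)
  have h: "homeomorphic_map (subtopology (mtop M) U) (subtopology (Euclidean_space (mdim M)) (\<phi> ` U)) \<phi>"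
    using M c by (auto simp: smooth_manifold_def)
  have ts: "topspace (subtopology (mtop M) U) = U"
    using openin_subset[OF U] by auto
  show "inj_on \<phi> U"
    using h ts by (metis homeomorphic_imp_injective_map)
  show "eopen (mdim M) (\<phi> ` (U \<inter> W))" if W: "mopen M W"
  proof -
    have "openin (subtopology (mtop M) U) (U \<inter> W)"
      using W by (simp add: openin_subtopology_Int2)
    then have "openin (subtopology (Euclidean_space (mdim M)) (\<phi> ` U)) (\<phi> ` (U \<inter> W))"
      using h homeomorphic_imp_open_map open_map_def by blast
    then show ?thesis
      using oi openin_trans_full by blast
  qed
  show "mopen M {p \<in> U. \<phi> p \<in> V}" if V: "eopen (mdim M) V"
  proof -
    have "openin (subtopology (Euclidean_space (mdim M)) (\<phi> ` U)) (\<phi> ` U \<inter> V)"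
      using V by (simp add: openin_subtopology_Int2)
    then have "openin (subtopology (mtop M) U) {p \<in> topspace (subtopology (mtop M) U). \<phi> p \<in> \<phi> ` U \<inter> V}"
      using h homeomorphic_imp_continuous_map openin_continuous_map_preimage by blast
    moreover have "{p \<in> topspace (subtopology (mtop M) U). \<phi> p \<in> \<phi> ` U \<inter> V} = {p \<in> U. \<phi> p \<in> V}"
      unfolding ts by auto
    ultimately show ?thesis
      using U openin_trans_full by metis
  qed
  show "smooth_on (mdim M) (\<phi> ` (U \<inter> V')) (\<lambda>x. \<psi> (inv_into U \<phi> x) i)"
    if "(V', \<psi>) \<in> matlas M" "i < mdim M"
  proof -
    have "\<forall>(U, \<phi>)\<in>matlas M. \<forall>(V, \<psi>)\<in>matlas M. \<forall>i<mdim M.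
       smooth_on (mdim M) (\<phi> ` (U \<inter> V)) (\<lambda>x. \<psi> (inv_into U \<phi> x) i)"
      using M by (simp add: smooth_manifold_def)
    from bspec[OF this c, unfolded split, THEN bspec, OF that(1)] that(2) show ?thesis
      by simp
  qed
qed

text \<open>The homeomorphism condition on charts is split into openness of images and of preimages,
  which is how it is verified for products, for the generated subgroup and for open sets of
  matrices.\<close>

lemma smooth_manifoldI:
  assumes "Hausdorff_space (mtop M)"
    and cover: "\<And>p. p \<in> mpoints M \<Longrightarrow> \<exists>U \<phi>. (U, \<phi>) \<in> matlas M \<and> p \<in> U"
    and open': "\<And>U \<phi>. (U, \<phi>) \<in> matlas M \<Longrightarrow> mopen M U"
    and inj: "\<And>U \<phi>. (U, \<phi>) \<in> matlas M \<Longrightarrow> inj_on \<phi> U"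
    and image: "\<And>U \<phi> W. (U, \<phi>) \<in> matlas M \<Longrightarrow> mopen M W \<Longrightarrow> W \<subseteq> U \<Longrightarrow> eopen (mdim M) (\<phi> ` W)"
    and preimage: "\<And>U \<phi> V. (U, \<phi>) \<in> matlas M \<Longrightarrow> eopen (mdim M) V \<Longrightarrow> mopen M {p \<in> U. \<phi> p \<in> V}"
    and transition: "\<And>U \<phi> V \<psi> i. (U, \<phi>) \<in> matlas M \<Longrightarrow> (V, \<psi>) \<in> matlas M \<Longrightarrow> i < mdim M \<Longrightarrow>
      smooth_on (mdim M) (\<phi> ` (U \<inter> V)) (\<lambda>x. \<psi> (inv_into U \<phi> x) i)"
  shows "smooth_manifold M"
proof -
  have sub: "U \<subseteq> mpoints M" if "(U, \<phi>) \<in> matlas M" for U \<phi>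
    using openin_subset[OF open'[OF that]] .
  have "homeomorphic_map (subtopology (mtop M) U) (subtopology (Euclidean_space (mdim M)) (\<phi> ` U)) \<phi>"
    if c: "(U, \<phi>) \<in> matlas M" for U \<phi>
  proof (rule bijective_open_imp_homeomorphic_map)
    have iU: "eopen (mdim M) (\<phi> ` U)"
      using image[OF c open'[OF c]] by simp
    have ts: "topspace (subtopology (mtop M) U) = U"
      using sub[OF c] by auto
    show "continuous_map (subtopology (mtop M) U) (subtopology (Euclidean_space (mdim M)) (\<phi> ` U)) \<phi>"
    proof (rule continuous_map_into_subtopology)
      show "continuous_map (subtopology (mtop M) U) (Euclidean_space (mdim M)) \<phi>"
        unfolding continuous_map_def ts
      proof (intro conjI allI impI)
        show "\<phi> \<in> U \<rightarrow> topspace (Euclidean_space (mdim M))"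
          using eopen_subset[OF iU] by auto
        fix V assume "eopen (mdim M) V"
        then show "openin (subtopology (mtop M) U) {x \<in> U. \<phi> x \<in> V}"
          using preimage[OF c] by (auto simp: openin_subtopology)
      qed
    qed (auto simp: ts)
    show "open_map (subtopology (mtop M) U) (subtopology (Euclidean_space (mdim M)) (\<phi> ` U)) \<phi>"
      unfolding open_map_def
    proof (intro allI impI)
      fix W assume W: "openin (subtopology (mtop M) U) W"
      then have "mopen M W" "W \<subseteq> U"
        using open'[OF c] openin_trans_full openin_imp_subset by blast+
      then have "eopen (mdim M) (\<phi> ` W)" "\<phi> ` W \<subseteq> \<phi> ` U"
        using image[OF c] by auto
      then show "openin (subtopology (Euclidean_space (mdim M)) (\<phi> ` U)) (\<phi> ` W)"
        by (rule subset_openin_subtopology)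
    qed
    show "\<phi> ` topspace (subtopology (mtop M) U) = topspace (subtopology (Euclidean_space (mdim M)) (\<phi> ` U))"
      using eopen_subset[OF iU] unfolding ts by auto
    show "inj_on \<phi> (topspace (subtopology (mtop M) U))"
      unfolding ts using inj[OF c] .
  qed
  moreover have "(\<Union>(U, \<phi>)\<in>matlas M. U) = mpoints M"
    using sub cover by fast
  moreover have "eopen (mdim M) (\<phi> ` U)" if "(U, \<phi>) \<in> matlas M" for U \<phi>
    using image[OF that open'[OF that]] by simp
  ultimately show ?thesis
    unfolding smooth_manifold_def using assms(1) open' transition by auto
qed

lemma chart_at:
  assumes "smooth_manifold M" "p \<in> mpoints M"
  obtains U \<phi> where "(U, \<phi>) \<in> matlas M" "p \<in> U"
  using assms unfolding smooth_manifold_def by fast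

text \<open>The local counterpart of \<open>smooth_funs\<close>, whose elements live on the whole
  manifold and vanish outside it.\<close>

definition msmooth :: "'a mfd \<Rightarrow> 'a set \<Rightarrow> ('a \<Rightarrow> real) \<Rightarrow> bool"
  where "msmooth M O' f \<longleftrightarrow> mopen M O' \<and>
    (\<forall>(U, \<phi>)\<in>matlas M. smooth_on (mdim M) (\<phi> ` (U \<inter> O')) (\<lambda>x. f (inv_into U \<phi> x)))"

lemma msmooth_open: "msmooth M O' f \<Longrightarrow> mopen M O'"
  by (simp add: msmooth_def)

lemma msmoothD:
  "msmooth M O' f \<Longrightarrow> (U, \<phi>) \<in> matlas M \<Longrightarrow> smooth_on (mdim M) (\<phi> ` (U \<inter> O')) (\<lambda>x. f (inv_into U \<phi> x))"
  by (auto simp: msmooth_def)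

lemma chart_inv [simp]: "smooth_manifold M \<Longrightarrow> (U, \<phi>) \<in> matlas M \<Longrightarrow> p \<in> U \<Longrightarrow> inv_into U \<phi> (\<phi> p) = p"
  using chart_inj inv_into_f_f by metis

lemma smooth_on_transition:
  assumes M: "smooth_manifold M" and c: "(U, \<phi>) \<in> matlas M" and d: "(V, \<psi>) \<in> matlas M"
    and W: "mopen M W" "W \<subseteq> U" and f: "smooth_on (mdim M) (\<phi> ` W) (\<lambda>x. f (inv_into U \<phi> x))"
  shows "smooth_on (mdim M) (\<psi> ` (V \<inter> W)) (\<lambda>x. f (inv_into V \<psi> x))"
proof -
  let ?n = "mdim M"
  have 1: "eopen ?n (\<phi> ` W)"
    using chart_image_open[OF M c W(1)] W(2) by (simp add: Int_absorb1)
  have 2: "eopen ?n (\<psi> ` (V \<inter> W))"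
    using chart_image_open[OF M d W(1)] .
  have "smooth_on ?n (\<psi> ` (V \<inter> W)) (\<lambda>x. (\<lambda>y. f (inv_into U \<phi> y)) (\<phi> (inv_into V \<psi> x)))"
  proof (rule smooth_on_compose[OF 1 2, where f = "\<lambda>y. f (inv_into U \<phi> y)" and g = "\<lambda>x. \<phi> (inv_into V \<psi> x)"])
    show "\<phi> (inv_into V \<psi> x) \<in> \<phi> ` W" if "x \<in> \<psi> ` (V \<inter> W)" for x
      using that chart_inv[OF M d] by auto
    show "smooth_on ?n (\<psi> ` (V \<inter> W)) (\<lambda>x. \<phi> (inv_into V \<psi> x) j)" if "j < ?n" for j
      by (rule smooth_on_subset[OF chart_image_open[OF M d chart_open[OF M c]] 2 _ chart_transition[OF M d c that]])
        (use W in auto)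
  qed (rule f)
  then show ?thesis
    by (rule smooth_on_cong[OF 2, rotated]) (use chart_inv[OF M c] chart_inv[OF M d] W in auto)
qed

text \<open>Transition maps carry smoothness from one chart to all others, so one chart around each
  point decides.\<close>

lemma msmoothI_local:
  assumes M: "smooth_manifold M" and O: "mopen M O'"
    and loc: "\<And>p. p \<in> O' \<Longrightarrow> \<exists>U \<phi> W. (U, \<phi>) \<in> matlas M \<and> mopen M W \<and> p \<in> W \<and> W \<subseteq> U \<and>
      smooth_on (mdim M) (\<phi> ` W) (\<lambda>x. f (inv_into U \<phi> x))"
  shows "msmooth M O' f"
  unfolding msmooth_def
proof (intro conjI O, clarify)
  fix V \<psi> assume d: "(V, \<psi>) \<in> matlas M"
  show "smooth_on (mdim M) (\<psi> ` (V \<inter> O')) (\<lambda>x. f (inv_into V \<psi> x))"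
  proof (rule smooth_on_locally)
    show "eopen (mdim M) (\<psi> ` (V \<inter> O'))"
      using chart_image_open[OF M d O] .
    fix x assume "x \<in> \<psi> ` (V \<inter> O')"
    then obtain p where p: "p \<in> V" "p \<in> O'" "x = \<psi> p"
      by auto
    then obtain U \<phi> W where *: "(U, \<phi>) \<in> matlas M" "mopen M W" "p \<in> W" "W \<subseteq> U"
      "smooth_on (mdim M) (\<phi> ` W) (\<lambda>x. f (inv_into U \<phi> x))"
      using loc by blast
    then show "\<exists>V'. eopen (mdim M) V' \<and> x \<in> V' \<and> smooth_on (mdim M) V' (\<lambda>x. f (inv_into V \<psi> x))"
      using smooth_on_transition[OF M *(1) d *(2,4,5)] chart_image_open[OF M d *(2)] p
      by (intro exI[of _ "\<psi> ` (V \<inter> W)"]) auto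
  qed
qed

lemma msmooth_subset:
  assumes "smooth_manifold M" "msmooth M O' f" "mopen M P" "P \<subseteq> O'"
  shows "msmooth M P f"
  unfolding msmooth_def
proof (intro conjI assms, clarify)
  fix U \<phi> assume c: "(U, \<phi>) \<in> matlas M"
  show "smooth_on (mdim M) (\<phi> ` (U \<inter> P)) (\<lambda>x. f (inv_into U \<phi> x))"
    by (rule smooth_on_subset[OF _ _ _ msmoothD[OF assms(2) c]])
      (use assms chart_image_open[OF assms(1) c] msmooth_open[OF assms(2)] in auto)
qed

lemma msmooth_locally:
  assumes "smooth_manifold M" "mopen M O'"
    and "\<And>p. p \<in> O' \<Longrightarrow> \<exists>W. p \<in> W \<and> msmooth M W f"
  shows "msmooth M O' f"
proof (rule msmoothI_local[OF assms(1,2)])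
  fix p assume p: "p \<in> O'"
  then obtain W where W: "p \<in> W" "msmooth M W f"
    using assms(3) by blast
  have "p \<in> mpoints M"
    using p openin_subset[OF assms(2)] by blast
  then obtain U \<phi> where c: "(U, \<phi>) \<in> matlas M" "p \<in> U"
    using chart_at[OF assms(1)] by blast
  have "mopen M (U \<inter> W)"
    using msmooth_open[OF W(2)] chart_open[OF assms(1) c(1)] by blast
  then show "\<exists>U \<phi> W. (U, \<phi>) \<in> matlas M \<and> mopen M W \<and> p \<in> W \<and> W \<subseteq> U \<and>
      smooth_on (mdim M) (\<phi> ` W) (\<lambda>x. f (inv_into U \<phi> x))"
    using c W msmoothD[OF W(2) c(1)] by (intro exI[of _ U] exI[of _ \<phi>] exI[of _ "U \<inter> W"]) auto
qed

lemma msmooth_cong: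
  assumes "smooth_manifold M" "\<And>p. p \<in> O' \<Longrightarrow> f p = g p" "msmooth M O' f"
  shows "msmooth M O' g"
  unfolding msmooth_def
proof (intro conjI msmooth_open[OF assms(3)], clarify)
  fix U \<phi> assume c: "(U, \<phi>) \<in> matlas M"
  show "smooth_on (mdim M) (\<phi> ` (U \<inter> O')) (\<lambda>x. g (inv_into U \<phi> x))"
    by (rule smooth_on_cong[OF _ _ msmoothD[OF assms(3) c]])
      (use assms(2) chart_inv[OF assms(1) c] chart_image_open[OF assms(1) c msmooth_open[OF assms(3)]] in auto)
qed

lemma msmoothI:
  assumes "smooth_manifold M" "mopen M O'"
    and "\<And>U \<phi>. (U, \<phi>) \<in> matlas M \<Longrightarrow> eopen (mdim M) (\<phi> ` (U \<inter> O')) \<Longrightarrow>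
      smooth_on (mdim M) (\<phi> ` (U \<inter> O')) (\<lambda>x. f (inv_into U \<phi> x))"
  shows "msmooth M O' f"
  unfolding msmooth_def using assms(2) assms(3)[OF _ chart_image_open[OF assms(1) _ assms(2)]] by blast

lemma msmooth_const: "smooth_manifold M \<Longrightarrow> mopen M O' \<Longrightarrow> msmooth M O' (\<lambda>p. c)"
  by (rule msmoothI) (auto intro: smooth_on_const)

lemma msmooth_add:
  assumes "smooth_manifold M" "msmooth M O' f" "msmooth M O' g"
  shows "msmooth M O' (\<lambda>p. f p + g p)"
  by (rule msmoothI[OF assms(1) msmooth_open[OF assms(2)] smooth_on_add[OF _ msmoothD[OF assms(2)] msmoothD[OF assms(3)]]])

lemma msmooth_mult:
  assumes "smooth_manifold M" "msmooth M O' f" "msmooth M O' g"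
  shows "msmooth M O' (\<lambda>p. f p * g p)"
  by (rule msmoothI[OF assms(1) msmooth_open[OF assms(2)] smooth_on_mult[OF _ msmoothD[OF assms(2)] msmoothD[OF assms(3)]]])

lemma msmooth_diff:
  assumes "smooth_manifold M" "msmooth M O' f" "msmooth M O' g"
  shows "msmooth M O' (\<lambda>p. f p - g p)"
  by (rule msmoothI[OF assms(1) msmooth_open[OF assms(2)] smooth_on_diff[OF _ msmoothD[OF assms(2)] msmoothD[OF assms(3)]]])

lemma msmooth_sum:
  assumes "smooth_manifold M" "mopen M O'" "\<And>j. j \<in> J \<Longrightarrow> msmooth M O' (f j)"
  shows "msmooth M O' (\<lambda>p. \<Sum>j\<in>J. f j p)"
  using assms(3) by (induction J rule: infinite_finite_induct)
    (auto intro: msmooth_const msmooth_add assms(1,2))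

lemma msmooth_comp_chart:
  assumes M: "smooth_manifold M" and c: "(U, \<phi>) \<in> matlas M" and V: "eopen (mdim M) V" and f: "smooth_on (mdim M) V f"
  shows "msmooth M {p \<in> U. \<phi> p \<in> V} (\<lambda>p. f (\<phi> p))"
proof (rule msmoothI_local[OF M chart_preimage_open[OF M c V]])
  let ?W = "{p \<in> U. \<phi> p \<in> V}"
  fix p assume p: "p \<in> ?W"
  have W: "?W \<subseteq> U" "mopen M ?W"
    using chart_preimage_open[OF M c V] by auto
  have e: "eopen (mdim M) (\<phi> ` ?W)"
    using chart_image_open[OF M c W(2)] W(1) by (simp add: Int_absorb1)
  have "smooth_on (mdim M) (\<phi> ` ?W) f"
    by (rule smooth_on_subset[OF V e _ f]) auto
  then have "smooth_on (mdim M) (\<phi> ` ?W) (\<lambda>x. f (\<phi> (inv_into U \<phi> x)))"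
    by (rule smooth_on_cong[OF e, rotated]) (use chart_inv[OF M c] in auto)
  then show "\<exists>U' \<phi>' W. (U', \<phi>') \<in> matlas M \<and> mopen M W \<and> p \<in> W \<and> W \<subseteq> U' \<and>
      smooth_on (mdim M) (\<phi>' ` W) (\<lambda>x. f (\<phi> (inv_into U' \<phi>' x)))"
    using c W p by blast
qed

lemma eopen_euc [simp]: "eopen n (euc n)"
  by (metis openin_topspace topspace_eucl)

lemma chart_in_euc:
  assumes M: "smooth_manifold M" and c: "(U, \<phi>) \<in> matlas M" and "p \<in> U"
  shows "\<phi> p \<in> euc (mdim M)"
  using eopen_subset[OF chart_image_open[OF M c chart_open[OF M c]]] assms(3) by auto

lemma msmooth_chart_coord:
  assumes M: "smooth_manifold M" and c: "(U, \<phi>) \<in> matlas M"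
  shows "msmooth M U (\<lambda>p. \<phi> p i)"
  using msmooth_comp_chart[OF M c eopen_euc smooth_on_coord[OF eopen_euc, of _ i]] chart_in_euc[OF M c]
  by (simp cong: conj_cong)

lemma smooth_funs_iff:
  assumes "smooth_manifold M"
  shows "f \<in> smooth_funs M \<longleftrightarrow> (\<forall>p. p \<notin> mpoints M \<longrightarrow> f p = 0) \<and> msmooth M (mpoints M) f"
proof -
  have "U \<inter> mpoints M = U" if "(U, \<phi>) \<in> matlas M" for U \<phi>
    using openin_subset[OF chart_open[OF assms that]] by auto
  then show ?thesis
    by (fastforce simp: smooth_funs_def msmooth_def)
qed

lemma smooth_funs_msmooth:
  "smooth_manifold M \<Longrightarrow> f \<in> smooth_funs M \<Longrightarrow> mopen M O' \<Longrightarrow> msmooth M O' f"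
  using msmooth_subset[of M "mpoints M" f O'] openin_subset[of "mtop M" O'] smooth_funs_iff by blast

section \<open>Smooth maps between open sets\<close>

text \<open>Openness of preimages is part of the definition because coordinates of the target are
  examined only on the preimage of their chart, which has to be open before smoothness on it makes
  sense.\<close>

definition smap :: "'a mfd \<Rightarrow> 'b mfd \<Rightarrow> 'a set \<Rightarrow> ('a \<Rightarrow> 'b) \<Rightarrow> bool"
  where "smap M N O' F \<longleftrightarrow> mopen M O' \<and> F ` O' \<subseteq> mpoints N \<and>
    (\<forall>P. mopen N P \<longrightarrow> mopen M {p \<in> O'. F p \<in> P}) \<and>
    (\<forall>(V, \<psi>)\<in>matlas N. \<forall>i<mdim N. msmooth M {p \<in> O'. F p \<in> V} (\<lambda>p. \<psi> (F p) i))"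

lemma smapD:
  assumes "smap M N O' F"
  shows smap_open: "mopen M O'"
    and smap_into: "p \<in> O' \<Longrightarrow> F p \<in> mpoints N"
    and smap_preimage: "mopen N P \<Longrightarrow> mopen M {p \<in> O'. F p \<in> P}"
    and smap_coord: "(V, \<psi>) \<in> matlas N \<Longrightarrow> i < mdim N \<Longrightarrow> msmooth M {p \<in> O'. F p \<in> V} (\<lambda>p. \<psi> (F p) i)"
  using assms by (auto simp: smap_def)

lemma smooth_map_iff_smap:
  assumes M: "smooth_manifold M" and N: "smooth_manifold N"
  shows "smooth_map M N F \<longleftrightarrow> smap M N (mpoints M) F"
proof -
  have eq: "U \<inter> {p \<in> mpoints M. F p \<in> V} = {p \<in> U. F p \<in> V}" if "(U, \<phi>) \<in> matlas M" for U V \<phi>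
    using openin_subset[OF chart_open[OF M that]] by auto
  have "continuous_map (mtop M) (mtop N) F \<Longrightarrow> (V, \<psi>) \<in> matlas N \<Longrightarrow> mopen M {p \<in> mpoints M. F p \<in> V}" for V \<psi>
    using chart_open[OF N] openin_continuous_map_preimage by blast
  then show ?thesis
    unfolding smooth_map_def smap_def msmooth_def using eq
    by (auto simp: continuous_map_def image_subset_iff Pi_iff; fastforce)
qed

lemma smap_msmooth:
  assumes M: "smooth_manifold M" and N: "smooth_manifold N" and F: "smap M N O' F" and f: "msmooth N P f"
  shows "msmooth M {p \<in> O'. F p \<in> P} (\<lambda>p. f (F p))"
proof (rule msmoothI_local[OF M smap_preimage[OF F msmooth_open[OF f]]])
  fix p assume p: "p \<in> {p \<in> O'. F p \<in> P}"
  then obtain V \<psi> where d: "(V, \<psi>) \<in> matlas N" "F p \<in> V"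
    using chart_at[OF N] smap_into[OF F] by blast
  have "p \<in> mpoints M"
    using p openin_subset[OF smap_open[OF F]] by blast
  then obtain U \<phi> where c: "(U, \<phi>) \<in> matlas M" "p \<in> U"
    using chart_at[OF M] by blast
  have VP: "mopen N (V \<inter> P)"
    using msmooth_open[OF f] chart_open[OF N d(1)] by blast
  define W where "W = U \<inter> {p \<in> O'. F p \<in> V \<inter> P}"
  have W: "mopen M W" "p \<in> W" "W \<subseteq> U"
    unfolding W_def using smap_preimage[OF F VP] chart_open[OF M c(1)] p c d by auto
  have eW: "eopen (mdim M) (\<phi> ` W)"
    using chart_image_open[OF M c(1) W(1)] W(3) by (simp add: Int_absorb1)
  have "smooth_on (mdim M) (\<phi> ` W) (\<lambda>x. (\<lambda>y. f (inv_into V \<psi> y)) (\<psi> (F (inv_into U \<phi> x))))"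
  proof (rule smooth_on_compose[OF chart_image_open[OF N d(1) msmooth_open[OF f]] eW,
        where f = "\<lambda>y. f (inv_into V \<psi> y)" and g = "\<lambda>x. \<psi> (F (inv_into U \<phi> x))"])
    show "\<psi> (F (inv_into U \<phi> x)) \<in> \<psi> ` (V \<inter> P)" if "x \<in> \<phi> ` W" for x
      using that chart_inv[OF M c(1)] by (auto simp: W_def)
    show "smooth_on (mdim N) (\<psi> ` (V \<inter> P)) (\<lambda>y. f (inv_into V \<psi> y))"
      using msmoothD[OF f d(1)] .
    show "smooth_on (mdim M) (\<phi> ` W) (\<lambda>x. \<psi> (F (inv_into U \<phi> x)) j)" if "j < mdim N" for j
      by (rule smooth_on_subset[OF _ eW _ msmoothD[OF smap_coord[OF F d(1) that] c(1)]])
        (use chart_image_open[OF M c(1)] smap_preimage[OF F chart_open[OF N d(1)]] in \<open>auto simp: W_def\<close>)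
  qed
  then have "smooth_on (mdim M) (\<phi> ` W) (\<lambda>x. f (F (inv_into U \<phi> x)))"
    by (rule smooth_on_cong[OF eW, rotated]) (use chart_inv[OF M c(1)] chart_inv[OF N d(1)] in \<open>auto simp: W_def\<close>)
  then show "\<exists>U \<phi> W. (U, \<phi>) \<in> matlas M \<and> mopen M W \<and> p \<in> W \<and> W \<subseteq> U \<and>
      smooth_on (mdim M) (\<phi> ` W) (\<lambda>x. f (F (inv_into U \<phi> x)))"
    using c W by blast
qed

lemma msmooth_preimage:
  assumes M: "smooth_manifold M" and f: "msmooth M O' f" and S: "open S"
  shows "mopen M {p \<in> O'. f p \<in> S}"
proof (subst openin_subopen, clarify)
  fix p assume p: "p \<in> O'" "f p \<in> S"
  have "p \<in> mpoints M"
    using p openin_subset[OF msmooth_open[OF f]] by blast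
  then obtain U \<phi> where c: "(U, \<phi>) \<in> matlas M" "p \<in> U"
    using chart_at[OF M] by blast
  note e = chart_image_open[OF M c(1) msmooth_open[OF f]]
  let ?f = "\<lambda>x. f (inv_into U \<phi> x)" and ?D = "\<phi> ` (U \<inter> O')"
  have "openin (top_of_set ?D) (?D \<inter> ?f -` S)"
    using smooth_on_continuous[OF e msmoothD[OF f c(1)]] S continuous_openin_preimage_gen by blast
  then have "eopen (mdim M) (?D \<inter> ?f -` S)"
    using e openin_trans unfolding Euclidean_space_eq by blast
  note chart_preimage_open[OF M c(1) this]
  moreover have "\<phi> t \<in> ?D \<longleftrightarrow> t \<in> O'" if "t \<in> U" for t
    using inj_on_image_mem_iff[OF chart_inj[OF M c(1)] that, of "U \<inter> O'"] that by simp
  ultimately show "\<exists>T. mopen M T \<and> p \<in> T \<and> T \<subseteq> {p \<in> O'. f p \<in> S}"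
    using p c chart_inv[OF M c(1)] by (intro exI[of _ "{q \<in> U. \<phi> q \<in> ?D \<inter> ?f -` S}"]) (simp add: subset_iff cong: conj_cong)
qed

lemma coordinates_preimage:
  assumes M: "smooth_manifold M" and W: "mopen M W" and g: "\<And>k. k < n \<Longrightarrow> msmooth M W (\<lambda>p. g p k)"
    and euc: "g ` W \<subseteq> euc n" and S: "eopen n S"
  shows "mopen M {p \<in> W. g p \<in> S}"
proof (subst openin_subopen, clarify)
  fix p assume p: "p \<in> W" "g p \<in> S"
  obtain r where r: "r > 0" "ebox n (g p) r \<subseteq> S"
    using S p(2) unfolding eopen_iff by blast
  let ?T = "W \<inter> (\<Inter>k<n. {q \<in> W. g q k \<in> {g p k - r<..<g p k + r}})"
  have "mopen M {q \<in> W. g q k \<in> {g p k - r<..<g p k + r}}" if "k < n" for k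
    by (rule msmooth_preimage[OF M g[OF that]]) auto
  then have "mopen M ?T"
    using W by (cases "n = 0") (auto intro!: openin_INT)
  moreover have "?T \<subseteq> {p \<in> W. g p \<in> S}"
  proof
    fix q assume q: "q \<in> ?T"
    then have "g q k \<in> {g p k - r<..<g p k + r}" if "k < n" for k
      using that by blast
    then have "\<bar>g q k - g p k\<bar> < r" if "k < n" for k
      using that by (fastforce simp: abs_less_iff)
    then show "q \<in> {p \<in> W. g p \<in> S}"
      using q r(2) euc by (auto simp: ebox_def)
  qed
  ultimately show "\<exists>T. mopen M T \<and> p \<in> T \<and> T \<subseteq> {p \<in> W. g p \<in> S}"
    using p(1) r(1) by (intro exI[of _ ?T]) auto
qed

text \<open>Continuity is derived: smooth coordinates in one target chart make preimages open, and
  the transition maps of the target then settle all other charts.\<close>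

lemma smapI_local:
  assumes M: "smooth_manifold M" and N: "smooth_manifold N" and O: "mopen M O'"
    and loc: "\<And>p. p \<in> O' \<Longrightarrow> \<exists>V \<psi> W. (V, \<psi>) \<in> matlas N \<and> mopen M W \<and> p \<in> W \<and> W \<subseteq> O' \<and> F ` W \<subseteq> V \<and>
      (\<forall>i<mdim N. msmooth M W (\<lambda>p. \<psi> (F p) i))"
  shows "smap M N O' F"
  unfolding smap_def
proof (intro conjI O allI impI)
  show "F ` O' \<subseteq> mpoints N"
  proof clarify
    fix p assume "p \<in> O'"
    from loc[OF this] show "F p \<in> mpoints N"
      using openin_subset[OF chart_open[OF N]] by blast
  qed
  have chart_pre: "mopen M {p \<in> W. F p \<in> P}"
    if "(V, \<psi>) \<in> matlas N" "mopen M W" "F ` W \<subseteq> V" "\<forall>i<mdim N. msmooth M W (\<lambda>p. \<psi> (F p) i)" "mopen N P" for V \<psi> W P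
  proof -
    have "mopen M {p \<in> W. \<psi> (F p) \<in> \<psi> ` (V \<inter> P)}"
      by (rule coordinates_preimage[OF M that(2) _ _ chart_image_open[OF N that(1,5)]])
        (use that chart_in_euc[OF N that(1)] in auto)
    moreover have "{p \<in> W. \<psi> (F p) \<in> \<psi> ` (V \<inter> P)} = {p \<in> W. F p \<in> P}"
      using that(3) inj_on_image_mem_iff[OF chart_inj[OF N that(1)], of _ "V \<inter> P"] by (auto simp: image_subset_iff)
    ultimately show ?thesis
      by simp
  qed
  show pre: "mopen M {p \<in> O'. F p \<in> P}" if P: "mopen N P" for P
  proof (subst openin_subopen, clarify)
    fix p assume p: "p \<in> O'" "F p \<in> P"
    obtain W where W: "p \<in> W" "W \<subseteq> O'" "mopen M {p \<in> W. F p \<in> P}"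
      using loc[OF p(1)] chart_pre[OF _ _ _ _ P] by meson
    then show "\<exists>T. mopen M T \<and> p \<in> T \<and> T \<subseteq> {p \<in> O'. F p \<in> P}"
      using P p by (intro exI[of _ "{p \<in> W. F p \<in> P}"]) auto
  qed
  show "\<forall>(V, \<psi>)\<in>matlas N. \<forall>i<mdim N. msmooth M {p \<in> O'. F p \<in> V} (\<lambda>p. \<psi> (F p) i)"
  proof clarify
    fix V' \<psi>' i assume d': "(V', \<psi>') \<in> matlas N" and i: "i < mdim N"
    show "msmooth M {p \<in> O'. F p \<in> V'} (\<lambda>p. \<psi>' (F p) i)"
    proof (rule msmooth_locally[OF M pre[OF chart_open[OF N d']]])
      fix p assume p: "p \<in> {p \<in> O'. F p \<in> V'}"
      then have "p \<in> O'"
        by simp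
      from loc[OF this] obtain V \<psi> W where d: "(V, \<psi>) \<in> matlas N" and W: "mopen M W" "p \<in> W" "W \<subseteq> O'"
        "F ` W \<subseteq> V" "\<forall>i<mdim N. msmooth M W (\<lambda>p. \<psi> (F p) i)"
        by blast
      define W' where "W' = {q \<in> W. F q \<in> V \<inter> V'}"
      have VV: "mopen N (V \<inter> V')"
        using chart_open[OF N d] chart_open[OF N d'] by blast
      have W': "mopen M W'" "W' \<subseteq> W"
        unfolding W'_def by (rule chart_pre[OF d W(1,4,5) VV]) auto
      have "msmooth M W' (\<lambda>p. \<psi>' (F p) i)"
        unfolding msmooth_def
      proof (intro conjI W'(1), clarify)
        fix U \<phi> assume c: "(U, \<phi>) \<in> matlas M"
        have e: "eopen (mdim M) (\<phi> ` (U \<inter> W'))"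
          using chart_image_open[OF M c W'(1)] .
        have "smooth_on (mdim M) (\<phi> ` (U \<inter> W')) (\<lambda>x. (\<lambda>y. \<psi>' (inv_into V \<psi> y) i) (\<psi> (F (inv_into U \<phi> x))))"
        proof (rule smooth_on_compose[OF chart_image_open[OF N d chart_open[OF N d']] e,
              where f = "\<lambda>y. \<psi>' (inv_into V \<psi> y) i" and g = "\<lambda>x. \<psi> (F (inv_into U \<phi> x))"])
          show "\<psi> (F (inv_into U \<phi> x)) \<in> \<psi> ` (V \<inter> V')" if "x \<in> \<phi> ` (U \<inter> W')" for x
            using that chart_inv[OF M c] by (auto simp: W'_def)
          show "smooth_on (mdim N) (\<psi> ` (V \<inter> V')) (\<lambda>y. \<psi>' (inv_into V \<psi> y) i)"
            by (rule chart_transition[OF N d d' i])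
          show "smooth_on (mdim M) (\<phi> ` (U \<inter> W')) (\<lambda>x. \<psi> (F (inv_into U \<phi> x)) j)" if "j < mdim N" for j
            using msmoothD[OF msmooth_subset[OF M _ W'] c] W(5) that by blast
        qed
        then show "smooth_on (mdim M) (\<phi> ` (U \<inter> W')) (\<lambda>x. \<psi>' (F (inv_into U \<phi> x)) i)"
          by (rule smooth_on_cong[OF e, rotated]) (use chart_inv[OF M c] chart_inv[OF N d] in \<open>auto simp: W'_def\<close>)
      qed
      then show "\<exists>W. p \<in> W \<and> msmooth M W (\<lambda>p. \<psi>' (F p) i)"
        using p W by (intro exI[of _ W']) (auto simp: W'_def)
    qed
  qed
qed

lemma smap_subset:
  assumes M: "smooth_manifold M" and F: "smap M N O' F" and P: "mopen M P" "P \<subseteq> O'" and N: "smooth_manifold N"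
  shows "smap M N P F"
  unfolding smap_def
proof (intro conjI P allI impI)
  show "F ` P \<subseteq> mpoints N"
    using smap_into[OF F] P by auto
  have eq: "{p \<in> P. F p \<in> Q} = P \<inter> {p \<in> O'. F p \<in> Q}" for Q
    using P by auto
  show pre: "mopen M {p \<in> P. F p \<in> Q}" if "mopen N Q" for Q
    unfolding eq using smap_preimage[OF F that] P by blast
  show "\<forall>(V, \<psi>)\<in>matlas N. \<forall>i<mdim N. msmooth M {p \<in> P. F p \<in> V} (\<lambda>p. \<psi> (F p) i)"
  proof clarify
    fix V \<psi> i assume "(V, \<psi>) \<in> matlas N" "i < mdim N"
    then show "msmooth M {p \<in> P. F p \<in> V} (\<lambda>p. \<psi> (F p) i)"
      using P pre[OF chart_open[OF N]] by (intro msmooth_subset[OF M smap_coord[OF F]]) auto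
  qed
qed

lemma smap_locally:
  assumes M: "smooth_manifold M" and N: "smooth_manifold N" and O: "mopen M O'"
    and loc: "\<And>p. p \<in> O' \<Longrightarrow> \<exists>W. p \<in> W \<and> smap M N W F"
  shows "smap M N O' F"
proof (rule smapI_local[OF M N O])
  fix p assume p: "p \<in> O'"
  obtain W where W: "p \<in> W" "smap M N W F"
    using loc[OF p] by blast
  obtain V \<psi> where d: "(V, \<psi>) \<in> matlas N" "F p \<in> V"
    using chart_at[OF N smap_into[OF W(2,1)]] by blast
  define W' where "W' = O' \<inter> {q \<in> W. F q \<in> V}"
  have W': "mopen M W'" "W' \<subseteq> W"
    unfolding W'_def using O smap_preimage[OF W(2) chart_open[OF N d(1)]] by auto
  have s: "smap M N W' F"
    by (rule smap_subset[OF M W(2) W' N])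
  have "{p \<in> W'. F p \<in> V} = W'"
    by (auto simp: W'_def)
  then have "msmooth M W' (\<lambda>p. \<psi> (F p) i)" if "i < mdim N" for i
    using smap_coord[OF s d(1) that] by simp
  then show "\<exists>V \<psi> W. (V, \<psi>) \<in> matlas N \<and> mopen M W \<and> p \<in> W \<and> W \<subseteq> O' \<and> F ` W \<subseteq> V \<and>
      (\<forall>i<mdim N. msmooth M W (\<lambda>p. \<psi> (F p) i))"
    using d W' p W
    by (intro exI[of _ V] exI[of _ \<psi>] exI[of _ W']) (auto simp: W'_def)
qed

lemma smap_cong:
  assumes "smooth_manifold M" "smap M N O' F" "\<And>p. p \<in> O' \<Longrightarrow> F p = G p"
  shows "smap M N O' G"
  unfolding smap_def
proof (intro conjI smap_open[OF assms(2)] allI impI)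
  show "G ` O' \<subseteq> mpoints N"
    using smap_into[OF assms(2)] assms(3) by fastforce
  have eq: "{p \<in> O'. G p \<in> P} = {p \<in> O'. F p \<in> P}" for P
    using assms(3) by auto
  show "mopen M {p \<in> O'. G p \<in> P}" if "mopen N P" for P
    unfolding eq by (rule smap_preimage[OF assms(2) that])
  show "\<forall>(V, \<psi>)\<in>matlas N. \<forall>i<mdim N. msmooth M {p \<in> O'. G p \<in> V} (\<lambda>p. \<psi> (G p) i)"
    unfolding eq
    by (clarify, rule msmooth_cong[OF assms(1) _ smap_coord[OF assms(2)]]) (auto simp: assms(3))
qed

lemma smap_compose:
  assumes M: "smooth_manifold M" and N: "smooth_manifold N" and L: "smooth_manifold L"
    and F: "smap M N O' F" and G: "smap N L P G" and sub: "\<And>p. p \<in> O' \<Longrightarrow> F p \<in> P"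
  shows "smap M L O' (\<lambda>p. G (F p))"
  unfolding smap_def
proof (intro conjI smap_open[OF F] allI impI)
  show "(\<lambda>p. G (F p)) ` O' \<subseteq> mpoints L"
    using sub smap_into[OF G] by auto
  have eq: "{p \<in> O'. G (F p) \<in> Q} = {p \<in> O'. F p \<in> {q \<in> P. G q \<in> Q}}" for Q
    using sub by auto
  show "mopen M {p \<in> O'. G (F p) \<in> Q}" if "mopen L Q" for Q
    unfolding eq by (rule smap_preimage[OF F smap_preimage[OF G that]])
  show "\<forall>(V, \<psi>)\<in>matlas L. \<forall>i<mdim L. msmooth M {p \<in> O'. G (F p) \<in> V} (\<lambda>p. \<psi> (G (F p)) i)"
    unfolding eq by (clarify, rule smap_msmooth[OF M N F smap_coord[OF G]])
qed

lemma smap_id: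
  assumes M: "smooth_manifold M" and O: "mopen M O'"
  shows "smap M M O' (\<lambda>p. p)"
  unfolding smap_def
proof (intro conjI O allI impI)
  show "(\<lambda>p. p) ` O' \<subseteq> mpoints M"
    using openin_subset[OF O] by simp
  show pre: "mopen M {p \<in> O'. p \<in> P}" if "mopen M P" for P
    using openin_Int[OF O that] by (simp add: Int_def)
  show "\<forall>(V, \<psi>)\<in>matlas M. \<forall>i<mdim M. msmooth M {p \<in> O'. p \<in> V} (\<lambda>p. \<psi> p i)"
    by (clarify, rule msmooth_subset[OF M msmooth_chart_coord[OF M] pre[OF chart_open[OF M]]]) auto
qed

lemma smap_const:
  assumes M: "smooth_manifold M" and O: "mopen M O'" and q: "q \<in> mpoints N"
  shows "smap M N O' (\<lambda>p. q)"
proof -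
  have "mopen M {p \<in> O'. q \<in> P}" for P
    using O by (cases "q \<in> P") auto
  then show ?thesis
    using q O msmooth_const[OF M] by (auto simp: smap_def)
qed

section \<open>Products\<close>

definition join :: "nat \<Rightarrow> (nat \<Rightarrow> real) \<Rightarrow> (nat \<Rightarrow> real) \<Rightarrow> nat \<Rightarrow> real"
  where "join m x y = (\<lambda>i. if i < m then x i else y (i - m))"

definition fst_part :: "nat \<Rightarrow> (nat \<Rightarrow> real) \<Rightarrow> nat \<Rightarrow> real"
  where "fst_part m z = (\<lambda>i. if i < m then z i else 0)"

definition snd_part :: "nat \<Rightarrow> (nat \<Rightarrow> real) \<Rightarrow> nat \<Rightarrow> real"
  where "snd_part m z = (\<lambda>i. z (i + m))"

lemma parts_join [simp]:
  "x \<in> euc m \<Longrightarrow> fst_part m (join m x y) = x" "snd_part m (join m x y) = y"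
  by (auto simp: fst_part_def snd_part_def join_def euc_def)

lemma join_parts [simp]: "join m (fst_part m z) (snd_part m z) = z"
  by (auto simp: fst_part_def snd_part_def join_def)

lemma join_in_euc: "x \<in> euc m \<Longrightarrow> y \<in> euc n \<Longrightarrow> join m x y \<in> euc (m + n)"
  by (auto simp: euc_def join_def)

lemma parts_in_euc: "fst_part m z \<in> euc m" "z \<in> euc (m + n) \<Longrightarrow> snd_part m z \<in> euc n"
  by (auto simp: euc_def fst_part_def snd_part_def)

lemma ebox_parts: "z \<in> ebox (m + n) w e \<longleftrightarrow> z \<in> euc (m + n) \<and> fst_part m z \<in> ebox m (fst_part m w) e \<and> snd_part m z \<in> ebox n (snd_part m w) e"
proof -
  have "(\<forall>i<m + n. \<bar>z i - w i\<bar> < e) \<longleftrightarrow> (\<forall>i<m. \<bar>z i - w i\<bar> < e) \<and> (\<forall>i<n. \<bar>z (i + m) - w (i + m)\<bar> < e)"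
    (is "?L \<longleftrightarrow> ?R")
  proof
    show "?L" if "?R"
    proof clarify
      fix i assume "i < m + n"
      then show "\<bar>z i - w i\<bar> < e"
        using that by (cases "i < m") (auto dest: spec[of _ "i - m"])
    qed
  qed auto
  then show ?thesis
    using parts_in_euc[where m = m and z = z] by (auto simp: ebox_def fst_part_def snd_part_def)
qed

lemma eopen_rectangle:
  assumes A: "eopen m A" and B: "eopen n B"
  shows "eopen (m + n) {z \<in> euc (m + n). fst_part m z \<in> A \<and> snd_part m z \<in> B}"
  unfolding eopen_iff
proof (intro conjI ballI)
  fix z assume z: "z \<in> {z \<in> euc (m + n). fst_part m z \<in> A \<and> snd_part m z \<in> B}"
  obtain d where d: "d > 0" "ebox m (fst_part m z) d \<subseteq> A"
    using A z by (auto simp: eopen_iff)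
  obtain e where e: "e > 0" "ebox n (snd_part m z) e \<subseteq> B"
    using B z by (auto simp: eopen_iff)
  have "ebox (m + n) z (min d e) \<subseteq> {z \<in> euc (m + n). fst_part m z \<in> A \<and> snd_part m z \<in> B}"
    using d(2) e(2) ebox_mono[of "min d e" d m "fst_part m z"] ebox_mono[of "min d e" e n "snd_part m z"]
    by (simp add: ebox_parts subset_iff)
  then show "\<exists>e>0. ebox (m + n) z e \<subseteq> {z \<in> euc (m + n). fst_part m z \<in> A \<and> snd_part m z \<in> B}"
    using d(1) e(1) by (intro exI[of _ "min d e"]) auto
qed auto

definition prod_chart :: "nat \<Rightarrow> ('a \<Rightarrow> nat \<Rightarrow> real) \<Rightarrow> ('b \<Rightarrow> nat \<Rightarrow> real) \<Rightarrow> 'a \<times> 'b \<Rightarrow> nat \<Rightarrow> real"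
  where "prod_chart m \<phi> \<psi> = (\<lambda>z. join m (\<phi> (fst z)) (\<psi> (snd z)))"

lemma prod_mfd_simps [simp]:
  "mtop (prod_mfd M N) = prod_topology (mtop M) (mtop N)"
  "mdim (prod_mfd M N) = mdim M + mdim N"
  by (simp_all add: prod_mfd_def)

lemma matlas_prod_mfd:
  "matlas (prod_mfd M N) = {(U \<times> V, prod_chart (mdim M) \<phi> \<psi>) | U \<phi> V \<psi>. (U, \<phi>) \<in> matlas M \<and> (V, \<psi>) \<in> matlas N}"
  by (simp add: prod_mfd_def prod_chart_def join_def case_prod_beta')

lemma inv_prod_chart:
  assumes M: "smooth_manifold M" and N: "smooth_manifold N"
    and c: "(U, \<phi>) \<in> matlas M" and d: "(V, \<psi>) \<in> matlas N" and z: "z \<in> prod_chart (mdim M) \<phi> \<psi> ` (U \<times> V)"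
  shows "inv_into (U \<times> V) (prod_chart (mdim M) \<phi> \<psi>) z =
    (inv_into U \<phi> (fst_part (mdim M) z), inv_into V \<psi> (snd_part (mdim M) z))"
proof -
  obtain p q where pq: "p \<in> U" "q \<in> V" "z = prod_chart (mdim M) \<phi> \<psi> (p, q)"
    using z by auto
  have "inj_on (prod_chart (mdim M) \<phi> \<psi>) (U \<times> V)"
  proof (rule inj_on_inverseI)
    fix w assume "w \<in> U \<times> V"
    then show "(\<lambda>z. (inv_into U \<phi> (fst_part (mdim M) z), inv_into V \<psi> (snd_part (mdim M) z))) (prod_chart (mdim M) \<phi> \<psi> w) = w"
      using chart_in_euc[OF M c] chart_inv[OF M c] chart_inv[OF N d] by (auto simp: prod_chart_def)
  qed
  then have "inv_into (U \<times> V) (prod_chart (mdim M) \<phi> \<psi>) z = (p, q)"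
    using pq by simp
  then show ?thesis
    using pq chart_in_euc[OF M c] chart_inv[OF M c] chart_inv[OF N d] by (auto simp: prod_chart_def)
qed

lemma smooth_on_fst_part: "eopen k U \<Longrightarrow> smooth_on k U (\<lambda>z. fst_part m z j)"
  by (cases "j < m") (simp_all add: fst_part_def smooth_on_coord smooth_on_const)

lemma smooth_on_snd_part: "eopen k U \<Longrightarrow> smooth_on k U (\<lambda>z. snd_part m z j)"
  by (simp add: snd_part_def smooth_on_coord)

lemma smooth_manifold_prod:
  assumes M: "smooth_manifold M" and N: "smooth_manifold N"
  shows "smooth_manifold (prod_mfd M N)"
proof (rule smooth_manifoldI)
  let ?m = "mdim M" and ?n = "mdim N"
  show "Hausdorff_space (mtop (prod_mfd M N))"
    using M N by (simp add: smooth_manifold_def Hausdorff_space_prod_topology)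
  show "\<exists>U \<phi>. (U, \<phi>) \<in> matlas (prod_mfd M N) \<and> p \<in> U" if p: "p \<in> mpoints (prod_mfd M N)" for p
  proof -
    have *: "fst p \<in> mpoints M" "snd p \<in> mpoints N"
      using p by auto
    obtain U \<phi> where "(U, \<phi>) \<in> matlas M" "fst p \<in> U"
      using chart_at[OF M *(1)] .
    moreover obtain V \<psi> where "(V, \<psi>) \<in> matlas N" "snd p \<in> V"
      using chart_at[OF N *(2)] .
    ultimately show ?thesis
      unfolding matlas_prod_mfd
      by (intro exI[of _ "U \<times> V"] exI[of _ "prod_chart ?m \<phi> \<psi>"]) (auto simp: mem_Times_iff)
  qed
  fix U' \<phi>' assume "(U', \<phi>') \<in> matlas (prod_mfd M N)"
  then obtain U \<phi> V \<psi> where c: "(U, \<phi>) \<in> matlas M" and d: "(V, \<psi>) \<in> matlas N"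
    and U': "U' = U \<times> V" "\<phi>' = prod_chart ?m \<phi> \<psi>"
    by (auto simp: matlas_prod_mfd)
  show "mopen (prod_mfd M N) U'"
    using chart_open[OF M c] chart_open[OF N d] by (simp add: U' openin_prod_Times_iff)
  show "inj_on \<phi>' U'"
    unfolding U'
  proof (rule inj_on_inverseI)
    fix w assume "w \<in> U \<times> V"
    then show "(\<lambda>z. (inv_into U \<phi> (fst_part ?m z), inv_into V \<psi> (snd_part ?m z))) (prod_chart ?m \<phi> \<psi> w) = w"
      using chart_in_euc[OF M c] chart_inv[OF M c] chart_inv[OF N d] by (auto simp: prod_chart_def)
  qed
  show image: "eopen (mdim (prod_mfd M N)) (\<phi>' ` W)" if W: "mopen (prod_mfd M N) W" "W \<subseteq> U'" for W
  proof (subst openin_subopen, clarify)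
    fix p q assume pq: "(p, q) \<in> W"
    have "\<exists>A B. mopen M A \<and> mopen N B \<and> p \<in> A \<and> q \<in> B \<and> A \<times> B \<subseteq> W"
      using W(1) pq by (simp add: openin_prod_topology_alt)
    then obtain A B where AB: "mopen M A" "mopen N B" "p \<in> A" "q \<in> B" "A \<times> B \<subseteq> W"
      by blast
    have *: "eopen ?m (\<phi> ` (U \<inter> A))" "eopen ?n (\<psi> ` (V \<inter> B))"
      using chart_image_open[OF M c AB(1)] chart_image_open[OF N d AB(2)] by auto
    let ?T = "{z \<in> euc (?m + ?n). fst_part ?m z \<in> \<phi> ` (U \<inter> A) \<and> snd_part ?m z \<in> \<psi> ` (V \<inter> B)}"
    have "?T \<subseteq> \<phi>' ` W"
    proof clarify
      fix z a b assume z: "fst_part ?m z = \<phi> a" "snd_part ?m z = \<psi> b" "a \<in> U" "a \<in> A" "b \<in> V" "b \<in> B"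
      have "z = \<phi>' (a, b)"
        using join_parts[of ?m z] z by (simp add: U' prod_chart_def)
      then show "z \<in> \<phi>' ` W"
        using AB z by blast
    qed
    moreover have "\<phi>' (p, q) \<in> ?T"
      using pq W(2) AB chart_in_euc[OF M c] chart_in_euc[OF N d] by (auto simp: U' prod_chart_def join_in_euc)
    ultimately show "\<exists>T. eopen (mdim (prod_mfd M N)) T \<and> \<phi>' (p, q) \<in> T \<and> T \<subseteq> \<phi>' ` W"
      using eopen_rectangle[OF *] unfolding prod_mfd_simps(2) by (intro exI[of _ ?T] conjI)
  qed
  show "mopen (prod_mfd M N) {p \<in> U'. \<phi>' p \<in> W}" if W: "eopen (mdim (prod_mfd M N)) W" for W
    unfolding prod_mfd_simps openin_prod_topology_alt
  proof (intro allI impI)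
    fix p q assume pq: "(p, q) \<in> {p \<in> U'. \<phi>' p \<in> W}"
    then obtain e where e: "e > 0" "ebox (?m + ?n) (\<phi>' (p, q)) e \<subseteq> W"
      using W by (auto simp: eopen_iff)
    have parts: "fst_part ?m (\<phi>' (a, b)) = \<phi> a" "snd_part ?m (\<phi>' (a, b)) = \<psi> b" "\<phi>' (a, b) \<in> euc (?m + ?n)"
      if "a \<in> U" "b \<in> V" for a b
      using that chart_in_euc[OF M c] chart_in_euc[OF N d] by (auto simp: U' prod_chart_def join_in_euc)
    let ?A = "{a \<in> U. \<phi> a \<in> ebox ?m (\<phi> p) e}" and ?B = "{b \<in> V. \<psi> b \<in> ebox ?n (\<psi> q) e}"
    have "?A \<times> ?B \<subseteq> {p \<in> U'. \<phi>' p \<in> W}"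
      using e(2) parts pq by (auto simp: U'(1) ebox_parts)
    moreover have "p \<in> ?A" "q \<in> ?B"
      using pq e(1) chart_in_euc[OF M c] chart_in_euc[OF N d] by (auto simp: U'(1) intro!: ebox_self)
    ultimately show "\<exists>A B. mopen M A \<and> mopen N B \<and> p \<in> A \<and> q \<in> B \<and> A \<times> B \<subseteq> {p \<in> U'. \<phi>' p \<in> W}"
      by (intro exI[of _ ?A] exI[of _ ?B] conjI chart_preimage_open[OF M c eopen_ebox]
          chart_preimage_open[OF N d eopen_ebox])
  qed
  fix U2' \<phi>2' i assume "(U2', \<phi>2') \<in> matlas (prod_mfd M N)" and i: "i < mdim (prod_mfd M N)"
  then obtain U2 \<phi>2 V2 \<psi>2 where c2: "(U2, \<phi>2) \<in> matlas M" and d2: "(V2, \<psi>2) \<in> matlas N"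
    and U2': "U2' = U2 \<times> V2" "\<phi>2' = prod_chart ?m \<phi>2 \<psi>2"
    by (auto simp: matlas_prod_mfd)
  let ?S = "\<phi>' ` (U' \<inter> U2')"
  have S: "eopen (?m + ?n) ?S"
  proof -
    have "mopen (prod_mfd M N) (U' \<inter> U2')"
      using chart_open[OF M c] chart_open[OF N d] chart_open[OF M c2] chart_open[OF N d2]
      by (simp add: U' U2' Times_Int_Times openin_prod_Times_iff openin_Int)
    then show ?thesis
      using image by simp
  qed
  have inv: "inv_into U' \<phi>' z = (inv_into U \<phi> (fst_part ?m z), inv_into V \<psi> (snd_part ?m z))" if "z \<in> ?S" for z
    unfolding U' by (rule inv_prod_chart[OF M N c d]) (use that U' in auto)
  have mem: "fst_part ?m z \<in> \<phi> ` (U \<inter> U2)" "snd_part ?m z \<in> \<psi> ` (V \<inter> V2)" if "z \<in> ?S" for z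
    using that chart_in_euc[OF M c] by (auto simp: U' U2' prod_chart_def)
  show "smooth_on (mdim (prod_mfd M N)) ?S (\<lambda>x. \<phi>2' (inv_into U' \<phi>' x) i)"
  proof (cases "i < ?m")
    case True
    have "smooth_on (?m + ?n) ?S (\<lambda>x. \<phi>2 (inv_into U \<phi> (fst_part ?m x)) i)"
      by (rule smooth_on_compose[OF chart_image_open[OF M c chart_open[OF M c2]] S mem(1) chart_transition[OF M c c2 True]
            smooth_on_fst_part[OF S]])
    then show ?thesis
      unfolding prod_mfd_simps by (rule smooth_on_cong[OF S, rotated]) (simp add: inv U2' prod_chart_def join_def True)
  next
    case False
    then have i': "i - ?m < ?n"
      using i by simp
    have "smooth_on (?m + ?n) ?S (\<lambda>x. \<psi>2 (inv_into V \<psi> (snd_part ?m x)) (i - ?m))"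
      by (rule smooth_on_compose[OF chart_image_open[OF N d chart_open[OF N d2]] S mem(2) chart_transition[OF N d d2 i']
            smooth_on_snd_part[OF S]])
    then show ?thesis
      unfolding prod_mfd_simps by (rule smooth_on_cong[OF S, rotated]) (simp add: inv U2' prod_chart_def join_def False)
  qed
qed

lemma smap_fst:
  assumes M: "smooth_manifold M" and N: "smooth_manifold N" and O: "mopen (prod_mfd M N) O'"
  shows "smap (prod_mfd M N) M O' fst"
proof (rule smapI_local[OF smooth_manifold_prod[OF M N] M O])
  fix z assume z: "z \<in> O'"
  have zM: "fst z \<in> mpoints M" "snd z \<in> mpoints N"
    using z openin_subset[OF O] by auto
  obtain U \<phi> where c: "(U, \<phi>) \<in> matlas M" "fst z \<in> U"
    using chart_at[OF M zM(1)] .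
  obtain V \<psi> where d: "(V, \<psi>) \<in> matlas N" "snd z \<in> V"
    using chart_at[OF N zM(2)] .
  have pc: "(U \<times> V, prod_chart (mdim M) \<phi> \<psi>) \<in> matlas (prod_mfd M N)"
    using c d by (auto simp: matlas_prod_mfd)
  define W where "W = U \<times> V \<inter> O'"
  have W: "mopen (prod_mfd M N) W" "W \<subseteq> U \<times> V" "W \<subseteq> O'" "z \<in> W"
    using z c d O chart_open[OF smooth_manifold_prod[OF M N] pc] by (auto simp: W_def mem_Times_iff)
  have "msmooth (prod_mfd M N) W (\<lambda>p. \<phi> (fst p) i)" if "i < mdim M" for i
    using msmooth_subset[OF smooth_manifold_prod[OF M N] msmooth_chart_coord[OF smooth_manifold_prod[OF M N] pc, of i] W(1,2)] that
    by (simp add: prod_chart_def join_def)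
  moreover have "fst ` W \<subseteq> U"
    using W(2) by auto
  ultimately show "\<exists>V \<psi> W. (V, \<psi>) \<in> matlas M \<and> mopen (prod_mfd M N) W \<and> z \<in> W \<and> W \<subseteq> O' \<and> fst ` W \<subseteq> V \<and>
      (\<forall>i<mdim M. msmooth (prod_mfd M N) W (\<lambda>p. \<psi> (fst p) i))"
    using W c by (intro exI[of _ U] exI[of _ \<phi>] exI[of _ W]) simp
qed

lemma smap_snd:
  assumes M: "smooth_manifold M" and N: "smooth_manifold N" and O: "mopen (prod_mfd M N) O'"
  shows "smap (prod_mfd M N) N O' snd"
proof (rule smapI_local[OF smooth_manifold_prod[OF M N] N O])
  fix z assume z: "z \<in> O'"
  have zM: "fst z \<in> mpoints M" "snd z \<in> mpoints N"
    using z openin_subset[OF O] by auto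
  obtain U \<phi> where c: "(U, \<phi>) \<in> matlas M" "fst z \<in> U"
    using chart_at[OF M zM(1)] .
  obtain V \<psi> where d: "(V, \<psi>) \<in> matlas N" "snd z \<in> V"
    using chart_at[OF N zM(2)] .
  have pc: "(U \<times> V, prod_chart (mdim M) \<phi> \<psi>) \<in> matlas (prod_mfd M N)"
    using c d by (auto simp: matlas_prod_mfd)
  define W where "W = U \<times> V \<inter> O'"
  have W: "mopen (prod_mfd M N) W" "W \<subseteq> U \<times> V" "W \<subseteq> O'" "z \<in> W"
    using z c d O chart_open[OF smooth_manifold_prod[OF M N] pc] by (auto simp: W_def mem_Times_iff)
  have "msmooth (prod_mfd M N) W (\<lambda>p. \<psi> (snd p) i)" for i
    using msmooth_subset[OF smooth_manifold_prod[OF M N] msmooth_chart_coord[OF smooth_manifold_prod[OF M N] pc, of "mdim M + i"] W(1,2)]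
    by (simp add: prod_chart_def join_def)
  moreover have "snd ` W \<subseteq> V"
    using W(2) by auto
  ultimately show "\<exists>V \<psi> W. (V, \<psi>) \<in> matlas N \<and> mopen (prod_mfd M N) W \<and> z \<in> W \<and> W \<subseteq> O' \<and> snd ` W \<subseteq> V \<and>
      (\<forall>i<mdim N. msmooth (prod_mfd M N) W (\<lambda>p. \<psi> (snd p) i))"
    using W d by (intro exI[of _ V] exI[of _ \<psi>] exI[of _ W]) simp
qed

lemma smap_Pair:
  assumes L: "smooth_manifold L" and F: "smap L M O' F" and G: "smap L N O' G"
    and M: "smooth_manifold M" and N: "smooth_manifold N"
  shows "smap L (prod_mfd M N) O' (\<lambda>p. (F p, G p))"
  unfolding smap_def
proof (intro conjI allI impI smap_open[OF F])
  show "(\<lambda>p. (F p, G p)) ` O' \<subseteq> mpoints (prod_mfd M N)"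
    using smap_into[OF F] smap_into[OF G] by auto
  show pre: "mopen L {p \<in> O'. (F p, G p) \<in> P}" if P: "mopen (prod_mfd M N) P" for P
  proof (subst openin_subopen, clarify)
    fix p assume p: "p \<in> O'" "(F p, G p) \<in> P"
    have "\<exists>A B. mopen M A \<and> mopen N B \<and> F p \<in> A \<and> G p \<in> B \<and> A \<times> B \<subseteq> P"
      using P p(2) by (simp add: openin_prod_topology_alt)
    then obtain A B where AB: "mopen M A" "mopen N B" "F p \<in> A" "G p \<in> B" "A \<times> B \<subseteq> P"
      by blast
    have "mopen L ({p \<in> O'. F p \<in> A} \<inter> {p \<in> O'. G p \<in> B})"
      using smap_preimage[OF F AB(1)] smap_preimage[OF G AB(2)] by blast
    then show "\<exists>T. mopen L T \<and> p \<in> T \<and> T \<subseteq> {p \<in> O'. (F p, G p) \<in> P}"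
      using p AB by (intro exI[of _ "{p \<in> O'. F p \<in> A} \<inter> {p \<in> O'. G p \<in> B}"]) auto
  qed
  show "\<forall>(V, \<psi>)\<in>matlas (prod_mfd M N). \<forall>i<mdim (prod_mfd M N). msmooth L {p \<in> O'. (F p, G p) \<in> V} (\<lambda>p. \<psi> (F p, G p) i)"
  proof clarify
    fix V' \<psi>' i assume a: "(V', \<psi>') \<in> matlas (prod_mfd M N)" and i: "i < mdim (prod_mfd M N)"
    obtain U \<phi> V \<psi> where c: "(U, \<phi>) \<in> matlas M" and d: "(V, \<psi>) \<in> matlas N"
      and V': "V' = U \<times> V" "\<psi>' = prod_chart (mdim M) \<phi> \<psi>"
      using a by (auto simp: matlas_prod_mfd)
    have op: "mopen L {p \<in> O'. (F p, G p) \<in> V'}"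
      by (rule pre[OF chart_open[OF smooth_manifold_prod[OF M N] a]])
    show "msmooth L {p \<in> O'. (F p, G p) \<in> V'} (\<lambda>p. \<psi>' (F p, G p) i)"
    proof (cases "i < mdim M")
      case True
      have "msmooth L {p \<in> O'. (F p, G p) \<in> V'} (\<lambda>p. \<phi> (F p) i)"
        by (rule msmooth_subset[OF L smap_coord[OF F c True] op]) (auto simp: V')
      then show ?thesis
        by (simp add: V'(2) prod_chart_def join_def True)
    next
      case False
      then have "i - mdim M < mdim N"
        using i by simp
      then have "msmooth L {p \<in> O'. (F p, G p) \<in> V'} (\<lambda>p. \<psi> (G p) (i - mdim M))"
        by (intro msmooth_subset[OF L smap_coord[OF G d] op]) (auto simp: V')
      then show ?thesis
        by (simp add: V'(2) prod_chart_def join_def False)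
    qed
  qed
qed

section \<open>Bump functions\<close>

text \<open>The set \<open>C\<close> is the image of a compact cube, hence closed because the
  manifold is Hausdorff, and this makes the extension by \<open>0\<close> smooth. Its compactness is
  returned as well, for later use with the compact-open topology.\<close>

lemma bump_exists:
  assumes M: "smooth_manifold M" and O: "mopen M O'" and p: "p \<in> O'"
  obtains \<eta> W C where "\<eta> \<in> smooth_funs M" and "mopen M W" "p \<in> W" "W \<subseteq> C" "\<And>q. q \<in> W \<Longrightarrow> \<eta> q = 1"
    "closedin (mtop M) C" "C \<subseteq> O'" "\<And>q. q \<notin> C \<Longrightarrow> \<eta> q = 0" "compactin (mtop M) C"
proof -
  let ?n = "mdim M"
  have "p \<in> mpoints M"
    using p openin_subset[OF O] by blast
  then obtain U \<phi> where c: "(U, \<phi>) \<in> matlas M" "p \<in> U"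
    using chart_at[OF M] by blast
  have "eopen ?n (\<phi> ` (U \<inter> O'))"
    by (rule chart_image_open[OF M c(1) O])
  then obtain e where e: "e > 0" "ebox ?n (\<phi> p) e \<subseteq> \<phi> ` (U \<inter> O')"
    using c p unfolding eopen_iff by blast
  \<comment> \<open>Half of the available radius keeps the closed cube, and with it the support of
    the cutoff, inside the chart.\<close>
  define r where "r = e / 2"
  have r: "r > 0" "r < e"
    using e by (auto simp: r_def)
  obtain b d where b: "smooth_on ?n (euc ?n) b" "d > 0" "d \<le> r" "\<And>x. x \<in> ebox ?n (\<phi> p) d \<Longrightarrow> b x = 1"
    "\<And>x. x \<in> euc ?n - ebox ?n (\<phi> p) r \<Longrightarrow> b x = 0"
    using cutoff_exists[OF r(1)] by metis
  define K where "K = cebox ?n (\<phi> p) r"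
  have K: "compactin (Euclidean_space ?n) K" "K \<subseteq> \<phi> ` (U \<inter> O')"
    using compact_cebox cebox_subset_ebox[OF r(2)] e(2) unfolding K_def by blast+
  define C where "C = inv_into U \<phi> ` K"
  have "continuous_map (subtopology (Euclidean_space ?n) (\<phi> ` U)) (mtop M) (inv_into U \<phi>)"
    unfolding continuous_map_def
  proof (intro conjI allI impI)
    show "inv_into U \<phi> \<in> topspace (subtopology (Euclidean_space ?n) (\<phi> ` U)) \<rightarrow> mpoints M"
      using chart_inv[OF M c(1)] openin_subset[OF chart_open[OF M c(1)]] by auto
    fix P assume P: "mopen M P"
    have "{x \<in> topspace (subtopology (Euclidean_space ?n) (\<phi> ` U)). inv_into U \<phi> x \<in> P} = \<phi> ` (U \<inter> P)"
      using chart_inv[OF M c(1)] chart_in_euc[OF M c(1)] by auto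
    then show "openin (subtopology (Euclidean_space ?n) (\<phi> ` U))
        {x \<in> topspace (subtopology (Euclidean_space ?n) (\<phi> ` U)). inv_into U \<phi> x \<in> P}"
      using chart_image_open[OF M c(1) P] by (auto intro: subset_openin_subtopology)
  qed
  moreover have "compactin (subtopology (Euclidean_space ?n) (\<phi> ` U)) K"
    using K by (auto simp: compactin_subtopology)
  ultimately have Cc: "compactin (mtop M) C"
    unfolding C_def by (rule image_compactin[rotated])
  then have C: "closedin (mtop M) C"
    using M compactin_imp_closedin by (auto simp: smooth_manifold_def)
  have CO: "C \<subseteq> U \<inter> O'"
  proof
    fix q assume "q \<in> C"
    then obtain x where x: "x \<in> K" "q = inv_into U \<phi> x"
      by (auto simp: C_def)
    then obtain q' where "q' \<in> U \<inter> O'" "x = \<phi> q'"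
      using K(2) by blast
    then show "q \<in> U \<inter> O'"
      using x(2) chart_inv[OF M c(1)] by simp
  qed
  have Cmem: "q \<in> C" if "q \<in> U" "\<phi> q \<in> K" for q
    using imageI[OF that(2), of "inv_into U \<phi>"] chart_inv[OF M c(1) that(1)] by (simp add: C_def)
  define \<eta> where "\<eta> q = (if q \<in> U then b (\<phi> q) else 0)" for q
  have zero: "\<eta> q = 0" if "q \<notin> C" for q
  proof (cases "q \<in> U")
    case True
    then have "\<phi> q \<notin> K"
      using Cmem that by blast
    then have "\<phi> q \<in> euc ?n - ebox ?n (\<phi> p) r"
      using ebox_subset_cebox chart_in_euc[OF M c(1) True] by (auto simp: K_def)
    then show ?thesis
      using b(5) True by (simp add: \<eta>_def)
  qed (simp add: \<eta>_def)
  have "msmooth M (mpoints M) \<eta>"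
  proof (rule msmooth_locally[OF M])
    fix q assume q: "q \<in> mpoints M"
    show "\<exists>W. q \<in> W \<and> msmooth M W \<eta>"
    proof (cases "q \<in> U")
      case True
      have "msmooth M {p \<in> U. \<phi> p \<in> euc ?n} (\<lambda>p. b (\<phi> p))"
        by (rule msmooth_comp_chart[OF M c(1) eopen_euc b(1)])
      then have "msmooth M U (\<lambda>p. b (\<phi> p))"
        using chart_in_euc[OF M c(1)] by (simp cong: conj_cong)
      then have "msmooth M U \<eta>"
        by (rule msmooth_cong[OF M, rotated]) (simp add: \<eta>_def)
      then show ?thesis
        using True by blast
    next
      case False
      have "msmooth M (mpoints M - C) \<eta>"
        by (rule msmooth_cong[OF M _ msmooth_const[OF M, of _ 0]]) (use zero C in auto)
      then show ?thesis
        using q False CO by blast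
    qed
  qed simp
  moreover have "\<eta> q = 0" if "q \<notin> mpoints M" for q
    using zero that closedin_subset[OF C] by blast
  ultimately have "\<eta> \<in> smooth_funs M"
    using smooth_funs_iff[OF M] by blast
  moreover have "mopen M {q \<in> U. \<phi> q \<in> ebox ?n (\<phi> p) d}"
    by (rule chart_preimage_open[OF M c(1) eopen_ebox])
  moreover have "p \<in> {q \<in> U. \<phi> q \<in> ebox ?n (\<phi> p) d}"
    using c(2) b(2) chart_in_euc[OF M c] ebox_self by auto
  moreover have "{q \<in> U. \<phi> q \<in> ebox ?n (\<phi> p) d} \<subseteq> C"
    using Cmem ebox_subset_cebox ebox_mono[OF b(3)] unfolding K_def by blast
  moreover have "\<eta> q = 1" if "q \<in> {q \<in> U. \<phi> q \<in> ebox ?n (\<phi> p) d}" for q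
    using that b(4) by (simp add: \<eta>_def)
  ultimately show ?thesis
    using that C CO zero Cc by blast
qed

section \<open>The algebra of smooth functions, and the extension of germs\<close>

lemma smooth_funs_zero: "smooth_manifold M \<Longrightarrow> (\<lambda>p. 0) \<in> smooth_funs M"
  by (simp add: smooth_funs_iff msmooth_const)

lemma smooth_funs_const: "smooth_manifold M \<Longrightarrow> (\<lambda>p. if p \<in> mpoints M then c else 0) \<in> smooth_funs M"
  by (auto simp: smooth_funs_iff intro: msmooth_cong[OF _ _ msmooth_const[of M _ c]])

lemma smooth_funs_add: "smooth_manifold M \<Longrightarrow> f \<in> smooth_funs M \<Longrightarrow> g \<in> smooth_funs M \<Longrightarrow> (\<lambda>p. f p + g p) \<in> smooth_funs M"
  by (simp add: smooth_funs_iff msmooth_add)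

lemma smooth_funs_diff: "smooth_manifold M \<Longrightarrow> f \<in> smooth_funs M \<Longrightarrow> g \<in> smooth_funs M \<Longrightarrow> (\<lambda>p. f p - g p) \<in> smooth_funs M"
  by (simp add: smooth_funs_iff msmooth_diff)

lemma smooth_funs_mult: "smooth_manifold M \<Longrightarrow> f \<in> smooth_funs M \<Longrightarrow> g \<in> smooth_funs M \<Longrightarrow> (\<lambda>p. f p * g p) \<in> smooth_funs M"
  by (simp add: smooth_funs_iff msmooth_mult)

lemma smooth_funs_cmult: "smooth_manifold M \<Longrightarrow> f \<in> smooth_funs M \<Longrightarrow> (\<lambda>p. c * f p) \<in> smooth_funs M"
  by (simp add: smooth_funs_iff msmooth_mult msmooth_const)

lemma smooth_funs_sum:
  "smooth_manifold M \<Longrightarrow> (\<And>j. j \<in> J \<Longrightarrow> f j \<in> smooth_funs M) \<Longrightarrow> (\<lambda>p. \<Sum>j\<in>J. f j p) \<in> smooth_funs M"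
  by (induction J rule: infinite_finite_induct) (auto intro: smooth_funs_zero smooth_funs_add)

lemma smooth_funs_outside: "f \<in> smooth_funs M \<Longrightarrow> p \<notin> mpoints M \<Longrightarrow> f p = 0"
  by (simp add: smooth_funs_def)

definition cut_ext :: "('a \<Rightarrow> real) \<Rightarrow> 'a set \<Rightarrow> ('a \<Rightarrow> real) \<Rightarrow> 'a \<Rightarrow> real"
  where "cut_ext \<eta> O' f = (\<lambda>q. if q \<in> O' then \<eta> q * f q else 0)"

lemma cut_ext_smooth:
  assumes M: "smooth_manifold M" and \<eta>: "\<eta> \<in> smooth_funs M" and C: "closedin (mtop M) C" "C \<subseteq> O'"
    and zero: "\<And>q. q \<notin> C \<Longrightarrow> \<eta> q = 0" and f: "msmooth M O' f"
  shows "cut_ext \<eta> O' f \<in> smooth_funs M"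
proof -
  note O = msmooth_open[OF f]
  have "msmooth M (mpoints M) (cut_ext \<eta> O' f)"
  proof (rule msmooth_locally[OF M])
    fix q assume q: "q \<in> mpoints M"
    show "\<exists>W. q \<in> W \<and> msmooth M W (cut_ext \<eta> O' f)"
    proof (cases "q \<in> O'")
      case True
      have "msmooth M O' (cut_ext \<eta> O' f)"
        by (rule msmooth_cong[OF M _ msmooth_mult[OF M smooth_funs_msmooth[OF M \<eta> O] f]]) (simp add: cut_ext_def)
      then show ?thesis
        using True by blast
    next
      case False
      have "msmooth M (mpoints M - C) (cut_ext \<eta> O' f)"
        by (rule msmooth_cong[OF M _ msmooth_const[OF M, of _ 0]]) (use zero C in \<open>auto simp: cut_ext_def\<close>)
      then show ?thesis
        using q False C by blast
    qed
  qed simp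
  then show ?thesis
    using openin_subset[OF O] by (auto simp: smooth_funs_iff[OF M] cut_ext_def)
qed

text \<open>Derivations act on global functions only. A locally defined function is therefore
  replaced by a global one with the same germ at \<open>p\<close>.\<close>

lemma smooth_extension:
  assumes M: "smooth_manifold M" and f: "msmooth M O' f" and p: "p \<in> O'"
  obtains g W where "g \<in> smooth_funs M" "mopen M W" "p \<in> W" "W \<subseteq> O'" "\<And>q. q \<in> W \<Longrightarrow> g q = f q"
proof -
  obtain \<eta> W C where *: "\<eta> \<in> smooth_funs M" "mopen M W" "p \<in> W" "W \<subseteq> C" "\<And>q. q \<in> W \<Longrightarrow> \<eta> q = 1"
    "closedin (mtop M) C" "C \<subseteq> O'" "\<And>q. q \<notin> C \<Longrightarrow> \<eta> q = 0"
    using bump_exists[OF M msmooth_open[OF f] p] by metis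
  have "cut_ext \<eta> O' f \<in> smooth_funs M"
    by (rule cut_ext_smooth[OF M *(1,6,7,8) f])
  then show ?thesis
    using * by (intro that[of "cut_ext \<eta> O' f" W]) (auto simp: cut_ext_def)
qed

section \<open>Derivations\<close>

lemma tangent_lin:
  "v \<in> tangent_space M p \<Longrightarrow> f \<in> smooth_funs M \<Longrightarrow> g \<in> smooth_funs M \<Longrightarrow> v (\<lambda>q. a * f q + g q) = a * v f + v g"
  by (simp add: tangent_space_def)

lemma tangent_mult:
  "v \<in> tangent_space M p \<Longrightarrow> f \<in> smooth_funs M \<Longrightarrow> g \<in> smooth_funs M \<Longrightarrow> v (\<lambda>q. f q * g q) = v f * g p + f p * v g"
  by (simp add: tangent_space_def)

lemma tangent_add:
  "v \<in> tangent_space M p \<Longrightarrow> f \<in> smooth_funs M \<Longrightarrow> g \<in> smooth_funs M \<Longrightarrow> v (\<lambda>q. f q + g q) = v f + v g"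
  using tangent_lin[of v M p f g 1] by simp

lemma tangent_zero: "smooth_manifold M \<Longrightarrow> v \<in> tangent_space M p \<Longrightarrow> v (\<lambda>q. 0) = 0"
  using tangent_lin[of v M p "\<lambda>q. 0" "\<lambda>q. 0" "-1"] smooth_funs_zero[of M] by simp

lemma tangent_cmult:
  "smooth_manifold M \<Longrightarrow> v \<in> tangent_space M p \<Longrightarrow> f \<in> smooth_funs M \<Longrightarrow> v (\<lambda>q. a * f q) = a * v f"
  using tangent_lin[of v M p f "\<lambda>q. 0" a] smooth_funs_zero tangent_zero by fastforce

lemma tangent_diff:
  "v \<in> tangent_space M p \<Longrightarrow> f \<in> smooth_funs M \<Longrightarrow> g \<in> smooth_funs M \<Longrightarrow> v (\<lambda>q. f q - g q) = v f - v g"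
  using tangent_lin[of v M p g f "-1"] by simp

lemma tangent_sum:
  assumes "smooth_manifold M" "v \<in> tangent_space M p" "\<And>j. j \<in> J \<Longrightarrow> f j \<in> smooth_funs M"
  shows "v (\<lambda>q. \<Sum>j\<in>J. f j q) = (\<Sum>j\<in>J. v (f j))"
  using assms(3)
proof (induction J rule: infinite_finite_induct)
  case (insert j J)
  then show ?case
    using tangent_add[OF assms(2), of "f j" "\<lambda>q. \<Sum>j\<in>J. f j q"] smooth_funs_sum[OF assms(1), of J f] by simp
qed (use tangent_zero[OF assms(1,2)] in simp_all)

text \<open>The unit of the algebra is the indicator function \<open>?u\<close> of the manifold, and
  \<open>?u * ?u = ?u\<close> forces a derivation to annihilate it.\<close>

lemma tangent_const:
  assumes "smooth_manifold M" "v \<in> tangent_space M p" "p \<in> mpoints M"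
  shows "v (\<lambda>q. if q \<in> mpoints M then c else 0) = 0"
proof -
  let ?u = "\<lambda>q. if q \<in> mpoints M then 1::real else 0"
  have u: "?u \<in> smooth_funs M"
    by (rule smooth_funs_const[OF assms(1)])
  have "(\<lambda>q. ?u q * ?u q) = ?u"
    by auto
  then have "v ?u = v ?u * ?u p + ?u p * v ?u"
    using tangent_mult[OF assms(2) u u] by simp
  then have "v ?u = 0"
    using assms(3) by simp
  moreover have "(\<lambda>q. if q \<in> mpoints M then c else 0) = (\<lambda>q. c * ?u q)"
    by auto
  ultimately show ?thesis
    using tangent_cmult[OF assms(1,2) u, of c] by simp
qed

text \<open>For a bump function \<open>\<eta>\<close> supported in \<open>W\<close>, the product
  \<open>\<eta> * (f - g)\<close> is zero. The product rule at \<open>p\<close>, where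
  \<open>\<eta>\<close> is \<open>1\<close> and \<open>f - g\<close> vanishes, gives the
  claim.\<close>

lemma tangent_local:
  assumes M: "smooth_manifold M" and v: "v \<in> tangent_space M p"
    and fg: "f \<in> smooth_funs M" "g \<in> smooth_funs M" and W: "mopen M W" "p \<in> W" "\<And>q. q \<in> W \<Longrightarrow> f q = g q"
  shows "v f = v g"
proof -
  obtain \<eta> W' C where *: "\<eta> \<in> smooth_funs M" "p \<in> W'" "\<And>q. q \<in> W' \<Longrightarrow> \<eta> q = 1" "C \<subseteq> W" "\<And>q. q \<notin> C \<Longrightarrow> \<eta> q = 0"
    using bump_exists[OF M W(1,2)] by metis
  have d: "(\<lambda>q. f q - g q) \<in> smooth_funs M"
    by (rule smooth_funs_diff[OF M fg])
  have "\<eta> q * (f q - g q) = 0" for q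
    using *(4,5) W(3) by (cases "q \<in> C") auto
  then have "(\<lambda>q. \<eta> q * (f q - g q)) = (\<lambda>q. 0)"
    by (rule ext)
  then have "v (\<lambda>q. \<eta> q * (f q - g q)) = 0"
    using tangent_zero[OF M v] by (simp only:)
  then have "v (\<lambda>q. f q - g q) = 0"
    using tangent_mult[OF v *(1) d] W(2,3) *(2,3) by simp
  then show ?thesis
    using tangent_diff[OF v fg] by simp
qed

lemma vf_tangent: "X \<in> vector_fields M \<Longrightarrow> (\<lambda>f. X f p) \<in> tangent_space M p"
  by (simp add: vector_fields_def tangent_space_def)

lemma vf_smooth: "X \<in> vector_fields M \<Longrightarrow> f \<in> smooth_funs M \<Longrightarrow> X f \<in> smooth_funs M"
  by (simp add: vector_fields_def)

lemma vf_junk: "X \<in> vector_fields M \<Longrightarrow> f \<notin> smooth_funs M \<Longrightarrow> X f = (\<lambda>p. 0)"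
  by (simp add: vector_fields_def)

lemma vfI:
  assumes "\<And>f p. f \<notin> smooth_funs M \<Longrightarrow> X f p = 0" "\<And>f. f \<in> smooth_funs M \<Longrightarrow> X f \<in> smooth_funs M"
    and "\<And>p. p \<in> mpoints M \<Longrightarrow> (\<lambda>f. X f p) \<in> tangent_space M p"
    and M: "smooth_manifold M"
  shows "X \<in> vector_fields M"
proof -
  have out: "X h p = 0" if "p \<notin> mpoints M" for h p
    using smooth_funs_outside[OF assms(2) that] assms(1) by blast
  have "X (\<lambda>p. a * f p + g p) p = a * X f p + X g p" if "f \<in> smooth_funs M" "g \<in> smooth_funs M" for f g a p
    using tangent_lin[OF assms(3) that] out[of p] by (cases "p \<in> mpoints M") auto
  moreover have "X (\<lambda>p. f p * g p) p = X f p * g p + f p * X g p" if "f \<in> smooth_funs M" "g \<in> smooth_funs M" for f g p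
    using tangent_mult[OF assms(3) that] out[of p] by (cases "p \<in> mpoints M") auto
  ultimately show ?thesis
    using assms(1,2) by (auto simp: vector_fields_def)
qed

lemma vf_scale:
  assumes "smooth_manifold M" "X \<in> vector_fields M" "f \<in> smooth_funs M"
  shows "(\<lambda>h p. f p * X h p) \<in> vector_fields M"
proof (rule vfI[OF _ smooth_funs_mult[OF assms(1,3) vf_smooth[OF assms(2)]] _ assms(1)])
  show "(\<lambda>h. f p * X h p) \<in> tangent_space M p" for p
    using vf_tangent[OF assms(2), of p] by (auto simp: tangent_space_def algebra_simps)
qed (simp_all add: vf_junk[OF assms(2)])

lemma vf_add:
  assumes "smooth_manifold M" "X \<in> vector_fields M" "Y \<in> vector_fields M"
  shows "(\<lambda>h p. X h p + Y h p) \<in> vector_fields M"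
proof (rule vfI[OF _ smooth_funs_add[OF assms(1) vf_smooth[OF assms(2)] vf_smooth[OF assms(3)]] _ assms(1)])
  show "(\<lambda>h. X h p + Y h p) \<in> tangent_space M p" for p
    using vf_tangent[OF assms(2), of p] vf_tangent[OF assms(3), of p] by (auto simp: tangent_space_def algebra_simps)
qed (simp_all add: vf_junk[OF assms(2)] vf_junk[OF assms(3)])

lemma vf_zero: "smooth_manifold M \<Longrightarrow> (\<lambda>h p. 0) \<in> vector_fields M"
  using smooth_funs_zero by (auto simp: vector_fields_def)

lemma vf_sum:
  assumes "smooth_manifold M" "\<And>j. j \<in> J \<Longrightarrow> X j \<in> vector_fields M"
  shows "(\<lambda>h p. \<Sum>j\<in>J. X j h p) \<in> vector_fields M"
  using assms(2) by (induction J rule: infinite_finite_induct) (auto intro: vf_zero vf_add assms(1))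

lemma vf_lie_bracket:
  assumes M: "smooth_manifold M" and X: "X \<in> vector_fields M" and Y: "Y \<in> vector_fields M"
  shows "lie_bracket X Y \<in> vector_fields M"
proof (rule vfI[OF _ _ _ M])
  fix f assume f: "f \<in> smooth_funs M"
  show "lie_bracket X Y f \<in> smooth_funs M"
    unfolding lie_bracket_def by (intro smooth_funs_diff[OF M] vf_smooth[OF X] vf_smooth[OF Y] f)
next
  fix f p assume "f \<notin> smooth_funs M"
  then show "lie_bracket X Y f p = 0"
    using tangent_zero[OF M vf_tangent[OF X]] tangent_zero[OF M vf_tangent[OF Y]]
    by (simp add: lie_bracket_def vf_junk[OF X] vf_junk[OF Y])
next
  fix p
  have XY: "X (\<lambda>p. a * f p + g p) = (\<lambda>p. a * X f p + X g p)" "X (\<lambda>p. f p * g p) = (\<lambda>p. X f p * g p + f p * X g p)"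
    "Y (\<lambda>p. a * f p + g p) = (\<lambda>p. a * Y f p + Y g p)" "Y (\<lambda>p. f p * g p) = (\<lambda>p. Y f p * g p + f p * Y g p)"
    if "f \<in> smooth_funs M" "g \<in> smooth_funs M" for f g a
    using that X Y by (simp_all add: vector_fields_def)
  have add: "X (\<lambda>p. f p + g p) = (\<lambda>p. X f p + X g p)" "Y (\<lambda>p. f p + g p) = (\<lambda>p. Y f p + Y g p)"
    if "f \<in> smooth_funs M" "g \<in> smooth_funs M" for f g
    using XY(1,3)[OF that, of 1] by simp_all
  note s = vf_smooth[OF X] vf_smooth[OF Y] smooth_funs_mult[OF M]
  show "(\<lambda>f. lie_bracket X Y f p) \<in> tangent_space M p"
    unfolding tangent_space_def lie_bracket_def mem_Collect_eq
  proof (intro conjI ballI allI impI)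
    fix f assume "f \<notin> smooth_funs M"
    then show "X (Y f) p - Y (X f) p = 0"
      using tangent_zero[OF M vf_tangent[OF X]] tangent_zero[OF M vf_tangent[OF Y]]
      by (simp add: vf_junk[OF X] vf_junk[OF Y])
  next
    fix f g a assume "f \<in> smooth_funs M" "g \<in> smooth_funs M"
    then have "X (Y (\<lambda>q. a * f q + g q)) p = a * X (Y f) p + X (Y g) p"
      "Y (X (\<lambda>q. a * f q + g q)) p = a * Y (X f) p + Y (X g) p"
      by (simp_all add: XY s)
    then show "X (Y (\<lambda>q. a * f q + g q)) p - Y (X (\<lambda>q. a * f q + g q)) p =
        a * (X (Y f) p - Y (X f) p) + (X (Y g) p - Y (X g) p)"
      by (simp add: algebra_simps)
  next
    fix f g assume "f \<in> smooth_funs M" "g \<in> smooth_funs M"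
    then have "X (Y (\<lambda>q. f q * g q)) p = X (Y f) p * g p + Y f p * X g p + (X f p * Y g p + f p * X (Y g) p)"
      "Y (X (\<lambda>q. f q * g q)) p = Y (X f) p * g p + X f p * Y g p + (Y f p * X g p + f p * Y (X g) p)"
      by (simp_all add: XY add s)
    then show "X (Y (\<lambda>q. f q * g q)) p - Y (X (\<lambda>q. f q * g q)) p =
        (X (Y f) p - Y (X f) p) * g p + f p * (X (Y g) p - Y (X g) p)"
      by (simp add: algebra_simps)
  qed
qed

section \<open>Tangent vectors in coordinates\<close>

lemma hadamard_centered:
  assumes f: "smooth_on n (ebox n x0 e) f" and e: "e > 0" and x0: "x0 \<in> euc n"
  obtains g where "\<And>i. i < n \<Longrightarrow> smooth_on n (ebox n x0 e) (g i)"
    "\<And>i. i < n \<Longrightarrow> g i x0 = pderiv_at i f x0"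
    "\<And>x. x \<in> ebox n x0 e \<Longrightarrow> f x = f x0 + (\<Sum>i<n. (x i - x0 i) * g i x)"
proof -
  define Q where "Q = ebox n (\<lambda>_. 0) e"
  define F where "F y = f (\<lambda>i. y i + x0 i)" for y
  define g where "g i x = radial 0 (pderiv_at i F) (\<lambda>j. x j - x0 j)" for i x
  have Q: "star_shaped Q" "eopen n Q"
    by (simp_all add: Q_def star_shaped_ebox eopen_ebox)
  have tr: "(\<lambda>i. y i + x0 i) \<in> ebox n x0 e" if "y \<in> Q" for y
    using that x0 by (auto simp: Q_def ebox_def euc_def)
  have tr': "(\<lambda>j. x j - x0 j) \<in> Q" if "x \<in> ebox n x0 e" for x
    using that x0 by (auto simp: Q_def ebox_def euc_def)
  have F: "smooth_on n Q F"
    unfolding F_def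
    by (rule smooth_on_compose[OF eopen_ebox Q(2) tr f])
      (auto intro!: smooth_on_add[OF Q(2)] smooth_on_coord[OF Q(2)] smooth_on_const[OF Q(2)])
  note pd = smooth_on_has_pderiv[OF Q(2) F]
  have "smooth_on n (ebox n x0 e) (g i)" if "i < n" for i
    unfolding g_def
    by (rule smooth_on_compose[OF Q(2) eopen_ebox tr' smooth_on_radial[OF Q smooth_on_pderiv_at[OF Q(2) F that]]])
      (assumption, rule smooth_on_diff[OF eopen_ebox smooth_on_coord[OF eopen_ebox] smooth_on_const[OF eopen_ebox]])
  moreover have "g i x0 = pderiv_at i f x0" if "i < n" for i
  proof -
    have 0: "(\<lambda>j. 0) \<in> Q"
      using e by (auto simp: Q_def ebox_def euc_def)
    have d: "((\<lambda>t. t - x0 i) has_real_derivative 1) (at (x0 i))"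
      by (auto intro!: derivative_eq_intros)
    have "((\<lambda>t. F ((\<lambda>j. 0)(i := t))) has_real_derivative pderiv_at i F (\<lambda>j. 0)) (at (x0 i - x0 i))"
      using pd[OF that 0] by (simp add: has_pderiv_def)
    from DERIV_chain2[OF this d] have "((\<lambda>t. F ((\<lambda>j. 0)(i := t - x0 i))) has_real_derivative pderiv_at i F (\<lambda>j. 0)) (at (x0 i))"
      by simp
    moreover have "F ((\<lambda>j. 0)(i := t - x0 i)) = f (x0(i := t))" for t
      unfolding F_def by (rule arg_cong[of _ _ f]) auto
    ultimately have "has_pderiv i f x0 (pderiv_at i F (\<lambda>j. 0))"
      by (simp add: has_pderiv_def)
    then have "pderiv_at i f x0 = pderiv_at i F (\<lambda>j. 0)"
      by (rule pderiv_at_eq)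
    then show ?thesis
      by (simp add: g_def radial_def)
  qed
  moreover have "f x = f x0 + (\<Sum>i<n. (x i - x0 i) * g i x)" if "x \<in> ebox n x0 e" for x
    using hadamard[OF Q tr'[OF that] pd smooth_on_continuous[OF Q(2) smooth_on_pderiv_at[OF Q(2) F]]]
    by (simp add: F_def g_def)
  ultimately show ?thesis
    using that by blast
qed

text \<open>The \<open>i\<close>-th coordinate vector field of the chart, applied to
  \<open>f\<close> at \<open>q\<close>.\<close>

definition cpd :: "'a set \<Rightarrow> ('a \<Rightarrow> nat \<Rightarrow> real) \<Rightarrow> nat \<Rightarrow> ('a \<Rightarrow> real) \<Rightarrow> 'a \<Rightarrow> real"
  where "cpd U \<phi> i f q = pderiv_at i (\<lambda>x. f (inv_into U \<phi> x)) (\<phi> q)"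

lemma cpd_has_pderiv:
  assumes M: "smooth_manifold M" and c: "(U, \<phi>) \<in> matlas M" and f: "msmooth M O' f" and q: "q \<in> U" "q \<in> O'" and i: "i < mdim M"
  shows "has_pderiv i (\<lambda>x. f (inv_into U \<phi> x)) (\<phi> q) (cpd U \<phi> i f q)"
  unfolding cpd_def
  using smooth_on_has_pderiv[OF chart_image_open[OF M c msmooth_open[OF f]] msmoothD[OF f c] i] q by blast

lemma cpd_eqI: "has_pderiv i (\<lambda>x. f (inv_into U \<phi> x)) (\<phi> q) D \<Longrightarrow> cpd U \<phi> i f q = D"
  unfolding cpd_def by (rule pderiv_at_eq)

lemma cpd_msmooth:
  assumes M: "smooth_manifold M" and c: "(U, \<phi>) \<in> matlas M" and f: "msmooth M O' f" and i: "i < mdim M"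
  shows "msmooth M (U \<inter> O') (cpd U \<phi> i f)"
proof -
  note e = chart_image_open[OF M c msmooth_open[OF f]]
  have "msmooth M {p \<in> U. \<phi> p \<in> \<phi> ` (U \<inter> O')} (\<lambda>p. pderiv_at i (\<lambda>x. f (inv_into U \<phi> x)) (\<phi> p))"
    by (rule msmooth_comp_chart[OF M c e smooth_on_pderiv_at[OF e msmoothD[OF f c] i]])
  moreover have "{p \<in> U. \<phi> p \<in> \<phi> ` (U \<inter> O')} = U \<inter> O'"
    using chart_inj[OF M c] by (auto dest: inj_onD)
  ultimately show ?thesis
    by (simp add: cpd_def[abs_def])
qed

lemma cpd_coord:
  assumes M: "smooth_manifold M" and c: "(U, \<phi>) \<in> matlas M" and W: "mopen M W" "q \<in> W" "W \<subseteq> U" and i: "i < mdim M"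
    and eq: "\<And>r. r \<in> W \<Longrightarrow> f r = \<phi> r j"
  shows "cpd U \<phi> i f q = (if i = j then 1 else 0)"
proof (rule cpd_eqI)
  have e: "eopen (mdim M) (\<phi> ` W)"
    using chart_image_open[OF M c W(1)] W(3) by (simp add: Int_absorb1)
  show "has_pderiv i (\<lambda>x. f (inv_into U \<phi> x)) (\<phi> q) (if i = j then 1 else 0)"
    by (rule has_pderiv_cong[OF e _ i _ has_pderiv_coord]) (use W eq chart_inv[OF M c] in auto)
qed

lemma cpd_tangent:
  assumes M: "smooth_manifold M" and c: "(U, \<phi>) \<in> matlas M" and q: "q \<in> U" and i: "i < mdim M"
  shows "(\<lambda>f. if f \<in> smooth_funs M then cpd U \<phi> i f q else 0) \<in> tangent_space M q"
proof -
  have hp: "has_pderiv i (\<lambda>x. f (inv_into U \<phi> x)) (\<phi> q) (cpd U \<phi> i f q)" if "f \<in> smooth_funs M" for f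
    by (rule cpd_has_pderiv[OF M c smooth_funs_msmooth[OF M that chart_open[OF M c]] q q i])
  have "cpd U \<phi> i (\<lambda>q. a * f q + g q) q = a * cpd U \<phi> i f q + cpd U \<phi> i g q"
    if "f \<in> smooth_funs M" "g \<in> smooth_funs M" for f g a
    using has_pderiv_add[OF has_pderiv_mult[OF has_pderiv_const hp[OF that(1)]] hp[OF that(2)], of a]
    by (intro cpd_eqI) simp
  moreover have "cpd U \<phi> i (\<lambda>q. f q * g q) q = cpd U \<phi> i f q * g q + f q * cpd U \<phi> i g q"
    if "f \<in> smooth_funs M" "g \<in> smooth_funs M" for f g
    using has_pderiv_mult[OF hp[OF that(1)] hp[OF that(2)]] chart_inv[OF M c q]
    by (intro cpd_eqI) simp
  ultimately show ?thesis
    by (auto simp: tangent_space_def smooth_funs_add[OF M] smooth_funs_cmult[OF M] smooth_funs_mult[OF M])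
qed

text \<open>Apply \<open>v\<close> to the first-order expansion of \<open>f\<close> around
  \<open>q\<close>: constants are annihilated, and the product rule keeps only the values at
  \<open>q\<close> of the coefficient functions, which are the partial derivatives. The
  \<open>\<xi> i\<close> are global functions standing in for the coordinates.\<close>

lemma tangent_coord:
  assumes M: "smooth_manifold M" and c: "(U, \<phi>) \<in> matlas M" and v: "v \<in> tangent_space M q"
    and W: "mopen M W" "q \<in> W" "W \<subseteq> U"
    and \<xi>: "\<And>i. i < mdim M \<Longrightarrow> \<xi> i \<in> smooth_funs M" "\<And>i r. i < mdim M \<Longrightarrow> r \<in> W \<Longrightarrow> \<xi> i r = \<phi> r i"
    and f: "f \<in> smooth_funs M"
  shows "v f = (\<Sum>i<mdim M. v (\<xi> i) * cpd U \<phi> i f q)"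
proof -
  let ?n = "mdim M"
  define F where "F x = f (inv_into U \<phi> x)" for x
  define x0 where "x0 = \<phi> q"
  have q: "q \<in> U" "q \<in> mpoints M"
    using W openin_subset[OF W(1)] by auto
  have eW: "eopen ?n (\<phi> ` W)"
    using chart_image_open[OF M c W(1)] W(3) by (simp add: Int_absorb1)
  have x0e: "x0 \<in> euc ?n"
    unfolding x0_def by (rule chart_in_euc[OF M c q(1)])
  from eW obtain e where e: "e > 0" "ebox ?n x0 e \<subseteq> \<phi> ` W"
    using W(2) unfolding x0_def eopen_iff by blast
  have "smooth_on ?n (\<phi> ` W) F"
    using msmoothD[OF smooth_funs_msmooth[OF M f W(1)] c] W(3) by (simp add: Int_absorb1 F_def[abs_def])
  then have F: "smooth_on ?n (ebox ?n x0 e) F"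
    by (rule smooth_on_subset[OF eW eopen_ebox e(2)])
  obtain g where g: "\<And>i. i < ?n \<Longrightarrow> smooth_on ?n (ebox ?n x0 e) (g i)"
    "\<And>i. i < ?n \<Longrightarrow> g i x0 = pderiv_at i F x0"
    "\<And>x. x \<in> ebox ?n x0 e \<Longrightarrow> F x = F x0 + (\<Sum>i<?n. (x i - x0 i) * g i x)"
    by (rule hadamard_centered[OF F e(1) x0e]) blast
  define B where "B = {p \<in> U. \<phi> p \<in> ebox ?n x0 e}"
  have B: "mopen M B" "q \<in> B" "B \<subseteq> U"
    unfolding B_def using chart_preimage_open[OF M c eopen_ebox] q(1) ebox_self[OF chart_in_euc[OF M c q(1)] e(1)]
    by (auto simp: x0_def)
  have BW: "B \<subseteq> W"
    using e(2) chart_inj[OF M c] W(3) by (auto simp: B_def dest!: subsetD inj_onD)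
  have gs: "msmooth M B (\<lambda>p. g i (\<phi> p))" if "i < ?n" for i
    unfolding B_def by (rule msmooth_comp_chart[OF M c eopen_ebox g(1)[OF that]])
  have "\<forall>i. \<exists>G V. i < ?n \<longrightarrow> G \<in> smooth_funs M \<and> mopen M V \<and> q \<in> V \<and> V \<subseteq> B \<and> (\<forall>r\<in>V. G r = g i (\<phi> r))"
    using smooth_extension[OF M gs B(2)] by metis
  then obtain G V where G: "\<And>i. i < ?n \<Longrightarrow> G i \<in> smooth_funs M" and V: "\<And>i. i < ?n \<Longrightarrow> mopen M (V i)"
    "\<And>i. i < ?n \<Longrightarrow> q \<in> V i" "\<And>i r. i < ?n \<Longrightarrow> r \<in> V i \<Longrightarrow> G i r = g i (\<phi> r)"
    by metis
  define k where "k c = (\<lambda>q. if q \<in> mpoints M then c else 0 :: real)" for c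
  have k: "k c \<in> smooth_funs M" for c
    unfolding k_def by (rule smooth_funs_const[OF M])
  define h where "h i p = (\<xi> i p - k (x0 i) p) * G i p" for i p
  have h: "h i \<in> smooth_funs M" if "i < ?n" for i
    unfolding h_def[abs_def] by (intro smooth_funs_mult[OF M] smooth_funs_diff[OF M] \<xi>(1) k G that)
  define W' where "W' = B \<inter> (\<Inter>i\<in>{..<?n}. V i)"
  have "W' = B \<inter> \<Inter> (insert B (V ` {..<?n}))"
    by (auto simp: W'_def)
  moreover have "mopen M (\<Inter> (insert B (V ` {..<?n})))"
    by (rule openin_Inter) (use V B in auto)
  ultimately have W': "mopen M W'"
    using B(1) by simp
  have qW': "q \<in> W'"
    using V B by (auto simp: W'_def)
  have eq: "f r = k (f q) r + (\<Sum>i<?n. h i r)" if "r \<in> W'" for r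
  proof -
    have r: "r \<in> U" "\<phi> r \<in> ebox ?n x0 e" "r \<in> W" "r \<in> mpoints M"
      using that BW openin_subset[OF B(1)] by (auto simp: W'_def B_def)
    have "f r = F (\<phi> r)"
      using chart_inv[OF M c r(1)] by (simp add: F_def)
    also have "\<dots> = F x0 + (\<Sum>i<?n. (\<phi> r i - x0 i) * g i (\<phi> r))"
      by (rule g(3)[OF r(2)])
    also have "F x0 = k (f q) r"
      using chart_inv[OF M c q(1)] r(4) by (simp add: F_def x0_def k_def)
    also have "(\<Sum>i<?n. (\<phi> r i - x0 i) * g i (\<phi> r)) = (\<Sum>i<?n. h i r)"
      by (rule sum.cong) (use that r V(3) \<xi>(2) in \<open>auto simp: h_def k_def W'_def\<close>)
    finally show ?thesis .
  qed
  have hs: "(\<lambda>r. \<Sum>i<?n. h i r) \<in> smooth_funs M"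
    by (rule smooth_funs_sum[OF M]) (use h in auto)
  have "v f = v (\<lambda>r. k (f q) r + (\<Sum>i<?n. h i r))"
    by (rule tangent_local[OF M v f smooth_funs_add[OF M k hs] W' qW' eq])
  also have "\<dots> = v (k (f q)) + (\<Sum>i<?n. v (h i))"
    using tangent_add[OF v k hs] tangent_sum[OF M v, of "{..<?n}" h] h by simp
  also have "v (k (f q)) = 0"
    unfolding k_def by (rule tangent_const[OF M v q(2)])
  also have "(\<Sum>i<?n. v (h i)) = (\<Sum>i<?n. v (\<xi> i) * cpd U \<phi> i f q)"
  proof (rule sum.cong)
    fix i assume "i \<in> {..<?n}"
    then have i: "i < ?n"
      by simp
    have "v (\<lambda>p. \<xi> i p - k (x0 i) p) = v (\<xi> i)"
      using tangent_diff[OF v \<xi>(1)[OF i] k] tangent_const[OF M v q(2), of "x0 i"] by (simp add: k_def)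
    moreover have "\<xi> i q - k (x0 i) q = 0"
      using \<xi>(2)[OF i W(2)] q(2) by (simp add: k_def x0_def)
    moreover have "G i q = cpd U \<phi> i f q"
      using V(3)[OF i V(2)[OF i]] g(2)[OF i] by (simp add: x0_def cpd_def F_def[abs_def])
    ultimately show "v (h i) = v (\<xi> i) * cpd U \<phi> i f q"
      using tangent_mult[OF v smooth_funs_diff[OF M \<xi>(1)[OF i] k] G[OF i], of "x0 i"]
      by (simp add: h_def[abs_def])
  qed simp
  finally show ?thesis
    by simp
qed

section \<open>Connections in a local frame\<close>

text \<open>Connections act on global vector fields. A local coordinate frame is therefore
  represented by global fields \<open>E i\<close> and global functions \<open>\<xi> i\<close> that
  have the right values on the smaller set \<open>W\<close>.\<close>

definition frame :: "'a mfd \<Rightarrow> 'a set \<Rightarrow> ('a \<Rightarrow> nat \<Rightarrow> real) \<Rightarrow> 'a set \<Rightarrow> (nat \<Rightarrow> 'a \<Rightarrow> real) \<Rightarrow> (nat \<Rightarrow> 'a vfield) \<Rightarrow> bool"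
  where "frame M U \<phi> W \<xi> E \<longleftrightarrow> (U, \<phi>) \<in> matlas M \<and> mopen M W \<and> W \<subseteq> U \<and>
    (\<forall>i<mdim M. \<xi> i \<in> smooth_funs M \<and> E i \<in> vector_fields M \<and>
      (\<forall>r\<in>W. \<xi> i r = \<phi> r i \<and> (\<forall>f\<in>smooth_funs M. E i f r = cpd U \<phi> i f r)))"

lemma frame_exists:
  assumes M: "smooth_manifold M" and p: "p \<in> mpoints M"
  obtains U \<phi> W \<xi> E where "frame M U \<phi> W \<xi> E" "p \<in> W"
proof -
  obtain U \<phi> where c: "(U, \<phi>) \<in> matlas M" "p \<in> U"
    using chart_at[OF M p] .
  obtain \<eta> W C where *: "\<eta> \<in> smooth_funs M" "mopen M W" "p \<in> W" "W \<subseteq> C" "\<And>q. q \<in> W \<Longrightarrow> \<eta> q = 1"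
    "closedin (mtop M) C" "C \<subseteq> U" "\<And>q. q \<notin> C \<Longrightarrow> \<eta> q = 0"
    by (rule bump_exists[OF M chart_open[OF M c(1)] c(2)]) blast
  have WU: "W \<subseteq> U"
    using *(4,7) by blast
  define \<xi> where "\<xi> i = cut_ext \<eta> U (\<lambda>q. \<phi> q i)" for i
  define E where "E i f = (if f \<in> smooth_funs M then cut_ext \<eta> U (cpd U \<phi> i f) else (\<lambda>p. 0))" for i f
  have "\<xi> i \<in> smooth_funs M" for i
    unfolding \<xi>_def by (rule cut_ext_smooth[OF M *(1,6-8) msmooth_chart_coord[OF M c(1)]])
  moreover have "E i \<in> vector_fields M" if i: "i < mdim M" for i
  proof (rule vfI[OF _ _ _ M])
    show "E i f p = 0" if "f \<notin> smooth_funs M" for f p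
      using that by (simp add: E_def)
    show "E i f \<in> smooth_funs M" if f: "f \<in> smooth_funs M" for f
    proof -
      have "msmooth M U (cpd U \<phi> i f)"
        using cpd_msmooth[OF M c(1) smooth_funs_msmooth[OF M f chart_open[OF M c(1)]] i] by simp
      then show ?thesis
        using cut_ext_smooth[OF M *(1,6-8)] f by (simp add: E_def)
    qed
    show "(\<lambda>f. E i f q) \<in> tangent_space M q" for q
    proof (cases "q \<in> U")
      case True
      have eq: "E i f q = \<eta> q * (if f \<in> smooth_funs M then cpd U \<phi> i f q else 0)" for f
        using True by (simp add: E_def cut_ext_def)
      show ?thesis
        unfolding eq using cpd_tangent[OF M c(1) True i] by (auto simp: tangent_space_def algebra_simps)
    next
      case False
      then show ?thesis
        by (auto simp: E_def cut_ext_def tangent_space_def)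
    qed
  qed
  ultimately have "frame M U \<phi> W \<xi> E"
    using c(1) *(2,5) WU by (auto simp: frame_def \<xi>_def E_def cut_ext_def)
  then show ?thesis
    using that *(3) by blast
qed

text \<open>The vanishing on \<open>O'\<close> of the covariant Hessian of \<open>f\<close>, that
  is, of the covariant derivative of \<open>df\<close>.\<close>

definition affine_on :: "'a mfd \<Rightarrow> 'a connection \<Rightarrow> 'a set \<Rightarrow> ('a \<Rightarrow> real) \<Rightarrow> bool"
  where "affine_on M D O' f \<longleftrightarrow> (\<forall>X\<in>vector_fields M. \<forall>Y\<in>vector_fields M. \<forall>q\<in>O'. X (Y f) q = D X Y f q)"

context
  fixes M :: "'a mfd" and U \<phi> W \<xi> E
  assumes M: "smooth_manifold M" and fr: "frame M U \<phi> W \<xi> E"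
begin

lemma frame_chart: "(U, \<phi>) \<in> matlas M"
  and frame_open: "mopen M W"
  and frame_sub: "W \<subseteq> U"
  and frame_coord: "i < mdim M \<Longrightarrow> \<xi> i \<in> smooth_funs M"
  and frame_vf: "i < mdim M \<Longrightarrow> E i \<in> vector_fields M"
  and frame_coord_eq: "i < mdim M \<Longrightarrow> r \<in> W \<Longrightarrow> \<xi> i r = \<phi> r i"
  and frame_vf_eq: "i < mdim M \<Longrightarrow> r \<in> W \<Longrightarrow> f \<in> smooth_funs M \<Longrightarrow> E i f r = cpd U \<phi> i f r"
  using fr by (auto simp: frame_def)

lemma frame_expand:
  assumes v: "v \<in> tangent_space M q" and q: "q \<in> W" and f: "f \<in> smooth_funs M"
  shows "v f = (\<Sum>i<mdim M. v (\<xi> i) * E i f q)"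
  using tangent_coord[OF M frame_chart v frame_open q frame_sub frame_coord frame_coord_eq f] frame_vf_eq[OF _ q f]
  by simp

lemma frame_vf_expand:
  "X \<in> vector_fields M \<Longrightarrow> q \<in> W \<Longrightarrow> f \<in> smooth_funs M \<Longrightarrow> X f q = (\<Sum>i<mdim M. X (\<xi> i) q * E i f q)"
  using frame_expand[OF vf_tangent] by simp

lemma frame_delta: "i < mdim M \<Longrightarrow> j < mdim M \<Longrightarrow> q \<in> W \<Longrightarrow> E i (\<xi> j) q = (if i = j then 1 else 0)"
  using frame_vf_eq[OF _ _ frame_coord] cpd_coord[OF M frame_chart frame_open _ frame_sub _ frame_coord_eq] by simp

lemma vf_local:
  "X \<in> vector_fields M \<Longrightarrow> f \<in> smooth_funs M \<Longrightarrow> g \<in> smooth_funs M \<Longrightarrow> mopen M V \<Longrightarrow> q \<in> V \<Longrightarrow>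
    (\<And>r. r \<in> V \<Longrightarrow> f r = g r) \<Longrightarrow> X f q = X g q"
  using tangent_local[OF M vf_tangent] by metis

lemma vf_locally_const:
  assumes X: "X \<in> vector_fields M" and f: "f \<in> smooth_funs M" and V: "mopen M V" "q \<in> V" "\<And>r. r \<in> V \<Longrightarrow> f r = c"
  shows "X f q = 0"
proof -
  have V': "V \<subseteq> mpoints M"
    using openin_subset[OF V(1)] .
  have "X f q = X (\<lambda>r. if r \<in> mpoints M then c else 0) q"
    by (rule vf_local[OF X f smooth_funs_const[OF M] V(1,2)]) (use V(3) V' in auto)
  then show ?thesis
    using tangent_const[OF M vf_tangent[OF X], of q c] V(2) V' by auto
qed

lemma vf_mult: "X \<in> vector_fields M \<Longrightarrow> f \<in> smooth_funs M \<Longrightarrow> g \<in> smooth_funs M \<Longrightarrow> X (\<lambda>p. f p * g p) q = X f q * g q + f q * X g q"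
  using tangent_mult[OF vf_tangent, of X M f g q] by simp

lemma vf_sum_fun:
  "X \<in> vector_fields M \<Longrightarrow> (\<And>j. j \<in> J \<Longrightarrow> f j \<in> smooth_funs M) \<Longrightarrow> X (\<lambda>p. \<Sum>j\<in>J. f j p) q = (\<Sum>j\<in>J. X (f j) q)"
  using tangent_sum[OF M vf_tangent, of X J f q] by metis

text \<open>All functions \<open>E j (\<xi> k)\<close> are constant on \<open>W\<close>, so the
  bracket annihilates every coordinate there, and a vector field is determined by its values on the
  coordinates.\<close>

lemma frame_bracket:
  assumes "i < mdim M" "j < mdim M" "q \<in> W" "f \<in> smooth_funs M"
  shows "lie_bracket (E i) (E j) f q = 0"
proof -
  have "E a (E b (\<xi> k)) q = 0" if "a < mdim M" "b < mdim M" "k < mdim M" for a b k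
    by (rule vf_locally_const[OF frame_vf vf_smooth[OF frame_vf frame_coord] frame_open assms(3) frame_delta])
      (use that in auto)
  then have "lie_bracket (E i) (E j) (\<xi> k) q = 0" if "k < mdim M" for k
    using assms that by (simp add: lie_bracket_def)
  then show ?thesis
    using frame_vf_expand[OF vf_lie_bracket[OF M frame_vf frame_vf] assms(3,4)] assms(1,2) by simp
qed

context
  fixes D :: "'a connection"
  assumes D: "linear_connection M D"
begin

lemma conn_vf: "X \<in> vector_fields M \<Longrightarrow> Y \<in> vector_fields M \<Longrightarrow> D X Y \<in> vector_fields M"
  using D by (simp add: linear_connection_def)

lemma conn_lin:
  "X \<in> vector_fields M \<Longrightarrow> Y \<in> vector_fields M \<Longrightarrow> Z \<in> vector_fields M \<Longrightarrow> f \<in> smooth_funs M \<Longrightarrow> g \<in> smooth_funs M \<Longrightarrow>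
    D (\<lambda>h p. f p * X h p + g p * Y h p) Z = (\<lambda>h p. f p * D X Z h p + g p * D Y Z h p)"
  using D by (simp add: linear_connection_def)

lemma conn_add:
  "X \<in> vector_fields M \<Longrightarrow> Y \<in> vector_fields M \<Longrightarrow> Z \<in> vector_fields M \<Longrightarrow>
    D X (\<lambda>h p. Y h p + Z h p) = (\<lambda>h p. D X Y h p + D X Z h p)"
  using D by (simp add: linear_connection_def)

lemma conn_leibniz:
  "X \<in> vector_fields M \<Longrightarrow> Y \<in> vector_fields M \<Longrightarrow> f \<in> smooth_funs M \<Longrightarrow>
    D X (\<lambda>h p. f p * Y h p) = (\<lambda>h p. X f p * Y h p + f p * D X Y h p)"
  using D by (simp add: linear_connection_def)

lemma conn_scale:
  assumes "X \<in> vector_fields M" "Z \<in> vector_fields M" "f \<in> smooth_funs M"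
  shows "D (\<lambda>h p. f p * X h p) Z = (\<lambda>h p. f p * D X Z h p)"
  using conn_lin[OF assms(1,1,2,3) smooth_funs_zero[OF M]] by simp

lemma conn_sum:
  assumes X: "\<And>j. j \<in> J \<Longrightarrow> X j \<in> vector_fields M" and Z: "Z \<in> vector_fields M"
    and f: "\<And>j. j \<in> J \<Longrightarrow> f j \<in> smooth_funs M" and J: "finite J"
  shows "D (\<lambda>h p. \<Sum>j\<in>J. f j p * X j h p) Z = (\<lambda>h p. \<Sum>j\<in>J. f j p * D (X j) Z h p)"
  using J X f
proof (induction J)
  case empty
  show ?case
    using conn_scale[OF Z Z smooth_funs_zero[OF M]] by simp
next
  case (insert j J)
  \<comment> \<open>The constant \<open>1\<close> as an element of \<open>smooth_funs\<close>, with
    the default value \<open>0\<close> outside the manifold. Multiplying a vector field by it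
    changes nothing, and it fits the two-coefficient rule \<open>conn_lin\<close>.\<close>
  let ?u = "\<lambda>p. if p \<in> mpoints M then 1::real else 0"
  define S where "S = (\<lambda>h p. \<Sum>j\<in>J. f j p * X j h p)"
  have S: "S \<in> vector_fields M"
    unfolding S_def by (intro vf_sum[OF M] vf_scale[OF M] insert.prems) auto
  have u: "?u p * Y h p = Y h p" if "Y \<in> vector_fields M" for Y h p
    using smooth_funs_outside[OF vf_smooth[OF that]] vf_junk[OF that] by (cases "h \<in> smooth_funs M") auto
  have "D (\<lambda>h p. f j p * X j h p + ?u p * S h p) Z = (\<lambda>h p. f j p * D (X j) Z h p + ?u p * D S Z h p)"
    by (rule conn_lin[OF _ S Z _ smooth_funs_const[OF M]]) (use insert.prems in auto)
  moreover have "(\<lambda>h p. f j p * X j h p + ?u p * S h p) = (\<lambda>h p. \<Sum>j\<in>insert j J. f j p * X j h p)"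
    unfolding u[OF S] using insert.hyps by (simp add: S_def)
  moreover have "D S Z = (\<lambda>h p. \<Sum>j\<in>J. f j p * D (X j) Z h p)"
    unfolding S_def by (rule insert.IH) (use insert.prems in auto)
  ultimately show ?case
    using insert.hyps u[OF conn_vf[OF S Z]] by (simp add: fun_eq_iff)
qed

lemma conn_sum_right:
  assumes X: "X \<in> vector_fields M" and Y: "\<And>j. j \<in> J \<Longrightarrow> Y j \<in> vector_fields M" and J: "finite J"
  shows "D X (\<lambda>h p. \<Sum>j\<in>J. Y j h p) = (\<lambda>h p. \<Sum>j\<in>J. D X (Y j) h p)"
  using J Y
proof (induction J)
  case empty
  have z: "X (\<lambda>p. 0) p = 0" for p
    by (rule tangent_zero[OF M vf_tangent[OF X]])
  show ?case
    using conn_leibniz[OF X X smooth_funs_zero[OF M]] by (simp add: z)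
next
  case (insert j J)
  then show ?case
    using conn_add[OF X, of "Y j" "\<lambda>h p. \<Sum>j\<in>J. Y j h p"] vf_sum[OF M, of J Y] by simp
qed

text \<open>The coordinate formula with Christoffel symbols \<open>D (E i) (E j) (\<xi> k)\<close>.
  It shows at the same time that \<open>D X Y\<close> at \<open>q\<close> depends only on the germs
  of the fields.\<close>

lemma frame_conn:
  assumes X: "X \<in> vector_fields M" and Y: "Y \<in> vector_fields M" and h: "h \<in> smooth_funs M" and q: "q \<in> W"
  shows "D X Y h q = (\<Sum>i<mdim M. X (\<xi> i) q * (\<Sum>j<mdim M. E i (Y (\<xi> j)) q * E j h q +
      Y (\<xi> j) q * (\<Sum>k<mdim M. D (E i) (E j) (\<xi> k) q * E k h q)))"
proof -
  let ?n = "mdim M"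
  \<comment> \<open>Multiplied by \<open>\<eta>\<close>, the fields \<open>X\<close> and
    \<open>Y\<close> become global combinations of the frame, which they are otherwise only on
    \<open>W\<close>. The factor is invisible at \<open>q\<close>, where \<open>\<eta> = 1\<close>
    and its derivatives vanish.\<close>
  obtain \<eta> V C where *: "\<eta> \<in> smooth_funs M" "mopen M V" "q \<in> V" "V \<subseteq> C" "\<And>q. q \<in> V \<Longrightarrow> \<eta> q = 1"
    "C \<subseteq> W" "\<And>q. q \<notin> C \<Longrightarrow> \<eta> q = 0"
    using bump_exists[OF M frame_open q] by metis
  have \<eta>q: "\<eta> q = 1" "X \<eta> q = 0"
    using *(3,5) vf_locally_const[OF X *(1,2,3,5)] by auto
  define a where "a Z i p = \<eta> p * Z (\<xi> i) p" for Z :: "'a vfield" and i p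
  have a: "a Z i \<in> smooth_funs M" if "Z \<in> vector_fields M" "i < ?n" for Z i
    unfolding a_def[abs_def] by (intro smooth_funs_mult[OF M] *(1) vf_smooth[OF that(1)] frame_coord that(2))
  have dec: "(\<lambda>h p. \<eta> p * Z h p) = (\<lambda>h p. \<Sum>i<?n. a Z i p * E i h p)" if Z: "Z \<in> vector_fields M" for Z
  proof (intro ext)
    fix h p
    show "\<eta> p * Z h p = (\<Sum>i<?n. a Z i p * E i h p)"
    proof (cases "p \<in> W \<and> h \<in> smooth_funs M")
      case True
      then show ?thesis
        using frame_vf_expand[OF Z] by (simp add: a_def sum_distrib_left algebra_simps)
    next
      case False
      then consider "\<eta> p = 0" | "h \<notin> smooth_funs M"
        using *(6,7) by blast
      then show ?thesis
        by cases (simp_all add: a_def vf_junk[OF Z] vf_junk[OF frame_vf])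
    qed
  qed
  have \<eta>Y: "(\<lambda>h p. \<eta> p * Y h p) \<in> vector_fields M"
    by (rule vf_scale[OF M Y *(1)])
  have "D X Y h q = D X (\<lambda>h p. \<eta> p * Y h p) h q"
    using conn_leibniz[OF X Y *(1)] \<eta>q by simp
  also have "\<dots> = D (\<lambda>h p. \<eta> p * X h p) (\<lambda>h p. \<eta> p * Y h p) h q"
    using conn_scale[OF X \<eta>Y *(1)] \<eta>q by simp
  also have "\<dots> = (\<Sum>i<?n. a X i q * D (E i) (\<lambda>h p. \<eta> p * Y h p) h q)"
    unfolding dec[OF X] by (subst conn_sum[OF frame_vf \<eta>Y a[OF X]]) auto
  also have "\<dots> = (\<Sum>i<?n. X (\<xi> i) q * (\<Sum>j<?n. E i (Y (\<xi> j)) q * E j h q +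
      Y (\<xi> j) q * (\<Sum>k<?n. D (E i) (E j) (\<xi> k) q * E k h q)))"
  proof (rule sum.cong[OF refl])
    fix i assume "i \<in> {..<?n}"
    then have i: "i < ?n"
      by simp
    have "D (E i) (\<lambda>h p. \<eta> p * Y h p) h q = (\<Sum>j<?n. D (E i) (\<lambda>h p. a Y j p * E j h p) h q)"
      unfolding dec[OF Y] by (subst conn_sum_right[OF frame_vf[OF i] vf_scale[OF M frame_vf a[OF Y]]]) auto
    also have "\<dots> = (\<Sum>j<?n. E i (Y (\<xi> j)) q * E j h q +
      Y (\<xi> j) q * (\<Sum>k<?n. D (E i) (E j) (\<xi> k) q * E k h q))"
    proof (rule sum.cong[OF refl])
      fix j assume "j \<in> {..<?n}"
      then have j: "j < ?n"
        by simp
      have "E i (a Y j) q = E i (Y (\<xi> j)) q"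
        by (rule vf_local[OF frame_vf[OF i] a[OF Y j] vf_smooth[OF Y frame_coord[OF j]] *(2,3)])
          (simp add: a_def *(5))
      then show "D (E i) (\<lambda>h p. a Y j p * E j h p) h q = E i (Y (\<xi> j)) q * E j h q +
          Y (\<xi> j) q * (\<Sum>k<?n. D (E i) (E j) (\<xi> k) q * E k h q)"
        using conn_leibniz[OF frame_vf[OF i] frame_vf[OF j] a[OF Y j]]
          frame_vf_expand[OF conn_vf[OF frame_vf[OF i] frame_vf[OF j]] q h] \<eta>q(1)
        by (simp add: a_def)
    qed
    finally show "a X i q * D (E i) (\<lambda>h p. \<eta> p * Y h p) h q = X (\<xi> i) q * (\<Sum>j<?n. E i (Y (\<xi> j)) q * E j h q +
      Y (\<xi> j) q * (\<Sum>k<?n. D (E i) (E j) (\<xi> k) q * E k h q))"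
      by (simp add: a_def \<eta>q(1))
  qed
  finally show ?thesis .
qed

text \<open>The Hessian is tensorial: the terms that differentiate the components of
  \<open>Y\<close> occur both in \<open>X (Y f)\<close> and in \<open>D X Y f\<close>. Pairs of
  frame fields therefore decide, and affineness becomes a linear second-order system for
  \<open>f\<close>.\<close>

lemma frame_affineI:
  assumes f: "f \<in> smooth_funs M" and V: "mopen M V" "V \<subseteq> W"
    and eq: "\<And>i j q. i < mdim M \<Longrightarrow> j < mdim M \<Longrightarrow> q \<in> V \<Longrightarrow>
      E i (E j f) q = (\<Sum>k<mdim M. D (E i) (E j) (\<xi> k) q * E k f q)"
  shows "affine_on M D V f"
  unfolding affine_on_def
proof (intro ballI)
  let ?n = "mdim M"
  fix X Y q assume X: "X \<in> vector_fields M" and Y: "Y \<in> vector_fields M" and q: "q \<in> V"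
  have qW: "q \<in> W"
    using q V by auto
  define g where "g = (\<lambda>p. \<Sum>j<?n. Y (\<xi> j) p * E j f p)"
  have gj: "(\<lambda>p. Y (\<xi> j) p * E j f p) \<in> smooth_funs M" if "j < ?n" for j
    by (intro smooth_funs_mult[OF M] vf_smooth[OF Y] vf_smooth[OF frame_vf] frame_coord f that)
  have g: "g \<in> smooth_funs M"
    unfolding g_def by (rule smooth_funs_sum[OF M]) (use gj in auto)
  have "X (Y f) q = (\<Sum>i<?n. X (\<xi> i) q * E i (Y f) q)"
    by (rule frame_vf_expand[OF X qW vf_smooth[OF Y f]])
  also have "\<dots> = D X Y f q"
    unfolding frame_conn[OF X Y f qW]
  proof (intro sum.cong[OF refl] arg_cong[of _ _ "(*) _"])
    fix i assume "i \<in> {..<?n}"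
    then have i: "i < ?n"
      by simp
    have "E i (Y f) q = E i g q"
      by (rule vf_local[OF frame_vf[OF i] vf_smooth[OF Y f] g frame_open qW])
        (use frame_vf_expand[OF Y _ f] in \<open>simp add: g_def\<close>)
    also have "\<dots> = (\<Sum>j<?n. E i (\<lambda>p. Y (\<xi> j) p * E j f p) q)"
      unfolding g_def by (rule vf_sum_fun[OF frame_vf[OF i]]) (use gj in auto)
    also have "\<dots> = (\<Sum>j<?n. E i (Y (\<xi> j)) q * E j f q +
        Y (\<xi> j) q * (\<Sum>k<?n. D (E i) (E j) (\<xi> k) q * E k f q))"
    proof (rule sum.cong[OF refl])
      fix j assume "j \<in> {..<?n}"
      then have j: "j < ?n"
        by simp
      show "E i (\<lambda>p. Y (\<xi> j) p * E j f p) q = E i (Y (\<xi> j)) q * E j f q +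
          Y (\<xi> j) q * (\<Sum>k<?n. D (E i) (E j) (\<xi> k) q * E k f q)"
        using vf_mult[OF frame_vf[OF i] vf_smooth[OF Y frame_coord[OF j]] vf_smooth[OF frame_vf[OF j] f]]
          eq[OF i j q] by simp
    qed
    finally show "E i (Y f) q = (\<Sum>j<?n. E i (Y (\<xi> j)) q * E j f q +
        Y (\<xi> j) q * (\<Sum>k<?n. D (E i) (E j) (\<xi> k) q * E k f q))" .
  qed
  finally show "X (Y f) q = D X Y f q" .
qed

lemma frame_affineD:
  assumes "f \<in> smooth_funs M" "affine_on M D V f" "V \<subseteq> W" "i < mdim M" "j < mdim M" "q \<in> V"
  shows "E i (E j f) q = (\<Sum>k<mdim M. D (E i) (E j) (\<xi> k) q * E k f q)"
proof -
  have "E i (E j f) q = D (E i) (E j) f q"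
    using assms frame_vf by (auto simp: affine_on_def)
  also have "\<dots> = (\<Sum>k<mdim M. D (E i) (E j) (\<xi> k) q * E k f q)"
    by (rule frame_vf_expand[OF conn_vf[OF frame_vf frame_vf]]) (use assms in auto)
  finally show ?thesis .
qed

end

lemma frame_torsion_free:
  assumes "flat_affine M D" "i < mdim M" "j < mdim M" "k < mdim M" "q \<in> W"
  shows "D (E i) (E j) (\<xi> k) q = D (E j) (E i) (\<xi> k) q"
proof -
  have "torsion D (E i) (E j) (\<xi> k) q = 0"
    using assms(1-3) frame_vf by (auto simp: flat_affine_def)
  then show ?thesis
    using frame_bracket[OF assms(2,3,5) frame_coord[OF assms(4)]] by (simp add: torsion_def)
qed

text \<open>The curvature equation in Christoffel symbols. The term with the bracket drops out
  because the frame commutes on \<open>W\<close>.\<close>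

lemma frame_flat:
  assumes flat: "flat_affine M D" and i: "i < mdim M" and j: "j < mdim M" and k: "k < mdim M" and l: "l < mdim M" and q: "q \<in> W"
  shows "E i (D (E j) (E k) (\<xi> l)) q + (\<Sum>m<mdim M. D (E j) (E k) (\<xi> m) q * D (E i) (E m) (\<xi> l) q) =
    E j (D (E i) (E k) (\<xi> l)) q + (\<Sum>m<mdim M. D (E i) (E k) (\<xi> m) q * D (E j) (E m) (\<xi> l) q)"
proof -
  let ?n = "mdim M"
  have D: "linear_connection M D"
    using flat by (simp add: flat_affine_def)
  have *: "D (E a) (D (E b) (E k)) (\<xi> l) q =
      E a (D (E b) (E k) (\<xi> l)) q + (\<Sum>m<?n. D (E b) (E k) (\<xi> m) q * D (E a) (E m) (\<xi> l) q)"
    if a: "a < ?n" and b: "b < ?n" for a b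
  proof -
    have d: "(\<Sum>m<?n. x m * E m (\<xi> l) q) = x l" for x :: "nat \<Rightarrow> real"
      using frame_delta[OF _ l q] l by (simp add: if_distrib[of "(*) _"] sum.delta cong: if_cong)
    have d': "(\<Sum>i<?n. E a (\<xi> i) q * x i) = x a" for x :: "nat \<Rightarrow> real"
      using frame_delta[OF a _ q] a by (simp add: if_distrib[of "\<lambda>c. c * _"] sum.delta' cong: if_cong)
    show ?thesis
      unfolding frame_conn[OF D frame_vf[OF a] conn_vf[OF D frame_vf[OF b] frame_vf[OF k]] frame_coord[OF l] q] d'
      by (simp add: sum.distrib d)
  qed
  have "D (lie_bracket (E i) (E j)) (E k) (\<xi> l) q = 0"
    using frame_conn[OF D vf_lie_bracket[OF M frame_vf[OF i] frame_vf[OF j]] frame_vf[OF k] frame_coord[OF l] q]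
      frame_bracket[OF i j q frame_coord] by simp
  moreover have "curvature D (E i) (E j) (E k) (\<xi> l) q = 0"
    using flat frame_vf[OF i] frame_vf[OF j] frame_vf[OF k] by (simp add: flat_affine_def)
  ultimately show ?thesis
    using *[OF i j] *[OF j i] by (simp add: curvature_def)
qed

end

section \<open>Flat linear systems\<close>

lemma radial_bound:
  assumes "star_shaped Q" "continuous_on Q f" "x \<in> Q" "\<And>t. 0 \<le> t \<Longrightarrow> t \<le> 1 \<Longrightarrow> \<bar>f (\<lambda>i. t * x i)\<bar> \<le> B"
  shows "\<bar>radial p f x\<bar> \<le> B"
proof -
  have "norm (integral (cbox 0 1) (\<lambda>t. t ^ p * f (\<lambda>i. t * x i))) \<le> B * Henstock_Kurzweil_Integration.content (cbox 0 (1::real))"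
  proof (rule integrable_bound)
    show "0 \<le> B"
      using assms(4)[of 0] by simp
    show "(\<lambda>t. t ^ p * f (\<lambda>i. t * x i)) integrable_on cbox 0 1"
      using radial_integrable[OF assms(1-3)] by (simp add: cbox_interval)
    fix t :: real assume "t \<in> cbox 0 1"
    then have t: "0 \<le> t" "t \<le> 1"
      by auto
    have "t ^ p * \<bar>f (\<lambda>i. t * x i)\<bar> \<le> 1 * B"
      using t assms(4)[OF t] by (intro mult_mono power_le_one) auto
    then show "norm (t ^ p * f (\<lambda>i. t * x i)) \<le> B"
      using t by (simp add: abs_mult)
  qed
  then show ?thesis
    by (simp add: radial_def cbox_interval)
qed

lemma radial_diff:
  assumes "star_shaped Q" "continuous_on Q f" "continuous_on Q g" "x \<in> Q"
  shows "radial p (\<lambda>y. f y - g y) x = radial p f x - radial p g x"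
  using integral_diff[OF radial_integrable[OF assms(1,2,4)] radial_integrable[OF assms(1,3,4)], of p]
  by (simp add: radial_def right_diff_distrib)

lemma radial_cong:
  assumes "star_shaped Q" "x \<in> Q" "\<And>z. z \<in> Q \<Longrightarrow> f z = g z"
  shows "radial p f x = radial p g x"
  unfolding radial_def using assms(3)[OF star_shapedD[OF assms(1,2)]] by (intro integral_cong) auto

lemma radial_sum_coord:
  assumes "star_shaped Q" "\<And>i. i < n \<Longrightarrow> continuous_on Q (f i)" "x \<in> Q"
  shows "(\<Sum>i<n. x i * radial p (f i) x) = integral {0..1} (\<lambda>t. \<Sum>i<n. x i * (t ^ p * f i (\<lambda>j. t * x j)))"
proof -
  have "(\<lambda>t. t ^ p * f i (\<lambda>j. t * x j)) integrable_on {0..1}" if "i < n" for i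
    by (rule radial_integrable[OF assms(1) assms(2)[OF that] assms(3)])
  then have "integral {0..1} (\<lambda>t. \<Sum>i<n. x i * (t ^ p * f i (\<lambda>j. t * x j))) =
      (\<Sum>i<n. integral {0..1} (\<lambda>t. x i * (t ^ p * f i (\<lambda>j. t * x j))))"
    by (intro integral_sum integrable_on_mult_right) auto
  then show ?thesis
    by (simp add: radial_def)
qed

text \<open>The fundamental theorem of calculus for \<open>t * g (t x)\<close> along the ray, that
  is, integration by parts.\<close>

lemma radial_ibp:
  assumes Q: "star_shaped Q" "eopen n Q" and x: "x \<in> Q" and g: "continuous_on Q g"
    and pd: "\<And>i y. i < n \<Longrightarrow> y \<in> Q \<Longrightarrow> has_pderiv i g y (g' i y)"
    and cont: "\<And>i. i < n \<Longrightarrow> continuous_on Q (g' i)"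
  shows "g x = radial 0 g x + (\<Sum>i<n. x i * radial 1 (g' i) x)"
proof -
  have "((\<lambda>t. t * g (\<lambda>i. t * x i)) has_real_derivative
      1 * g (\<lambda>i. t * x i) + (\<Sum>i<n. g' i (\<lambda>i. t * x i) * x i) * t) (at t within {0..1})" if "t \<in> {0..1}" for t
    using that by (intro has_field_derivative_at_within[OF DERIV_mult[OF DERIV_ident radial_derivative[OF Q x _ _ pd cont]]]) auto
  then have 1: "((\<lambda>t. 1 * g (\<lambda>i. t * x i) + (\<Sum>i<n. g' i (\<lambda>i. t * x i) * x i) * t) has_integral
      1 * g (\<lambda>i. 1 * x i) - 0 * g (\<lambda>i. 0 * x i)) {0..1}"
    by (intro fundamental_theorem_of_calculus) (auto simp flip: has_real_derivative_iff_has_vector_derivative)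
  have 2: "((\<lambda>t. t ^ 0 * g (\<lambda>i. t * x i)) has_integral radial 0 g x) {0..1}"
    unfolding radial_def by (rule integrable_integral[OF radial_integrable[OF Q(1) g x]])
  have 3: "((\<lambda>t. \<Sum>i<n. x i * (t ^ 1 * g' i (\<lambda>i. t * x i))) has_integral (\<Sum>i<n. x i * radial 1 (g' i) x)) {0..1}"
    unfolding radial_def
    by (intro has_integral_sum has_integral_mult_right integrable_integral radial_integrable[OF Q(1) cont x]) auto
  have "(\<lambda>t. 1 * g (\<lambda>i. t * x i) + (\<Sum>i<n. g' i (\<lambda>i. t * x i) * x i) * t) =
      (\<lambda>t. t ^ 0 * g (\<lambda>i. t * x i) + (\<Sum>i<n. x i * (t ^ 1 * g' i (\<lambda>i. t * x i))))"
    by (simp add: sum_distrib_left mult_ac)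
  from has_integral_unique[OF 1[unfolded this] has_integral_add[OF 2 3]] show ?thesis
    by simp
qed

text \<open>A bound on the ray from the origin to \<open>x\<close> holds at first by compactness.
  Since shorter rays lie in this ray, \<open>half\<close> improves the bound by a factor
  \<open>1 / 2\<close> at all its points simultaneously, again and again.\<close>

lemma ray_vanish:
  fixes w :: "nat \<Rightarrow> (nat \<Rightarrow> real) \<Rightarrow> real"
  assumes Q: "star_shaped Q" and cont: "\<And>a. a < N \<Longrightarrow> continuous_on Q (w a)"
    and half: "\<And>x B a. x \<in> Q \<Longrightarrow> a < N \<Longrightarrow> (\<And>t b. 0 \<le> t \<Longrightarrow> t \<le> 1 \<Longrightarrow> b < N \<Longrightarrow> \<bar>w b (\<lambda>i. t * x i)\<bar> \<le> B) \<Longrightarrow> \<bar>w a x\<bar> \<le> B / 2"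
    and x: "x \<in> Q" and a: "a < N"
  shows "w a x = 0"
proof -
  have c1: "continuous_on {0..1} (\<lambda>t. (\<lambda>i. t * x i) :: nat \<Rightarrow> real)"
    by (intro continuous_on_coordinatewise_then_product continuous_intros)
  have "continuous_on {0..1} (\<lambda>t. \<Sum>b<N. \<bar>w b (\<lambda>i. t * x i)\<bar>)"
    by (intro continuous_on_sum continuous_on_rabs continuous_on_compose2[OF cont c1])
      (auto intro: star_shapedD[OF Q x])
  then have "compact ((\<lambda>t. \<Sum>b<N. \<bar>w b (\<lambda>i. t * x i)\<bar>) ` {0..1})"
    by (rule compact_continuous_image) simp
  then have "bounded ((\<lambda>t. \<Sum>b<N. \<bar>w b (\<lambda>i. t * x i)\<bar>) ` {0..1})"
    by (rule compact_imp_bounded)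
  then obtain C where "\<forall>y\<in>(\<lambda>t. \<Sum>b<N. \<bar>w b (\<lambda>i. t * x i)\<bar>) ` {0..1}. norm y \<le> C"
    by (auto simp: bounded_iff)
  then have C: "(\<Sum>b<N. \<bar>w b (\<lambda>i. t * x i)\<bar>) \<le> C" if "0 \<le> t" "t \<le> 1" for t
    using that by force
  have bound: "\<bar>w b (\<lambda>i. t * x i)\<bar> \<le> C / 2 ^ k" if "0 \<le> t" "t \<le> 1" "b < N" for t b k
    using that
  proof (induction k arbitrary: t b)
    case 0
    have "\<bar>w b (\<lambda>i. t * x i)\<bar> \<le> (\<Sum>b<N. \<bar>w b (\<lambda>i. t * x i)\<bar>)"
      using 0 by (intro member_le_sum) auto
    then show ?case
      using C[OF 0(1,2)] by simp
  next
    case (Suc k)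
    have "\<bar>w b (\<lambda>i. t * x i)\<bar> \<le> (C / 2 ^ k) / 2"
    proof (rule half[OF star_shapedD[OF Q x Suc.prems(1,2)] Suc.prems(3)])
      fix s c assume s: "0 \<le> s" "s \<le> (1::real)" "c < N"
      have "s * t \<le> 1"
        using s Suc.prems mult_le_one by blast
      then show "\<bar>w c (\<lambda>i. s * (t * x i))\<bar> \<le> C / 2 ^ k"
        using Suc.IH[of "s * t" c] s Suc.prems by (simp add: mult.assoc)
    qed
    then show ?case
      by simp
  qed
  have "(\<lambda>k. C / 2 ^ k) \<longlonglongrightarrow> 0"
    using tendsto_mult_right_zero[OF LIMSEQ_realpow_zero[of "1/2"], of C] by (simp add: power_one_over field_simps)
  moreover have "\<bar>w a x\<bar> \<le> C / 2 ^ k" for k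
    using bound[of 1 a k] a by simp
  ultimately have "\<bar>w a x\<bar> \<le> 0"
    by (intro LIMSEQ_le_const) auto
  then show ?thesis
    by simp
qed

text \<open>Termwise differentiation by the Weierstrass test, on an interval of the line through
  \<open>x\<close> in direction \<open>j\<close> that stays in \<open>U\<close>.\<close>

lemma has_pderiv_suminf:
  fixes g g' :: "nat \<Rightarrow> (nat \<Rightarrow> real) \<Rightarrow> real"
  assumes U: "eopen n U" "x \<in> U" "j < n"
    and pd: "\<And>k y. y \<in> U \<Longrightarrow> has_pderiv j (g k) y (g' k y)"
    and b: "\<And>k y. y \<in> U \<Longrightarrow> \<bar>g k y\<bar> \<le> C / 2 ^ k" "\<And>k y. y \<in> U \<Longrightarrow> \<bar>g' k y\<bar> \<le> C / 2 ^ k"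
  shows "has_pderiv j (\<lambda>y. \<Sum>k. g k y) x (\<Sum>k. g' k x)"
proof -
  obtain e where e: "e > 0" "ebox n x e \<subseteq> U"
    using U by (meson eopen_iff)
  have xe: "x \<in> euc n"
    using eopen_subset[OF U(1)] U(2) by blast
  define S where "S = ball (x j) e"
  have S: "x(j := s) \<in> U" if "s \<in> S" for s
  proof -
    have "x(j := s) \<in> ebox n x e"
      using that e(1) U(3) euc_upd[OF xe U(3)] by (auto simp: S_def ebox_def dist_real_def)
    then show ?thesis
      using e(2) by blast
  qed
  have sm: "summable (\<lambda>k. C / 2 ^ k)"
    using summable_mult[OF summable_geometric[of "1/2::real"], of C] by (simp add: power_one_over field_simps)
  have "((\<lambda>s. \<Sum>k. g k (x(j := s))) has_field_derivative (\<Sum>k. g' k (x(j := x j)))) (at (x j))"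
  proof (rule has_field_derivative_series')
    show "convex S"
      by (simp add: S_def)
    show "((\<lambda>s. g k (x(j := s))) has_field_derivative g' k (x(j := s))) (at s within S)" if "s \<in> S" for k s
      using pd[OF S[OF that], of k] by (auto simp: has_pderiv_def intro: has_field_derivative_at_within)
    show "uniformly_convergent_on S (\<lambda>m s. \<Sum>k<m. g' k (x(j := s)))"
      by (rule Weierstrass_m_test'[OF _ sm]) (use b(2)[OF S] in simp)
    show "x j \<in> S" "x j \<in> interior S"
      using e by (auto simp: S_def)
    have "\<bar>g k (x(j := x j))\<bar> \<le> C / 2 ^ k" for k
      using b(1)[OF U(2)] by simp
    then show "summable (\<lambda>k. g k (x(j := x j)))"
      by (intro summable_comparison_test'[OF sm]) auto
  qed
  then show ?thesis
    by (simp add: has_pderiv_def)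
qed

lemma continuous_on_suminf:
  fixes g :: "nat \<Rightarrow> (nat \<Rightarrow> real) \<Rightarrow> real"
  assumes "\<And>k. continuous_on U (g k)" "\<And>k y. y \<in> U \<Longrightarrow> \<bar>g k y\<bar> \<le> C / 2 ^ k"
  shows "continuous_on U (\<lambda>y. \<Sum>k. g k y)"
proof -
  have sm: "summable (\<lambda>k. C / 2 ^ k)"
    using summable_mult[OF summable_geometric[of "1/2::real"], of C] by (simp add: power_one_over field_simps)
  have "uniform_limit U (\<lambda>m y. \<Sum>k<m. g k y) (\<lambda>y. \<Sum>k. g k y) sequentially"
    by (rule Weierstrass_m_test[OF _ sm]) (use assms(2) in simp)
  then show ?thesis
    by (rule uniform_limit_theorem[rotated]) (auto intro: continuous_on_sum assms(1) always_eventually)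
qed

text \<open>\<open>flat_op\<close> is the integral operator of the radial equation; a solution with initial value \<open>c\<close>
  is the Neumann series of its iterates on the constant \<open>c\<close>.\<close>

definition flat_rhs :: "nat \<Rightarrow> (nat \<Rightarrow> nat \<Rightarrow> nat \<Rightarrow> (nat \<Rightarrow> real) \<Rightarrow> real) \<Rightarrow> (nat \<Rightarrow> (nat \<Rightarrow> real) \<Rightarrow> real) \<Rightarrow> nat \<Rightarrow> nat \<Rightarrow> (nat \<Rightarrow> real) \<Rightarrow> real"
  where "flat_rhs N A u i a = (\<lambda>x. \<Sum>b<N. A i a b x * u b x)"

definition flat_op :: "nat \<Rightarrow> nat \<Rightarrow> (nat \<Rightarrow> nat \<Rightarrow> nat \<Rightarrow> (nat \<Rightarrow> real) \<Rightarrow> real) \<Rightarrow> (nat \<Rightarrow> (nat \<Rightarrow> real) \<Rightarrow> real) \<Rightarrow> nat \<Rightarrow> (nat \<Rightarrow> real) \<Rightarrow> real"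
  where "flat_op n N A u a = (\<lambda>x. \<Sum>i<n. x i * radial 0 (flat_rhs N A u i a) x)"

text \<open>The system asks that the \<open>i\<close>-th derivative of \<open>u a\<close> be
  \<open>\<Sum>b<N. A i a b * u b\<close>, on a cube around the origin. Here
  \<open>A' j i a b\<close> is the \<open>j\<close>-th derivative of \<open>A i a b\<close>, and
  \<open>flat\<close> says that the mixed second derivatives prescribed by the system agree. By
  \<open>small\<close>, the operator \<open>flat_op\<close> contracts by the factor
  \<open>1 / 4\<close>; the margin below \<open>1 / 2\<close> is spent on the differentiated
  series.\<close>

locale flat_system =
  fixes n N :: nat and A A' and r K :: real and Q
  assumes r: "r > 0" and Q_def: "Q = ebox n (\<lambda>_. 0) r"
    and A_cont: "\<And>i a b. i < n \<Longrightarrow> a < N \<Longrightarrow> b < N \<Longrightarrow> continuous_on Q (A i a b)"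
    and A_pd: "\<And>i j a b x. i < n \<Longrightarrow> j < n \<Longrightarrow> a < N \<Longrightarrow> b < N \<Longrightarrow> x \<in> Q \<Longrightarrow> has_pderiv j (A i a b) x (A' j i a b x)"
    and A'_cont: "\<And>i j a b. i < n \<Longrightarrow> j < n \<Longrightarrow> a < N \<Longrightarrow> b < N \<Longrightarrow> continuous_on Q (A' j i a b)"
    and A_bound: "\<And>i a b x. i < n \<Longrightarrow> a < N \<Longrightarrow> b < N \<Longrightarrow> x \<in> Q \<Longrightarrow> \<bar>A i a b x\<bar> \<le> K"
    and A'_bound: "\<And>i j a b x. i < n \<Longrightarrow> j < n \<Longrightarrow> a < N \<Longrightarrow> b < N \<Longrightarrow> x \<in> Q \<Longrightarrow> \<bar>A' j i a b x\<bar> \<le> K"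
    and K: "K \<ge> 0"
    and small: "r * n * N * K \<le> 1 / 4"
    and flat: "\<And>i j a b x. i < n \<Longrightarrow> j < n \<Longrightarrow> a < N \<Longrightarrow> b < N \<Longrightarrow> x \<in> Q \<Longrightarrow>
      A' j i a b x + (\<Sum>c<N. A i a c x * A j c b x) = A' i j a b x + (\<Sum>c<N. A j a c x * A i c b x)"
begin

lemma Q: "star_shaped Q" "eopen n Q"
  by (simp_all add: Q_def star_shaped_ebox eopen_ebox)

lemma Q_coord: "x \<in> Q \<Longrightarrow> i < n \<Longrightarrow> \<bar>x i\<bar> \<le> r"
  by (auto simp: Q_def ebox_def intro: less_imp_le)

lemma rhs_cont:
  "(\<And>b. b < N \<Longrightarrow> continuous_on Q (u b)) \<Longrightarrow> i < n \<Longrightarrow> a < N \<Longrightarrow> continuous_on Q (flat_rhs N A u i a)"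
  unfolding flat_rhs_def by (intro continuous_on_sum continuous_on_mult A_cont) auto

lemma rhs_bound:
  assumes "i < n" "a < N" "x \<in> Q" "\<And>b. b < N \<Longrightarrow> \<bar>u b x\<bar> \<le> B"
  shows "\<bar>flat_rhs N A u i a x\<bar> \<le> N * K * B"
proof -
  have "\<bar>flat_rhs N A u i a x\<bar> \<le> (\<Sum>b<N. \<bar>A i a b x * u b x\<bar>)"
    unfolding flat_rhs_def by (rule sum_abs)
  also have "\<dots> \<le> (\<Sum>b<N. K * B)"
    unfolding abs_mult using assms A_bound[OF assms(1,2)] K by (intro sum_mono mult_mono) auto
  finally show ?thesis
    by simp
qed

lemma op_cont: "(\<And>b. b < N \<Longrightarrow> continuous_on Q (u b)) \<Longrightarrow> a < N \<Longrightarrow> continuous_on Q (flat_op n N A u a)"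
  unfolding flat_op_def
  by (intro continuous_on_sum continuous_on_mult continuous_on_coord continuous_on_radial[OF Q(1)] rhs_cont) auto

text \<open>The factor \<open>x i\<close> makes an integral operator with kernel bounded by \<open>K\<close> small on a small box.\<close>

lemma small_sum:
  assumes x: "x \<in> Q" and h: "\<And>i. i < n \<Longrightarrow> \<bar>h i\<bar> \<le> N * K * B" and B: "B \<ge> 0"
  shows "\<bar>\<Sum>i<n. x i * h i\<bar> \<le> B / 4"
proof -
  have "\<bar>\<Sum>i<n. x i * h i\<bar> \<le> (\<Sum>i<n. \<bar>x i * h i\<bar>)"
    by (rule sum_abs)
  also have "\<dots> \<le> (\<Sum>i<n. r * (N * K * B))"
    unfolding abs_mult using Q_coord[OF x] h r by (intro sum_mono mult_mono) auto
  also have "\<dots> = (r * n * N * K) * B"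
    by simp
  also have "\<dots> \<le> (1 / 4) * B"
    using small B by (rule mult_right_mono)
  finally show ?thesis
    by simp
qed

text \<open>The value of the operator at \<open>x\<close> involves only the ray from the origin to
  \<open>x\<close>, so a bound on that ray is enough. This is the form that
  \<open>ray_vanish\<close> consumes.\<close>

lemma op_bound:
  assumes u: "\<And>b. b < N \<Longrightarrow> continuous_on Q (u b)" and a: "a < N" and x: "x \<in> Q"
    and B: "\<And>t b. 0 \<le> t \<Longrightarrow> t \<le> 1 \<Longrightarrow> b < N \<Longrightarrow> \<bar>u b (\<lambda>i. t * x i)\<bar> \<le> B"
  shows "\<bar>flat_op n N A u a x\<bar> \<le> B / 4"
  unfolding flat_op_def
proof (rule small_sum[OF x])
  show "B \<ge> 0"
    using B[of 1 a] a by simp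
  show "\<bar>radial 0 (flat_rhs N A u i a) x\<bar> \<le> N * K * B" if "i < n" for i
    using that a B star_shapedD[OF Q(1) x]
    by (intro radial_bound[OF Q(1) rhs_cont[OF u] x] rhs_bound) auto
qed

lemma op_pderiv:
  assumes u: "\<And>b. b < N \<Longrightarrow> continuous_on Q (u b)" and u': "\<And>b. b < N \<Longrightarrow> continuous_on Q (u' b)"
    and pd: "\<And>b y. b < N \<Longrightarrow> y \<in> Q \<Longrightarrow> has_pderiv j (u b) y (u' b y)"
    and j: "j < n" and a: "a < N" and x: "x \<in> Q"
  shows "has_pderiv j (flat_op n N A u a) x (radial 0 (flat_rhs N A u j a) x +
    (\<Sum>i<n. x i * radial 1 (\<lambda>y. \<Sum>b<N. A' j i a b y * u b y + A i a b y * u' b y) x))"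
proof -
  let ?f' = "\<lambda>i y. \<Sum>b<N. A' j i a b y * u b y + A i a b y * u' b y"
  have f': "continuous_on Q (?f' i)" if "i < n" for i
    by (intro continuous_on_sum continuous_on_add continuous_on_mult A_cont A'_cont u u') (use that j a in auto)
  have f: "has_pderiv j (flat_rhs N A u i a) y (?f' i y)" if "i < n" "y \<in> Q" for i y
    unfolding flat_rhs_def by (intro has_pderiv_sum has_pderiv_mult A_pd pd) (use that j a in auto)
  have "has_pderiv j (\<lambda>x. x i * radial 0 (flat_rhs N A u i a) x) x
      ((if j = i then 1 else 0) * radial 0 (flat_rhs N A u i a) x + x i * radial (Suc 0) (?f' i) x)" if "i < n" for i
    by (rule has_pderiv_mult[OF has_pderiv_coord has_pderiv_radial[OF Q x j rhs_cont[OF u that a] f'[OF that] f[OF that]]])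
  then have "has_pderiv j (flat_op n N A u a) x
      (\<Sum>i<n. (if j = i then 1 else 0) * radial 0 (flat_rhs N A u i a) x + x i * radial (Suc 0) (?f' i) x)"
    unfolding flat_op_def by (intro has_pderiv_sum) auto
  moreover have "(\<Sum>i<n. (if j = i then 1 else 0) * radial 0 (flat_rhs N A u i a) x) = radial 0 (flat_rhs N A u j a) x"
    using j by (simp add: if_distrib[of "\<lambda>c. c * _"] sum.delta' cong: if_cong)
  ultimately show ?thesis
    by (simp add: sum.distrib)
qed

text \<open>If the partial derivatives of \<open>c + flat_op u = u\<close> exist, the defect \<open>e\<^sub>j = \<partial>\<^sub>j u - A\<^sub>j u\<close> satisfies, by
  flatness, the homogeneous radial equation \<open>e\<^sub>j(x) = \<Sum>\<^sub>i x\<^sub>i \<integral> s A\<^sub>i e\<^sub>j (s x) ds\<close>, so it vanishes.\<close>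

lemma fixpoint_solves:
  assumes u: "\<And>b. b < N \<Longrightarrow> continuous_on Q (u b)" and u': "\<And>j b. j < n \<Longrightarrow> b < N \<Longrightarrow> continuous_on Q (u' j b)"
    and pd: "\<And>j b y. j < n \<Longrightarrow> b < N \<Longrightarrow> y \<in> Q \<Longrightarrow> has_pderiv j (u b) y (u' j b y)"
    and fp: "\<And>b y. b < N \<Longrightarrow> y \<in> Q \<Longrightarrow> u b y = c b + flat_op n N A u b y"
    and j: "j < n" and a: "a < N" and x: "x \<in> Q"
  shows "has_pderiv j (u a) x (flat_rhs N A u j a x)"
proof -
  define w where "w j b y = u' j b y - flat_rhs N A u j b y" for j b y
  \<comment> \<open>Up to notation this is the \<open>j\<close>-th derivative of
    \<open>A i u\<close> minus the \<open>i\<close>-th derivative of \<open>A j u\<close>. It is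
    antisymmetric in \<open>i\<close> and \<open>j\<close>.\<close>
  define h where "h i j b z = (\<Sum>d<N. A' j i b d z * u d z + A i b d z * u' j d z) -
    (\<Sum>d<N. A' i j b d z * u d z + A j b d z * u' i d z)" for i j b z
  have w_cont: "continuous_on Q (w j b)" if "j < n" "b < N" for j b
    unfolding w_def by (intro continuous_on_diff u' rhs_cont u that)
  have Au_cont: "continuous_on Q (\<lambda>y. \<Sum>d<N. A' i j b d y * u d y + A j b d y * u' i d y)"
    if "i < n" "j < n" "b < N" for i j b
    by (intro continuous_on_sum continuous_on_add continuous_on_mult A_cont A'_cont u u') (use that in auto)
  have h_cont: "continuous_on Q (h i j b)" if "i < n" "j < n" "b < N" for i j b
    unfolding h_def by (intro continuous_on_diff Au_cont that)
  \<comment> \<open>Differentiating the fixed-point equation yields a formula for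
    \<open>u' j\<close>, and integrating by parts along the ray yields one for
    \<open>flat_rhs\<close>. They share the term \<open>radial 0\<close>, which cancels in the
    difference \<open>w j\<close>.\<close>
  have w_eq: "w j b y = (\<Sum>i<n. y i * radial 1 (h i j b) y)" if j: "j < n" and b: "b < N" and y: "y \<in> Q" for j b y
  proof -
    have "has_pderiv j (u b) y (0 + (radial 0 (flat_rhs N A u j b) y +
        (\<Sum>i<n. y i * radial 1 (\<lambda>z. \<Sum>d<N. A' j i b d z * u d z + A i b d z * u' j d z) y)))"
    proof (rule has_pderiv_cong[OF Q(2) y j, where f = "\<lambda>y. c b + flat_op n N A u b y"])
      show "has_pderiv j (\<lambda>y. c b + flat_op n N A u b y) y (0 + (radial 0 (flat_rhs N A u j b) y +
        (\<Sum>i<n. y i * radial 1 (\<lambda>z. \<Sum>d<N. A' j i b d z * u d z + A i b d z * u' j d z) y)))"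
        by (rule has_pderiv_add[OF has_pderiv_const op_pderiv[OF u u'[OF j] pd[OF j] j b y]])
    qed (use fp[OF b] in simp)
    then have 1: "u' j b y = radial 0 (flat_rhs N A u j b) y +
        (\<Sum>i<n. y i * radial 1 (\<lambda>z. \<Sum>d<N. A' j i b d z * u d z + A i b d z * u' j d z) y)"
      using has_pderiv_unique[OF pd[OF j b y]] by simp
    have 2: "flat_rhs N A u j b y = radial 0 (flat_rhs N A u j b) y +
        (\<Sum>i<n. y i * radial 1 (\<lambda>z. \<Sum>d<N. A' i j b d z * u d z + A j b d z * u' i d z) y)"
    proof (rule radial_ibp[OF Q y rhs_cont[OF u j b]])
      show "has_pderiv i (flat_rhs N A u j b) z (\<Sum>d<N. A' i j b d z * u d z + A j b d z * u' i d z)"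
        if "i < n" "z \<in> Q" for i z
        unfolding flat_rhs_def by (intro has_pderiv_sum has_pderiv_mult A_pd pd) (use that j b in auto)
    qed (use Au_cont j b in auto)
    have 3: "radial 1 (h i j b) y = radial 1 (\<lambda>z. \<Sum>d<N. A' j i b d z * u d z + A i b d z * u' j d z) y -
        radial 1 (\<lambda>z. \<Sum>d<N. A' i j b d z * u d z + A j b d z * u' i d z) y" if "i < n" for i
      unfolding h_def by (rule radial_diff[OF Q(1) Au_cont Au_cont y]) (use that j b in auto)
    show ?thesis
      unfolding w_def 1 2 using 3 by (simp add: right_diff_distrib sum_subtractf)
  qed
  \<comment> \<open>The defect has no radial component: its pairing with \<open>y\<close> is a
    double sum over the antisymmetric \<open>h\<close>, equal to its own negative.\<close>
  have euler: "(\<Sum>j<n. y j * w j b y) = 0" if b: "b < N" and y: "y \<in> Q" for b y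
  proof -
    have anti: "radial 1 (h j i b) y = - radial 1 (h i j b) y" if "i < n" "j < n" for i j
    proof -
      have "radial 1 (h j i b) y = radial 1 (\<lambda>z. 0 - h i j b z) y"
        by (rule radial_cong[OF Q(1) y]) (simp add: h_def)
      also have "\<dots> = radial 1 (\<lambda>z. 0) y - radial 1 (h i j b) y"
        by (rule radial_diff[OF Q(1) _ h_cont y]) (use that b in auto)
      finally show ?thesis
        by (simp add: radial_def)
    qed
    define S where "S = (\<Sum>j<n. \<Sum>i<n. y j * (y i * radial 1 (h i j b) y))"
    have "S = (\<Sum>i<n. \<Sum>j<n. y j * (y i * radial 1 (h i j b) y))"
      unfolding S_def by (rule sum.swap)
    also have "\<dots> = (\<Sum>i<n. \<Sum>j<n. - (y i * (y j * radial 1 (h j i b) y)))"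
    proof (intro sum.cong refl)
      fix i j assume "i \<in> {..<n}" "j \<in> {..<n}"
      then show "y j * (y i * radial 1 (h i j b) y) = - (y i * (y j * radial 1 (h j i b) y))"
        using anti[of i j] by simp
    qed
    also have "\<dots> = - S"
      by (simp add: S_def sum_negf)
    finally have "S = 0"
      by simp
    moreover have "(\<Sum>j<n. y j * w j b y) = S"
      using w_eq[OF _ b y] by (simp add: S_def sum_distrib_left)
    ultimately show ?thesis
      by simp
  qed
  \<comment> \<open>Replacing the derivatives \<open>u'\<close> by \<open>flat_rhs\<close> plus
    defect, flatness cancels everything except the terms containing the defect.\<close>
  have h_eq: "h i j b z = flat_rhs N A (w j) i b z - (\<Sum>d<N. A j b d z * w i d z)"
    if i: "i < n" and j: "j < n" and b: "b < N" and z: "z \<in> Q" for i j b z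
  proof -
    have AA: "(\<Sum>d<N. A i b d z * flat_rhs N A u j d z) = (\<Sum>c<N. (\<Sum>d<N. A i b d z * A j d c z) * u c z)" for i j
      unfolding flat_rhs_def sum_distrib_left sum_distrib_right by (subst sum.swap) (simp add: mult.assoc)
    have "(\<Sum>c<N. (A' j i b c z + (\<Sum>d<N. A i b d z * A j d c z)) * u c z) =
        (\<Sum>c<N. (A' i j b c z + (\<Sum>d<N. A j b d z * A i d c z)) * u c z)"
      using flat[OF i j b _ z] by simp
    then have "(\<Sum>c<N. A' j i b c z * u c z) + (\<Sum>d<N. A i b d z * flat_rhs N A u j d z) =
        (\<Sum>c<N. A' i j b c z * u c z) + (\<Sum>d<N. A j b d z * flat_rhs N A u i d z)"
      unfolding AA by (simp add: distrib_right sum.distrib)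
    then show ?thesis
      unfolding h_def w_def flat_rhs_def[of N A "\<lambda>b y. u' j b y - flat_rhs N A u j b y"]
      by (simp add: sum.distrib right_diff_distrib sum_subtractf)
  qed
  have "w j a x = 0"
  proof (rule ray_vanish[OF Q(1) w_cont[OF j] _ x a])
    fix y B b
    assume y: "y \<in> Q" and b: "b < N" and B: "\<And>t b. 0 \<le> t \<Longrightarrow> t \<le> 1 \<Longrightarrow> b < N \<Longrightarrow> \<bar>w j b (\<lambda>i. t * y i)\<bar> \<le> B"
    have c1: "continuous_on Q (flat_rhs N A (w j) i b)" if "i < n" for i
      by (rule rhs_cont[OF w_cont[OF j] that b])
    have c2: "continuous_on Q (\<lambda>z. \<Sum>d<N. A j b d z * w i d z)" if "i < n" for i
      by (intro continuous_on_sum continuous_on_mult A_cont w_cont) (use that j b in auto)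
    have "w j b y = (\<Sum>i<n. y i * radial 1 (flat_rhs N A (w j) i b) y) -
        (\<Sum>i<n. y i * radial 1 (\<lambda>z. \<Sum>d<N. A j b d z * w i d z) y)"
    proof -
      have "radial 1 (h i j b) y = radial 1 (flat_rhs N A (w j) i b) y - radial 1 (\<lambda>z. \<Sum>d<N. A j b d z * w i d z) y"
        if "i < n" for i
        using radial_cong[OF Q(1) y h_eq[OF that j b]] radial_diff[OF Q(1) c1[OF that] c2[OF that] y] by simp
      then show ?thesis
        unfolding w_eq[OF j b y] by (simp add: right_diff_distrib sum_subtractf)
    qed
    \<comment> \<open>Interchanging the sums, the integrand is \<open>A j\<close> applied to the
      radial component of the defect along the ray, which vanishes by \<open>euler\<close>.\<close>
    also have "(\<Sum>i<n. y i * radial 1 (\<lambda>z. \<Sum>d<N. A j b d z * w i d z) y) = 0"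
    proof -
      have "(\<Sum>i<n. y i * (t ^ 1 * (\<Sum>d<N. A j b d (\<lambda>k. t * y k) * w i d (\<lambda>k. t * y k)))) = 0"
        if t: "t \<in> {0..1}" for t
      proof -
        have "(\<Sum>i<n. y i * (t ^ 1 * (\<Sum>d<N. A j b d (\<lambda>k. t * y k) * w i d (\<lambda>k. t * y k)))) =
            (\<Sum>d<N. A j b d (\<lambda>k. t * y k) * (\<Sum>i<n. (t * y i) * w i d (\<lambda>k. t * y k)))"
          unfolding sum_distrib_left by (subst sum.swap) (simp add: mult_ac)
        also have "\<dots> = 0"
          using euler[OF _ star_shapedD[OF Q(1) y, of t]] t by simp
        finally show ?thesis .
      qed
      then have "integral {0..1} (\<lambda>t. \<Sum>i<n. y i * (t ^ 1 * (\<Sum>d<N. A j b d (\<lambda>k. t * y k) * w i d (\<lambda>k. t * y k)))) =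
          integral {0..1} (\<lambda>t :: real. 0 :: real)"
        by (rule Henstock_Kurzweil_Integration.integral_cong)
      then show ?thesis
        using radial_sum_coord[OF Q(1) c2 y, where n = n and p = 1] by simp
    qed
    finally have eq: "w j b y = (\<Sum>i<n. y i * radial 1 (flat_rhs N A (w j) i b) y)"
      by simp
    have B0: "B \<ge> 0"
      using B[of 1 b] b by simp
    have "\<bar>w j b y\<bar> \<le> B / 4"
      unfolding eq
    proof (rule small_sum[OF y _ B0])
      show "\<bar>radial 1 (flat_rhs N A (w j) i b) y\<bar> \<le> N * K * B" if "i < n" for i
        using that b B star_shapedD[OF Q(1) y]
        by (intro radial_bound[OF Q(1) c1[OF that] y] rhs_bound) auto
    qed
    then show "\<bar>w j b y\<bar> \<le> B / 2"
      using B0 by linarith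
  qed
  then show ?thesis
    using pd[OF j a x] by (simp add: w_def)
qed

lemma op_add:
  assumes "\<And>b. b < N \<Longrightarrow> continuous_on Q (f b)" "\<And>b. b < N \<Longrightarrow> continuous_on Q (g b)" "a < N" "x \<in> Q"
  shows "flat_op n N A (\<lambda>b y. f b y + g b y) a x = flat_op n N A f a x + flat_op n N A g a x"
proof -
  have "radial 0 (flat_rhs N A (\<lambda>b y. f b y + g b y) i a) x = radial 0 (flat_rhs N A f i a) x + radial 0 (flat_rhs N A g i a) x"
    if i: "i < n" for i
  proof -
    have "flat_rhs N A (\<lambda>b y. f b y + g b y) i a = (\<lambda>y. flat_rhs N A f i a y + flat_rhs N A g i a y)"
      by (simp add: flat_rhs_def distrib_left sum.distrib)
    then show ?thesis
      using integral_add[OF radial_integrable[OF Q(1) rhs_cont[OF assms(1) i assms(3)] assms(4), where p = 0]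
          radial_integrable[OF Q(1) rhs_cont[OF assms(2) i assms(3)] assms(4), where p = 0]]
      by (simp add: radial_def)
  qed
  then show ?thesis
    by (simp add: flat_op_def distrib_left sum.distrib)
qed

text \<open>Integrated along rays, a solution that vanishes at the origin is a fixed point of the
  contracting operator \<open>flat_op\<close>.\<close>

lemma solution_unique:
  assumes cont: "\<And>b. b < N \<Longrightarrow> continuous_on Q (v b)"
    and pd: "\<And>j b y. j < n \<Longrightarrow> b < N \<Longrightarrow> y \<in> Q \<Longrightarrow> has_pderiv j (v b) y (flat_rhs N A v j b y)"
    and 0: "\<And>b. b < N \<Longrightarrow> v b (\<lambda>_. 0) = 0" and a: "a < N" and x: "x \<in> Q"
  shows "v a x = 0"
proof (rule ray_vanish[OF Q(1) cont _ x a])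
  fix y B b
  assume y: "y \<in> Q" and b: "b < N" and B: "\<And>t b. 0 \<le> t \<Longrightarrow> t \<le> 1 \<Longrightarrow> b < N \<Longrightarrow> \<bar>v b (\<lambda>i. t * y i)\<bar> \<le> B"
  have "v b y = flat_op n N A v b y"
    using hadamard[OF Q y pd[OF _ b] rhs_cont[OF cont _ b]] 0[OF b] by (simp add: flat_op_def)
  moreover have "\<bar>flat_op n N A v b y\<bar> \<le> B / 4"
    by (rule op_bound[OF cont b y B])
  moreover have "B \<ge> 0"
    using B[of 1 b] b by simp
  ultimately show "\<bar>v b y\<bar> \<le> B / 2"
    by linarith
qed

context
  fixes c :: "nat \<Rightarrow> real"
begin

primrec iter :: "nat \<Rightarrow> nat \<Rightarrow> (nat \<Rightarrow> real) \<Rightarrow> real"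
  where "iter 0 = (\<lambda>a x. c a)"
  | "iter (Suc k) = flat_op n N A (iter k)"

text \<open>The partial derivatives of the iterates, obtained by feeding the derivative of the
  previous iterate into the formula of \<open>op_pderiv\<close>.\<close>

primrec diter :: "nat \<Rightarrow> nat \<Rightarrow> nat \<Rightarrow> (nat \<Rightarrow> real) \<Rightarrow> real"
  where "diter j 0 = (\<lambda>a x. 0)"
  | "diter j (Suc k) = (\<lambda>a x. radial 0 (flat_rhs N A (iter k) j a) x +
      (\<Sum>i<n. x i * radial 1 (\<lambda>y. \<Sum>b<N. A' j i a b y * iter k b y + A i a b y * diter j k b y) x))"

lemma iter_cont: "a < N \<Longrightarrow> continuous_on Q (iter k a)"
proof (induction k arbitrary: a)
  case (Suc k)
  then show ?case
    unfolding iter.simps by (intro op_cont)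
qed simp

lemma diter_integrand_cont:
  assumes "\<And>b. b < N \<Longrightarrow> continuous_on Q (diter j k b)" "i < n" "j < n" "a < N"
  shows "continuous_on Q (\<lambda>y. \<Sum>b<N. A' j i a b y * iter k b y + A i a b y * diter j k b y)"
  by (intro continuous_on_sum continuous_on_add continuous_on_mult A_cont A'_cont iter_cont assms) (use assms in auto)

lemma diter_cont: "j < n \<Longrightarrow> a < N \<Longrightarrow> continuous_on Q (diter j k a)"
proof (induction k arbitrary: a)
  case (Suc k)
  have "continuous_on Q (radial 0 (flat_rhs N A (iter k) j a))"
    by (intro continuous_on_radial[OF Q(1)] rhs_cont iter_cont Suc.prems)
  moreover have "continuous_on Q (radial 1 (\<lambda>y. \<Sum>b<N. A' j i a b y * iter k b y + A i a b y * diter j k b y))" if "i < n" for i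
    by (intro continuous_on_radial[OF Q(1)] diter_integrand_cont[OF Suc.IH[OF Suc.prems(1)] that Suc.prems])
  ultimately show ?case
    unfolding diter.simps by (intro continuous_on_add continuous_on_sum continuous_on_mult continuous_on_coord) auto
qed simp

lemma iter_pderiv: "j < n \<Longrightarrow> a < N \<Longrightarrow> x \<in> Q \<Longrightarrow> has_pderiv j (iter k a) x (diter j k a x)"
proof (induction k arbitrary: a x)
  case 0
  then show ?case
    by (simp add: has_pderiv_const)
next
  case (Suc k)
  show ?case
    unfolding iter.simps diter.simps
    by (rule op_pderiv[OF iter_cont diter_cont[OF Suc.prems(1)] Suc.IH[OF Suc.prems(1)] Suc.prems])
qed

definition C0 :: real where "C0 = (\<Sum>a<N. \<bar>c a\<bar>)"

text \<open>Chosen so that \<open>N * K * C0 + (C0 + C1) / 4 = C1 / 2\<close>, which closes the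
  induction in \<open>diter_bound\<close>.\<close>

definition C1 :: real where "C1 = 4 * (N * K * C0) + C0"

lemma C0_nonneg: "C0 \<ge> 0"
  by (simp add: C0_def sum_nonneg)

lemma C01: "C0 \<le> C1"
  using C0_nonneg K by (simp add: C1_def)

lemma iter_bound4: "a < N \<Longrightarrow> x \<in> Q \<Longrightarrow> \<bar>iter k a x\<bar> \<le> C0 / 4 ^ k"
proof (induction k arbitrary: a x)
  case 0
  have "\<bar>c a\<bar> \<le> C0"
    unfolding C0_def using 0 by (intro member_le_sum) auto
  then show ?case
    by simp
next
  case (Suc k)
  have "\<bar>flat_op n N A (iter k) a x\<bar> \<le> (C0 / 4 ^ k) / 4"
    using Suc star_shapedD[OF Q(1) Suc.prems(2)] by (intro op_bound iter_cont) auto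
  then show ?case
    by simp
qed

lemma four_two: "C0 / 4 ^ k \<le> C0 / 2 ^ k"
  using C0_nonneg power_mono[of "2::real" 4 k] by (intro divide_left_mono) auto

lemma iter_bound: "a < N \<Longrightarrow> x \<in> Q \<Longrightarrow> \<bar>iter k a x\<bar> \<le> C1 / 2 ^ k"
  using iter_bound4[of a x k] four_two[of k] divide_right_mono[OF C01, of "2 ^ k"] by simp

lemma diter_bound: "j < n \<Longrightarrow> a < N \<Longrightarrow> x \<in> Q \<Longrightarrow> \<bar>diter j k a x\<bar> \<le> C1 / 2 ^ k"
proof (induction k arbitrary: a x)
  case 0
  then show ?case
    using C01 C0_nonneg by simp
next
  case (Suc k)
  let ?B = "C0 / 2 ^ k + C1 / 2 ^ k"
  have C1: "C1 \<ge> 0"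
    using C01 C0_nonneg by simp
  have it: "\<bar>iter k b y\<bar> \<le> C0 / 2 ^ k" if "b < N" "y \<in> Q" for b y
    using iter_bound4[OF that, of k] four_two[of k] by simp
  have 1: "\<bar>radial 0 (flat_rhs N A (iter k) j a) x\<bar> \<le> N * K * (C0 / 2 ^ k)"
    using it star_shapedD[OF Q(1) Suc.prems(3)] Suc.prems
    by (intro radial_bound[OF Q(1) rhs_cont[OF iter_cont]] rhs_bound) auto
  have 2: "\<bar>\<Sum>i<n. x i * radial 1 (\<lambda>y. \<Sum>b<N. A' j i a b y * iter k b y + A i a b y * diter j k b y) x\<bar> \<le> ?B / 4"
  proof (rule small_sum[OF Suc.prems(3)])
    show "?B \<ge> 0"
      using C1 C0_nonneg by simp
    fix i assume i: "i < n"
    have "\<bar>\<Sum>b<N. A' j i a b y * iter k b y + A i a b y * diter j k b y\<bar> \<le> N * K * ?B" if y: "y \<in> Q" for y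
    proof -
      have "\<bar>A' j i a b y * iter k b y + A i a b y * diter j k b y\<bar> \<le> K * ?B" if b: "b < N" for b
      proof -
        have "\<bar>A' j i a b y * iter k b y\<bar> \<le> K * (C0 / 2 ^ k)"
          unfolding abs_mult using A'_bound[OF i Suc.prems(1,2) b y] it[OF b y] K by (intro mult_mono) auto
        moreover have "\<bar>A i a b y * diter j k b y\<bar> \<le> K * (C1 / 2 ^ k)"
          unfolding abs_mult using A_bound[OF i Suc.prems(2) b y] Suc.IH[OF Suc.prems(1) b y] K by (intro mult_mono) auto
        ultimately show ?thesis
          by (simp add: distrib_left)
      qed
      then have "(\<Sum>b<N. \<bar>A' j i a b y * iter k b y + A i a b y * diter j k b y\<bar>) \<le> (\<Sum>b<N. K * ?B)"
        by (intro sum_mono) auto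
      moreover have "(\<Sum>b<N. K * ?B) = N * K * ?B"
        by simp
      ultimately show ?thesis
        using sum_abs[of "\<lambda>b. A' j i a b y * iter k b y + A i a b y * diter j k b y" "{..<N}"] by linarith
    qed
    then show "\<bar>radial 1 (\<lambda>y. \<Sum>b<N. A' j i a b y * iter k b y + A i a b y * diter j k b y) x\<bar> \<le> N * K * ?B"
      using star_shapedD[OF Q(1) Suc.prems(3)]
      by (intro radial_bound[OF Q(1) diter_integrand_cont[OF diter_cont[OF Suc.prems(1)] i Suc.prems(1,2)] Suc.prems(3)]) auto
  qed
  have "\<bar>diter j (Suc k) a x\<bar> \<le> N * K * (C0 / 2 ^ k) + ?B / 4"
    unfolding diter.simps using 1 2 by linarith
  also have "\<dots> = C1 / 2 ^ Suc k"
    by (simp add: C1_def field_simps)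
  finally show ?case .
qed

lemma geometric_summable: "summable (\<lambda>k. C1 / 2 ^ k)" "(\<Sum>k. C1 / 2 ^ k) = 2 * C1"
proof -
  have "(\<lambda>k. C1 * (1 / 2) ^ k) sums (C1 * (1 / (1 - 1 / 2)))"
    by (intro sums_mult geometric_sums) simp
  then have "(\<lambda>k. C1 / 2 ^ k) sums (2 * C1)"
    by (simp add: power_one_over field_simps)
  then show "summable (\<lambda>k. C1 / 2 ^ k)" "(\<Sum>k. C1 / 2 ^ k) = 2 * C1"
    by (auto simp: sums_iff)
qed

definition solution :: "nat \<Rightarrow> (nat \<Rightarrow> real) \<Rightarrow> real"
  where "solution a x = (\<Sum>k. iter k a x)"

lemma solution_cont: "a < N \<Longrightarrow> continuous_on Q (solution a)"
  unfolding solution_def using iter_cont iter_bound by (intro continuous_on_suminf) auto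

lemma iter_summable: "a < N \<Longrightarrow> x \<in> Q \<Longrightarrow> summable (\<lambda>k. iter k a x)"
  using iter_bound by (intro summable_comparison_test'[OF geometric_summable(1)]) auto

lemma solution_tail: 
  assumes "a < N" "x \<in> Q"
  shows "\<bar>solution a x - (\<Sum>k<m. iter k a x)\<bar> \<le> 2 * C1 / 2 ^ m"
proof -
  have s: "summable (\<lambda>k. C1 / 2 ^ (k + m))"
    using geometric_summable(1) summable_iff_shift[of "\<lambda>k. C1 / 2 ^ k" m] by simp
  have "solution a x - (\<Sum>k<m. iter k a x) = (\<Sum>k. iter (k + m) a x)"
    using suminf_minus_initial_segment[OF iter_summable[OF assms], of m] by (simp add: solution_def)
  also have "\<bar>\<dots>\<bar> \<le> (\<Sum>k. C1 / 2 ^ (k + m))"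
    using norm_suminf_le[OF _ s, of "\<lambda>k. iter (k + m) a x"] iter_bound[OF assms] by simp
  also have "\<dots> = (\<Sum>k. (1 / 2 ^ m) * (C1 / 2 ^ k))"
    by (simp add: power_add mult.commute)
  also have "\<dots> = (1 / 2 ^ m) * (2 * C1)"
    using suminf_mult[OF geometric_summable(1), of "1 / 2 ^ m"] geometric_summable(2) by simp
  finally show ?thesis
    by simp
qed

text \<open>The operator shifts the partial sums of the series by one index. The tail
  \<open>v (Suc m)\<close> and the image of the tail \<open>v m\<close> are both geometrically
  small, and \<open>m\<close> is arbitrary.\<close>

lemma solution_fixpoint:
  assumes a: "a < N" and x: "x \<in> Q"
  shows "solution a x = c a + flat_op n N A solution a x"
proof -
  define v where "v m a x = solution a x - (\<Sum>k<m. iter k a x)" for m a x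
  have vc: "continuous_on Q (v m b)" if "b < N" for m b
    unfolding v_def by (intro continuous_on_diff solution_cont continuous_on_sum iter_cont that)
  have op: "flat_op n N A solution a x = flat_op n N A (v m) a x + (\<Sum>k<m. iter (Suc k) a x)" for m
  proof (induction m)
    case 0
    show ?case
      by (simp add: v_def[abs_def])
  next
    case (Suc m)
    have "flat_op n N A (v m) a x = flat_op n N A (\<lambda>b y. v (Suc m) b y + iter m b y) a x"
      by (simp add: v_def[abs_def])
    also have "\<dots> = flat_op n N A (v (Suc m)) a x + iter (Suc m) a x"
      using op_add[of "v (Suc m)" "iter m" a x] vc iter_cont a x by simp
    finally show ?case
      using Suc.IH by simp
  qed
  have "\<bar>solution a x - (c a + flat_op n N A solution a x)\<bar> \<le> 3 * C1 / 2 ^ m" for m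
  proof -
    have "(\<Sum>k<Suc m. iter k a x) = c a + (\<Sum>k<m. iter (Suc k) a x)"
      by (simp only: sum.lessThan_Suc_shift) simp
    then have "solution a x - (c a + flat_op n N A solution a x) = v (Suc m) a x - flat_op n N A (v m) a x"
      unfolding op[of m] v_def[of "Suc m"] by simp
    moreover have "\<bar>v (Suc m) a x\<bar> \<le> 2 * C1 / 2 ^ Suc m"
      unfolding v_def by (rule solution_tail[OF a x])
    moreover have "\<bar>flat_op n N A (v m) a x\<bar> \<le> (2 * C1 / 2 ^ m) / 4"
    proof (rule op_bound[OF vc a x])
      show "\<bar>v m b (\<lambda>i. t * x i)\<bar> \<le> 2 * C1 / 2 ^ m" if "0 \<le> t" "t \<le> 1" "b < N" for t b
        unfolding v_def by (rule solution_tail[OF that(3) star_shapedD[OF Q(1) x that(1,2)]])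
    qed
    moreover have "C1 / 2 ^ m \<ge> 0"
      using C01 C0_nonneg by simp
    ultimately show ?thesis
      by simp
  qed
  moreover have "(\<lambda>m. 3 * C1 / 2 ^ m) \<longlonglongrightarrow> 0"
    using tendsto_mult_right_zero[OF LIMSEQ_realpow_zero[of "1/2"], of "3 * C1"] by (simp add: power_one_over field_simps)
  ultimately have "\<bar>solution a x - (c a + flat_op n N A solution a x)\<bar> \<le> 0"
    by (intro LIMSEQ_le_const) auto
  then show ?thesis
    by simp
qed

text \<open>The termwise differentiated series supplies the partial derivatives that
  \<open>fixpoint_solves\<close> presupposes. Flatness enters at that point and identifies them with
  the right-hand sides.\<close>

lemma solution_pderiv:
  assumes "j < n" "a < N" "x \<in> Q"
  shows "has_pderiv j (solution a) x (flat_rhs N A solution j a x)"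
proof (rule fixpoint_solves[OF solution_cont _ _ solution_fixpoint assms])
  show "continuous_on Q (\<lambda>y. \<Sum>k. diter j k b y)" if "j < n" "b < N" for j b
    using diter_cont[OF that] diter_bound[OF that] by (intro continuous_on_suminf) auto
  show "has_pderiv j (solution b) y (\<Sum>k. diter j k b y)" if "j < n" "b < N" "y \<in> Q" for j b y
    unfolding solution_def
    using iter_pderiv[OF that(1,2)] iter_bound[OF that(2)] diter_bound[OF that(1,2)]
    by (intro has_pderiv_suminf[OF Q(2) that(3,1)]) auto
qed

lemma solution_at_0: "a < N \<Longrightarrow> solution a (\<lambda>_. 0) = c a"
proof -
  assume a: "a < N"
  have "(\<lambda>_. 0) \<in> Q"
    using r by (simp add: Q_def ebox_def euc_def)
  from solution_fixpoint[OF a this] show ?thesis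
    by (simp add: flat_op_def)
qed

end

end

lemma locally_bounded_family:
  assumes "finite F" "eopen n U" "x0 \<in> U" "\<And>f. f \<in> F \<Longrightarrow> continuous_on U f"
  shows "\<exists>d>0. \<exists>K\<ge>0. ebox n x0 d \<subseteq> U \<and> (\<forall>f\<in>F. \<forall>y\<in>ebox n x0 d. \<bar>f y\<bar> \<le> (K::real))"
proof -
  obtain d where d: "d > 0" "ebox n x0 d \<subseteq> U" "\<And>f y. f \<in> F \<Longrightarrow> y \<in> ebox n x0 d \<Longrightarrow> \<bar>f y - f x0\<bar> < 1"
    by (rule continuous_on_box_family[OF assms(1,2,4,3) zero_less_one_class.zero_less_one]) blast+
  have "\<bar>f y\<bar> \<le> (\<Sum>f\<in>F. \<bar>f x0\<bar>) + 1" if "f \<in> F" "y \<in> ebox n x0 d" for f y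
    using d(3)[OF that] member_le_sum[OF that(1), of "\<lambda>f. \<bar>f x0\<bar>"] assms(1) by fastforce
  then show ?thesis
    using d(1,2) by (intro exI[of _ d] conjI exI[of _ "(\<Sum>f\<in>F. \<bar>f x0\<bar>) + 1"]) (auto intro!: add_nonneg_nonneg sum_nonneg)
qed

text \<open>The bound \<open>K\<close> is fixed on one cube; shrinking the radius further then makes
  the product in \<open>small\<close> as small as desired. All radii up to \<open>r0\<close> are
  offered with the same \<open>K\<close>, because uniqueness is later applied on arbitrarily small
  cubes.\<close>

lemma flat_system_small:
  fixes A :: "nat \<Rightarrow> nat \<Rightarrow> nat \<Rightarrow> (nat \<Rightarrow> real) \<Rightarrow> real"
  assumes R: "R > 0"
    and A: "\<And>i a b. i < n \<Longrightarrow> a < N \<Longrightarrow> b < N \<Longrightarrow> smooth_on n (ebox n (\<lambda>_. 0) R) (A i a b)"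
    and flat: "\<And>i j a b x. i < n \<Longrightarrow> j < n \<Longrightarrow> a < N \<Longrightarrow> b < N \<Longrightarrow> x \<in> ebox n (\<lambda>_. 0) R \<Longrightarrow>
      pderiv_at j (A i a b) x + (\<Sum>c<N. A i a c x * A j c b x) = pderiv_at i (A j a b) x + (\<Sum>c<N. A j a c x * A i c b x)"
  obtains r0 K where "r0 > 0" "r0 \<le> R"
    "\<And>r. 0 < r \<Longrightarrow> r \<le> r0 \<Longrightarrow> flat_system n N A (\<lambda>j i a b. pderiv_at j (A i a b)) r K (ebox n (\<lambda>_. 0) r)"
proof -
  let ?B = "ebox n (\<lambda>_. 0)"
  define F where "F = (\<lambda>(i, a, b). A i a b) ` ({..<n} \<times> {..<N} \<times> {..<N}) \<union>
    (\<lambda>(j, i, a, b). pderiv_at j (A i a b)) ` ({..<n} \<times> {..<n} \<times> {..<N} \<times> {..<N})"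
  have finF: "finite F"
    by (simp add: F_def)
  have z: "(\<lambda>_. 0) \<in> ?B R"
    using R by (simp add: ebox_def euc_def)
  have cont: "continuous_on (?B R) f" if "f \<in> F" for f
    using that smooth_on_continuous[OF eopen_ebox A] smooth_on_continuous[OF eopen_ebox smooth_on_pderiv_at[OF eopen_ebox A]]
    by (auto simp: F_def)
  obtain d K where dK: "d > 0" "K \<ge> 0" "?B d \<subseteq> ?B R" "\<forall>f\<in>F. \<forall>y\<in>?B d. \<bar>f y\<bar> \<le> K"
    using locally_bounded_family[OF finF eopen_ebox z cont] by blast
  define m where "m = real n * N * K"
  have m: "m \<ge> 0"
    using dK by (simp add: m_def)
  \<comment> \<open>The third term gives \<open>r * m \<le> 1 / 4\<close>; writing
    \<open>m + 1\<close> keeps the denominator nonzero when \<open>m = 0\<close>.\<close>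
  define r0 where "r0 = Min {R, d, 1 / (4 * (m + 1))}"
  have r0: "r0 > 0" "r0 \<le> R" "r0 \<le> d" "r0 \<le> 1 / (4 * (m + 1))"
    using R dK m by (auto simp: r0_def)
  have "flat_system n N A (\<lambda>j i a b. pderiv_at j (A i a b)) r K (?B r)" if r: "0 < r" "r \<le> r0" for r
  proof
    have sub: "?B r \<subseteq> ?B R" "?B r \<subseteq> ?B d"
      using r r0 by (auto intro!: ebox_mono)
    show "continuous_on (?B r) (A i a b)" if "i < n" "a < N" "b < N" for i a b
      by (rule continuous_on_subset[OF smooth_on_continuous[OF eopen_ebox A[OF that]] sub(1)])
    show "has_pderiv j (A i a b) x (pderiv_at j (A i a b) x)" if "i < n" "j < n" "a < N" "b < N" "x \<in> ?B r" for i j a b x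
      by (rule smooth_on_has_pderiv[OF eopen_ebox A]) (use that sub in auto)
    show "continuous_on (?B r) (pderiv_at j (A i a b))" if "i < n" "j < n" "a < N" "b < N" for i j a b
      by (rule continuous_on_subset[OF smooth_on_continuous[OF eopen_ebox smooth_on_pderiv_at[OF eopen_ebox A]] sub(1)]) (use that in auto)
    show "\<bar>A i a b x\<bar> \<le> K" if "i < n" "a < N" "b < N" "x \<in> ?B r" for i a b x
    proof -
      have "A i a b \<in> F"
        unfolding F_def using that by (intro UnI1 image_eqI[of _ _ "(i, a, b)"]) auto
      then show ?thesis
        using dK(4) sub(2) that by blast
    qed
    show "\<bar>pderiv_at j (A i a b) x\<bar> \<le> K" if "i < n" "j < n" "a < N" "b < N" "x \<in> ?B r" for i j a b x
    proof -
      have "pderiv_at j (A i a b) \<in> F"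
        unfolding F_def using that by (intro UnI2 image_eqI[of _ _ "(j, i, a, b)"]) auto
      then show ?thesis
        using dK(4) sub(2) that by blast
    qed
    have "r * m \<le> 1 / (4 * (m + 1)) * (m + 1)"
      using r r0 m by (intro mult_mono) auto
    also have "\<dots> = 1 / 4"
      using m by (simp add: field_simps)
    finally show "r * n * N * K \<le> 1 / 4"
      by (simp add: m_def mult_ac)
    show "pderiv_at j (A i a b) x + (\<Sum>c<N. A i a c x * A j c b x) = pderiv_at i (A j a b) x + (\<Sum>c<N. A j a c x * A i c b x)"
      if "i < n" "j < n" "a < N" "b < N" "x \<in> ?B r" for i j a b x
      using flat that sub by blast
  qed (use r dK in auto)
  then show ?thesis
    using that r0 by blast
qed

section \<open>Affine coordinates\<close>

lemma has_pderiv_shift: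
  "has_pderiv i f (\<lambda>j. x j + c j) D \<Longrightarrow> has_pderiv i (\<lambda>y. f (\<lambda>j. y j + c j)) x D"
proof -
  assume "has_pderiv i f (\<lambda>j. x j + c j) D"
  then have "((\<lambda>t. f ((\<lambda>j. x j + c j)(i := t))) has_real_derivative D) (at (x i + c i))"
    by (simp add: has_pderiv_def)
  moreover have "((\<lambda>t. t + c i) has_real_derivative 1) (at (x i))"
    by (auto intro!: derivative_eq_intros)
  ultimately have "((\<lambda>t. f ((\<lambda>j. x j + c j)(i := t + c i))) has_real_derivative D * 1) (at (x i))"
    by (rule DERIV_chain2)
  moreover have "(\<lambda>j. x j + c j)(i := t + c i) = (\<lambda>j. (x(i := t)) j + c j)" for t
    by auto
  ultimately show ?thesis
    by (simp add: has_pderiv_def)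
qed

lemma smooth_on_shift:
  assumes "eopen n U" "smooth_on n U f" "eopen n V" "\<And>x. x \<in> V \<Longrightarrow> (\<lambda>j. x j + c j) \<in> U"
  shows "smooth_on n V (\<lambda>x. f (\<lambda>j. x j + c j))"
  by (rule smooth_on_compose[OF assms(1,3,4,2)])
    (assumption, rule smooth_on_add[OF assms(3) smooth_on_coord[OF assms(3)] smooth_on_const[OF assms(3)]])

lemma ebox_shift: "x0 \<in> euc n \<Longrightarrow> x \<in> ebox n (\<lambda>_. 0) e \<longleftrightarrow> (\<lambda>j. x j + x0 j) \<in> ebox n x0 e"
  by (auto simp: ebox_def euc_def)

lemma ebox_shift': "x0 \<in> euc n \<Longrightarrow> (\<lambda>j. x j - x0 j) \<in> ebox n (\<lambda>_. 0) e \<longleftrightarrow> x \<in> ebox n x0 e"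
  by (auto simp: ebox_def euc_def)

text \<open>Summing the \<open>n\<close> inequalities bounds the sum of the
  \<open>\<bar>b i\<bar>\<close> by half of itself. This expresses the invertibility of a matrix
  whose entries are close to those of the identity.\<close>

lemma diagonally_small_zero:
  fixes b :: "nat \<Rightarrow> real"
  assumes "\<And>i. i < n \<Longrightarrow> \<bar>b i\<bar> \<le> (\<Sum>j<n. \<bar>b j\<bar>) / (2 * (real n + 1))" and "i < n"
  shows "b i = 0"
proof -
  let ?s = "\<Sum>j<n. \<bar>b j\<bar>"
  have "?s \<le> (\<Sum>i<n. ?s / (2 * (real n + 1)))"
    using assms(1) by (intro sum_mono) auto
  also have "\<dots> = ?s / 2 * (real n / (real n + 1))"
    by simp
  also have "\<dots> \<le> ?s / 2 * 1"
    by (intro mult_left_mono) (auto simp: field_simps intro: sum_nonneg)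
  finally have "?s \<le> 0"
    by simp
  moreover have "\<bar>b i\<bar> \<le> ?s"
    using assms(2) by (intro member_le_sum) auto
  ultimately show ?thesis
    by simp
qed

lemma chart_box:
  assumes M: "smooth_manifold M" and c: "(U, \<phi>) \<in> matlas M" and V: "mopen M V" "p \<in> V" "p \<in> U"
  obtains r where "r > 0" "ebox (mdim M) (\<phi> p) r \<subseteq> \<phi> ` (U \<inter> V)"
  using chart_image_open[OF M c V(1)] V(2,3) unfolding eopen_iff by blast

locale affine_setup =
  fixes M :: "'a mfd" and D U \<phi> W \<xi> E p R
  assumes M: "smooth_manifold M" and flat: "flat_affine M D" and fr: "frame M U \<phi> W \<xi> E" and p: "p \<in> W"
    and R: "R > 0" "ebox (mdim M) (\<phi> p) R \<subseteq> \<phi> ` W"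
begin

abbreviation "n \<equiv> mdim M"

abbreviation "bx r \<equiv> ebox n (\<lambda>_. 0) r"

text \<open>Together with \<open>co\<close>, coordinates centred at \<open>p\<close>, so that the
  systems live on cubes around the origin.\<close>

definition pt :: "(nat \<Rightarrow> real) \<Rightarrow> 'a"
  where "pt x = inv_into U \<phi> (\<lambda>j. x j + \<phi> p j)"

definition co :: "'a \<Rightarrow> nat \<Rightarrow> real"
  where "co q = (\<lambda>j. \<phi> q j - \<phi> p j)"

definition nb :: "real \<Rightarrow> 'a set"
  where "nb r = {q \<in> U. \<phi> q \<in> ebox n (\<phi> p) r}"

lemmas chart = frame_chart[OF M fr]
  and Wopen = frame_open[OF M fr]
  and Wsub = frame_sub[OF M fr]
  and coord = frame_coord[OF M fr]
  and vf = frame_vf[OF M fr]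

lemma conn: "linear_connection M D"
  using flat by (simp add: flat_affine_def)

lemma pU: "p \<in> U"
  using p Wsub by blast

lemma p0: "\<phi> p \<in> euc n"
  by (rule chart_in_euc[OF M chart pU])

lemma nb_open: "mopen M (nb r)"
  unfolding nb_def by (rule chart_preimage_open[OF M chart eopen_ebox])

lemma p_nb: "r > 0 \<Longrightarrow> p \<in> nb r"
  using pU ebox_self[OF p0] by (simp add: nb_def)

lemma nb_mono: "r \<le> s \<Longrightarrow> nb r \<subseteq> nb s"
  using ebox_mono by (fastforce simp: nb_def)

lemma nb_subset:
  assumes "ebox n (\<phi> p) r \<subseteq> \<phi> ` (U \<inter> V)"
  shows "nb r \<subseteq> V"
proof
  fix q assume q: "q \<in> nb r"
  then obtain q' where "q' \<in> U" "q' \<in> V" "\<phi> q = \<phi> q'"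
    using assms by (auto simp: nb_def)
  then show "q \<in> V"
    using q chart_inj[OF M chart] by (auto simp: nb_def dest: inj_onD)
qed

lemma nb_W: "r \<le> R \<Longrightarrow> nb r \<subseteq> W"
  using nb_subset[of R W] nb_mono[of r R] R(2) Wsub by (auto simp: Int_absorb1)

lemma co_box: "q \<in> nb r \<Longrightarrow> co q \<in> bx r"
  using ebox_shift'[OF p0] by (simp add: co_def nb_def)

lemma pt_nb: "x \<in> bx r \<Longrightarrow> r \<le> R \<Longrightarrow> pt x \<in> nb r"
  and co_pt: "x \<in> bx r \<Longrightarrow> r \<le> R \<Longrightarrow> co (pt x) = x"
proof -
  assume x: "x \<in> bx r" "r \<le> R"
  then have *: "(\<lambda>j. x j + \<phi> p j) \<in> ebox n (\<phi> p) r"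
    using ebox_shift[OF p0] by simp
  then have "(\<lambda>j. x j + \<phi> p j) \<in> \<phi> ` W"
    using R(2) ebox_mono[OF x(2)] by blast
  then obtain q where q: "q \<in> W" "\<phi> q = (\<lambda>j. x j + \<phi> p j)"
    by auto
  then have "pt x = q"
    using chart_inv[OF M chart, of q] Wsub by (auto simp: pt_def)
  then show "pt x \<in> nb r" "co (pt x) = x"
    using q * Wsub by (auto simp: nb_def co_def)
qed

lemma pt_co: "q \<in> nb r \<Longrightarrow> pt (co q) = q"
  using chart_inv[OF M chart] by (simp add: pt_def co_def nb_def)

lemma smooth_pt:
  assumes "f \<in> smooth_funs M" "r \<le> R"
  shows "smooth_on n (bx r) (\<lambda>x. f (pt x))"
  unfolding pt_def
proof (rule smooth_on_shift)
  show "eopen n (\<phi> ` W)"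
    using chart_image_open[OF M chart Wopen] Wsub by (simp add: Int_absorb1)
  show "smooth_on n (\<phi> ` W) (\<lambda>x. f (inv_into U \<phi> x))"
    using msmoothD[OF smooth_funs_msmooth[OF M assms(1) Wopen] chart] Wsub by (simp add: Int_absorb1)
  show "(\<lambda>j. x j + \<phi> p j) \<in> \<phi> ` W" if "x \<in> bx r" for x
    using that ebox_shift[OF p0] R(2) ebox_mono[OF assms(2)] by blast
qed (rule eopen_ebox)

lemma pderiv_pt:
  assumes f: "f \<in> smooth_funs M" and i: "i < n" and x: "x \<in> bx r" and r: "r \<le> R"
  shows "has_pderiv i (\<lambda>x. f (pt x)) x (E i f (pt x))"
proof -
  let ?q = "pt x"
  have q: "?q \<in> W" "?q \<in> U"
    using pt_nb[OF x r] nb_W[OF r] Wsub by auto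
  have "has_pderiv i (\<lambda>x. f (inv_into U \<phi> x)) (\<phi> ?q) (E i f ?q)"
    using cpd_has_pderiv[OF M chart smooth_funs_msmooth[OF M f Wopen] q(2,1) i] frame_vf_eq[OF M fr i q(1) f] by simp
  moreover have "\<phi> ?q = (\<lambda>j. x j + \<phi> p j)"
    using co_pt[OF x r] by (auto simp: co_def fun_eq_iff diff_eq_eq)
  ultimately show ?thesis
    unfolding pt_def[of "_"] by (intro has_pderiv_shift) simp
qed

lemma vf_from_pderiv:
  assumes f: "f \<in> smooth_funs M" and i: "i < n" and q: "q \<in> nb r" and r: "r \<le> R"
    and eq: "\<And>s. s \<in> nb r \<Longrightarrow> f s = F (co s)" and F: "has_pderiv i F (co q) d"
  shows "E i f q = d"
proof -
  have "has_pderiv i (\<lambda>x. f (pt x)) (co q) d"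
    by (rule has_pderiv_cong[OF eopen_ebox co_box[OF q] i _ F]) (use eq pt_nb co_pt r in auto)
  then show ?thesis
    using has_pderiv_unique[OF pderiv_pt[OF f i co_box[OF q] r]] pt_co[OF q] by simp
qed

text \<open>The Christoffel symbols in the frame \<open>E\<close>.\<close>

definition Gam :: "nat \<Rightarrow> nat \<Rightarrow> nat \<Rightarrow> 'a \<Rightarrow> real"
  where "Gam i j k = D (E i) (E j) (\<xi> k)"

lemma Gam_smooth: "i < n \<Longrightarrow> j < n \<Longrightarrow> k < n \<Longrightarrow> Gam i j k \<in> smooth_funs M"
  unfolding Gam_def by (intro vf_smooth[OF conn_vf[OF M fr conn vf vf]] coord)

text \<open>The unknowns are \<open>u 0 = f\<close> and \<open>u (Suc k) = \<partial>\<^sub>k f\<close>.\<close>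

definition coef :: "nat \<Rightarrow> nat \<Rightarrow> nat \<Rightarrow> (nat \<Rightarrow> real) \<Rightarrow> real"
  where "coef i a b = (case a of 0 \<Rightarrow> (\<lambda>x. if b = Suc i then 1 else 0)
    | Suc j \<Rightarrow> (case b of 0 \<Rightarrow> (\<lambda>x. 0) | Suc k \<Rightarrow> (\<lambda>x. Gam i j k (pt x))))"

lemma coef_smooth: "i < n \<Longrightarrow> a < Suc n \<Longrightarrow> b < Suc n \<Longrightarrow> smooth_on n (bx R) (coef i a b)"
  by (auto simp: coef_def eopen_ebox intro!: smooth_on_const smooth_pt Gam_smooth split: nat.split)

lemma sum_Suc_shift: "(\<Sum>b<Suc m. f b) = f 0 + (\<Sum>k<m. f (Suc k))" for f :: "nat \<Rightarrow> real"
  by (rule sum.lessThan_Suc_shift)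

lemma rhs_0: "i < n \<Longrightarrow> flat_rhs (Suc n) coef u i 0 x = u (Suc i) x"
  unfolding flat_rhs_def sum_Suc_shift by (simp add: coef_def if_distrib[of "\<lambda>c. c * _"] sum.delta' cong: if_cong)

lemma rhs_Suc: "flat_rhs (Suc n) coef u i (Suc j) x = (\<Sum>k<n. Gam i j k (pt x) * u (Suc k) x)"
  unfolding flat_rhs_def sum_Suc_shift by (simp add: coef_def)

text \<open>For \<open>a = 0\<close> the condition is the symmetry of the Christoffel symbols, hence
  vanishing torsion. For \<open>a = Suc a'\<close> it is either trivial or the vanishing of the
  curvature.\<close>

lemma coef_flat:
  assumes i: "i < n" and j: "j < n" and a: "a < Suc n" and b: "b < Suc n" and x: "x \<in> bx R"
  shows "pderiv_at j (coef i a b) x + (\<Sum>c<Suc n. coef i a c x * coef j c b x) =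
    pderiv_at i (coef j a b) x + (\<Sum>c<Suc n. coef j a c x * coef i c b x)"
proof -
  have q: "pt x \<in> W"
    using pt_nb[OF x] nb_W[of R] by auto
  have pc: "pderiv_at i (\<lambda>x. c) x = 0" for i c
    by (rule pderiv_at_eq[OF has_pderiv_const])
  show ?thesis
  proof (cases a)
    case 0
    have "(\<Sum>c<Suc n. coef i a c x * coef j c b x) = coef j (Suc i) b x" if "i < n" for i j
      unfolding 0 using rhs_0[OF that, of "\<lambda>c. coef j c b" x] by (simp add: flat_rhs_def)
    moreover have "coef j (Suc i) b x = coef i (Suc j) b x"
      using frame_torsion_free[OF M fr flat i j _ q] b by (auto simp: coef_def Gam_def split: nat.split)
    ultimately show ?thesis
      using i j by (simp add: 0 coef_def pc)
  next
    case (Suc a')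
    have a': "a' < n"
      using a Suc by simp
    have sum: "(\<Sum>c<Suc n. coef i a c x * coef j c b x) = (\<Sum>k<n. Gam i a' k (pt x) * coef j (Suc k) b x)" for i j
      unfolding Suc using rhs_Suc[of "\<lambda>c. coef j c b" i a' x] by (simp add: flat_rhs_def)
    show ?thesis
    proof (cases b)
      case 0
      then show ?thesis
        unfolding sum by (simp add: Suc coef_def pc)
    next
      case (Suc b')
      then have b': "b' < n"
        using b by simp
      have pd: "pderiv_at j (coef i a b) x = E j (Gam i a' b') (pt x)" if "i < n" "j < n" for i j
        using pderiv_at_eq[OF pderiv_pt[OF Gam_smooth[OF that(1) a' b'] that(2) x order_refl]]
        by (simp add: \<open>a = Suc a'\<close> Suc coef_def)
      show ?thesis
        unfolding sum pd[OF i j] pd[OF j i]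
        using frame_flat[OF M fr flat j i a' b' q] by (simp add: Suc coef_def Gam_def)
    qed
  qed
qed

end

section \<open>Affine charts\<close>

text \<open>The coordinates \<open>y j\<close> are global functions that are affine and jointly
  injective on \<open>O'\<close>. Independence is demanded on every nonempty open subset, so that
  coefficients can be compared wherever two expressions are both known. Spanning is demanded on
  arbitrarily small neighbourhoods \<open>O1\<close>, which can thus be chosen inside a given
  preimage or compact set.\<close>

definition affine_chart :: "'a mfd \<Rightarrow> 'a connection \<Rightarrow> 'a \<Rightarrow> 'a set \<Rightarrow> (nat \<Rightarrow> 'a \<Rightarrow> real) \<Rightarrow> bool"
  where "affine_chart M D p O' y \<longleftrightarrow> mopen M O' \<and> p \<in> O' \<and>
    (\<forall>j<mdim M. y j \<in> smooth_funs M \<and> affine_on M D O' (y j)) \<and>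
    (\<forall>q\<in>O'. \<forall>s\<in>O'. (\<forall>j<mdim M. y j q = y j s) \<longrightarrow> q = s) \<and>
    (\<forall>V a b. mopen M V \<longrightarrow> V \<noteq> {} \<longrightarrow> V \<subseteq> O' \<longrightarrow> (\<forall>q\<in>V. a + (\<Sum>j<mdim M. b j * y j q) = 0) \<longrightarrow>
      a = 0 \<and> (\<forall>j<mdim M. b j = 0)) \<and>
    (\<forall>N. mopen M N \<longrightarrow> p \<in> N \<longrightarrow> (\<exists>O1. mopen M O1 \<and> p \<in> O1 \<and> O1 \<subseteq> N \<and> O1 \<subseteq> O' \<and>
      (\<forall>f\<in>smooth_funs M. affine_on M D O1 f \<longrightarrow> (\<exists>a b. \<forall>q\<in>O1. f q = a + (\<Sum>j<mdim M. b j * y j q)))))"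

lemma affine_chartD:
  assumes "affine_chart M D p O' y"
  shows affine_chart_open: "mopen M O'" and affine_chart_mem: "p \<in> O'"
    and affine_chart_smooth: "j < mdim M \<Longrightarrow> y j \<in> smooth_funs M"
    and affine_chart_affine: "j < mdim M \<Longrightarrow> affine_on M D O' (y j)"
    and affine_chart_inj: "q \<in> O' \<Longrightarrow> s \<in> O' \<Longrightarrow> (\<And>j. j < mdim M \<Longrightarrow> y j q = y j s) \<Longrightarrow> q = s"
    and affine_chart_indep: "mopen M V \<Longrightarrow> V \<noteq> {} \<Longrightarrow> V \<subseteq> O' \<Longrightarrow>
      (\<And>q. q \<in> V \<Longrightarrow> a + (\<Sum>j<mdim M. b j * y j q) = 0) \<Longrightarrow> a = 0 \<and> (\<forall>j<mdim M. b j = 0)"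
    and affine_chart_span: "mopen M N \<Longrightarrow> p \<in> N \<Longrightarrow> \<exists>O1. mopen M O1 \<and> p \<in> O1 \<and> O1 \<subseteq> N \<and> O1 \<subseteq> O' \<and>
      (\<forall>f\<in>smooth_funs M. affine_on M D O1 f \<longrightarrow> (\<exists>a b. \<forall>q\<in>O1. f q = a + (\<Sum>j<mdim M. b j * y j q)))"
proof -
  note ac = assms[unfolded affine_chart_def]
  show "mopen M O'" "p \<in> O'" "j < mdim M \<Longrightarrow> y j \<in> smooth_funs M" "j < mdim M \<Longrightarrow> affine_on M D O' (y j)"
    using ac by simp_all
  show "q \<in> O' \<Longrightarrow> s \<in> O' \<Longrightarrow> (\<And>j. j < mdim M \<Longrightarrow> y j q = y j s) \<Longrightarrow> q = s"
  proof -
    have "\<forall>q\<in>O'. \<forall>s\<in>O'. (\<forall>j<mdim M. y j q = y j s) \<longrightarrow> q = s"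
      using ac by (elim conjE)
    then show "q \<in> O' \<Longrightarrow> s \<in> O' \<Longrightarrow> (\<And>j. j < mdim M \<Longrightarrow> y j q = y j s) \<Longrightarrow> q = s"
      by blast
  qed
  show "a = 0 \<and> (\<forall>j<mdim M. b j = 0)" if "mopen M V" "V \<noteq> {}" "V \<subseteq> O'"
    "\<And>q. q \<in> V \<Longrightarrow> a + (\<Sum>j<mdim M. b j * y j q) = 0"
  proof -
    have "\<forall>a b. (\<forall>q\<in>V. a + (\<Sum>j<mdim M. b j * y j q) = 0) \<longrightarrow> a = 0 \<and> (\<forall>j<mdim M. b j = 0)"
      using ac that(1-3) by simp
    then show ?thesis
      using that(4) by (elim allE[of _ a] allE[of _ b]) blast
  qed
  show "mopen M N \<Longrightarrow> p \<in> N \<Longrightarrow> \<exists>O1. mopen M O1 \<and> p \<in> O1 \<and> O1 \<subseteq> N \<and> O1 \<subseteq> O' \<and>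
      (\<forall>f\<in>smooth_funs M. affine_on M D O1 f \<longrightarrow> (\<exists>a b. \<forall>q\<in>O1. f q = a + (\<Sum>j<mdim M. b j * y j q)))"
    using ac by simp
qed

text \<open>Near \<open>p\<close> the Jacobian of \<open>y\<close> is close to the identity, which
  yields injectivity and independence. Spanning is uniqueness for the flat system: an affine
  function is determined by its value and differential at \<open>p\<close>.\<close>

lemma affine_chart_exists:
  fixes M :: "'a mfd"
  assumes M: "smooth_manifold M" and flat: "flat_affine M D" and p: "p \<in> mpoints M"
  shows "\<exists>O' y. affine_chart M D p O' y"
proof -
  let ?n = "mdim M"
  obtain U \<phi> W \<xi> E where fr: "frame M U \<phi> W \<xi> E" and pW: "p \<in> W"
    using frame_exists[OF M p] .
  have pU: "p \<in> U"
    using pW frame_sub[OF M fr] by blast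
  have UW: "U \<inter> W = W"
    using frame_sub[OF M fr] by blast
  obtain R where R: "R > 0" "ebox ?n (\<phi> p) R \<subseteq> \<phi> ` W"
    using chart_box[OF M frame_chart[OF M fr] frame_open[OF M fr] pW pU] unfolding UW .
  interpret affine_setup M D U \<phi> W \<xi> E p R
    by unfold_locales (use M flat fr pW R in auto)
  obtain r0 K where r0: "r0 > 0" "r0 \<le> R"
    and fs: "\<And>r. 0 < r \<Longrightarrow> r \<le> r0 \<Longrightarrow> flat_system n (Suc n) coef (\<lambda>j i a b. pderiv_at j (coef i a b)) r K (bx r)"
    by (rule flat_system_small[OF R(1) coef_smooth coef_flat]; (assumption | (rule that; assumption)))
  interpret fs0: flat_system n "Suc n" coef "\<lambda>j i a b. pderiv_at j (coef i a b)" r0 K "bx r0"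
    by (rule fs[OF r0(1) order_refl])
  \<comment> \<open>Component \<open>0\<close> is the function and component \<open>Suc k\<close>
    its \<open>k\<close>-th derivative. The initial data are the value \<open>0\<close> and the
    \<open>j\<close>-th coordinate covector.\<close>
  define sol where "sol j = fs0.solution (\<lambda>a. if a = Suc j then 1 else 0)" for j
  have sol_cont: "continuous_on (bx r0) (sol j a)" if "a < Suc n" for j a
    unfolding sol_def by (rule fs0.solution_cont[OF that])
  have sol_pd: "has_pderiv i (sol j a) x (flat_rhs (Suc n) coef (sol j) i a x)" if "i < n" "a < Suc n" "x \<in> bx r0" for i j a x
    unfolding sol_def by (rule fs0.solution_pderiv[OF that])
  have sol_0: "sol j a (\<lambda>_. 0) = (if a = Suc j then 1 else 0)" if "a < Suc n" for j a
    unfolding sol_def by (rule fs0.solution_at_0[OF that])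
  have sol_smooth: "smooth_on n (bx r0) (sol j a)" if a: "a < Suc n" for j a
    unfolding smooth_on_def
  proof
    fix k
    show "Ck_on k n (bx r0) (sol j a)"
    proof (rule Ck_on_bootstrap[where n = n and U = "bx r0" and B = "{..<Suc n}" and u = "sol j" and A = coef])
      show "smooth_on n (bx r0) (coef i b c)" if "i < n" "b \<in> {..<Suc n}" "c \<in> {..<Suc n}" for i b c
        by (rule smooth_on_subset[OF eopen_ebox eopen_ebox ebox_mono[OF r0(2)] coef_smooth]) (use that in auto)
      show "has_pderiv i (sol j b) x (\<Sum>c<Suc n. coef i b c x * sol j c x)" if "i < n" "b \<in> {..<Suc n}" "x \<in> bx r0" for i b x
        using sol_pd[of i b x j] that by (simp add: flat_rhs_def)
    qed (use a sol_cont eopen_ebox in auto)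
  qed
  \<comment> \<open>The tolerance for the Jacobian that matches the constant in
    \<open>diagonally_small_zero\<close>.\<close>
  define eps where "eps = 1 / (2 * (real n + 1))"
  have eps: "eps > 0"
    by (simp add: eps_def add_nonneg_pos)
  have zr: "(\<lambda>_. 0) \<in> bx r0"
    using r0 by (simp add: ebox_def euc_def)
  obtain d where d: "d > 0"
    and close: "\<And>a y. a \<in> {..<n} \<times> {..<n} \<Longrightarrow> y \<in> bx d \<Longrightarrow> \<bar>sol (fst a) (Suc (snd a)) y - sol (fst a) (Suc (snd a)) (\<lambda>_. 0)\<bar> < eps"
    by (rule continuous_on_box_family[of "{..<n} \<times> {..<n}" n "bx r0" "\<lambda>a. sol (fst a) (Suc (snd a))", OF _ eopen_ebox sol_cont zr eps])
      auto
  have near: "\<bar>sol j (Suc i) y - (if i = j then 1 else 0)\<bar> \<le> eps" if "y \<in> bx d" "j < n" "i < n" for y j i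
    using close[of "(j, i)" y] sol_0[of "Suc i" j] that by simp
  obtain \<eta> V C where \<eta>: "\<eta> \<in> smooth_funs M" "mopen M V" "p \<in> V" "V \<subseteq> C" "\<And>q. q \<in> V \<Longrightarrow> \<eta> q = 1"
    "closedin (mtop M) C" "C \<subseteq> nb r0" "\<And>q. q \<notin> C \<Longrightarrow> \<eta> q = 0"
    by (rule bump_exists[OF M nb_open p_nb[OF r0(1)]]) blast
  obtain r1 where r1: "r1 > 0" "ebox n (\<phi> p) r1 \<subseteq> \<phi> ` (U \<inter> V)"
    using chart_box[OF M chart \<eta>(2,3) pU] .
  \<comment> \<open>Within \<open>r0\<close> the solutions exist, within \<open>d\<close> the
    Jacobian is close to the identity, and within \<open>r1\<close> the bump function is
    \<open>1\<close>, so that \<open>y\<close> is the solution itself.\<close>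
  define r where "r = Min {r0, d, r1}"
  have r: "r > 0" "r \<le> r0" "r \<le> d" "r \<le> r1" "r \<le> R"
    using r0 d r1 by (auto simp: r_def)
  define O' where "O' = nb r"
  have OV: "O' \<subseteq> V"
    unfolding O'_def using nb_mono[OF r(4)] nb_subset[OF r1(2)] by blast
  define y where "y j = cut_ext \<eta> (nb r0) (\<lambda>q. sol j 0 (co q))" for j
  have y_smooth: "y j \<in> smooth_funs M" for j
  proof -
    have "smooth_on n (ebox n (\<phi> p) r0) (\<lambda>x. sol j 0 (\<lambda>k. x k + - \<phi> p k))"
      by (rule smooth_on_shift[OF eopen_ebox sol_smooth eopen_ebox, of 0]) (use ebox_shift'[OF p0] in auto)
    then have "msmooth M (nb r0) (\<lambda>q. sol j 0 (\<lambda>k. \<phi> q k + - \<phi> p k))"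
      unfolding nb_def by (rule msmooth_comp_chart[OF M chart eopen_ebox])
    then have "msmooth M (nb r0) (\<lambda>q. sol j 0 (co q))"
      by (simp add: co_def)
    from cut_ext_smooth[OF M \<eta>(1,6,7,8) this] show ?thesis
      by (simp add: y_def)
  qed
  have y_eq: "y j q = sol j 0 (co q)" if "q \<in> O'" for j q
    using that OV \<eta>(5) nb_mono[OF r(2)] by (auto simp: y_def cut_ext_def O'_def)
  have sub: "bx r \<subseteq> bx r0" "bx r \<subseteq> bx d"
    using r by (auto intro!: ebox_mono)
  have E_y: "E i (y j) q = sol j (Suc i) (co q)" if "q \<in> O'" "i < n" for i j q
  proof (rule vf_from_pderiv[OF y_smooth that(2) that(1)[unfolded O'_def] r(5)])
    show "has_pderiv i (sol j 0) (co q) (sol j (Suc i) (co q))"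
      using sol_pd[OF that(2), of 0 "co q" j] rhs_0[OF that(2)] co_box[OF that(1)[unfolded O'_def]] sub(1) by auto
  qed (use y_eq O'_def in auto)
  have EE_y: "E i (E j (y l)) q = (\<Sum>k<n. Gam i j k q * E k (y l) q)" if "q \<in> O'" "i < n" "j < n" for i j l q
  proof (rule vf_from_pderiv[OF vf_smooth[OF vf[OF that(3)] y_smooth] that(2) that(1)[unfolded O'_def] r(5)])
    show "has_pderiv i (sol l (Suc j)) (co q) (\<Sum>k<n. Gam i j k q * E k (y l) q)"
      using sol_pd[OF that(2), of "Suc j" "co q" l] rhs_Suc[of "sol l" i j "co q"] co_box[OF that(1)[unfolded O'_def]]
        sub(1) that E_y pt_co[OF that(1)[unfolded O'_def]] by auto
  qed (use E_y[OF _ that(3)] O'_def in auto)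
  have y_affine: "affine_on M D O' (y j)" for j
    unfolding O'_def
    by (rule frame_affineI[OF M fr conn y_smooth nb_open nb_W[OF r(5)]])
      (use EE_y in \<open>auto simp: O'_def Gam_def\<close>)
  \<comment> \<open>Two points with equal values of \<open>y\<close> are compared by the mean value
    theorem on the segment between their coordinates; each coordinate difference is at most
    \<open>eps\<close> times the sum of all of them.\<close>
  have y_inj: "q = s" if q: "q \<in> O'" and s: "s \<in> O'" and eq: "\<And>j. j < n \<Longrightarrow> y j q = y j s" for q s
  proof -
    define x x' where "x = co q" and "x' = co s"
    have xx: "x \<in> bx r" "x' \<in> bx r"
      using co_box q s by (auto simp: x_def x'_def O'_def)
    have "\<bar>x j - x' j\<bar> \<le> (\<Sum>i<n. \<bar>x i - x' i\<bar>) / (2 * (real n + 1))" if j: "j < n" for j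
    proof -
      define c where "c t = (\<lambda>i. x' i + t * (x i - x' i))" for t
      have seg: "c t \<in> bx r" if "0 \<le> t" "t \<le> 1" for t
        unfolding c_def by (rule ebox_segment[OF xx(2,1) that])
      obtain t where t: "0 \<le> t" "t \<le> 1" "sol j 0 x - sol j 0 x' = (\<Sum>i<n. sol j (Suc i) (c t) * (x i - x' i))"
        unfolding c_def
      proof (rule mean_value_segment[of n "bx r0" x' x "sol j 0" "\<lambda>i. sol j (Suc i)"])
        show "has_pderiv i (sol j 0) z (sol j (Suc i) z)" if "i < n" "z \<in> bx r0" for i z
          using sol_pd[OF that(1) _ that(2), of 0 j] rhs_0[OF that(1)] by simp
        show "(\<lambda>i. x' i + t * (x i - x' i)) \<in> bx r0" if "0 \<le> t" "t \<le> 1" for t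
          using seg[OF that] sub(1) unfolding c_def by blast
      qed (use xx sol_cont eopen_ebox ebox_subset in \<open>auto simp: subset_iff\<close>)
      have cd: "c t \<in> bx d"
        using seg[of t] t sub(2) by auto
      have z: "(\<Sum>i<n. sol j (Suc i) (c t) * (x i - x' i)) = 0"
        using t(3) eq[OF j] y_eq[OF q] y_eq[OF s] by (simp add: x_def x'_def)
      have "(\<Sum>i<n. (if i = j then 1 else 0) * (x i - x' i)) = x j - x' j"
        using j by (simp add: if_distrib[of "\<lambda>c. c * _"] sum.delta cong: if_cong)
      then have "x j - x' j = - (\<Sum>i<n. (sol j (Suc i) (c t) - (if i = j then 1 else 0)) * (x i - x' i))"
        using z by (simp add: left_diff_distrib sum_subtractf)
      then have "\<bar>x j - x' j\<bar> \<le> (\<Sum>i<n. \<bar>(sol j (Suc i) (c t) - (if i = j then 1 else 0)) * (x i - x' i)\<bar>)"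
        by (simp only: abs_minus_cancel sum_abs)
      also have "\<dots> \<le> (\<Sum>i<n. eps * \<bar>x i - x' i\<bar>)"
        unfolding abs_mult by (intro sum_mono mult_right_mono near[OF cd j]) auto
      also have "\<dots> = (\<Sum>i<n. \<bar>x i - x' i\<bar>) / (2 * (real n + 1))"
        by (simp add: eps_def sum_divide_distrib)
      finally show ?thesis .
    qed
    then have "x j - x' j = 0" if "j < n" for j
      using diagonally_small_zero[of n "\<lambda>j. x j - x' j" j] that by simp
    then have "x = x'"
      using xx by (auto simp: ebox_def euc_def fun_eq_iff) (metis not_le)
    then show "q = s"
      using pt_co q s unfolding x_def x'_def O'_def by metis
  qed
  \<comment> \<open>A locally constant combination has zero differential, and the Jacobian of
    \<open>y\<close> is close to the identity at every point of \<open>O'\<close>.\<close>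
  have y_indep: "a = 0 \<and> (\<forall>j<n. b j = 0)"
    if V: "mopen M V" "V \<noteq> {}" "V \<subseteq> O'" and z: "\<And>q. q \<in> V \<Longrightarrow> a + (\<Sum>j<n. b j * y j q) = 0" for V a b
  proof -
    obtain q where q: "q \<in> V"
      using V by blast
    define f where "f = (\<lambda>q. \<Sum>j<n. b j * y j q)"
    have f: "f \<in> smooth_funs M"
      unfolding f_def by (intro smooth_funs_sum[OF M] smooth_funs_cmult[OF M] y_smooth)
    have fz: "f r = - a" if "r \<in> V" for r
      using z[OF that] by (simp add: f_def)
    have "(\<Sum>j<n. b j * sol j (Suc i) (co q)) = 0" if i: "i < n" for i
    proof -
      have "E i f q = 0"
        by (rule vf_locally_const[OF M fr vf[OF i] f V(1) q fz])
      moreover have "E i f q = (\<Sum>j<n. b j * E i (y j) q)"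
        unfolding f_def
        using vf_sum_fun[OF M fr vf[OF i], of "{..<n}" "\<lambda>j q. b j * y j q" q] smooth_funs_cmult[OF M y_smooth]
          tangent_cmult[OF M vf_tangent[OF vf[OF i]] y_smooth] by simp
      ultimately show ?thesis
        using E_y[OF _ i] V q by auto
    qed
    have cq: "co q \<in> bx d"
      using co_box[of q r] q V(3) sub(2) by (auto simp: O'_def)
    have b0: "\<bar>b i\<bar> \<le> (\<Sum>j<n. \<bar>b j\<bar>) / (2 * (real n + 1))" if i: "i < n" for i
    proof -
      have "(\<Sum>j<n. b j * (if i = j then 1 else 0)) = b i"
        using i by (simp add: if_distrib[of "\<lambda>c. _ * c"] sum.delta' cong: if_cong)
      then have "b i = - (\<Sum>j<n. b j * (sol j (Suc i) (co q) - (if i = j then 1 else 0)))"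
        using \<open>\<And>i. i < n \<Longrightarrow> (\<Sum>j<n. b j * sol j (Suc i) (co q)) = 0\<close>[OF i] by (simp add: right_diff_distrib sum_subtractf)
      then have "\<bar>b i\<bar> \<le> (\<Sum>j<n. \<bar>b j * (sol j (Suc i) (co q) - (if i = j then 1 else 0))\<bar>)"
        by (simp only: abs_minus_cancel sum_abs)
      also have "\<dots> \<le> (\<Sum>j<n. \<bar>b j\<bar> * eps)"
        unfolding abs_mult by (intro sum_mono mult_left_mono near[OF cq _ i]) auto
      also have "\<dots> = (\<Sum>j<n. \<bar>b j\<bar>) / (2 * (real n + 1))"
        by (simp add: eps_def sum_divide_distrib)
      finally show ?thesis .
    qed
    have "b j = 0" if "j < n" for j
      by (rule diagonally_small_zero[OF b0 that])
    then show ?thesis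
      using z[OF q] by simp
  qed
  \<comment> \<open>The system is available with every radius up to \<open>r0\<close>, so uniqueness
    can be invoked on a cube that fits into \<open>N\<close>.\<close>
  have small: "\<exists>O1. mopen M O1 \<and> p \<in> O1 \<and> O1 \<subseteq> N \<and> O1 \<subseteq> O' \<and>
      (\<forall>f\<in>smooth_funs M. affine_on M D O1 f \<longrightarrow> (\<exists>a b. \<forall>q\<in>O1. f q = a + (\<Sum>j<n. b j * y j q)))"
    if N: "mopen M N" "p \<in> N" for N
  proof -
    obtain r2' where r2': "r2' > 0" "ebox n (\<phi> p) r2' \<subseteq> \<phi> ` (U \<inter> N)"
      using chart_box[OF M chart N pU] .
    define r2 where "r2 = min r2' r"
    have r2: "r2 > 0" "r2 \<le> r" "r2 \<le> r0" "r2 \<le> R"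
      using r2' r by (auto simp: r2_def)
    have O1: "nb r2 \<subseteq> N" "nb r2 \<subseteq> O'"
      using nb_mono[of r2 r2'] nb_mono[of r2 r] nb_subset[OF r2'(2)] by (auto simp: r2_def O'_def)
    interpret fs2: flat_system n "Suc n" coef "\<lambda>j i a b. pderiv_at j (coef i a b)" r2 K "bx r2"
      by (rule fs[OF r2(1,3)])
    have y_span: "\<exists>a b. \<forall>q\<in>nb r2. f q = a + (\<Sum>j<n. b j * y j q)"
      if f: "f \<in> smooth_funs M" and aff: "affine_on M D (nb r2) f" for f
    proof -
      \<comment> \<open>The function and its first derivatives, as a solution of the system;
        \<open>one\<close> is the same for the constant \<open>1\<close>. Subtracting the
        combination with equal initial data leaves a solution \<open>v\<close> that vanishes at the
        origin.\<close>
      define u where "u a x = (case a of 0 \<Rightarrow> f (pt x) | Suc k \<Rightarrow> E k f (pt x))" for a x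
      define one where "one a x = (case a of 0 \<Rightarrow> (1::real) | Suc k \<Rightarrow> 0)" for a and x :: "nat \<Rightarrow> real"
      define v where "v a x = u a x - u 0 (\<lambda>_. 0) * one a x - (\<Sum>j<n. u (Suc j) (\<lambda>_. 0) * sol j a x)" for a x
      have sub2: "bx r2 \<subseteq> bx r0"
        using r2 by (auto intro!: ebox_mono)
      have u_pd: "has_pderiv i (u a) x (flat_rhs (Suc n) coef u i a x)" if "i < n" "a < Suc n" "x \<in> bx r2" for i a x
      proof (cases a)
        case 0
        then show ?thesis
          using pderiv_pt[OF f that(1,3) r2(4)] rhs_0[OF that(1), of u x] by (simp add: u_def[abs_def])
      next
        case (Suc j)
        then have j: "j < n"
          using that by simp
        have "E i (E j f) (pt x) = (\<Sum>k<n. Gam i j k (pt x) * E k f (pt x))"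
          unfolding Gam_def
          by (rule frame_affineD[OF M fr conn f aff nb_W[OF r2(4)] that(1) j pt_nb[OF that(3) r2(4)]])
        then show ?thesis
          using pderiv_pt[OF vf_smooth[OF vf[OF j] f] that(1,3) r2(4)] Suc rhs_Suc[of u i j x] by (simp add: u_def[abs_def])
      qed
      have one_pd: "has_pderiv i (one a) x (flat_rhs (Suc n) coef one i a x)" if "i < n" for i a x
      proof -
        have "flat_rhs (Suc n) coef one i a x = 0"
          using rhs_0[OF that, of one x] rhs_Suc[of one i _ x] by (cases a) (simp_all add: one_def)
        moreover have "one a = (\<lambda>x. case a of 0 \<Rightarrow> 1 | Suc k \<Rightarrow> 0)"
          by (simp add: one_def[abs_def])
        ultimately show ?thesis
          using has_pderiv_const by simp
      qed
      have v_rhs: "flat_rhs (Suc n) coef v i a x = flat_rhs (Suc n) coef u i a x - u 0 (\<lambda>_. 0) * flat_rhs (Suc n) coef one i a x -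
          (\<Sum>j<n. u (Suc j) (\<lambda>_. 0) * flat_rhs (Suc n) coef (sol j) i a x)" for i a x
      proof -
        have "(\<Sum>b<Suc n. coef i a b x * (\<Sum>j<n. u (Suc j) (\<lambda>_. 0) * sol j b x)) =
            (\<Sum>j<n. u (Suc j) (\<lambda>_. 0) * (\<Sum>b<Suc n. coef i a b x * sol j b x))"
          unfolding sum_distrib_left by (subst sum.swap) (simp only: mult_ac)
        then show ?thesis
          unfolding flat_rhs_def v_def right_diff_distrib sum_subtractf
          by (simp only: sum_distrib_left mult.left_commute)
      qed
      have v0: "v a x = 0" if "a < Suc n" "x \<in> bx r2" for a x
      proof (rule fs2.solution_unique[OF _ _ _ that])
        show "continuous_on (bx r2) (v b)" if b: "b < Suc n" for b
        proof -
          have "continuous_on (bx r2) (u b)"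
            using smooth_on_continuous[OF eopen_ebox smooth_pt[OF f r2(4)]]
              smooth_on_continuous[OF eopen_ebox smooth_pt[OF vf_smooth[OF vf f] r2(4)]] b
            by (cases b) (auto simp: u_def[abs_def])
          moreover have "continuous_on (bx r2) (one b)"
            by (simp add: one_def[abs_def])
          ultimately show ?thesis
            unfolding v_def using continuous_on_subset[OF sol_cont[OF b] sub2]
            by (intro continuous_on_diff continuous_on_sum continuous_on_mult continuous_on_const) auto
        qed
        show "has_pderiv j (v b) z (flat_rhs (Suc n) coef v j b z)" if "j < n" "b < Suc n" "z \<in> bx r2" for j b z
        proof -
          have "has_pderiv j (v b) z ((flat_rhs (Suc n) coef u j b z - (0 * one b z + u 0 (\<lambda>_. 0) * flat_rhs (Suc n) coef one j b z)) -
              (\<Sum>k<n. 0 * sol k b z + u (Suc k) (\<lambda>_. 0) * flat_rhs (Suc n) coef (sol k) j b z))"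
            unfolding v_def
            by (intro has_pderiv_diff has_pderiv_sum has_pderiv_mult[OF has_pderiv_const] u_pd one_pd sol_pd that subsetD[OF sub2])
          then show ?thesis
            by (simp add: v_rhs)
        qed
        show "v b (\<lambda>_. 0) = 0" if "b < Suc n" for b
          using that sol_0[OF that] by (cases b)
            (simp_all add: v_def one_def if_distrib[of "\<lambda>c. _ * c"] sum.delta' cong: if_cong)
      qed
      have "f q = u 0 (\<lambda>_. 0) + (\<Sum>j<n. u (Suc j) (\<lambda>_. 0) * y j q)" if q: "q \<in> nb r2" for q
      proof -
        have "v 0 (co q) = 0"
          by (rule v0[OF _ co_box[OF q]]) simp
        then show ?thesis
          using pt_co[OF q] y_eq[of q] O1(2) q by (auto simp: v_def u_def one_def)
      qed
      then show ?thesis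
        by (intro exI[of _ "u 0 (\<lambda>_. 0)"] exI[of _ "\<lambda>j. u (Suc j) (\<lambda>_. 0)"] ballI)
    qed
    then show ?thesis
      using nb_open p_nb[OF r2(1)] O1 by (intro exI[of _ "nb r2"] conjI ballI impI)
  qed
  have "affine_chart M D p O' y"
    unfolding affine_chart_def
  proof (intro conjI)
    show "mopen M O'" "p \<in> O'"
      unfolding O'_def by (rule nb_open, rule p_nb[OF r(1)])
    show "\<forall>j<n. y j \<in> smooth_funs M \<and> affine_on M D O' (y j)"
      using y_smooth y_affine by simp
    show "\<forall>q\<in>O'. \<forall>s\<in>O'. (\<forall>j<n. y j q = y j s) \<longrightarrow> q = s"
      by (intro ballI impI) (rule y_inj; simp)
    show "\<forall>V a b. mopen M V \<longrightarrow> V \<noteq> {} \<longrightarrow> V \<subseteq> O' \<longrightarrow> (\<forall>q\<in>V. a + (\<Sum>j<n. b j * y j q) = 0) \<longrightarrow>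
        a = 0 \<and> (\<forall>j<n. b j = 0)"
    proof (intro allI impI)
      fix V a b
      assume V: "mopen M V" "V \<noteq> {}" "V \<subseteq> O'" and z: "\<forall>q\<in>V. a + (\<Sum>j<n. b j * y j q) = 0"
      show "a = 0 \<and> (\<forall>j<n. b j = 0)"
        using z by (intro y_indep[OF V, of a b]) blast
    qed
    show "\<forall>N. mopen M N \<longrightarrow> p \<in> N \<longrightarrow> (\<exists>O1. mopen M O1 \<and> p \<in> O1 \<and> O1 \<subseteq> N \<and> O1 \<subseteq> O' \<and>
        (\<forall>f\<in>smooth_funs M. affine_on M D O1 f \<longrightarrow> (\<exists>a b. \<forall>q\<in>O1. f q = a + (\<Sum>j<n. b j * y j q))))"
      by (intro allI impI small)
  qed
  then show ?thesis
    by blast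
qed

section \<open>Affine transformations\<close>

lemma pullback_smooth:
  assumes M: "smooth_manifold M" and N: "smooth_manifold N" and F: "smap M N (mpoints M) F" and f: "f \<in> smooth_funs N"
  shows "pullback M F f \<in> smooth_funs M"
proof -
  have "msmooth M {p \<in> mpoints M. F p \<in> mpoints N} (\<lambda>p. f (F p))"
    using smap_msmooth[OF M N F] f smooth_funs_iff[OF N] by blast
  moreover have "{p \<in> mpoints M. F p \<in> mpoints N} = mpoints M"
    using smap_into[OF F] by auto
  ultimately have "msmooth M (mpoints M) (\<lambda>p. f (F p))"
    by simp
  then have "msmooth M (mpoints M) (pullback M F f)"
    by (rule msmooth_cong[OF M, rotated]) (simp add: pullback_def)
  then show ?thesis
    by (simp add: smooth_funs_iff[OF M] pullback_def)
qed

context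
  fixes M :: "'a mfd"
  assumes M: "smooth_manifold M"
begin

lemma diffeosD:
  assumes "F \<in> diffeos M"
  shows diffeo_smap: "smap M M (mpoints M) F"
    and diffeo_inv_smap: "smap M M (mpoints M) (inverse_on (mpoints M) F)"
    and diffeo_into: "p \<in> mpoints M \<Longrightarrow> F p \<in> mpoints M"
    and diffeo_onto: "F ` mpoints M = mpoints M"
    and diffeo_inverse: "p \<in> mpoints M \<Longrightarrow> inverse_on (mpoints M) F (F p) = p"
    and diffeo_ext: "F \<in> extensional (mpoints M)"
proof -
  show "smap M M (mpoints M) F" "smap M M (mpoints M) (inverse_on (mpoints M) F)"
    using assms smooth_map_iff_smap[OF M M] by (auto simp: diffeos_def)
  have b: "bij_betw F (mpoints M) (mpoints M)"
    using assms by (auto simp: diffeos_def Bij_def)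
  show "F \<in> extensional (mpoints M)"
    using assms by (auto simp: diffeos_def Bij_def)
  have "inj_on F (mpoints M)"
    using b by (simp add: bij_betw_def)
  moreover show "F ` mpoints M = mpoints M"
    using b by (simp add: bij_betw_def)
  ultimately show "F p \<in> mpoints M" "inverse_on (mpoints M) F (F p) = p" if "p \<in> mpoints M"
    using that by (auto simp: inverse_on_def)
qed

lemma pushforward_at:
  assumes "F \<in> diffeos M" "f \<in> smooth_funs M" "p \<in> mpoints M"
  shows "pushforward M F X f (F p) = X (pullback M F f) p"
  using assms diffeo_inverse diffeo_into by (simp add: pushforward_def pullback_def)

lemma pushforward_vf:
  assumes F: "F \<in> diffeos M" and X: "X \<in> vector_fields M"
  shows "pushforward M F X \<in> vector_fields M"
proof (rule vfI[OF _ _ _ M])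
  show "pushforward M F X f p = 0" if "f \<notin> smooth_funs M" for f p
    using that by (simp add: pushforward_def)
  show "pushforward M F X f \<in> smooth_funs M" if f: "f \<in> smooth_funs M" for f
    using f by (simp add: pushforward_def pullback_smooth[OF M M diffeo_inv_smap[OF F]] vf_smooth[OF X]
        pullback_smooth[OF M M diffeo_smap[OF F]])
  fix q assume "q \<in> mpoints M"
  then obtain p where p: "p \<in> mpoints M" "q = F p"
    using diffeo_onto[OF F] by blast
  note pb = pullback_smooth[OF M M diffeo_smap[OF F]]
  note at = pushforward_at[OF F _ p(1)]
  have lin: "pullback M F (\<lambda>q. a * f q + g q) = (\<lambda>q. a * pullback M F f q + pullback M F g q)"
    "pullback M F (\<lambda>q. f q * g q) = (\<lambda>q. pullback M F f q * pullback M F g q)" for a f g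
    by (auto simp: pullback_def)
  have pf: "pullback M F f p = f q" for f
    using p by (simp add: pullback_def)
  show "(\<lambda>f. pushforward M F X f q) \<in> tangent_space M q"
    unfolding tangent_space_def mem_Collect_eq
  proof (intro conjI ballI allI impI)
    show "pushforward M F X f q = 0" if "f \<notin> smooth_funs M" for f
      using that by (simp add: pushforward_def)
    fix f g assume fg: "f \<in> smooth_funs M" "g \<in> smooth_funs M"
    show "pushforward M F X (\<lambda>q. a * f q + g q) q = a * pushforward M F X f q + pushforward M F X g q" for a
      unfolding p(2) at[OF smooth_funs_add[OF M smooth_funs_cmult[OF M fg(1)] fg(2)]] at[OF fg(1)] at[OF fg(2)] lin
      by (rule tangent_lin[OF vf_tangent[OF X] pb[OF fg(1)] pb[OF fg(2)]])
    show "pushforward M F X (\<lambda>q. f q * g q) q = pushforward M F X f q * g q + f q * pushforward M F X g q"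
      unfolding p(2) at[OF smooth_funs_mult[OF M fg]] at[OF fg(1)] at[OF fg(2)] lin
      using tangent_mult[OF vf_tangent[OF X, of p] pb[OF fg(1)] pb[OF fg(2)]] pf p(2) by simp
  qed
qed

text \<open>Pullback along \<open>F\<close> turns the action of a pushed-forward field into that of
  the original one, and \<open>F\<close> carries \<open>D X Y\<close> to the derivative of the
  pushed-forward fields. The Hessian is therefore natural under \<open>F\<close>.\<close>

lemma affine_pullback:
  assumes F: "F \<in> affine_transformations M D" and f: "f \<in> smooth_funs M" and aff: "affine_on M D O' f"
  shows "affine_on M D {p \<in> mpoints M. F p \<in> O'} (pullback M F f)"
  unfolding affine_on_def
proof (intro ballI)
  fix X Y p assume X: "X \<in> vector_fields M" and Y: "Y \<in> vector_fields M" and "p \<in> {p \<in> mpoints M. F p \<in> O'}"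
  then have p: "p \<in> mpoints M" "F p \<in> O'"
    by auto
  have d: "F \<in> diffeos M"
    using F by (simp add: affine_transformations_def)
  let ?X = "pushforward M F X" and ?Y = "pushforward M F Y"
  note XY = pushforward_vf[OF d X] pushforward_vf[OF d Y]
  have pb: "pullback M F f \<in> smooth_funs M"
    by (rule pullback_smooth[OF M M diffeo_smap[OF d] f])
  have "Y (pullback M F f) q = pullback M F (?Y f) q" for q
    using pushforward_at[OF d f, of q Y] smooth_funs_outside[OF vf_smooth[OF Y pb]] by (auto simp: pullback_def)
  then have "Y (pullback M F f) = pullback M F (?Y f)"
    by (rule ext)
  then have "X (Y (pullback M F f)) p = ?X (?Y f) (F p)"
    using pushforward_at[OF d vf_smooth[OF XY(2) f] p(1), of X] by simp
  also have "\<dots> = D ?X ?Y f (F p)"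
    using aff XY p(2) by (simp add: affine_on_def)
  also have "\<dots> = pushforward M F (D X Y) f (F p)"
    using F X Y by (simp add: affine_transformations_def)
  also have "\<dots> = D X Y (pullback M F f) p"
    by (rule pushforward_at[OF d f p(1)])
  finally show "X (Y (pullback M F f)) p = D X Y (pullback M F f) p" .
qed

text \<open>The interior \<open>S\<close> of the fixed-point set is also closed, so connectedness
  makes it everything. Around a fixed point, \<open>y j\<close> and \<open>y j\<close> after
  \<open>F\<close> are both combinations of \<open>1\<close> and the coordinates; once they agree on
  a nonempty open part of \<open>O1\<close>, their coefficients agree, and \<open>F\<close> fixes
  all of \<open>O1\<close>.\<close>

lemma affine_identity_propagates:
  assumes conn: "connected_space (mtop M)" and flat: "flat_affine M D"
    and F: "F \<in> affine_transformations M D"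
    and V: "mopen M V" "V \<noteq> {}" "\<And>q. q \<in> V \<Longrightarrow> F q = q"
    and q: "q \<in> mpoints M"
  shows "F q = q"
proof -
  let ?n = "mdim M"
  have d: "F \<in> diffeos M"
    using F by (simp add: affine_transformations_def)
  note Fs = diffeo_smap[OF d]
  have haus: "Hausdorff_space (mtop M)"
    using M by (simp add: smooth_manifold_def)
  define S where "S = \<Union> {V. mopen M V \<and> (\<forall>q\<in>V. F q = q)}"
  have S: "mopen M S"
    unfolding S_def by (rule openin_Union) auto
  have "mopen M (mpoints M - S)"
  proof (subst openin_subopen, clarify)
    fix r assume r: "r \<in> mpoints M" "r \<notin> S"
    show "\<exists>T. mopen M T \<and> r \<in> T \<and> T \<subseteq> mpoints M - S"
    proof (cases "F r = r")
      case False
      obtain A B where AB: "mopen M A" "mopen M B" "F r \<in> A" "r \<in> B" "disjnt A B"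
        using haus diffeo_into[OF d r(1)] r(1) False unfolding Hausdorff_space_def by blast
      define T where "T = B \<inter> {q \<in> mpoints M. F q \<in> A}"
      have "mopen M T"
        unfolding T_def by (intro openin_Int AB smap_preimage[OF Fs AB(1)])
      moreover have "T \<subseteq> mpoints M - S"
        using AB(5) by (auto simp: T_def S_def disjnt_def)
      ultimately show ?thesis
        using AB r by (intro exI[of _ T]) (auto simp: T_def)
    next
      case True
      obtain O' y where ac: "affine_chart M D r O' y"
        using affine_chart_exists[OF M flat r(1)] by blast
      \<comment> \<open>Inside the preimage of \<open>O'\<close> the pulled-back coordinates are
        affine, so spanning on \<open>O1\<close> applies to them.\<close>
      obtain O1 where O1: "mopen M O1" "r \<in> O1" "O1 \<subseteq> {q \<in> mpoints M. F q \<in> O'}" "O1 \<subseteq> O'"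
        "\<And>f. f \<in> smooth_funs M \<Longrightarrow> affine_on M D O1 f \<Longrightarrow> \<exists>a b. \<forall>q\<in>O1. f q = a + (\<Sum>j<?n. b j * y j q)"
        using affine_chart_span[OF ac smap_preimage[OF Fs affine_chart_open[OF ac]]] r(1) True affine_chart_mem[OF ac]
        by auto
      have "O1 \<inter> S = {}"
      proof (rule ccontr)
        assume ne: "O1 \<inter> S \<noteq> {}"
        have OS: "mopen M (O1 \<inter> S)"
          using O1(1) S by blast
        have fixd: "F q = q" if "q \<in> O1 \<inter> S" for q
          using that by (auto simp: S_def)
        have "y j (F q) = y j q" if j: "j < ?n" and q: "q \<in> O1" for j q
        proof -
          have "affine_on M D O1 (pullback M F (y j))"
            using affine_pullback[OF F affine_chart_smooth[OF ac j] affine_chart_affine[OF ac j]] O1(3)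
            unfolding affine_on_def by blast
          moreover have "pullback M F (y j) \<in> smooth_funs M"
            by (rule pullback_smooth[OF M M Fs affine_chart_smooth[OF ac j]])
          ultimately obtain a b where ab: "\<forall>q\<in>O1. pullback M F (y j) q = a + (\<Sum>k<?n. b k * y k q)"
            using O1(5) by blast
          have yF: "y j (F q) = a + (\<Sum>k<?n. b k * y k q)" if "q \<in> O1" for q
          proof -
            have "q \<in> mpoints M"
              using that O1(3) by blast
            then show ?thesis
              using ab that by (auto simp: pullback_def)
          qed
          have dl: "(\<Sum>k<?n. (b k - (if k = j then 1 else 0)) * y k q) = (\<Sum>k<?n. b k * y k q) - y j q" for q
            using j by (simp add: left_diff_distrib sum_subtractf if_distrib[of "\<lambda>c. c * _"] sum.delta cong: if_cong)
          have "a = 0 \<and> (\<forall>k<?n. b k - (if k = j then 1 else 0) = 0)"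
          proof (rule affine_chart_indep[OF ac OS ne])
            show "O1 \<inter> S \<subseteq> O'"
              using O1(4) by blast
            show "a + (\<Sum>k<?n. (b k - (if k = j then 1 else 0)) * y k q) = 0" if "q \<in> O1 \<inter> S" for q
              using yF[of q] fixd[OF that] that unfolding dl by simp
          qed
          then have "(\<Sum>k<?n. (b k - (if k = j then 1 else 0)) * y k q) = 0" "a = 0"
            by auto
          then show ?thesis
            using yF[OF q] unfolding dl by simp
        qed
        then have "F q = q" if "q \<in> O1" for q
          using affine_chart_inj[OF ac, of "F q" q] that O1(3,4) by blast
        then have "O1 \<subseteq> S"
          using O1(1) by (auto simp: S_def)
        then show False
          using O1(2) r(2) by blast
      qed
      then show ?thesis
        using O1(1,2) openin_subset[OF O1(1)] by blast
    qed
  qed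
  then have "closedin (mtop M) S"
    using openin_subset[OF S] by (simp add: closedin_def)
  then have "S = {} \<or> S = mpoints M"
    using conn S by (auto simp: connected_space_clopen_in)
  moreover have "V \<subseteq> S"
    using V by (auto simp: S_def)
  ultimately have "q \<in> S"
    using V(2) q by auto
  then show ?thesis
    by (auto simp: S_def)
qed

end

text \<open>Point evaluations separate independent functions, so finitely many of them have
  combinations forming a dual basis. This recovers the coefficients of an affine function linearly
  from its values at fixed points, and thereby makes the matrix entries depend smoothly on the
  transformation.\<close>

lemma dual_evaluations:
  fixes g :: "nat \<Rightarrow> 'a \<Rightarrow> real"
  assumes "\<And>b. (\<And>q. q \<in> S \<Longrightarrow> (\<Sum>k<N. b k * g k q) = 0) \<Longrightarrow> \<forall>k<N. b k = 0"
  shows "\<exists>q c. (\<forall>l<N. q l \<in> S) \<and> (\<forall>k<N. \<forall>k'<N. (\<Sum>l<N. c k l * g k' (q l)) = (if k = k' then 1 else 0))"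
  using assms
proof (induction N)
  case (Suc N)
  have "\<forall>k<N. b k = 0" if "\<And>q. q \<in> S \<Longrightarrow> (\<Sum>k<N. b k * g k q) = 0" for b
    using Suc.prems[of "\<lambda>k. if k < N then b k else 0"] that by (auto split: if_splits)
  then obtain q c where q: "\<forall>l<N. q l \<in> S"
    and c: "\<And>k k'. k < N \<Longrightarrow> k' < N \<Longrightarrow> (\<Sum>l<N. c k l * g k' (q l)) = (if k = k' then 1 else 0)"
    using Suc.IH by blast
  define ev where "ev k f = (\<Sum>l<N. c k l * f (q l))" for k and f :: "'a \<Rightarrow> real"
  \<comment> \<open>The new function minus its expansion with respect to the earlier ones;
    independence provides a point where it does not vanish.\<close>
  define h where "h x = g N x - (\<Sum>k<N. ev k (g N) * g k x)" for x
  have "\<exists>x\<in>S. h x \<noteq> 0"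
  proof (rule ccontr)
    assume "\<not> (\<exists>x\<in>S. h x \<noteq> 0)"
    then have "(\<Sum>k<Suc N. (if k = N then 1 else - ev k (g N)) * g k x) = 0" if "x \<in> S" for x
      using that by (auto simp: h_def sum_negf)
    from Suc.prems[OF this] show False
      by auto
  qed
  then obtain x where x: "x \<in> S" "h x \<noteq> 0"
    by blast
  text \<open>\<open>r\<close> is the functional \<open>f \<mapsto> (f x - \<Sum>\<^sub>k g\<^sub>k(x) ev\<^sub>k f) / h x\<close>.\<close>
  define s where "s l = (\<Sum>k<N. g k x * c k l)" for l
  define r where "r l = (if l = N then 1 else - s l) / h x" for l
  define q' where "q' l = (if l = N then x else q l)" for l
  \<comment> \<open>The old functionals are corrected by a multiple of the new one so that they
    annihilate \<open>g N\<close>.\<close>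
  define c' where "c' k l = (if k = N then r l else (if l = N then 0 else c k l) - ev k (g N) * r l)" for k l
  have rf: "(\<Sum>l<Suc N. r l * f (q' l)) = (f x - (\<Sum>k<N. g k x * ev k f)) / h x" for f
  proof -
    have "(\<Sum>l<N. s l * f (q l)) = (\<Sum>k<N. g k x * ev k f)"
      unfolding s_def ev_def sum_distrib_left sum_distrib_right by (subst sum.swap) (simp add: mult.assoc)
    moreover have "(\<Sum>l<N. r l * f (q' l)) = - (\<Sum>l<N. s l * f (q l)) / h x"
      by (simp add: r_def q'_def sum_negf sum_divide_distrib)
    ultimately show ?thesis
      by (simp add: r_def q'_def diff_divide_distrib)
  qed
  have rg: "(\<Sum>l<Suc N. r l * g k' (q' l)) = (if k' = N then 1 else 0)" if "k' < Suc N" for k'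
  proof (cases "k' = N")
    case True
    then show ?thesis
      using rf[of "g N"] x(2) by (simp add: h_def mult.commute)
  next
    case False
    then have k': "k' < N"
      using that by simp
    have "(\<Sum>k<N. g k x * ev k (g k')) = (\<Sum>k<N. g k x * (if k = k' then 1 else 0))"
      using c k' by (intro sum.cong) (auto simp: ev_def)
    then show ?thesis
      using rf[of "g k'"] False k' by (simp add: if_distrib[of "\<lambda>c. _ * c"] sum.delta cong: if_cong)
  qed
  have "(\<Sum>l<Suc N. c' k l * g k' (q' l)) = (if k = k' then 1 else 0)" if "k < Suc N" "k' < Suc N" for k k'
  proof (cases "k = N")
    case True
    then show ?thesis
      using rg[OF that(2)] by (simp add: c'_def)
  next
    case False
    then have k: "k < N"
      using that by simp
    have "(\<Sum>l<Suc N. c' k l * g k' (q' l)) =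
        (\<Sum>l<Suc N. (if l = N then 0 else c k l) * g k' (q' l)) - ev k (g N) * (\<Sum>l<Suc N. r l * g k' (q' l))"
      using False unfolding sum_distrib_left sum_subtractf[symmetric]
      by (intro sum.cong) (auto simp: c'_def left_diff_distrib mult.assoc)
    also have "(\<Sum>l<Suc N. (if l = N then 0 else c k l) * g k' (q' l)) = ev k (g k')"
      by (simp add: ev_def q'_def)
    finally show ?thesis
      using rg[OF that(2)] c[OF k, of k'] that False by (cases "k' = N") (auto simp: ev_def)
  qed
  moreover have "\<forall>l<Suc N. q' l \<in> S"
    using q x by (auto simp: q'_def less_Suc_eq)
  ultimately show ?case
    by blast
qed simp

section \<open>The local representation of the affine group\<close>

definition ent :: "nat \<Rightarrow> (nat \<Rightarrow> real) \<Rightarrow> nat \<Rightarrow> nat \<Rightarrow> real"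
  where "ent N x i j = x (i * N + j)"

text \<open>Row-major order, with zeros from \<open>N * N\<close> on: a matrix is a point of
  \<open>euc (N * N)\<close>, so groups of matrices carry their manifold structure without further
  coding.\<close>

definition enc :: "nat \<Rightarrow> (nat \<Rightarrow> nat \<Rightarrow> real) \<Rightarrow> nat \<Rightarrow> real"
  where "enc N m = (\<lambda>k. if k < N * N then m (k div N) (k mod N) else 0)"

definition mmul :: "nat \<Rightarrow> (nat \<Rightarrow> real) \<Rightarrow> (nat \<Rightarrow> real) \<Rightarrow> nat \<Rightarrow> real"
  where "mmul N x y = enc N (\<lambda>i k. \<Sum>j<N. ent N x i j * ent N y j k)"

definition mone :: "nat \<Rightarrow> nat \<Rightarrow> real"
  where "mone N = enc N (\<lambda>i j. if i = j then 1 else 0)"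

lemma index_bound: "i < N \<Longrightarrow> j < N \<Longrightarrow> i * N + j < N * (N :: nat)"
proof -
  assume "i < N" "j < N"
  then have "i * N + j < i * N + N"
    by simp
  also have "\<dots> = Suc i * N"
    by simp
  also have "\<dots> \<le> N * N"
    using \<open>i < N\<close> by (intro mult_le_mono1) simp
  finally show ?thesis .
qed

lemma ent_enc [simp]: "i < N \<Longrightarrow> j < N \<Longrightarrow> ent N (enc N m) i j = m i j"
  using index_bound[of i N j] by (simp add: ent_def enc_def)

lemma enc_in_euc [simp]: "enc N m \<in> euc (N * N)"
  by (auto simp: enc_def euc_def)

lemma div_mod_less: "k < N * N \<Longrightarrow> k div N < (N :: nat) \<and> k mod N < N"
  by (metis less_mult_imp_div_less mod_less_divisor mult_0_right not_gr_zero not_less_zero)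

lemma ent_eqI:
  assumes "x \<in> euc (N * N)" "y \<in> euc (N * N)" "\<And>i j. i < N \<Longrightarrow> j < N \<Longrightarrow> ent N x i j = ent N y i j"
  shows "x = y"
proof
  fix k
  show "x k = y k"
  proof (cases "k < N * N")
    case True
    then show ?thesis
      using assms(3)[of "k div N" "k mod N"] div_mod_less[OF True] by (simp add: ent_def)
  next
    case False
    then show ?thesis
      using assms(1,2) by (auto simp: euc_def)
  qed
qed

lemma mone_in_euc: "mone N \<in> euc (N * N)"
  by (simp add: mone_def)

lemma mmul_mone_left:
  assumes "x \<in> euc (N * N)"
  shows "mmul N (mone N) x = x"
  by (rule ent_eqI[OF _ assms])
    (simp_all add: mmul_def mone_def if_distrib[of "\<lambda>c. c * _"] sum.delta' cong: if_cong)

lemma mmul_mone_right: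
  assumes "x \<in> euc (N * N)"
  shows "mmul N x (mone N) = x"
  by (rule ent_eqI[OF _ assms])
    (simp_all add: mmul_def mone_def if_distrib[of "\<lambda>c. _ * c"] sum.delta cong: if_cong)

lemma mmul_assoc: "mmul N (mmul N x y) z = mmul N x (mmul N y z)"
proof (rule ent_eqI[of _ N])
  fix i k assume ik: "i < N" "k < N"
  have "(\<Sum>j<N. (\<Sum>l<N. ent N x i l * ent N y l j) * ent N z j k) =
      (\<Sum>l<N. ent N x i l * (\<Sum>j<N. ent N y l j * ent N z j k))"
    unfolding sum_distrib_left sum_distrib_right by (subst sum.swap) (simp add: mult.assoc)
  then show "ent N (mmul N (mmul N x y) z) i k = ent N (mmul N x (mmul N y z)) i k"
    using ik by (simp add: mmul_def)
qed (simp_all add: mmul_def)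

lemma compact_open_subbasis:
  assumes "compactin X K" "openin X U"
  shows "openin (compact_open_topology X S) {F \<in> S. F ` K \<subseteq> U}"
  unfolding compact_open_topology_def by (rule topology_generated_by_Basis) (use assms in blast)

text \<open>With \<open>Y\<close> read as the column of \<open>1\<close> and the affine coordinates,
  the matrix is characterised by \<open>Y (F r) = \<rho> F Y r\<close> for \<open>r\<close> near
  \<open>p\<close>. This order of the factors makes composition correspond to the matrix
  product.\<close>

lemma local_representation:
  fixes M :: "'a mfd" and A :: "('a \<Rightarrow> 'a) mfd"
  assumes M: "smooth_manifold M" and conn: "connected_space (mtop M)" and flat: "flat_affine M D"
    and A: "affine_lie_group M D A"
  defines "G \<equiv> affine_group M D"
  obtains N W \<rho> where "mopen A W" "\<one>\<^bsub>G\<^esub> \<in> W" "\<And>F. \<rho> F \<in> euc (N * N)"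
    "\<And>i. msmooth A W (\<lambda>F. \<rho> F i)" "inj_on \<rho> W" "\<rho> \<one>\<^bsub>G\<^esub> = mone N"
    "\<And>F H. F \<in> W \<Longrightarrow> H \<in> W \<Longrightarrow> F \<otimes>\<^bsub>G\<^esub> H \<in> W \<Longrightarrow> \<rho> (F \<otimes>\<^bsub>G\<^esub> H) = mmul N (\<rho> F) (\<rho> H)"
proof -
  let ?n = "mdim M" and ?Aff = "affine_transformations M D"
  have lie: "lie_group G A" and top: "mtop A = compact_open_topology (mtop M) ?Aff"
    and act: "smooth_map (prod_mfd A M) M (\<lambda>(F, p). F p)"
    using A by (auto simp: affine_lie_group_def G_def)
  have Am: "smooth_manifold A" and grp: "group G" and Apts: "mpoints A = carrier G"
    using lie by (auto simp: lie_group_def)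
  interpret group G
    by (rule grp)
  have car: "carrier G = ?Aff"
    by (simp add: G_def affine_group_def)
  have one: "\<one>\<^bsub>G\<^esub> = (\<lambda>x\<in>mpoints M. x)"
    by (simp add: G_def affine_group_def BijGroup_def)
  have Aff_Bij: "F \<in> Bij (mpoints M)" "F \<in> diffeos M" if "F \<in> ?Aff" for F
    using that by (auto simp: affine_transformations_def diffeos_def)
  have mult: "F \<otimes>\<^bsub>G\<^esub> H = compose (mpoints M) F H" if "F \<in> ?Aff" "H \<in> ?Aff" for F H
    using Aff_Bij(1)[OF that(1)] Aff_Bij(1)[OF that(2)] by (simp add: G_def affine_group_def BijGroup_def)
  have oneA: "\<one>\<^bsub>G\<^esub> \<in> ?Aff"
    using one_closed car by simp
  have aff_eqI: "F = H" if "F \<in> ?Aff" "H \<in> ?Aff" "\<And>q. q \<in> mpoints M \<Longrightarrow> F q = H q" for F H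
    using extensionalityI[OF diffeo_ext[OF M Aff_Bij(2)[OF that(1)]] diffeo_ext[OF M Aff_Bij(2)[OF that(2)]]] that(3)
    by blast
  show ?thesis
  proof (cases "mpoints M = {}")
    case True
    \<comment> \<open>Over the empty manifold the affine group is trivial, and the unit matrix of
      size \<open>1\<close> represents it.\<close>
    have single: "F = H" if "F \<in> ?Aff" "H \<in> ?Aff" for F H
      by (rule aff_eqI[OF that]) (use True in simp)
    show ?thesis
    proof (rule that[of "mpoints A" "\<lambda>F. mone 1" 1])
      show "inj_on (\<lambda>F. mone 1) (mpoints A)"
        unfolding Apts car by (rule inj_onI) (rule single)
      show "mone 1 = mmul 1 (mone 1) (mone 1)"
        by (rule mmul_mone_left[OF mone_in_euc, symmetric])
      show "mone 1 \<in> euc (1 * 1)"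
        by (rule mone_in_euc)
      show openA: "mopen A (mpoints A)"
        by simp
      show "msmooth A (mpoints A) (\<lambda>F. mone 1 i)" for i
        by (rule msmooth_const[OF Am openA])
    qed (use Apts in auto)
  next
    case False
    then obtain p where p: "p \<in> mpoints M"
      by blast
    obtain O' y where ac: "affine_chart M D p O' y"
      using affine_chart_exists[OF M flat p] by blast
    \<comment> \<open>A compact neighbourhood of \<open>p\<close> inside the chart, so that mapping
      it into \<open>O'\<close> is a basic open condition of the compact-open topology.\<close>
    obtain W2 K where K: "mopen M W2" "p \<in> W2" "W2 \<subseteq> K" "K \<subseteq> O'" "compactin (mtop M) K"
      by (rule bump_exists[OF M affine_chart_open[OF ac] affine_chart_mem[OF ac]]) (rule that)
    obtain O1 where O1: "mopen M O1" "p \<in> O1" "O1 \<subseteq> W2"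
      "\<And>f. f \<in> smooth_funs M \<Longrightarrow> affine_on M D O1 f \<Longrightarrow> \<exists>a b. \<forall>q\<in>O1. f q = a + (\<Sum>j<?n. b j * y j q)"
      using affine_chart_span[OF ac K(1,2)] by blast
    have O1K: "O1 \<subseteq> K" "O1 \<subseteq> O'" "O1 \<subseteq> mpoints M"
      using O1(3) K(3,4) openin_subset[OF O1(1)] by auto
    define N where "N = Suc ?n"
    define Y where "Y k q = (case k of 0 \<Rightarrow> 1 | Suc j \<Rightarrow> y j q)" for k q
    have Y_sum: "(\<Sum>k<N. b k * Y k q) = b 0 + (\<Sum>j<?n. b (Suc j) * y j q)" for b q
      unfolding N_def sum.lessThan_Suc_shift by (simp add: Y_def)
    have Y_indep: "\<forall>k<N. b k = 0" if "mopen M V" "V \<noteq> {}" "V \<subseteq> O'" "\<And>q. q \<in> V \<Longrightarrow> (\<Sum>k<N. b k * Y k q) = 0" for V b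
      using affine_chart_indep[OF ac that(1-3), of "b 0" "\<lambda>j. b (Suc j)"] that(4) unfolding Y_sum
      by (auto simp: N_def less_Suc_eq_0_disj)
    have "O1 \<noteq> {}"
      using O1(2) by blast
    from dual_evaluations[where S = O1 and N = N and g = Y, OF Y_indep[OF O1(1) this O1K(2)]]
    obtain q c where q: "\<And>l. l < N \<Longrightarrow> q l \<in> O1"
      and c: "\<And>k k'. k < N \<Longrightarrow> k' < N \<Longrightarrow> (\<Sum>l<N. c k l * Y k' (q l)) = (if k = k' then 1 else 0)"
      by blast
    have dual: "(\<Sum>l<N. c k l * (\<Sum>k'<N. b k' * Y k' (q l))) = b k" if "k < N" for k b
    proof -
      have "(\<Sum>l<N. c k l * (\<Sum>k'<N. b k' * Y k' (q l))) = (\<Sum>k'<N. b k' * (\<Sum>l<N. c k l * Y k' (q l)))"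
        unfolding sum_distrib_left by (subst sum.swap) (simp add: mult_ac)
      also have "\<dots> = (\<Sum>k'<N. b k' * (if k = k' then 1 else 0))"
        using c[OF that] by simp
      also have "\<dots> = b k"
        using that by (simp add: if_distrib[of "\<lambda>c. _ * c"] sum.delta' cong: if_cong)
      finally show ?thesis .
    qed
    \<comment> \<open>The entry is the coefficient of \<open>Y k\<close> in \<open>Y i\<close> after
      \<open>F\<close>, extracted from the values at the points \<open>q l\<close>. The formula
      makes sense for every \<open>F\<close> and has this meaning on \<open>W\<close>.\<close>
    define \<rho> where "\<rho> F = enc N (\<lambda>i k. \<Sum>l<N. c k l * Y i (F (q l)))" for F
    \<comment> \<open>The first condition keeps \<open>O1\<close>, which lies in \<open>K\<close>,
      inside the chart. The second provides a nonempty open set on which two transformations can be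
      expanded one after the other.\<close>
    define W where "W = {F \<in> ?Aff. F ` K \<subseteq> O'} \<inter> {F \<in> ?Aff. F ` {p} \<subseteq> O1}"
    have W: "F \<in> ?Aff" "F ` K \<subseteq> O'" "F p \<in> O1" if "F \<in> W" for F
      using that by (auto simp: W_def)
    have Wopen: "mopen A W"
      unfolding W_def top
      by (intro openin_Int compact_open_subbasis K(5) affine_chart_open[OF ac] O1(1)) (use p in simp)
    have oneW: "\<one>\<^bsub>G\<^esub> \<in> W"
      using oneA p O1(2) K(4) compactin_subset_topspace[OF K(5)] by (auto simp: W_def one)
    have rep: "Y i (F r) = (\<Sum>k<N. ent N (\<rho> F) i k * Y k r)" if F: "F \<in> W" and i: "i < N" and r: "r \<in> O1" for F i r
    proof -
      have "\<exists>b. \<forall>r\<in>O1. Y i (F r) = (\<Sum>k<N. b k * Y k r)"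
      proof (cases i)
        case 0
        then show ?thesis
          unfolding Y_sum by (intro exI[of _ "\<lambda>k. if k = 0 then 1 else 0"]) (simp add: Y_def)
      next
        case (Suc j)
        then have j: "j < ?n"
          using i by (simp add: N_def)
        have "O1 \<subseteq> {p \<in> mpoints M. F p \<in> O'}"
          using W(2)[OF F] O1K by blast
        then have "affine_on M D O1 (pullback M F (y j))"
          using affine_pullback[OF M W(1)[OF F] affine_chart_smooth[OF ac j] affine_chart_affine[OF ac j]]
          unfolding affine_on_def by blast
        moreover have "pullback M F (y j) \<in> smooth_funs M"
          by (rule pullback_smooth[OF M M diffeo_smap[OF M Aff_Bij(2)[OF W(1)[OF F]]] affine_chart_smooth[OF ac j]])
        ultimately obtain a b where ab: "\<forall>r\<in>O1. pullback M F (y j) r = a + (\<Sum>k<?n. b k * y k r)"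
          using O1(4) by blast
        have "Y i (F r) = a + (\<Sum>k<?n. b k * y k r)" if "r \<in> O1" for r
        proof -
          have "pullback M F (y j) r = y j (F r)"
            using that O1K(3) by (auto simp: pullback_def)
          then show ?thesis
            using ab that Suc by (simp add: Y_def)
        qed
        then show ?thesis
          unfolding Y_sum by (intro exI[of _ "\<lambda>k. case k of 0 \<Rightarrow> a | Suc k \<Rightarrow> b k"]) simp
      qed
      then obtain b where b: "\<And>r. r \<in> O1 \<Longrightarrow> Y i (F r) = (\<Sum>k<N. b k * Y k r)"
        by blast
      have "ent N (\<rho> F) i k = b k" if k: "k < N" for k
        unfolding \<rho>_def using dual[OF k, of b] b[OF q] i k by simp
      then show ?thesis
        using b[OF r] by simp
    qed
    have Y_smooth: "Y i \<in> smooth_funs M \<or> i = 0" if "i < N" for i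
    proof (cases i)
      case (Suc j)
      then show ?thesis
        using that affine_chart_smooth[OF ac, of j] by (simp add: N_def Y_def[abs_def])
    qed simp
    \<comment> \<open>An entry of \<open>\<rho> F\<close> depends on \<open>F\<close> through
      finitely many orbit maps, and these are smooth because the action is.\<close>
    have orbit: "msmooth A W (\<lambda>F. f (F r))" if f: "f \<in> smooth_funs M" and r: "r \<in> mpoints M" for f r
    proof -
      note AM = smooth_manifold_prod[OF Am M]
      have s1: "smap A (prod_mfd A M) W (\<lambda>F. (F, r))"
        by (intro smap_Pair Am M smap_id smap_const Wopen r)
      have s2: "smap (prod_mfd A M) M (mpoints (prod_mfd A M)) (\<lambda>(F, p). F p)"
        using act smooth_map_iff_smap[OF AM M] by blast
      have "smap A M W (\<lambda>F. (\<lambda>(F, p). F p) (F, r))"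
        by (rule smap_compose[OF Am AM M s1 s2]) (use smap_into[OF s1] in blast)
      then have s: "smap A M W (\<lambda>F. F r)"
        by simp
      have "msmooth A {F \<in> W. F r \<in> mpoints M} (\<lambda>F. f (F r))"
        using smap_msmooth[OF Am M s] f smooth_funs_iff[OF M] by blast
      moreover have "{F \<in> W. F r \<in> mpoints M} = W"
        using smap_into[OF s] by auto
      ultimately show ?thesis
        by simp
    qed
    have "msmooth A W (\<lambda>F. \<rho> F i)" for i
    proof (cases "i < N * N")
      case True
      have "msmooth A W (\<lambda>F. Y (i div N) (F (q l)))" if "l < N" for l
        using Y_smooth[of "i div N"] div_mod_less[OF True] orbit[of "Y (i div N)" "q l"] q[OF that] O1K(3)
          msmooth_const[OF Am Wopen, of 1] by (auto simp: Y_def[of 0])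
      then have "msmooth A W (\<lambda>F. \<Sum>l<N. c (i mod N) l * Y (i div N) (F (q l)))"
        by (intro msmooth_sum[OF Am Wopen] msmooth_mult[OF Am] msmooth_const[OF Am Wopen]) auto
      then show ?thesis
        using True by (simp add: \<rho>_def enc_def)
    next
      case False
      then show ?thesis
        using msmooth_const[OF Am Wopen, of 0] by (simp add: \<rho>_def enc_def)
    qed
    \<comment> \<open>Equal matrices give equal affine coordinates of the images of points of
      \<open>O1\<close>. The quotient of the two transformations then fixes \<open>O1\<close>
      pointwise and is the identity.\<close>
    moreover have "inj_on \<rho> W"
    proof (rule inj_onI)
      fix F H assume FH: "F \<in> W" "H \<in> W" "\<rho> F = \<rho> H"
      have eq: "F r = H r" if r: "r \<in> O1" for r
      proof (rule affine_chart_inj[OF ac])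
        show "F r \<in> O'" "H r \<in> O'"
          using W(2) FH r O1K by blast+
        show "y j (F r) = y j (H r)" if "j < ?n" for j
          using rep[OF FH(1) _ r, of "Suc j"] rep[OF FH(2) _ r, of "Suc j"] FH(3) that by (simp add: Y_def N_def)
      qed
      have FA: "F \<in> carrier G" "H \<in> carrier G"
        using W(1) FH car by auto
      define Z where "Z = inv\<^bsub>G\<^esub> H \<otimes>\<^bsub>G\<^esub> F"
      have Z: "Z \<in> ?Aff" "inv\<^bsub>G\<^esub> H \<in> ?Aff"
        using FA car by (auto simp: Z_def)
      have invH: "(inv\<^bsub>G\<^esub> H) (H r) = r" if "r \<in> mpoints M" for r
      proof -
        have "compose (mpoints M) (inv\<^bsub>G\<^esub> H) H = \<one>\<^bsub>G\<^esub>"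
          using mult[OF Z(2), of H] FA(2) car l_inv[OF FA(2)] by metis
        then have "compose (mpoints M) (inv\<^bsub>G\<^esub> H) H r = \<one>\<^bsub>G\<^esub> r"
          by simp
        then show ?thesis
          using that by (simp add: compose_def one)
      qed
      have Zr: "Z r = (inv\<^bsub>G\<^esub> H) (F r)" if "r \<in> mpoints M" for r
        using mult[OF Z(2), of F] FA(1) car that by (simp add: Z_def compose_def)
      have "Z r = r" if "r \<in> mpoints M" for r
      proof (rule affine_identity_propagates[OF M conn flat Z(1) O1(1) \<open>O1 \<noteq> {}\<close> _ that])
        show "Z r = r" if "r \<in> O1" for r
          using that eq[OF that] Zr invH O1K(3) by auto
      qed
      then have "Z = \<one>\<^bsub>G\<^esub>"
        by (intro aff_eqI Z(1) oneA) (simp add: one)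
      then show "F = H"
        using FA unfolding Z_def by (metis inv_closed inv_equality inv_inv)
    qed
    moreover have "\<rho> \<one>\<^bsub>G\<^esub> = mone N"
    proof (rule ent_eqI[of _ N])
      fix i k assume ik: "i < N" "k < N"
      have "\<one>\<^bsub>G\<^esub> (q l) = q l" if "l < N" for l
        using q[OF that] O1K(3) by (auto simp: one)
      then show "ent N (\<rho> \<one>\<^bsub>G\<^esub>) i k = ent N (mone N) i k"
        using ik c[OF ik(2,1)] by (simp add: \<rho>_def mone_def)
    qed (simp_all add: \<rho>_def mone_def)
    moreover have "\<rho> (F \<otimes>\<^bsub>G\<^esub> H) = mmul N (\<rho> F) (\<rho> H)" if F: "F \<in> W" and H: "H \<in> W" and FH: "F \<otimes>\<^bsub>G\<^esub> H \<in> W" for F H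
    proof (rule ent_eqI[of _ N])
      fix i k assume ik: "i < N" "k < N"
      \<comment> \<open>Here \<open>H\<close> moves points within \<open>O1\<close>, so the
        expansion for \<open>F\<close> applies at \<open>H r\<close>. Since \<open>H p\<close> lies
        in \<open>O1\<close>, this open set contains \<open>p\<close>, and independence on it
        identifies the coefficients.\<close>
      define V where "V = O1 \<inter> {r \<in> mpoints M. H r \<in> O1}"
      have V: "mopen M V" "V \<noteq> {}" "V \<subseteq> O'"
        unfolding V_def using O1(1,2) smap_preimage[OF diffeo_smap[OF M Aff_Bij(2)[OF W(1)[OF H]]] O1(1)] W(3)[OF H] p O1K(2)
        by auto
      let ?m = "\<lambda>k. \<Sum>j<N. ent N (\<rho> F) i j * ent N (\<rho> H) j k"
      have "\<forall>k<N. ent N (\<rho> (F \<otimes>\<^bsub>G\<^esub> H)) i k - ?m k = 0"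
      proof (rule Y_indep[OF V])
        fix r assume "r \<in> V"
        then have r: "r \<in> O1" "H r \<in> O1" "r \<in> mpoints M"
          by (auto simp: V_def)
        have "(\<Sum>k<N. ent N (\<rho> (F \<otimes>\<^bsub>G\<^esub> H)) i k * Y k r) = Y i (F (H r))"
          using rep[OF FH ik(1) r(1)] mult[OF W(1)[OF F] W(1)[OF H]] r(3) by (simp add: compose_def)
        also have "\<dots> = (\<Sum>j<N. ent N (\<rho> F) i j * (\<Sum>k<N. ent N (\<rho> H) j k * Y k r))"
          using rep[OF F ik(1) r(2)] rep[OF H _ r(1)] by simp
        also have "\<dots> = (\<Sum>k<N. ?m k * Y k r)"
          unfolding sum_distrib_left sum_distrib_right by (subst sum.swap) (simp add: mult.assoc)
        finally show "(\<Sum>k<N. (ent N (\<rho> (F \<otimes>\<^bsub>G\<^esub> H)) i k - ?m k) * Y k r) = 0"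
          by (simp add: left_diff_distrib sum_subtractf)
      qed
      then show "ent N (\<rho> (F \<otimes>\<^bsub>G\<^esub> H)) i k = ent N (mmul N (\<rho> F) (\<rho> H)) i k"
        using ik by (simp add: mmul_def)
    qed (simp_all add: \<rho>_def mmul_def)
    moreover have "\<rho> F \<in> euc (N * N)" for F
      by (simp add: \<rho>_def)
    ultimately show ?thesis
      using that[of W \<rho> N] Wopen oneW by blast
  qed
qed

section \<open>Lie subgroups generated by a local homomorphism\<close>

lemma lie_groupD:
  assumes "lie_group G M"
  shows lie_group_group: "group G" and lie_group_mfd: "smooth_manifold M" and lie_group_points: "mpoints M = carrier G"
    and lie_group_mult: "smap (prod_mfd M M) M (carrier G \<times> carrier G) (\<lambda>z. fst z \<otimes>\<^bsub>G\<^esub> snd z)"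
    and lie_group_inv: "smap M M (carrier G) (\<lambda>x. inv\<^bsub>G\<^esub> x)"
proof -
  show *: "group G" "smooth_manifold M" "mpoints M = carrier G"
    using assms by (auto simp: lie_group_def)
  have "smap (prod_mfd M M) M (mpoints (prod_mfd M M)) (\<lambda>(x, y). x \<otimes>\<^bsub>G\<^esub> y)"
    using assms smooth_map_iff_smap[OF smooth_manifold_prod[OF *(2,2)] *(2)] by (auto simp: lie_group_def)
  then show "smap (prod_mfd M M) M (carrier G \<times> carrier G) (\<lambda>z. fst z \<otimes>\<^bsub>G\<^esub> snd z)"
    by (simp add: * case_prod_beta')
  show "smap M M (carrier G) (\<lambda>x. inv\<^bsub>G\<^esub> x)"
    using assms smooth_map_iff_smap[OF *(2,2)] *(3) by (auto simp: lie_group_def)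
qed

lemma smap_mult:
  assumes G: "lie_group G M" and L: "smooth_manifold L" and F: "smap L M O' F" and H: "smap L M O' H"
  shows "smap L M O' (\<lambda>p. F p \<otimes>\<^bsub>G\<^esub> H p)"
proof -
  note M = lie_group_mfd[OF G]
  have "smap L M O' (\<lambda>p. (\<lambda>z. fst z \<otimes>\<^bsub>G\<^esub> snd z) (F p, H p))"
    by (rule smap_compose[OF L smooth_manifold_prod[OF M M] M smap_Pair[OF L F H M M] lie_group_mult[OF G]])
      (use smap_into[OF F] smap_into[OF H] lie_group_points[OF G] in auto)
  then show ?thesis
    by simp
qed

lemma smap_inv:
  assumes G: "lie_group G M" and L: "smooth_manifold L" and F: "smap L M O' F"
  shows "smap L M O' (\<lambda>p. inv\<^bsub>G\<^esub> F p)"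
  by (rule smap_compose[OF L lie_group_mfd[OF G] lie_group_mfd[OF G] F lie_group_inv[OF G]])
    (use smap_into[OF F] lie_group_points[OF G] in auto)

lemma smap_left:
  assumes G: "lie_group G M" and a: "a \<in> carrier G"
  shows "smap M M (carrier G) (\<lambda>x. a \<otimes>\<^bsub>G\<^esub> x)"
proof -
  have op: "mopen M (carrier G)"
    by (metis lie_group_points[OF G] openin_topspace)
  note M = lie_group_mfd[OF G]
  show ?thesis
    using a lie_group_points[OF G] by (intro smap_mult[OF G M] smap_const[OF M op] smap_id[OF M op]) simp
qed

text \<open>The set \<open>V\<close> lies in a single chart, so that one \<open>\<phi>\<close>
  serves for all charts of the generated subgroup; the connectedness of \<open>V\<close> will make
  that subgroup connected.\<close>

locale local_hom = A: group \<A> + G: group \<G>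
  for \<A> :: "'a monoid" and \<G> :: "'b monoid" +
  fixes A :: "'a mfd" and GM :: "'b mfd" and U \<phi> V \<rho>
  assumes lieA: "lie_group \<A> A" and lieG: "lie_group \<G> GM"
    and chart: "(U, \<phi>) \<in> matlas A" and Vopen: "mopen A V" and VU: "V \<subseteq> U" and oneV: "\<one>\<^bsub>\<A>\<^esub> \<in> V"
    and Vconn: "connectedin (mtop A) V"
    and \<rho>: "smap A GM V \<rho>" and inj: "inj_on \<rho> V"
    and hom: "\<And>x y. x \<in> V \<Longrightarrow> y \<in> V \<Longrightarrow> x \<otimes>\<^bsub>\<A>\<^esub> y \<in> V \<Longrightarrow> \<rho> (x \<otimes>\<^bsub>\<A>\<^esub> y) = \<rho> x \<otimes>\<^bsub>\<G>\<^esub> \<rho> y"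
begin

abbreviation mul_a (infixl \<open>\<cdot>\<close> 70) where "x \<cdot> y \<equiv> x \<otimes>\<^bsub>\<A>\<^esub> y"
abbreviation mul_g (infixl \<open>\<star>\<close> 70) where "x \<star> y \<equiv> x \<otimes>\<^bsub>\<G>\<^esub> y"
abbreviation one_a (\<open>\<e>\<close>) where "\<e> \<equiv> \<one>\<^bsub>\<A>\<^esub>"
abbreviation one_g (\<open>\<u>\<close>) where "\<u> \<equiv> \<one>\<^bsub>\<G>\<^esub>"
abbreviation inv_a (\<open>inva _\<close> [81] 80) where "inva x \<equiv> inv\<^bsub>\<A>\<^esub> x"
abbreviation inv_g (\<open>invg _\<close> [81] 80) where "invg x \<equiv> inv\<^bsub>\<G>\<^esub> x"

lemmas Am = lie_group_mfd[OF lieA] and Gm = lie_group_mfd[OF lieG]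

lemma VA: "x \<in> V \<Longrightarrow> x \<in> carrier \<A>"
  using openin_subset[OF Vopen] lie_group_points[OF lieA] by auto

lemma \<rho>G: "x \<in> V \<Longrightarrow> \<rho> x \<in> carrier \<G>"
  using smap_into[OF \<rho>] lie_group_points[OF lieG] by auto

lemma \<rho>_one: "\<rho> \<e> = \<u>"
  using hom[OF oneV oneV] oneV \<rho>G[OF oneV] by (simp add: G.r_cancel_one)

definition H :: "'b set"
  where "H = generate \<G> (\<rho> ` V)"

definition L :: "'b \<Rightarrow> 'a \<Rightarrow> 'b"
  where "L h x = h \<star> \<rho> x"

definition R :: "'b \<Rightarrow> 'b \<Rightarrow> 'a"
  where "R h = inv_into V (L h)"

lemma H_subgroup: "subgroup H \<G>"
  unfolding H_def by (rule G.generate_is_subgroup) (use \<rho>G in auto)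

lemma H_carrier: "h \<in> H \<Longrightarrow> h \<in> carrier \<G>"
  using subgroup.mem_carrier[OF H_subgroup] .

lemma H_mult: "h \<in> H \<Longrightarrow> g \<in> H \<Longrightarrow> h \<star> g \<in> H"
  using subgroup.m_closed[OF H_subgroup] .

lemma H_inv: "h \<in> H \<Longrightarrow> invg h \<in> H"
  using subgroup.m_inv_closed[OF H_subgroup] .

lemma H_one: "\<u> \<in> H"
  using subgroup.one_closed[OF H_subgroup] .

lemma \<rho>H: "x \<in> V \<Longrightarrow> \<rho> x \<in> H"
  unfolding H_def by (rule generate.incl) simp

lemma L_H: "h \<in> H \<Longrightarrow> x \<in> V \<Longrightarrow> L h x \<in> H"
  by (simp add: L_def H_mult \<rho>H)

lemma L_one: "h \<in> H \<Longrightarrow> L h \<e> = h"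
  by (simp add: L_def \<rho>_one H_carrier)

lemma L_inj: "h \<in> H \<Longrightarrow> inj_on (L h) V"
  unfolding L_def using inj \<rho>G H_carrier by (auto simp: inj_on_def)

lemma R_L: "h \<in> H \<Longrightarrow> x \<in> V \<Longrightarrow> R h (L h x) = x"
  unfolding R_def by (rule inv_into_f_f[OF L_inj])

lemma L_R: "g \<in> L h ` V \<Longrightarrow> L h (R h g) = g" and R_V: "g \<in> L h ` V \<Longrightarrow> R h g \<in> V"
  unfolding R_def by (simp_all add: f_inv_into_f inv_into_into)

lemma L_mult: "h \<in> H \<Longrightarrow> x \<in> V \<Longrightarrow> z \<in> V \<Longrightarrow> x \<cdot> z \<in> V \<Longrightarrow> L (L h x) z = L h (x \<cdot> z)"
  by (simp add: L_def hom G.m_assoc H_carrier \<rho>G)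

lemma near_one_left:
  assumes "x \<in> P" "mopen A P"
  shows "mopen A {z \<in> V. x \<cdot> z \<in> P}" "\<e> \<in> {z \<in> V. x \<cdot> z \<in> P}"
proof -
  have x: "x \<in> carrier \<A>"
    using assms openin_subset lie_group_points[OF lieA] by blast
  have "mopen A (V \<inter> {z \<in> carrier \<A>. x \<cdot> z \<in> P})"
    using smap_preimage[OF smap_left[OF lieA x] assms(2)] Vopen by blast
  moreover have "V \<inter> {z \<in> carrier \<A>. x \<cdot> z \<in> P} = {z \<in> V. x \<cdot> z \<in> P}"
    using VA by auto
  ultimately show "mopen A {z \<in> V. x \<cdot> z \<in> P}"
    by simp
  show "\<e> \<in> {z \<in> V. x \<cdot> z \<in> P}"
    using oneV assms x by simp
qed

text \<open>The neighbourhoods of \<open>h\<close> are modelled on the translates by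
  \<open>L h\<close> of neighbourhoods of the unit in \<open>V\<close>. The resulting topology may
  be finer than the one induced from the ambient group.\<close>

definition H_open :: "'b set \<Rightarrow> bool"
  where "H_open S \<longleftrightarrow> S \<subseteq> H \<and> (\<forall>h\<in>S. \<exists>N. mopen A N \<and> \<e> \<in> N \<and> N \<subseteq> V \<and> L h ` N \<subseteq> S)"

definition HM :: "'b mfd"
  where "HM = \<lparr>mtop = topology H_open, mdim = mdim A, matlas = {(L h ` V, \<lambda>g. \<phi> (R h g)) | h. h \<in> H}\<rparr>"

lemma istopology_H_open: "istopology H_open"
  unfolding istopology_def
proof (intro conjI allI impI)
  fix S T assume S: "H_open S" and T: "H_open T"
  show "H_open (S \<inter> T)"
    unfolding H_open_def
  proof (intro conjI ballI)
    show "S \<inter> T \<subseteq> H"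
      using S by (auto simp: H_open_def)
    fix h assume h: "h \<in> S \<inter> T"
    obtain N where N: "mopen A N" "\<e> \<in> N" "N \<subseteq> V" "L h ` N \<subseteq> S"
      using S h by (auto simp: H_open_def)
    obtain N' where N': "mopen A N'" "\<e> \<in> N'" "N' \<subseteq> V" "L h ` N' \<subseteq> T"
      using T h by (auto simp: H_open_def)
    show "\<exists>N. mopen A N \<and> \<e> \<in> N \<and> N \<subseteq> V \<and> L h ` N \<subseteq> S \<inter> T"
      using N N' by (intro exI[of _ "N \<inter> N'"]) auto
  qed
next
  fix \<K> assume K: "\<forall>S\<in>\<K>. H_open S"
  show "H_open (\<Union> \<K>)"
    unfolding H_open_def
  proof (intro conjI ballI)
    show "\<Union> \<K> \<subseteq> H"
      using K by (auto simp: H_open_def)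
    fix h assume "h \<in> \<Union> \<K>"
    then obtain S where S: "S \<in> \<K>" "h \<in> S"
      by blast
    then have "\<exists>N. mopen A N \<and> \<e> \<in> N \<and> N \<subseteq> V \<and> L h ` N \<subseteq> S"
      using K by (auto simp: H_open_def)
    then obtain N where "mopen A N" "\<e> \<in> N" "N \<subseteq> V" "L h ` N \<subseteq> S"
      by (elim exE conjE)
    then show "\<exists>N. mopen A N \<and> \<e> \<in> N \<and> N \<subseteq> V \<and> L h ` N \<subseteq> \<Union> \<K>"
      using S by (intro exI[of _ N]) auto
  qed
qed

lemma HM_open: "mopen HM S \<longleftrightarrow> H_open S"
  by (simp add: HM_def topology_inverse'[OF istopology_H_open])

lemma HM_dim [simp]: "mdim HM = mdim A"
  by (simp add: HM_def)

text \<open>By \<open>L_mult\<close>, the translate based at a point \<open>L h u\<close> is the one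
  based at \<open>h\<close> with argument \<open>u \<cdot> z\<close>, and \<open>u \<cdot> z\<close>
  stays in \<open>N\<close> for \<open>z\<close> near the unit.\<close>

lemma L_open: "h \<in> H \<Longrightarrow> mopen A N \<Longrightarrow> N \<subseteq> V \<Longrightarrow> mopen HM (L h ` N)"
  unfolding HM_open H_open_def
proof (intro conjI ballI)
  assume h: "h \<in> H" and N: "mopen A N" "N \<subseteq> V"
  show "L h ` N \<subseteq> H"
    using L_H[OF h] N by auto
  fix g assume "g \<in> L h ` N"
  then obtain u where u: "u \<in> N" "g = L h u"
    by blast
  have "L g ` {z \<in> V. u \<cdot> z \<in> N} \<subseteq> L h ` N"
    using L_mult[OF h, of u] u N by auto
  then show "\<exists>N'. mopen A N' \<and> \<e> \<in> N' \<and> N' \<subseteq> V \<and> L g ` N' \<subseteq> L h ` N"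
    using near_one_left[OF u(1) N(1)] by (intro exI[of _ "{z \<in> V. u \<cdot> z \<in> N}"]) auto
qed

lemma HM_points: "mpoints HM = H"
proof -
  have "H_open H"
    unfolding H_open_def using Vopen oneV L_H by (intro conjI ballI exI[of _ V]) auto
  then have "H \<subseteq> mpoints HM"
    by (simp add: HM_open[symmetric] openin_subset)
  moreover have "H_open (mpoints HM)"
    unfolding HM_open[symmetric] by simp
  ultimately show ?thesis
    by (auto simp: H_open_def)
qed

text \<open>Points near \<open>x\<close> are written as \<open>x \<cdot> (inva x \<cdot> y)\<close>,
  which changes the base point from \<open>h\<close> to \<open>L h x\<close>, where the definition
  of openness applies.\<close>

lemma L_preimage:
  assumes h: "h \<in> H" and S: "mopen HM S"
  shows "mopen A {x \<in> V. L h x \<in> S}"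
proof (subst openin_subopen, clarify)
  fix x assume x: "x \<in> V" "L h x \<in> S"
  then obtain N where N: "mopen A N" "\<e> \<in> N" "N \<subseteq> V" "L (L h x) ` N \<subseteq> S"
    using S unfolding HM_open H_open_def by blast
  define T where "T = V \<inter> {y \<in> carrier \<A>. inva x \<cdot> y \<in> N}"
  have xA: "x \<in> carrier \<A>"
    using VA x by blast
  have "mopen A T"
    unfolding T_def using smap_preimage[OF smap_left[OF lieA] N(1)] xA Vopen by blast
  moreover have "x \<in> T"
    using x xA N(2) by (simp add: T_def)
  moreover have "T \<subseteq> {x \<in> V. L h x \<in> S}"
  proof
    fix y assume "y \<in> T"
    then have y: "y \<in> V" "y \<in> carrier \<A>" "inva x \<cdot> y \<in> N"
      by (auto simp: T_def)
    have "x \<cdot> (inva x \<cdot> y) = y"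
      using xA y by (simp add: A.m_assoc[symmetric])
    then have "L h y = L (L h x) (inva x \<cdot> y)"
      using L_mult[OF h x(1), of "inva x \<cdot> y"] y N(3) by auto
    then show "y \<in> {x \<in> V. L h x \<in> S}"
      using y N(4) by auto
  qed
  ultimately show "\<exists>T. mopen A T \<and> x \<in> T \<and> T \<subseteq> {x \<in> V. L h x \<in> S}"
    by blast
qed

text \<open>Continuity of the inclusion into the ambient group, through which the Hausdorff property
  is inherited.\<close>

lemma incl_preimage:
  assumes P: "mopen GM P"
  shows "mopen HM {h \<in> H. h \<in> P}"
  unfolding HM_open H_open_def
proof (intro conjI ballI)
  fix h assume h: "h \<in> {h \<in> H. h \<in> P}"
  have hG: "h \<in> carrier \<G>"
    using h H_carrier by auto
  have "smap A GM V (L h)"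
    unfolding L_def using hG lie_group_points[OF lieG] by (intro smap_mult[OF lieG Am] smap_const[OF Am Vopen] \<rho>) simp
  from smap_preimage[OF this P]
  have "mopen A {x \<in> V. L h x \<in> P}" .
  then show "\<exists>N. mopen A N \<and> \<e> \<in> N \<and> N \<subseteq> V \<and> L h ` N \<subseteq> {h \<in> H. h \<in> P}"
    using h oneV L_one L_H by (intro exI[of _ "{x \<in> V. L h x \<in> P}"]) auto
qed auto

lemma HM_chart: "h \<in> H \<Longrightarrow> (L h ` V, \<lambda>g. \<phi> (R h g)) \<in> matlas HM"
  by (auto simp: HM_def)

lemma HM_manifold: "smooth_manifold HM"
proof (rule smooth_manifoldI)
  show "Hausdorff_space (mtop HM)"
    unfolding Hausdorff_space_def HM_points
  proof (intro allI impI, elim conjE)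
    fix g h assume gh: "g \<in> H" "h \<in> H" "g \<noteq> h"
    have "Hausdorff_space (mtop GM)"
      using Gm by (simp add: smooth_manifold_def)
    moreover have "g \<in> mpoints GM \<and> h \<in> mpoints GM \<and> g \<noteq> h"
      using gh H_carrier lie_group_points[OF lieG] by simp
    ultimately obtain P Q where "mopen GM P" "mopen GM Q" "g \<in> P" "h \<in> Q" "disjnt P Q"
      unfolding Hausdorff_space_def by meson
    then show "\<exists>P Q. mopen HM P \<and> mopen HM Q \<and> g \<in> P \<and> h \<in> Q \<and> disjnt P Q"
      using gh incl_preimage[of P] incl_preimage[of Q]
      by (intro exI[of _ "{h \<in> H. h \<in> P}"] exI[of _ "{h \<in> H. h \<in> Q}"]) (auto simp: disjnt_def)
  qed
  show "\<exists>U' \<phi>'. (U', \<phi>') \<in> matlas HM \<and> h \<in> U'" if "h \<in> mpoints HM" for h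
  proof -
    have h: "h \<in> H"
      using that HM_points by simp
    then have "h \<in> L h ` V"
      using L_one oneV by (intro image_eqI[of _ _ "\<e>"]) auto
    then show ?thesis
      using HM_chart[OF h] by blast
  qed
  fix U' \<phi>' assume "(U', \<phi>') \<in> matlas HM"
  then obtain h where h: "h \<in> H" and U': "U' = L h ` V" "\<phi>' = (\<lambda>g. \<phi> (R h g))"
    by (auto simp: HM_def)
  show "mopen HM U'"
    unfolding U' by (rule L_open[OF h Vopen]) simp
  show "inj_on \<phi>' U'"
    unfolding U'
  proof (rule inj_onI)
    fix g g' assume "g \<in> L h ` V" "g' \<in> L h ` V" and eq: "\<phi> (R h g) = \<phi> (R h g')"
    then have "R h g = R h g'"
      using R_V VU by (intro inj_onD[OF chart_inj[OF Am chart] eq]) auto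
    then show "g = g'"
      using \<open>g \<in> L h ` V\<close> \<open>g' \<in> L h ` V\<close> by (metis L_R)
  qed
  show "eopen (mdim HM) (\<phi>' ` S)" if S: "mopen HM S" "S \<subseteq> U'" for S
  proof -
    have "\<phi>' ` S = \<phi> ` (U \<inter> {x \<in> V. L h x \<in> S})"
    proof (intro equalityI subsetI)
      fix z assume "z \<in> \<phi>' ` S"
      then obtain g where g: "g \<in> S" "z = \<phi> (R h g)"
        by (auto simp: U')
      then have "g \<in> L h ` V"
        using S(2) U' by blast
      then show "z \<in> \<phi> ` (U \<inter> {x \<in> V. L h x \<in> S})"
        using g L_R R_V VU by (intro image_eqI[of _ _ "R h g"]) auto
    next
      fix z assume "z \<in> \<phi> ` (U \<inter> {x \<in> V. L h x \<in> S})"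
      then obtain x where "x \<in> V" "L h x \<in> S" "z = \<phi> x"
        by blast
      then show "z \<in> \<phi>' ` S"
        using R_L[OF h] by (intro image_eqI[of _ _ "L h x"]) (auto simp: U')
    qed
    then show ?thesis
      using chart_image_open[OF Am chart L_preimage[OF h S(1)]] by simp
  qed
  show "mopen HM {g \<in> U'. \<phi>' g \<in> S}" if S: "eopen (mdim HM) S" for S
  proof -
    have "mopen HM (L h ` (V \<inter> {x \<in> U. \<phi> x \<in> S}))"
      using chart_preimage_open[OF Am chart] S Vopen by (intro L_open[OF h]) auto
    moreover have "L h ` (V \<inter> {x \<in> U. \<phi> x \<in> S}) = {g \<in> U'. \<phi>' g \<in> S}"
      using R_L[OF h] VU by (auto simp: U')
    ultimately show ?thesis
      by simp
  qed
  fix U2 \<phi>2 i assume "(U2, \<phi>2) \<in> matlas HM" and i: "i < mdim HM"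
  then obtain k where k: "k \<in> H" and U2: "U2 = L k ` V" "\<phi>2 = (\<lambda>g. \<phi> (R k g))"
    by (auto simp: HM_def)
  define Q where "Q = {x \<in> V. L h x \<in> L k ` V}"
  have Q: "mopen A Q"
    unfolding Q_def by (rule L_preimage[OF h L_open[OF k Vopen]]) simp
  have im: "\<phi>' ` (U' \<inter> U2) = \<phi> ` (U \<inter> Q)"
  proof (intro equalityI subsetI)
    fix z assume "z \<in> \<phi>' ` (U' \<inter> U2)"
    then obtain x where "x \<in> V" "L h x \<in> L k ` V" "z = \<phi> (R h (L h x))"
      by (auto simp: U' U2)
    then show "z \<in> \<phi> ` (U \<inter> Q)"
      using R_L[OF h] VU by (auto simp: Q_def)
  next
    fix z assume "z \<in> \<phi> ` (U \<inter> Q)"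
    then obtain x where "x \<in> V" "L h x \<in> L k ` V" "z = \<phi> x"
      by (auto simp: Q_def)
    then show "z \<in> \<phi>' ` (U' \<inter> U2)"
      using R_L[OF h] by (intro image_eqI[of _ _ "L h x"]) (auto simp: U' U2)
  qed
  have "msmooth A Q (\<lambda>x. \<phi> (R k (L h x)) i)"
  proof (rule msmooth_locally[OF Am Q])
    fix x assume "x \<in> Q"
    then have x: "x \<in> V" "L h x \<in> L k ` V"
      by (auto simp: Q_def)
    define y where "y = R k (L h x)"
    have y: "y \<in> V" "L k y = L h x"
      using L_R[OF x(2)] R_V[OF x(2)] by (auto simp: y_def)
    have xA: "x \<in> carrier \<A>" and yA: "y \<in> carrier \<A>"
      using VA x y by auto
    \<comment> \<open>Near \<open>x\<close> the change of charts is the left translation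
      \<open>x' \<mapsto> y \<cdot> (inva x \<cdot> x')\<close> of the source group;
      \<open>T\<close> collects the points for which all products involved stay in
      \<open>V\<close>.\<close>
    define T where "T = V \<inter> {x' \<in> carrier \<A>. inva x \<cdot> x' \<in> {z \<in> V. y \<cdot> z \<in> V}}"
    have T: "mopen A T"
      unfolding T_def using smap_preimage[OF smap_left[OF lieA] near_one_left(1)[OF y(1) Vopen], of "inva x"] xA Vopen by blast
    have xT: "x \<in> T"
      using x xA yA y oneV by (simp add: T_def)
    have eq: "R k (L h x') = y \<cdot> (inva x \<cdot> x')" "y \<cdot> (inva x \<cdot> x') \<in> V" if "x' \<in> T" for x'
    proof -
      let ?z = "inva x \<cdot> x'"
      have x': "x' \<in> V" "x' \<in> carrier \<A>" "?z \<in> V" "y \<cdot> ?z \<in> V"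
        using that by (auto simp: T_def)
      have "x \<cdot> ?z = x'"
        using xA x' by (simp add: A.m_assoc[symmetric])
      then have "L h x' = L (L h x) ?z"
        using L_mult[OF h x(1) x'(3)] x'(1) by simp
      also have "\<dots> = L k (y \<cdot> ?z)"
        unfolding y(2)[symmetric] by (rule L_mult[OF k y(1) x'(3,4)])
      finally show "R k (L h x') = y \<cdot> ?z" "y \<cdot> ?z \<in> V"
        using R_L[OF k x'(4)] x'(4) by auto
    qed
    have "smap A A T (\<lambda>x'. y \<cdot> (inva x \<cdot> x'))"
      using xA yA lie_group_points[OF lieA]
      by (intro smap_mult[OF lieA Am] smap_const[OF Am T] smap_id[OF Am T]) auto
    from smap_coord[OF this chart] i
    have "msmooth A {x' \<in> T. y \<cdot> (inva x \<cdot> x') \<in> U} (\<lambda>x'. \<phi> (y \<cdot> (inva x \<cdot> x')) i)"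
      by simp
    moreover have "{x' \<in> T. y \<cdot> (inva x \<cdot> x') \<in> U} = T"
      using eq(2) VU by blast
    ultimately have "msmooth A T (\<lambda>x'. \<phi> (y \<cdot> (inva x \<cdot> x')) i)"
      by simp
    then have "msmooth A T (\<lambda>x'. \<phi> (R k (L h x')) i)"
      by (rule msmooth_cong[OF Am, rotated]) (simp add: eq(1))
    then show "\<exists>T. x \<in> T \<and> msmooth A T (\<lambda>x. \<phi> (R k (L h x)) i)"
      using xT by blast
  qed
  from msmoothD[OF this chart]
  have s: "smooth_on (mdim A) (\<phi> ` (U \<inter> Q)) (\<lambda>x. \<phi> (R k (L h (inv_into U \<phi> x))) i)" .
  have "inv_into U' \<phi>' z = L h (inv_into U \<phi> z)" if z: "z \<in> \<phi> ` (U \<inter> Q)" for z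
  proof -
    obtain x where x: "x \<in> V" "z = \<phi> x" "x \<in> U"
      using z by (auto simp: Q_def)
    have "inv_into U' \<phi>' z = L h x"
      by (rule inv_into_f_eq) (use \<open>inj_on \<phi>' U'\<close> x R_L[OF h] in \<open>auto simp: U'\<close>)
    then show ?thesis
      using chart_inv[OF Am chart x(3)] x(2) by simp
  qed
  then show "smooth_on (mdim HM) (\<phi>' ` (U' \<inter> U2)) (\<lambda>x. \<phi>2 (inv_into U' \<phi>' x) i)"
    unfolding im HM_dim using chart_image_open[OF Am chart Q]
    by (intro smooth_on_cong[OF _ _ s]) (auto simp: U2)
qed

lemma smap_L: "h \<in> H \<Longrightarrow> smap A HM V (L h)"
proof (rule smapI_local[OF Am HM_manifold Vopen])
  fix x assume h: "h \<in> H" and x: "x \<in> V"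
  have "msmooth A V (\<lambda>x. \<phi> (R h (L h x)) i)" for i
    using msmooth_subset[OF Am msmooth_chart_coord[OF Am chart] Vopen VU]
    by (rule msmooth_cong[OF Am, rotated]) (simp add: R_L[OF h])
  then show "\<exists>V' \<psi> W. (V', \<psi>) \<in> matlas HM \<and> mopen A W \<and> x \<in> W \<and> W \<subseteq> V \<and> L h ` W \<subseteq> V' \<and>
      (\<forall>i<mdim HM. msmooth A W (\<lambda>p. \<psi> (L h p) i))"
    using HM_chart[OF h] Vopen x by (intro exI[of _ "L h ` V"] exI[of _ "\<lambda>g. \<phi> (R h g)"] exI[of _ V]) auto
qed

lemma LV_open: "h \<in> H \<Longrightarrow> mopen HM (L h ` V)"
  by (rule L_open[OF _ Vopen]) auto

lemma smap_R: "h \<in> H \<Longrightarrow> smap HM A (L h ` V) (R h)"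
proof (rule smapI_local[OF HM_manifold Am LV_open])
  fix g assume h: "h \<in> H" and "g \<in> L h ` V"
  then show "\<exists>V' \<psi> W. (V', \<psi>) \<in> matlas A \<and> mopen HM W \<and> g \<in> W \<and> W \<subseteq> L h ` V \<and> R h ` W \<subseteq> V' \<and>
      (\<forall>i<mdim A. msmooth HM W (\<lambda>p. \<psi> (R h p) i))"
    using chart LV_open[OF h] msmooth_chart_coord[OF HM_manifold HM_chart[OF h]] R_V VU
    by (intro exI[of _ U] exI[of _ \<phi>] exI[of _ "L h ` V"]) auto
qed

lemma mem_LV: "h \<in> H \<Longrightarrow> h \<in> L h ` V"
  using L_one oneV by (intro image_eqI[of _ _ "\<e>"]) auto

lemma R_self: "h \<in> H \<Longrightarrow> R h h = \<e>"
  using R_L[OF _ oneV] L_one by metis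

section \<open>Conjugation near the unit, and the group operations of the generated subgroup\<close>

text \<open>The map \<open>c\<close> lifts conjugation by \<open>h\<close> to the source group near
  its unit. The inverse stands on the left because \<open>\<rho> x\<close> has to be moved to the
  right past \<open>h\<close>.\<close>

definition conj_by :: "'b \<Rightarrow> 'a set \<Rightarrow> ('a \<Rightarrow> 'a) \<Rightarrow> bool"
  where "conj_by h N c \<longleftrightarrow> mopen A N \<and> \<e> \<in> N \<and> N \<subseteq> V \<and> smap A A N c \<and> c \<e> = \<e> \<and> c ` N \<subseteq> V \<and>
    (\<forall>x\<in>N. invg h \<star> \<rho> x \<star> h = \<rho> (c x))"

lemma conj_by_element:
  assumes a: "a \<in> carrier \<A>" and h: "h \<in> carrier \<G>"
    and T: "mopen A T" "\<e> \<in> T"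
    and eq: "\<And>x. x \<in> V \<Longrightarrow> x \<in> T \<Longrightarrow> inva a \<cdot> x \<cdot> a \<in> V \<Longrightarrow>
      invg h \<star> \<rho> x \<star> h = \<rho> (inva a \<cdot> x \<cdot> a)"
  shows "\<exists>N c. conj_by h N c"
proof -
  let ?c = "\<lambda>x. inva a \<cdot> x \<cdot> a"
  have VT: "mopen A (V \<inter> T)"
    using Vopen T by blast
  have s: "smap A A (V \<inter> T) ?c"
    using a lie_group_points[OF lieA]
    by (intro smap_mult[OF lieA Am] smap_const[OF Am VT] smap_id[OF Am VT]) auto
  define N where "N = {x \<in> V \<inter> T. ?c x \<in> V}"
  have N: "mopen A N"
    unfolding N_def by (rule smap_preimage[OF s Vopen])
  have "conj_by h N ?c"
    unfolding conj_by_def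
  proof (intro conjI N ballI)
    show "smap A A N ?c"
      by (rule smap_subset[OF Am s N _ Am]) (auto simp: N_def)
  qed (use a oneV T(2) eq in \<open>auto simp: N_def\<close>)
  then show ?thesis
    by blast
qed

text \<open>For a generator \<open>\<rho> w\<close> the lift is conjugation by \<open>w\<close>,
  restricted to a neighbourhood where the products stay in \<open>V\<close> and \<open>hom\<close>
  applies. For longer words the lifts are composed on shrinking neighbourhoods.\<close>

lemma conj_exists: "h \<in> H \<Longrightarrow> \<exists>N c. conj_by h N c"
  unfolding H_def
proof (induction h rule: generate.induct)
  case one
  show ?case
    by (rule conj_by_element[of "\<e>", OF _ _ Vopen oneV]) (use \<rho>G VA in simp_all)
next
  case (incl h)
  then obtain w where w: "w \<in> V" "h = \<rho> w"
    by blast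
  have wA: "w \<in> carrier \<A>" "\<rho> w \<in> carrier \<G>"
    using w VA \<rho>G by auto
  have "smap A A (carrier \<A>) (\<lambda>x. x \<cdot> w)"
    using wA lie_group_points[OF lieA] openin_topspace[of "mtop A"]
    by (intro smap_mult[OF lieA Am] smap_const[OF Am] smap_id[OF Am]) auto
  from smap_preimage[OF this Vopen]
  have T: "mopen A {x \<in> carrier \<A>. x \<cdot> w \<in> V}" .
  show ?case
  proof (rule conj_by_element[OF wA(1) _ T])
    fix x assume x: "x \<in> V" "x \<in> {x \<in> carrier \<A>. x \<cdot> w \<in> V}" "inva w \<cdot> x \<cdot> w \<in> V"
    let ?y = "inva w \<cdot> x \<cdot> w"
    have "w \<cdot> ?y = x \<cdot> w"
      using wA x by (simp add: A.m_assoc[symmetric])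
    then have "\<rho> w \<star> \<rho> ?y = \<rho> x \<star> \<rho> w"
      using hom[OF w(1) x(3)] hom[OF x(1) w(1)] x(2) by simp
    then show "invg h \<star> \<rho> x \<star> h = \<rho> ?y"
      using wA \<rho>G[OF x(1)] \<rho>G[OF x(3)] w(2) by (metis G.inv_closed G.inv_solve_left G.m_assoc G.m_closed)
  qed (use w wA in auto)
next
  case (inv h)
  then obtain w where w: "w \<in> V" "h = \<rho> w"
    by blast
  have wA: "w \<in> carrier \<A>" "\<rho> w \<in> carrier \<G>"
    using w VA \<rho>G by auto
  show ?case
  proof (rule conj_by_element[of "inva w", OF _ _ near_one_left[OF w(1) Vopen]])
    fix x assume x: "x \<in> V" "x \<in> {z \<in> V. w \<cdot> z \<in> V}"
      "inva (inva w) \<cdot> x \<cdot> inva w \<in> V"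
    let ?y = "w \<cdot> x \<cdot> inva w"
    have y: "?y \<in> V"
      using x(3) wA by simp
    have "?y \<cdot> w = w \<cdot> x"
      using wA VA[OF x(1)] by (simp add: A.m_assoc)
    then have "\<rho> ?y \<star> \<rho> w = \<rho> w \<star> \<rho> x"
      using hom[OF y w(1)] hom[OF w(1) x(1)] x(2) by simp
    then have "\<rho> ?y = \<rho> w \<star> \<rho> x \<star> invg \<rho> w"
      using wA \<rho>G[OF x(1)] \<rho>G[OF y] by (metis G.inv_solve_right G.m_closed)
    then show "invg (invg h) \<star> \<rho> x \<star> invg h = \<rho> (inva (inva w) \<cdot> x \<cdot> inva w)"
      using wA w(2) by simp
  qed (use w wA in auto)
next
  case (eng h1 h2)
  obtain N1 c1 where 1: "conj_by h1 N1 c1"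
    using eng.IH(1) by blast
  obtain N2 c2 where 2: "conj_by h2 N2 c2"
    using eng.IH(2) by blast
  have G: "h1 \<in> carrier \<G>" "h2 \<in> carrier \<G>"
    using eng.hyps H_carrier unfolding H_def by auto
  define N where "N = {x \<in> N1. c1 x \<in> N2}"
  have s1: "smap A A N1 c1" and s2: "smap A A N2 c2" and N2: "mopen A N2"
    using 1 2 by (auto simp: conj_by_def)
  have N: "mopen A N"
    unfolding N_def by (rule smap_preimage[OF s1 N2])
  have "conj_by (h1 \<star> h2) N (\<lambda>x. c2 (c1 x))"
    unfolding conj_by_def
  proof (intro conjI N ballI)
    show "smap A A N (\<lambda>x. c2 (c1 x))"
      by (rule smap_compose[OF Am Am Am smap_subset[OF Am s1 N _ Am] s2]) (auto simp: N_def)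
    fix x assume x: "x \<in> N"
    have xV: "x \<in> V"
      using x 1 by (auto simp: N_def conj_by_def)
    have "invg (h1 \<star> h2) \<star> \<rho> x \<star> (h1 \<star> h2) =
        invg h2 \<star> (invg h1 \<star> \<rho> x \<star> h1) \<star> h2"
      using G \<rho>G[OF xV] by (simp add: G.inv_mult_group G.m_assoc)
    also have "\<dots> = \<rho> (c2 (c1 x))"
      using x 1 2 by (auto simp: N_def conj_by_def)
    finally show "invg (h1 \<star> h2) \<star> \<rho> x \<star> (h1 \<star> h2) = \<rho> (c2 (c1 x))" .
  qed (use 1 2 in \<open>auto simp: N_def conj_by_def\<close>)
  then show ?case
    by blast
qed

text \<open>With \<open>c\<close> the lift of conjugation by \<open>h2\<close>, one has \<open>(h1
  \<star> \<rho> x) \<star> (h2 \<star> \<rho> y) = L (h1 \<star> h2) (c x \<cdot> y)\<close>, and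
  the right-hand side is smooth in the charts.\<close>

lemma smap_H_mult: "smap (prod_mfd HM HM) HM (H \<times> H) (\<lambda>z. fst z \<star> snd z)"
proof (rule smap_locally[OF smooth_manifold_prod[OF HM_manifold HM_manifold] HM_manifold])
  note PM = smooth_manifold_prod[OF HM_manifold HM_manifold]
  have HH: "mopen HM H"
    by (metis HM_points openin_topspace)
  show "mopen (prod_mfd HM HM) (H \<times> H)"
    using HH by (simp add: openin_prod_Times_iff)
  fix p assume "p \<in> H \<times> H"
  then obtain h1 h2 where p: "p = (h1, h2)" and h1: "h1 \<in> H" and h2: "h2 \<in> H"
    by auto
  obtain N c where N: "conj_by h2 N c"
    using conj_exists[OF h2] by blast
  then have c: "smap A A N c" and NV: "N \<subseteq> V" and No: "mopen A N" and c1: "c \<e> = \<e>" and N1: "\<e> \<in> N"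
    by (auto simp: conj_by_def)
  define D where "D = L h1 ` N \<times> L h2 ` V"
  have D: "mopen (prod_mfd HM HM) D"
    unfolding D_def using L_open[OF h1 No NV] LV_open[OF h2] by (simp add: openin_prod_Times_iff)
  have LN: "L h1 ` N \<subseteq> L h1 ` V"
    using NV by blast
  have a: "smap (prod_mfd HM HM) A D (\<lambda>z. R h1 (fst z))"
    by (rule smap_compose[OF PM HM_manifold Am smap_fst[OF HM_manifold HM_manifold D] smap_R[OF h1]])
      (use LN in \<open>auto simp: D_def\<close>)
  have ca: "smap (prod_mfd HM HM) A D (\<lambda>z. c (R h1 (fst z)))"
    by (rule smap_compose[OF PM Am Am a c]) (use NV R_L[OF h1] in \<open>auto simp: D_def\<close>)
  have b: "smap (prod_mfd HM HM) A D (\<lambda>z. R h2 (snd z))"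
    by (rule smap_compose[OF PM HM_manifold Am smap_snd[OF HM_manifold HM_manifold D] smap_R[OF h2]])
      (auto simp: D_def)
  define m where "m z = c (R h1 (fst z)) \<cdot> R h2 (snd z)" for z
  have m: "smap (prod_mfd HM HM) A D m"
    unfolding m_def by (rule smap_mult[OF lieA PM ca b])
  define D' where "D' = {z \<in> D. m z \<in> V}"
  have D': "mopen (prod_mfd HM HM) D'"
    unfolding D'_def by (rule smap_preimage[OF m Vopen])
  have h12: "h1 \<star> h2 \<in> H"
    using h1 h2 by (rule H_mult)
  have "smap (prod_mfd HM HM) HM D' (\<lambda>z. L (h1 \<star> h2) (m z))"
    by (rule smap_compose[OF PM Am HM_manifold smap_subset[OF PM m D' _ Am] smap_L[OF h12]]) (auto simp: D'_def)
  moreover have "L (h1 \<star> h2) (m z) = fst z \<star> snd z" if z: "z \<in> D'" for z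
  proof -
    obtain x y where xy: "x \<in> N" "y \<in> V" "z = (L h1 x, L h2 y)"
      using z by (auto simp: D'_def D_def)
    have mz: "m z = c x \<cdot> y" and mV: "c x \<cdot> y \<in> V"
      using xy NV R_L[OF h1] R_L[OF h2] z by (auto simp: m_def D'_def)
    have cx: "c x \<in> V" "invg h2 \<star> \<rho> x \<star> h2 = \<rho> (c x)"
      using N xy(1) by (auto simp: conj_by_def)
    have g: "h1 \<in> carrier \<G>" "h2 \<in> carrier \<G>" "\<rho> x \<in> carrier \<G>" "\<rho> y \<in> carrier \<G>"
      using h1 h2 H_carrier \<rho>G xy NV by auto
    have "L (h1 \<star> h2) (m z) = h1 \<star> h2 \<star> (invg h2 \<star> \<rho> x \<star> h2 \<star> \<rho> y)"
      unfolding L_def mz using hom[OF cx(1) xy(2) mV] cx(2) by simp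
    also have "\<dots> = h1 \<star> (h2 \<star> invg h2) \<star> \<rho> x \<star> (h2 \<star> \<rho> y)"
      using g by (simp add: G.m_assoc del: G.r_inv G.Units_r_inv)
    also have "\<dots> = fst z \<star> snd z"
      using g by (simp add: xy(3) L_def)
    finally show ?thesis .
  qed
  ultimately have "smap (prod_mfd HM HM) HM D' (\<lambda>z. fst z \<star> snd z)"
    by (rule smap_cong[OF PM])
  moreover have "p \<in> D'"
  proof -
    have "h1 \<in> L h1 ` N"
      using L_one[OF h1] N1 by (intro image_eqI[of _ _ "\<e>"]) auto
    then show ?thesis
      using mem_LV[OF h2] R_self[OF h1] R_self[OF h2] c1 oneV by (simp add: p D'_def D_def m_def)
  qed
  ultimately show "\<exists>W. p \<in> W \<and> smap (prod_mfd HM HM) HM W (\<lambda>z. fst z \<star> snd z)"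
    by blast
qed

text \<open>With \<open>c\<close> the lift of conjugation by \<open>invg h\<close>, the inverse of
  \<open>h \<star> \<rho> x\<close> is \<open>L (invg h) (c (inva x))\<close>.\<close>

lemma smap_H_inv: "smap HM HM H (\<lambda>g. invg g)"
proof (rule smap_locally[OF HM_manifold HM_manifold])
  show "mopen HM H"
    by (metis HM_points openin_topspace)
  fix h assume h: "h \<in> H"
  have h': "invg h \<in> H"
    by (rule H_inv[OF h])
  obtain N c where N: "conj_by (invg h) N c"
    using conj_exists[OF h'] by blast
  then have c: "smap A A N c" and NV: "N \<subseteq> V" and No: "mopen A N" and c1: "c \<e> = \<e>" and N1: "\<e> \<in> N"
    and cV: "c ` N \<subseteq> V"
    by (auto simp: conj_by_def)
  have r: "smap HM A (L h ` V) (\<lambda>g. inva (R h g))"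
    by (rule smap_inv[OF lieA HM_manifold smap_R[OF h]])
  define D where "D = {g \<in> L h ` V. inva (R h g) \<in> N}"
  have D: "mopen HM D"
    unfolding D_def by (rule smap_preimage[OF r No])
  have "smap HM A D (\<lambda>g. c (inva (R h g)))"
    by (rule smap_compose[OF HM_manifold Am Am smap_subset[OF HM_manifold r D _ Am] c]) (auto simp: D_def)
  from smap_compose[OF HM_manifold Am HM_manifold this smap_L[OF h']]
  have "smap HM HM D (\<lambda>g. L (invg h) (c (inva (R h g))))"
    using cV by (auto simp: D_def)
  moreover have "L (invg h) (c (inva (R h g))) = invg g" if gD: "g \<in> D" for g
  proof -
    obtain x where x: "x \<in> V" "g = L h x" "inva x \<in> N"
      using gD L_R[of g h] R_V[of g h] unfolding D_def by fastforce
    have g: "h \<in> carrier \<G>" "\<rho> x \<in> carrier \<G>" "x \<in> carrier \<A>"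
      using H_carrier[OF h] \<rho>G[OF x(1)] VA[OF x(1)] by auto
    have xi: "inva x \<in> V"
      using x NV by blast
    have "\<rho> x \<star> \<rho> (inva x) = \<u>"
      using hom[OF x(1) xi] g oneV \<rho>_one by simp
    then have ri: "\<rho> (inva x) = invg (\<rho> x)"
      using g \<rho>G[OF xi] by (metis G.inv_comm G.inv_equality)
    have "L (invg h) (c (inva (R h g))) = invg h \<star> (h \<star> invg (\<rho> x) \<star> invg h)"
      using N x R_L[OF h x(1)] g ri by (auto simp: L_def conj_by_def)
    also have "\<dots> = (invg h \<star> h) \<star> (invg (\<rho> x) \<star> invg h)"
      using g by (simp add: G.m_assoc del: G.l_inv G.Units_l_inv)
    also have "\<dots> = invg g"
      using g x(2) by (simp add: L_def G.inv_mult_group)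
    finally show ?thesis .
  qed
  ultimately have "smap HM HM D (\<lambda>g. invg g)"
    by (rule smap_cong[OF HM_manifold])
  moreover have "h \<in> D"
    using mem_LV[OF h] R_self[OF h] N1 by (simp add: D_def)
  ultimately show "\<exists>W. h \<in> W \<and> smap HM HM W (\<lambda>g. invg g)"
    by blast
qed

lemma H_lie_group: "lie_group (\<G>\<lparr>carrier := H\<rparr>) HM"
  unfolding lie_group_def
proof (intro conjI)
  show gr: "group (\<G>\<lparr>carrier := H\<rparr>)"
    by (rule subgroup.subgroup_is_group[OF H_subgroup G.group_axioms])
  show "smooth_manifold HM"
    by (rule HM_manifold)
  show "mpoints HM = carrier (\<G>\<lparr>carrier := H\<rparr>)"
    by (simp add: HM_points)
  show "smooth_map (prod_mfd HM HM) HM (\<lambda>(x, y). x \<otimes>\<^bsub>\<G>\<lparr>carrier := H\<rparr>\<^esub> y)"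
    using smap_H_mult smooth_map_iff_smap[OF smooth_manifold_prod[OF HM_manifold HM_manifold] HM_manifold]
    by (simp add: HM_points case_prod_beta')
  have "smap HM HM H (\<lambda>x. inv\<^bsub>\<G>\<lparr>carrier := H\<rparr>\<^esub> x)"
    by (rule smap_cong[OF HM_manifold smap_H_inv]) (simp add: G.m_inv_consistent[OF H_subgroup])
  then show "smooth_map HM HM (\<lambda>x. inv\<^bsub>\<G>\<lparr>carrier := H\<rparr>\<^esub> x)"
    using smooth_map_iff_smap[OF HM_manifold HM_manifold] by (simp add: HM_points)
qed

lemma smap_incl: "smap HM GM H (\<lambda>h. h)"
proof (rule smap_locally[OF HM_manifold Gm])
  show "mopen HM H"
    by (metis HM_points openin_topspace)
  fix h assume h: "h \<in> H"
  have "smap HM GM (L h ` V) (\<lambda>g. \<rho> (R h g))"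
    by (rule smap_compose[OF HM_manifold Am Gm smap_R[OF h] \<rho> R_V])
  then have "smap HM GM (L h ` V) (\<lambda>g. h \<star> \<rho> (R h g))"
    using H_carrier[OF h] lie_group_points[OF lieG]
    by (intro smap_mult[OF lieG HM_manifold] smap_const[OF HM_manifold LV_open[OF h]]) auto
  then have "smap HM GM (L h ` V) (\<lambda>g. g)"
    by (rule smap_cong[OF HM_manifold]) (use L_R in \<open>simp add: L_def\<close>)
  then show "\<exists>W. h \<in> W \<and> smap HM GM W (\<lambda>h. h)"
    using mem_LV[OF h] by blast
qed

text \<open>The image of \<open>V\<close> under \<open>L g\<close> is connected and contains
  \<open>g\<close>, so multiplication by a generator stays in the connected component; for an
  inverse generator the same step is read backwards. Induction on words reaches all of
  \<open>H\<close>.\<close>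

lemma HM_connected: "connected_space (mtop HM)"
proof -
  have LV: "connectedin (mtop HM) (L h ` V)" if h: "h \<in> H" for h
  proof -
    have "continuous_map (subtopology (mtop A) V) (mtop HM) (L h)"
      unfolding continuous_map_def
    proof (intro conjI allI impI)
      show "L h \<in> topspace (subtopology (mtop A) V) \<rightarrow> mpoints HM"
        using smap_into[OF smap_L[OF h]] by auto
      fix P assume P: "mopen HM P"
      have "{x \<in> topspace (subtopology (mtop A) V). L h x \<in> P} = {x \<in> V. L h x \<in> P}"
        using openin_subset[OF Vopen] by auto
      then show "openin (subtopology (mtop A) V) {x \<in> topspace (subtopology (mtop A) V). L h x \<in> P}"
        using L_preimage[OF h P] by (auto intro: subset_openin_subtopology)
    qed
    moreover have "connectedin (subtopology (mtop A) V) V"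
      using Vconn by (simp add: connectedin_subtopology)
    ultimately show ?thesis
      by (rule connectedin_continuous_map_image)
  qed
  have step: "connected_component_of (mtop HM) g (g \<star> \<rho> w)" if g: "g \<in> H" and w: "w \<in> V" for g w
    unfolding connected_component_of_def
    using LV[OF g] mem_LV[OF g] w by (intro exI[of _ "L g ` V"]) (auto simp: L_def)
  have "\<forall>g\<in>H. connected_component_of (mtop HM) g (g \<star> h)" if "h \<in> H" for h
    using that unfolding H_def
  proof (induction h rule: generate.induct)
    case one
    show ?case
      using H_carrier HM_points by (auto simp: H_def[symmetric] connected_component_of_refl)
  next
    case (incl h)
    then show ?case
      using step by (auto simp: H_def[symmetric])
  next
    case (inv h)
    then obtain w where w: "w \<in> V" "h = \<rho> w"
      by blast
    show ?case
    proof
      fix g assume "g \<in> generate \<G> (\<rho> ` V)"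
      then have g: "g \<in> H"
        by (simp add: H_def)
      let ?g = "g \<star> invg h"
      have "?g \<in> H"
        using g w \<rho>H by (simp add: H_mult H_inv)
      from step[OF this w(1)] have "connected_component_of (mtop HM) ?g (?g \<star> \<rho> w)" .
      moreover have "?g \<star> \<rho> w = g"
        using H_carrier[OF g] \<rho>G[OF w(1)] w(2) by (simp add: G.m_assoc)
      ultimately show "connected_component_of (mtop HM) g ?g"
        by (simp add: connected_component_of_sym)
    qed
  next
    case (eng h1 h2)
    show ?case
    proof
      fix g assume "g \<in> generate \<G> (\<rho> ` V)"
      then have g: "g \<in> H"
        by (simp add: H_def)
      have h: "h1 \<in> H" "h2 \<in> H"
        using eng.hyps by (simp_all add: H_def)
      have "connected_component_of (mtop HM) g (g \<star> h1)"
        using eng.IH(1) g by (simp add: H_def)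
      moreover have "connected_component_of (mtop HM) (g \<star> h1) (g \<star> h1 \<star> h2)"
        using eng.IH(2) H_mult[OF g h(1)] by (simp add: H_def)
      ultimately have "connected_component_of (mtop HM) g (g \<star> h1 \<star> h2)"
        by (rule connected_component_of_trans)
      then show "connected_component_of (mtop HM) g (g \<star> (h1 \<star> h2))"
        using g h H_carrier by (simp add: G.m_assoc)
    qed
  qed
  then have "connected_component_of (mtop HM) \<u> h" if "h \<in> H" for h
    using that H_one H_carrier by force
  then show ?thesis
    unfolding connected_space_iff_connected_component HM_points
    by (metis connected_component_of_sym connected_component_of_trans)
qed

end

section \<open>Lie algebras of locally isomorphic groups\<close>

lemma left_translation_diffeo:
  fixes G (structure)
  assumes G: "lie_group G M" and g: "g \<in> carrier G"
  shows "left_translation G g \<in> diffeos M"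
    and "inverse_on (mpoints M) (left_translation G g) = left_translation G (inv g)"
proof -
  interpret group G
    by (rule lie_group_group[OF G])
  note M = lie_group_mfd[OF G] and pts = lie_group_points[OF G]
  have inj: "inj_on (left_translation G g) (carrier G)"
    by (auto simp: left_translation_def inj_on_def g)
  have onto: "left_translation G g ` carrier G = carrier G"
  proof (intro equalityI subsetI)
    fix p assume "p \<in> carrier G"
    then show "p \<in> left_translation G g ` carrier G"
      by (intro image_eqI[of _ _ "inv g \<otimes> p"]) (simp_all add: left_translation_def g m_assoc[symmetric])
  qed (auto simp: left_translation_def g)
  show inv: "inverse_on (mpoints M) (left_translation G g) = left_translation G (inv g)"
  proof
    fix p
    have "inv_into (carrier G) (left_translation G g) p = inv g \<otimes> p" if "p \<in> carrier G"
      using that g by (intro inv_into_f_eq[OF inj]) (simp_all add: left_translation_def m_assoc[symmetric])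
    then show "inverse_on (mpoints M) (left_translation G g) p = left_translation G (inv g) p"
      by (auto simp: inverse_on_def left_translation_def pts)
  qed
  have s: "smooth_map M M (left_translation G a)" if "a \<in> carrier G" for a
    unfolding smooth_map_iff_smap[OF M M] pts
    by (rule smap_cong[OF M smap_left[OF G that]]) (simp add: left_translation_def)
  show "left_translation G g \<in> diffeos M"
    using s[OF g] s[of "inv g"] inj onto g inv
    by (simp add: diffeos_def Bij_def bij_betw_def pts) (simp add: left_translation_def)
qed

text \<open>Left invariance moves the evaluation from \<open>g\<close> to the unit, and locality
  lets any global \<open>E\<close> with the germ of the translated function take its place.\<close>

lemma lie_algebra_at:
  fixes G (structure)
  assumes G: "lie_group G M" and X: "X \<in> lie_algebra G M" and f: "f \<in> smooth_funs M" and g: "g \<in> carrier G"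
    and E: "E \<in> smooth_funs M" and N: "mopen M N" "\<one> \<in> N" "\<And>x. x \<in> N \<Longrightarrow> E x = f (g \<otimes> x)"
  shows "X f g = X E \<one>"
proof -
  interpret group G
    by (rule lie_group_group[OF G])
  note M = lie_group_mfd[OF G] and pts = lie_group_points[OF G] and F = left_translation_diffeo(1)[OF G g]
  have X': "X \<in> vector_fields M" "pushforward M (left_translation G g) X = X"
    using X g by (auto simp: lie_algebra_def)
  have "X f g = X (pullback M (left_translation G g) f) \<one>"
    using pushforward_at[OF M F f, of \<one> X] X'(2) pts g by (simp add: left_translation_def)
  also have "\<dots> = X E \<one>"
    by (rule tangent_local[OF M vf_tangent[OF X'(1)] pullback_smooth[OF M M diffeo_smap[OF M F] f] E N(1,2)])
      (use N(3) openin_subset[OF N(1)] pts in \<open>auto simp: pullback_def left_translation_def\<close>)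
  finally show ?thesis .
qed

lemma lie_algebraI:
  fixes G (structure)
  assumes G: "lie_group G M" and X: "X \<in> vector_fields M"
    and eq: "\<And>f g p. f \<in> smooth_funs M \<Longrightarrow> g \<in> carrier G \<Longrightarrow> p \<in> carrier G \<Longrightarrow>
      X (pullback M (left_translation G g) f) p = X f (g \<otimes> p)"
  shows "X \<in> lie_algebra G M"
proof -
  interpret group G
    by (rule lie_group_group[OF G])
  note M = lie_group_mfd[OF G] and pts = lie_group_points[OF G]
  have pb: "pullback M (left_translation G g) Z p = (if p \<in> carrier G then Z (g \<otimes> p) else 0)" for g Z p
    by (simp add: pullback_def left_translation_def pts)
  have "pushforward M (left_translation G g) X f p = X f p" if g: "g \<in> carrier G" for f g p
  proof (cases "f \<in> smooth_funs M")
    case True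
    then show ?thesis
      using eq[OF True g, of "inv g \<otimes> p"] g smooth_funs_outside[OF vf_smooth[OF X True], of p]
      unfolding pushforward_def left_translation_diffeo(2)[OF G g] pb[of "inv g"]
      by (cases "p \<in> carrier G") (simp_all add: pts m_assoc[symmetric])
  qed (simp add: pushforward_def vf_junk[OF X])
  then show ?thesis
    using X by (auto simp: lie_algebra_def intro!: ext)
qed

text \<open>The assumption on \<open>\<sigma>\<close> includes that the image of \<open>V\<close> is
  open in \<open>B\<close>.\<close>

locale local_iso =
  fixes \<A> :: "'a monoid" and A :: "'a mfd" and \<B> :: "'b monoid" and B :: "'b mfd" and V \<rho> \<sigma>
  assumes lieA: "lie_group \<A> A" and lieB: "lie_group \<B> B"
    and V: "mopen A V" and one: "\<one>\<^bsub>\<A>\<^esub> \<in> V" and \<rho>: "smap A B V \<rho>"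
    and \<sigma>: "smap B A (\<rho> ` V) \<sigma>" and \<sigma>\<rho>: "\<And>x. x \<in> V \<Longrightarrow> \<sigma> (\<rho> x) = x"
    and hom: "\<And>x y. x \<in> V \<Longrightarrow> y \<in> V \<Longrightarrow> x \<otimes>\<^bsub>\<A>\<^esub> y \<in> V \<Longrightarrow> \<rho> (x \<otimes>\<^bsub>\<A>\<^esub> y) = \<rho> x \<otimes>\<^bsub>\<B>\<^esub> \<rho> y"
begin

abbreviation mul_a (infixl \<open>\<cdot>\<close> 70) where "x \<cdot> y \<equiv> x \<otimes>\<^bsub>\<A>\<^esub> y"
abbreviation mul_b (infixl \<open>\<star>\<close> 70) where "x \<star> y \<equiv> x \<otimes>\<^bsub>\<B>\<^esub> y"
abbreviation one_a (\<open>\<e>\<close>) where "\<e> \<equiv> \<one>\<^bsub>\<A>\<^esub>"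

lemmas Am = lie_group_mfd[OF lieA] and Bm = lie_group_mfd[OF lieB]
  and Apts = lie_group_points[OF lieA] and Bpts = lie_group_points[OF lieB]

sublocale A: group \<A>
  by (rule lie_group_group[OF lieA])

sublocale B: group \<B>
  by (rule lie_group_group[OF lieB])

lemma VA: "x \<in> V \<Longrightarrow> x \<in> carrier \<A>"
  using openin_subset[OF V] Apts by auto

lemma \<rho>B: "x \<in> V \<Longrightarrow> \<rho> x \<in> carrier \<B>"
  using smap_into[OF \<rho>] Bpts by auto

lemma \<rho>_one: "\<rho> \<e> = \<one>\<^bsub>\<B>\<^esub>"
  using hom[OF one one] one \<rho>B[OF one] by (simp add: B.r_cancel_one)

text \<open>\<open>E\<close> is a global representative of the germ at the unit of
  \<open>f (h \<star> \<rho> x)\<close>, as needed to apply vector fields of \<open>A\<close> to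
  it.\<close>

definition germ :: "('b \<Rightarrow> real) \<Rightarrow> 'b \<Rightarrow> ('a \<Rightarrow> real) \<Rightarrow> 'a set \<Rightarrow> bool"
  where "germ f h E N \<longleftrightarrow> E \<in> smooth_funs A \<and> mopen A N \<and> \<e> \<in> N \<and> N \<subseteq> V \<and> (\<forall>x\<in>N. E x = f (h \<star> \<rho> x))"

text \<open>The left-invariant field on \<open>B\<close> whose value at the unit is the image of
  that of \<open>X\<close> under the differential of \<open>\<rho>\<close>. The choice of the
  representative is immaterial by \<open>transfer_eq\<close>.\<close>

definition transfer :: "'a vfield \<Rightarrow> 'b vfield"
  where "transfer X f h =
    (if f \<in> smooth_funs B \<and> h \<in> carrier \<B> then X (SOME E. \<exists>N. germ f h E N) \<e> else 0)"

lemma germ_exists: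
  assumes f: "f \<in> smooth_funs B" and h: "h \<in> carrier \<B>"
  obtains E N where "germ f h E N"
proof -
  have s: "smap A B V (\<lambda>x. h \<star> \<rho> x)"
    using h Bpts by (intro smap_mult[OF lieB Am] smap_const[OF Am V] \<rho>) simp
  have "msmooth A {x \<in> V. h \<star> \<rho> x \<in> mpoints B} (\<lambda>x. f (h \<star> \<rho> x))"
    using smap_msmooth[OF Am Bm s] f smooth_funs_iff[OF Bm] by blast
  moreover have "{x \<in> V. h \<star> \<rho> x \<in> mpoints B} = V"
    using smap_into[OF s] by auto
  ultimately have "msmooth A V (\<lambda>x. f (h \<star> \<rho> x))"
    by simp
  then obtain E N where "E \<in> smooth_funs A" "mopen A N" "\<e> \<in> N" "N \<subseteq> V" "\<And>x. x \<in> N \<Longrightarrow> E x = f (h \<star> \<rho> x)"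
    by (rule smooth_extension[OF Am _ one]) blast
  then show thesis
    using that[of E N] by (simp add: germ_def)
qed

lemma transfer_eq:
  assumes X: "X \<in> vector_fields A" and f: "f \<in> smooth_funs B" and h: "h \<in> carrier \<B>" and E: "germ f h E N"
  shows "transfer X f h = X E \<e>"
proof -
  define E' where "E' = (SOME E. \<exists>N. germ f h E N)"
  have "\<exists>N. germ f h E' N"
    using someI_ex[of "\<lambda>E. \<exists>N. germ f h E N"] E unfolding E'_def by blast
  then obtain N' where N': "germ f h E' N'"
    by blast
  have "X E' \<e> = X E \<e>"
    by (rule tangent_local[OF Am vf_tangent[OF X], of _ _ "N \<inter> N'"]) (use E N' in \<open>auto simp: germ_def\<close>)
  then show ?thesis
    using f h by (simp add: transfer_def E'_def)
qed

lemma left_preimage: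
  assumes w: "w \<in> N" and N: "mopen A N"
  shows "mopen A {x \<in> carrier \<A>. w \<cdot> x \<in> N}" "\<e> \<in> {x \<in> carrier \<A>. w \<cdot> x \<in> N}"
proof -
  have wA: "w \<in> carrier \<A>"
    using w openin_subset[OF N] Apts by auto
  from smap_preimage[OF smap_left[OF lieA wA] N] show "mopen A {x \<in> carrier \<A>. w \<cdot> x \<in> N}" .
  show "\<e> \<in> {x \<in> carrier \<A>. w \<cdot> x \<in> N}"
    using w wA by simp
qed

text \<open>Left invariance of \<open>X\<close> shifts the evaluation from the unit to
  \<open>w\<close>, and multiplicativity of \<open>\<rho>\<close> matches the germs. So the two
  fields are related by \<open>\<rho>\<close> followed by translation with \<open>h\<close>, the
  source of smoothness and of compatibility with brackets.\<close>

lemma transfer_near: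
  assumes X: "X \<in> lie_algebra \<A> A" and f: "f \<in> smooth_funs B" and h: "h \<in> carrier \<B>" and E: "germ f h E N" and w: "w \<in> N"
  shows "transfer X f (h \<star> \<rho> w) = X E w"
proof -
  have E': "E \<in> smooth_funs A" "mopen A N" "N \<subseteq> V" "\<And>x. x \<in> N \<Longrightarrow> E x = f (h \<star> \<rho> x)"
    using E by (auto simp: germ_def)
  have wV: "w \<in> V" and wA: "w \<in> carrier \<A>"
    using w E'(3) VA by auto
  have hw: "h \<star> \<rho> w \<in> carrier \<B>"
    using h \<rho>B[OF wV] by simp
  obtain E2 N2 where 2: "germ f (h \<star> \<rho> w) E2 N2"
    using germ_exists[OF f hw] .
  have XV: "X \<in> vector_fields A"
    using X by (simp add: lie_algebra_def)
  have "X E w = X E2 \<e>"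
  proof (rule lie_algebra_at[OF lieA X E'(1) wA])
    show "mopen A (N2 \<inter> {x \<in> carrier \<A>. w \<cdot> x \<in> N})" "\<e> \<in> N2 \<inter> {x \<in> carrier \<A>. w \<cdot> x \<in> N}" "E2 \<in> smooth_funs A"
      using 2 left_preimage[OF w E'(2)] by (auto simp: germ_def)
    fix x assume x: "x \<in> N2 \<inter> {x \<in> carrier \<A>. w \<cdot> x \<in> N}"
    then have xV: "x \<in> V" "w \<cdot> x \<in> V" and eq: "E2 x = f (h \<star> \<rho> w \<star> \<rho> x)"
      using 2 E'(3) by (auto simp: germ_def)
    then show "E2 x = E (w \<cdot> x)"
      using E'(4) x hom[OF wV xV] h \<rho>B[OF wV] \<rho>B[OF xV(1)] by (simp add: B.m_assoc)
  qed
  then show ?thesis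
    using transfer_eq[OF XV f hw 2] by simp
qed

lemma transfer_smooth:
  assumes X: "X \<in> lie_algebra \<A> A" and f: "f \<in> smooth_funs B"
  shows "transfer X f \<in> smooth_funs B"
proof -
  have "msmooth B (mpoints B) (transfer X f)"
  proof (rule msmooth_locally[OF Bm openin_topspace])
    fix h assume "h \<in> mpoints B"
    then have h: "h \<in> carrier \<B>"
      by (simp add: Bpts)
    obtain E N where E: "germ f h E N"
      using germ_exists[OF f h] .
    then have N: "mopen A N" "N \<subseteq> V" "\<e> \<in> N" "E \<in> smooth_funs A"
      by (auto simp: germ_def)
    have s: "smap B B (carrier \<B>) (\<lambda>g. inv\<^bsub>\<B>\<^esub> h \<star> g)"
      using h by (intro smap_left[OF lieB]) simp
    \<comment> \<open>Near \<open>h\<close> every point has the form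
      \<open>h \<star> \<rho> x\<close> with \<open>x\<close> recovered by \<open>\<sigma>\<close>,
      so \<open>transfer_near\<close> exhibits the transferred function as a composition of smooth
      maps.\<close>
    define P where "P = {g \<in> carrier \<B>. inv\<^bsub>\<B>\<^esub> h \<star> g \<in> \<rho> ` V}"
    have P: "mopen B P"
      unfolding P_def by (rule smap_preimage[OF s smap_open[OF \<sigma>]])
    have s2: "smap B A P (\<lambda>g. \<sigma> (inv\<^bsub>\<B>\<^esub> h \<star> g))"
      by (rule smap_compose[OF Bm Bm Am smap_subset[OF Bm s P _ Bm] \<sigma>]) (auto simp: P_def)
    have XE: "msmooth A N (X E)"
      using X N by (intro smooth_funs_msmooth[OF Am vf_smooth]) (auto simp: lie_algebra_def)
    have "msmooth B {g \<in> P. \<sigma> (inv\<^bsub>\<B>\<^esub> h \<star> g) \<in> N} (transfer X f)"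
    proof (rule msmooth_cong[OF Bm _ smap_msmooth[OF Bm Am s2 XE]])
      fix g assume g: "g \<in> {g \<in> P. \<sigma> (inv\<^bsub>\<B>\<^esub> h \<star> g) \<in> N}"
      then obtain x where x: "x \<in> V" "inv\<^bsub>\<B>\<^esub> h \<star> g = \<rho> x" "g \<in> carrier \<B>"
        by (auto simp: P_def)
      then have "g = h \<star> \<rho> x"
        using h by (metis B.inv_solve_left \<rho>B)
      then show "X E (\<sigma> (inv\<^bsub>\<B>\<^esub> h \<star> g)) = transfer X f g"
        using g x \<sigma>\<rho> transfer_near[OF X f h E] by simp
    qed
    moreover have "\<one>\<^bsub>\<B>\<^esub> \<in> \<rho> ` V"
      using one \<rho>_one by force
    ultimately show "\<exists>W. h \<in> W \<and> msmooth B W (transfer X f)"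
      using h N(3) \<sigma>\<rho>[OF one] by (intro exI[of _ "{g \<in> P. \<sigma> (inv\<^bsub>\<B>\<^esub> h \<star> g) \<in> N}"]) (simp add: P_def \<rho>_one)
  qed
  then show ?thesis
    by (simp add: smooth_funs_iff[OF Bm] transfer_def Bpts)
qed

lemma transfer_lie_algebra:
  assumes X: "X \<in> lie_algebra \<A> A"
  shows "transfer X \<in> lie_algebra \<B> B"
proof (rule lie_algebraI[OF lieB])
  have XV: "X \<in> vector_fields A"
    using X by (simp add: lie_algebra_def)
  have "transfer X (\<lambda>q. a * f q + g q) h = a * transfer X f h + transfer X g h \<and>
      transfer X (\<lambda>q. f q * g q) h = transfer X f h * g h + f h * transfer X g h"
    if fg: "f \<in> smooth_funs B" "g \<in> smooth_funs B" and h: "h \<in> carrier \<B>" for f g a h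
  proof -
    obtain E1 N1 where 1: "germ f h E1 N1"
      using germ_exists[OF fg(1) h] .
    obtain E2 N2 where 2: "germ g h E2 N2"
      using germ_exists[OF fg(2) h] .
    have E: "E1 \<in> smooth_funs A" "E2 \<in> smooth_funs A" "E1 \<e> = f h" "E2 \<e> = g h"
      using 1 2 h by (auto simp: germ_def \<rho>_one)
    have "germ (\<lambda>q. a * f q + g q) h (\<lambda>q. a * E1 q + E2 q) (N1 \<inter> N2)" "germ (\<lambda>q. f q * g q) h (\<lambda>q. E1 q * E2 q) (N1 \<inter> N2)"
      using 1 2 by (auto simp: germ_def intro: smooth_funs_add[OF Am] smooth_funs_cmult[OF Am] smooth_funs_mult[OF Am])
    moreover have "(\<lambda>q. a * f q + g q) \<in> smooth_funs B" "(\<lambda>q. f q * g q) \<in> smooth_funs B"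
      using fg by (auto intro: smooth_funs_add[OF Bm] smooth_funs_cmult[OF Bm] smooth_funs_mult[OF Bm])
    moreover note transfer_eq[OF XV fg(1) h 1] transfer_eq[OF XV fg(2) h 2]
      tangent_lin[OF vf_tangent[OF XV] E(1,2)] tangent_mult[OF vf_tangent[OF XV] E(1,2)]
    ultimately show ?thesis
      using transfer_eq[OF XV _ h, of "\<lambda>q. a * f q + g q" "\<lambda>q. a * E1 q + E2 q"]
        transfer_eq[OF XV _ h, of "\<lambda>q. f q * g q" "\<lambda>q. E1 q * E2 q"] E(3,4) by simp
  qed
  then show TV: "transfer X \<in> vector_fields B"
    by (intro vfI[OF _ transfer_smooth[OF X] _ Bm]) (auto simp: tangent_space_def transfer_def[of X f for f] Bpts)
  fix f g p assume f: "f \<in> smooth_funs B" and g: "g \<in> carrier \<B>" and p: "p \<in> carrier \<B>"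
  let ?f = "pullback B (left_translation \<B> g) f"
  have f': "?f \<in> smooth_funs B"
    by (rule pullback_smooth[OF Bm Bm diffeo_smap[OF Bm left_translation_diffeo(1)[OF lieB g]] f])
  have gp: "g \<star> p \<in> carrier \<B>"
    using g p by simp
  obtain E N where E: "germ f (g \<star> p) E N"
    using germ_exists[OF f gp] .
  then have "germ ?f p E N"
    using g p \<rho>B by (fastforce simp: germ_def pullback_def left_translation_def Bpts B.m_assoc)
  then show "transfer X ?f p = transfer X f (g \<star> p)"
    using transfer_eq[OF XV f gp E] transfer_eq[OF XV f' p] by simp
qed

text \<open>By \<open>transfer_near\<close>, if \<open>E\<close> represents the germ of
  \<open>f\<close>, then \<open>X E\<close> represents that of \<open>transfer X f\<close>; second
  derivatives are then transferred in the same way.\<close>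

lemma transfer_bracket:
  assumes X: "X \<in> lie_algebra \<A> A" and Y: "Y \<in> lie_algebra \<A> A"
  shows "transfer (lie_bracket X Y) = lie_bracket (transfer X) (transfer Y)"
proof (intro ext)
  fix f h
  have XY: "X \<in> vector_fields A" "Y \<in> vector_fields A"
    using X Y by (auto simp: lie_algebra_def)
  have Z: "transfer X (\<lambda>q. 0) h = 0" if X: "X \<in> lie_algebra \<A> A" for X
    using tangent_zero[OF Bm vf_tangent] transfer_lie_algebra[OF X] unfolding lie_algebra_def by blast
  show "transfer (lie_bracket X Y) f h = lie_bracket (transfer X) (transfer Y) f h"
  proof (cases "f \<in> smooth_funs B \<and> h \<in> carrier \<B>")
    case False
    then have "transfer Y f = (\<lambda>q. 0) \<and> transfer X f = (\<lambda>q. 0) \<or> h \<notin> carrier \<B>"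
      by (auto simp: transfer_def)
    then show ?thesis
      using False Z[OF X] Z[OF Y] by (auto simp: lie_bracket_def) (auto simp: transfer_def)
  next
    case True
    then have f: "f \<in> smooth_funs B" and h: "h \<in> carrier \<B>"
      by auto
    obtain E N where E: "germ f h E N"
      using germ_exists[OF f h] .
    have germ: "germ (transfer X f) h (X E) N" if X: "X \<in> lie_algebra \<A> A" for X
      using E transfer_near[OF X f h E] X by (auto simp: germ_def lie_algebra_def vf_smooth)
    then show ?thesis
      using transfer_eq[OF vf_lie_bracket[OF Am XY] f h E] transfer_eq[OF XY(1) transfer_smooth[OF Y f] h germ[OF Y]]
        transfer_eq[OF XY(2) transfer_smooth[OF X f] h germ[OF X]]
      by (simp add: lie_bracket_def)
  qed
qed

lemma transfer_lin: "transfer (\<lambda>f p. a * X f p + Y f p) = (\<lambda>f p. a * transfer X f p + transfer Y f p)"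
  by (intro ext) (simp add: transfer_def)

text \<open>The domain has to shrink: multiplicativity of \<open>\<sigma>\<close> follows from that
  of \<open>\<rho>\<close> only for products that remain in \<open>V\<close>, and continuity of
  multiplication provides such a \<open>P\<close>.\<close>

lemma inverse_local_iso:
  obtains P where "local_iso \<B> B \<A> A (\<rho> ` P) \<sigma> \<rho>" "P \<subseteq> V"
proof -
  define S where "S = {z \<in> V \<times> V. fst z \<cdot> snd z \<in> V}"
  have "mopen (prod_mfd A A) (V \<times> V)"
    using V by (simp add: openin_prod_Times_iff)
  then have "mopen (prod_mfd A A) (V \<times> V \<inter> {z \<in> carrier \<A> \<times> carrier \<A>. fst z \<cdot> snd z \<in> V})"
    using smap_preimage[OF lie_group_mult[OF lieA] V] by blast
  moreover have "V \<times> V \<inter> {z \<in> carrier \<A> \<times> carrier \<A>. fst z \<cdot> snd z \<in> V} = S"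
    using VA by (auto simp: S_def)
  ultimately have S: "openin (prod_topology (mtop A) (mtop A)) S"
    by simp
  have "(\<e>, \<e>) \<in> S"
    using one by (simp add: S_def)
  then obtain P1 P2 where P12: "mopen A P1" "mopen A P2" "\<e> \<in> P1" "\<e> \<in> P2" "P1 \<times> P2 \<subseteq> S"
    using S unfolding openin_prod_topology_alt by meson
  define P where "P = P1 \<inter> P2"
  have P: "mopen A P" "\<e> \<in> P" "P \<subseteq> V" "\<And>x y. x \<in> P \<Longrightarrow> y \<in> P \<Longrightarrow> x \<cdot> y \<in> V"
    using P12 by (auto simp: P_def S_def)
  have "\<rho> ` P = {y \<in> \<rho> ` V. \<sigma> y \<in> P}"
    using P(3) \<sigma>\<rho> by force
  then have op: "mopen B (\<rho> ` P)"
    using smap_preimage[OF \<sigma> P(1)] by simp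
  have im: "\<sigma> ` \<rho> ` P = P"
    using \<sigma>\<rho> P(3) by force
  have "local_iso \<B> B \<A> A (\<rho> ` P) \<sigma> \<rho>"
  proof
    show "smap B A (\<rho> ` P) \<sigma>"
      by (rule smap_subset[OF Bm \<sigma> op _ Am]) (use P(3) in auto)
    show "smap A B (\<sigma> ` \<rho> ` P) \<rho>"
      unfolding im by (rule smap_subset[OF Am \<rho> P(1,3) Bm])
    show "\<one>\<^bsub>\<B>\<^esub> \<in> \<rho> ` P"
      using P(2) \<rho>_one by force
    show "\<rho> (\<sigma> x) = x" if "x \<in> \<rho> ` P" for x
      using that \<sigma>\<rho> P(3) by force
    fix x y assume "x \<in> \<rho> ` P" "y \<in> \<rho> ` P"
    then obtain u v where uv: "u \<in> P" "v \<in> P" "x = \<rho> u" "y = \<rho> v"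
      by blast
    have "x \<star> y = \<rho> (u \<cdot> v)"
      using hom[of u v] P uv by (auto simp: subset_iff)
    then show "\<sigma> (x \<star> y) = \<sigma> x \<cdot> \<sigma> y"
      using uv P \<sigma>\<rho> by (auto simp: subset_iff)
  qed (rule lieA lieB op)+
  then show thesis
    using that P(3) by blast
qed

lemma transfer_inverse:
  assumes "local_iso \<B> B \<A> A (\<rho> ` P) \<sigma> \<rho>" and PV: "P \<subseteq> V" and X: "X \<in> lie_algebra \<A> A"
  shows "local_iso.transfer \<B> B \<A> A (\<rho> ` P) \<sigma> (transfer X) = X"
proof (intro ext)
  interpret I: local_iso \<B> B \<A> A "\<rho> ` P" \<sigma> \<rho>
    by fact
  fix f p
  note TV = transfer_lie_algebra[OF X]
  have XV: "X \<in> vector_fields A" "transfer X \<in> vector_fields B"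
    using X TV by (auto simp: lie_algebra_def)
  show "I.transfer (transfer X) f p = X f p"
  proof (cases "f \<in> smooth_funs A \<and> p \<in> carrier \<A>")
    case False
    then show ?thesis
      using vf_junk[OF XV(1)] smooth_funs_outside[OF vf_smooth[OF XV(1)], of f p] Apts
      by (cases "f \<in> smooth_funs A") (auto simp: I.transfer_def)
  next
    case True
    then have f: "f \<in> smooth_funs A" and p: "p \<in> carrier \<A>"
      by auto
    obtain E1 N1 where 1: "I.germ f p E1 N1"
      using I.germ_exists[OF f p] .
    have E1: "E1 \<in> smooth_funs B"
      using 1 by (simp add: I.germ_def)
    obtain E2 N2 where 2: "germ E1 \<one>\<^bsub>\<B>\<^esub> E2 N2"
      using germ_exists[OF E1 B.one_closed] .
    have "I.transfer (transfer X) f p = X E2 \<e>"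
      using I.transfer_eq[OF XV(2) f p 1] transfer_eq[OF XV(1) E1 B.one_closed 2] by simp
    also have "\<dots> = X f p"
    proof (rule lie_algebra_at[OF lieA X f p, symmetric])
      have "mopen A {x \<in> V. \<rho> x \<in> N1}"
        using 1 by (intro smap_preimage[OF \<rho>]) (simp add: I.germ_def)
      then show "mopen A (N2 \<inter> {x \<in> V. \<rho> x \<in> N1})" "\<e> \<in> N2 \<inter> {x \<in> V. \<rho> x \<in> N1}" "E2 \<in> smooth_funs A"
        using 1 2 one by (auto simp: germ_def I.germ_def \<rho>_one)
      show "E2 x = f (p \<cdot> x)" if "x \<in> N2 \<inter> {x \<in> V. \<rho> x \<in> N1}" for x
        using that 1 2 \<sigma>\<rho> \<rho>B by (auto simp: germ_def I.germ_def)
    qed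
    finally show ?thesis .
  qed
qed

theorem locally_isomorphic: "locally_isomorphic \<A> A \<B> B"
proof -
  obtain P where I: "local_iso \<B> B \<A> A (\<rho> ` P) \<sigma> \<rho>" and P: "P \<subseteq> V"
    using inverse_local_iso .
  interpret I: local_iso \<B> B \<A> A "\<rho> ` P" \<sigma> \<rho>
    by (rule I)
  obtain Q where J: "local_iso \<A> A \<B> B (\<sigma> ` Q) \<rho> \<sigma>" and Q: "Q \<subseteq> \<rho> ` P"
    using I.inverse_local_iso .
  interpret J: local_iso \<A> A \<B> B "\<sigma> ` Q" \<rho> \<sigma>
    by (rule J)
  have QV: "\<sigma> ` Q \<subseteq> V"
    using Q P \<sigma>\<rho> by force
  \<comment> \<open>\<open>J\<close> is again \<open>\<rho>\<close>, restricted to a smaller set.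
    Transfer depends on germs at the unit only, so the right inverse of \<open>I.transfer\<close> is
    \<open>transfer\<close> itself.\<close>
  have "J.transfer X = transfer X" if X: "X \<in> lie_algebra \<A> A" for X
  proof (intro ext)
    fix f h
    show "J.transfer X f h = transfer X f h"
    proof (cases "f \<in> smooth_funs B \<and> h \<in> carrier \<B>")
      case True
      then obtain E N where E: "J.germ f h E N"
        using J.germ_exists by blast
      then have "germ f h E N"
        using QV unfolding J.germ_def germ_def by blast
      then show ?thesis
        using True X E transfer_eq J.transfer_eq by (metis (no_types, lifting) lie_algebra_def mem_Collect_eq)
    qed (auto simp: transfer_def J.transfer_def)
  qed
  then have "transfer (I.transfer Y) = Y" if "Y \<in> lie_algebra \<B> B" for Y
    using I.transfer_inverse[OF J Q that] I.transfer_lie_algebra[OF that] by simp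
  then have "bij_betw transfer (lie_algebra \<A> A) (lie_algebra \<B> B)"
    using transfer_inverse[OF I P] transfer_lie_algebra I.transfer_lie_algebra
    by (intro bij_betw_byWitness[of _ I.transfer]) auto
  then show ?thesis
    unfolding locally_isomorphic_def using transfer_lin transfer_bracket by blast
qed

end

section \<open>The inclusion of the subgroup is an immersion\<close>

lemma sum_split_add: "(\<Sum>j<n + m. f j) = (\<Sum>j<n. f j) + (\<Sum>j<m. f (n + j))" for f :: "nat \<Rightarrow> real"
  by (induction m) auto

text \<open>\<open>F\<close> is a group multiplication in a chart around the unit \<open>x0\<close>.
  The left unit law makes its derivative in the second argument the identity at
  \<open>(x0, x0)\<close>, continuity keeps it within \<open>\<epsilon>\<close> nearby, and the mean
  value theorem in the second argument, starting from the right unit law, gives the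
  estimate.\<close>

lemma multiplication_estimate:
  assumes Z: "eopen (n + n) Z" and x0: "x0 \<in> euc n" "join n x0 x0 \<in> Z" and \<epsilon>: "\<epsilon> > 0"
    and F: "\<And>i. i < n \<Longrightarrow> smooth_on (n + n) Z (F i)"
    and left: "\<And>i y. i < n \<Longrightarrow> y \<in> euc n \<Longrightarrow> join n x0 y \<in> Z \<Longrightarrow> F i (join n x0 y) = y i"
    and right: "\<And>i x. i < n \<Longrightarrow> x \<in> euc n \<Longrightarrow> join n x x0 \<in> Z \<Longrightarrow> F i (join n x x0) = x i"
  shows "\<exists>r>0. ebox (n + n) (join n x0 x0) r \<subseteq> Z \<and> (\<forall>x\<in>ebox n x0 r. \<forall>e\<in>euc n. (\<forall>j<n. \<bar>e j\<bar> < r) \<longrightarrow>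
    (\<forall>i<n. \<bar>F i (join n x (\<lambda>j. x0 j + e j)) - x i - e i\<bar> \<le> \<epsilon> * (\<Sum>j<n. \<bar>e j\<bar>)))"
proof -
  let ?z = "join n x0 x0"
  define d where "d i j z = pderiv_at (n + j) (F i) z - (if i = j then 1 else 0)" for i j z
  have pd: "has_pderiv j (F i) z (pderiv_at j (F i) z)" "continuous_on Z (pderiv_at j (F i))"
    if "i < n" "j < n + n" "z \<in> Z" for i j z
    using smooth_on_has_pderiv[OF Z F that(2,3)] smooth_on_continuous[OF Z smooth_on_pderiv_at[OF Z F]] that by auto
  obtain r where r: "r > 0" "ebox (n + n) ?z r \<subseteq> Z"
    and near: "\<And>a y. a \<in> {..<n} \<times> {..<n} \<Longrightarrow> y \<in> ebox (n + n) ?z r \<Longrightarrow> \<bar>d (fst a) (snd a) y - d (fst a) (snd a) ?z\<bar> < \<epsilon>"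
    by (rule continuous_on_box_family[of "{..<n} \<times> {..<n}" "n + n" Z "\<lambda>a. d (fst a) (snd a)", OF _ Z _ x0(2) \<epsilon>])
      (auto simp: d_def intro!: continuous_intros pd(2)[OF _ _ x0(2)])
  have d0: "d i j ?z = 0" if ij: "i < n" "j < n" for i j
  proof -
    have "has_pderiv (n + j) (F i) ?z (if n + j = n + i then 1 else 0)"
    proof -
      define Z' where "Z' t = ?z(n + j := t)" for t
      have eq: "?z(n + j := t) = join n x0 (x0(j := t))" for t
        by (auto simp: join_def fun_eq_iff)
      have "eventually (\<lambda>t. ?z(n + j := t) \<in> Z) (nhds (?z (n + j)))"
        using eventually_upd[OF Z x0(2)] ij by simp
      then have "eventually (\<lambda>t. (?z(n + j := t)) (n + i) = F i (?z(n + j := t))) (nhds (?z (n + j)))"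
      proof eventually_elim
        case (elim t)
        have "x0(j := t) \<in> euc n"
          using x0(1) ij by (auto simp: euc_def)
        then show ?case
          using left[OF ij(1)] elim unfolding eq by (simp add: join_def)
      qed
      then show ?thesis
        using has_pderiv_coord[of "n + j" "n + i" ?z] unfolding has_pderiv_def
        by (rule DERIV_cong_ev[THEN iffD1, OF refl _ refl])
    qed
    then show ?thesis
      using pderiv_at_eq by (fastforce simp: d_def)
  qed
  have small: "\<bar>d i j y\<bar> \<le> \<epsilon>" if "i < n" "j < n" "y \<in> ebox (n + n) ?z r" for i j y
    using near[of "(i, j)" y] d0[OF that(1,2)] that by simp
  have "\<bar>F i (join n x (\<lambda>j. x0 j + e j)) - x i - e i\<bar> \<le> \<epsilon> * (\<Sum>j<n. \<bar>e j\<bar>)"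
    if x: "x \<in> ebox n x0 r" and e: "e \<in> euc n" "\<And>j. j < n \<Longrightarrow> \<bar>e j\<bar> < r" and i: "i < n" for x e i
  proof -
    let ?a = "join n x x0" and ?b = "join n x (\<lambda>j. x0 j + e j)"
    have ab: "?a \<in> ebox (n + n) ?z r" "?b \<in> ebox (n + n) ?z r"
      using x x0(1) e r(1) by (auto simp: ebox_def euc_def join_def)
    have seg: "(\<lambda>i. ?a i + t * (?b i - ?a i)) \<in> ebox (n + n) ?z r" if "0 \<le> t" "t \<le> 1" for t
      by (rule ebox_segment[OF ab that])
    obtain t where t: "0 \<le> t" "t \<le> 1"
      "F i ?b - F i ?a = (\<Sum>j<n + n. pderiv_at j (F i) (\<lambda>i. ?a i + t * (?b i - ?a i)) * (?b j - ?a j))"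
      by (rule mean_value_segment[of "n + n" Z ?a ?b "F i" "\<lambda>j. pderiv_at j (F i)"])
        (use Z ab seg r(2) pd i x0(2) ebox_subset in \<open>auto simp: subset_iff\<close>)
    let ?c = "\<lambda>i. ?a i + t * (?b i - ?a i)"
    have "F i ?b - F i ?a = (\<Sum>j<n. pderiv_at (n + j) (F i) ?c * e j)"
      unfolding t(3) sum_split_add by (simp add: join_def)
    moreover have "(\<Sum>j<n. (if i = j then 1 else 0) * e j) = (\<Sum>j<n. if i = j then e j else 0)"
      by (rule sum.cong) auto
    ultimately have "F i ?b - F i ?a - e i = (\<Sum>j<n. d i j ?c * e j)"
      using i by (simp add: d_def left_diff_distrib sum_subtractf)
    then have "\<bar>F i ?b - F i ?a - e i\<bar> \<le> (\<Sum>j<n. \<bar>d i j ?c * e j\<bar>)"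
      by (simp only: sum_abs)
    also have "\<dots> \<le> (\<Sum>j<n. \<epsilon> * \<bar>e j\<bar>)"
      unfolding abs_mult using small[OF i _ seg[OF t(1,2)]] by (intro sum_mono mult_right_mono) auto
    finally have "\<bar>F i ?b - F i ?a - e i\<bar> \<le> \<epsilon> * (\<Sum>j<n. \<bar>e j\<bar>)"
      by (simp add: sum_distrib_left)
    moreover have "F i ?a = x i"
      using right[OF i, of x] ab(1) r(2) x by (auto simp: ebox_def)
    ultimately show ?thesis
      by (simp add: algebra_simps)
  qed
  then show ?thesis
    using r(1,2) by blast
qed

locale local_matrix_hom = local_hom \<A> \<G> A GM U \<phi> V \<rho>
  for \<A> :: "'a monoid" and \<G> :: "(nat \<Rightarrow> real) monoid" and A GM U \<phi> V \<rho> +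
  fixes N W
  assumes GM: "GM = \<lparr>mtop = subtopology (Euclidean_space (N * N)) W, mdim = N * N, matlas = {(W, \<lambda>x. x)}\<rparr>"
    and W: "eopen (N * N) W" and mult: "\<And>x y. x \<otimes>\<^bsub>\<G>\<^esub> y = mmul N x y" and one: "\<one>\<^bsub>\<G>\<^esub> = mone N"
begin

abbreviation n where "n \<equiv> mdim A"
abbreviation pt where "pt \<equiv> inv_into U \<phi>"
abbreviation base where "base \<equiv> \<phi> \<one>\<^bsub>\<A>\<^esub>"

lemma points: "mpoints GM = W"
  using W by (simp add: GM eopen_subset Int_absorb1)

lemma smap_GM_coord:
  assumes F: "smap X GM P F" and k: "k < N * N"
  shows "msmooth X P (\<lambda>p. F p k)"
proof -
  have "msmooth X {p \<in> P. F p \<in> W} (\<lambda>p. F p k)"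
    using smap_coord[OF F, of W "\<lambda>x. x" k] k by (simp add: GM)
  moreover have "{p \<in> P. F p \<in> W} = P"
    using smap_into[OF F] points by auto
  ultimately show ?thesis
    by simp
qed

lemma GM_euc: "x \<in> W \<Longrightarrow> x \<in> euc (N * N)"
  using eopen_subset[OF W] by blast

lemma coords_open: "eopen n (\<phi> ` V)"
  using chart_image_open[OF Am chart Vopen] VU by (simp add: Int_absorb1)

lemma rho_coord_smooth: "k < N * N \<Longrightarrow> smooth_on n (\<phi> ` V) (\<lambda>x. \<rho> (pt x) k)"
  using msmoothD[OF smap_GM_coord[OF \<rho>] chart] VU by (simp add: Int_absorb1)

text \<open>
  If \<open>d\<rho>\<close> killed a vector \<open>c\<close> with \<open>c j0 \<noteq> 0\<close>, take \<open>g\<close> with coordinates \<open>base + s c\<close>, where \<open>s = T / M\<close>.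
  The coordinate \<open>j0\<close> of \<open>g\<^sup>M\<close> stays within \<open>T \<bar>c j0\<bar> / 2\<close> of \<open>base j0 + T c j0\<close>, while \<open>\<rho> (g\<^sup>M)\<close> tends to the
  unit as \<open>M\<close> grows, contradicting injectivity of \<open>\<rho>\<close>. The powers of \<open>g\<close> replace the flow of a left-invariant field.
\<close>

lemma rho_rank:
  assumes c0: "\<And>k. k < N * N \<Longrightarrow> (\<Sum>i<n. c i * cpd U \<phi> i (\<lambda>x. \<rho> x k) \<e>) = 0" and j0: "j0 < n"
  shows "c j0 = 0"
proof (rule ccontr)
  assume cj0: "c j0 \<noteq> 0"
  define S where "S = (\<Sum>i<n. \<bar>c i\<bar>)"
  have cS: "\<bar>c i\<bar> \<le> S" if "i < n" for i
    unfolding S_def using that by (intro member_le_sum) auto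
  have S0: "S > 0"
    using cS[OF j0] cj0 by linarith
  \<comment> \<open>The relative error of one multiplication; \<open>\<epsilon> * S\<close> is half
    of \<open>\<bar>c j0\<bar>\<close>.\<close>
  define \<epsilon> where "\<epsilon> = \<bar>c j0\<bar> / (2 * S)"
  have \<epsilon>: "\<epsilon> > 0" "\<epsilon> * S = \<bar>c j0\<bar> / 2"
    using S0 cj0 by (auto simp: \<epsilon>_def)
  let ?P = "prod_mfd A A"
  let ?pc = "prod_chart n \<phi> \<phi>"
  note PM = smooth_manifold_prod[OF Am Am]
  have baseE: "base \<in> euc n"
    using chart_in_euc[OF Am chart] oneV VU by blast
  define Q where "Q = {z \<in> V \<times> V. fst z \<cdot> snd z \<in> V}"
  have pchart: "(U \<times> U, ?pc) \<in> matlas ?P"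
    using chart unfolding matlas_prod_mfd by blast
  have mul: "smap ?P A (carrier \<A> \<times> carrier \<A>) (\<lambda>z. fst z \<cdot> snd z)"
    by (rule lie_group_mult[OF lieA])
  have VV: "V \<times> V \<subseteq> carrier \<A> \<times> carrier \<A>"
    using VA by auto
  have "mopen ?P (V \<times> V \<inter> {z \<in> carrier \<A> \<times> carrier \<A>. fst z \<cdot> snd z \<in> V})"
    using smap_preimage[OF mul Vopen] Vopen by (intro openin_Int) (simp_all add: openin_prod_Times_iff)
  moreover have "V \<times> V \<inter> {z \<in> carrier \<A> \<times> carrier \<A>. fst z \<cdot> snd z \<in> V} = Q"
    using VV by (auto simp: Q_def)
  ultimately have Q: "mopen ?P Q"
    by metis
  define Z where "Z = ?pc ` (U \<times> U \<inter> Q)"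
  have Z: "eopen (n + n) Z"
    using chart_image_open[OF PM pchart Q] by (simp add: Z_def)
  define F where "F i z = \<phi> (fst (inv_into (U \<times> U) ?pc z) \<cdot> snd (inv_into (U \<times> U) ?pc z)) i" for i z
  have FQ: "join n (\<phi> p) (\<phi> q) \<in> Z \<longleftrightarrow> p \<cdot> q \<in> V" "F i (join n (\<phi> p) (\<phi> q)) = \<phi> (p \<cdot> q) i"
    if pq: "p \<in> V" "q \<in> V" for p q i
  proof -
    have pqU: "(p, q) \<in> U \<times> U"
      using pq VU by auto
    have eq: "join n (\<phi> p) (\<phi> q) = ?pc (p, q)"
      by (simp add: prod_chart_def)
    have "?pc (p, q) \<in> Z \<longleftrightarrow> (p, q) \<in> U \<times> U \<inter> Q"
      unfolding Z_def using inj_on_image_mem_iff[OF chart_inj[OF PM pchart] pqU] by blast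
    then show "join n (\<phi> p) (\<phi> q) \<in> Z \<longleftrightarrow> p \<cdot> q \<in> V"
      unfolding eq using pq pqU by (simp add: Q_def)
    show "F i (join n (\<phi> p) (\<phi> q)) = \<phi> (p \<cdot> q) i"
      unfolding eq F_def using chart_inv[OF PM pchart pqU] by simp
  qed
  have Zparts: "\<exists>p\<in>V. \<exists>q\<in>V. x = \<phi> p \<and> y = \<phi> q" if xy: "join n x y \<in> Z" "x \<in> euc n" for x y
  proof -
    obtain p q where pq: "p \<in> V" "q \<in> V" "join n x y = join n (\<phi> p) (\<phi> q)"
      using xy(1) by (auto simp: Z_def Q_def prod_chart_def)
    moreover have "\<phi> p \<in> euc n"
      using chart_in_euc[OF Am chart] pq VU by blast
    ultimately show ?thesis
      by (metis parts_join xy(2))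
  qed
  have z0: "join n base base \<in> Z"
    using FQ(1)[OF oneV oneV] oneV by simp
  have "\<exists>r>0. ebox (n + n) (join n base base) r \<subseteq> Z \<and> (\<forall>x\<in>ebox n base r. \<forall>e\<in>euc n. (\<forall>j<n. \<bar>e j\<bar> < r) \<longrightarrow>
    (\<forall>i<n. \<bar>F i (join n x (\<lambda>j. base j + e j)) - x i - e i\<bar> \<le> \<epsilon> * (\<Sum>j<n. \<bar>e j\<bar>)))"
  proof (rule multiplication_estimate[OF Z baseE z0 \<epsilon>(1)])
    fix i assume i: "i < n"
    have "msmooth ?P {z \<in> carrier \<A> \<times> carrier \<A>. fst z \<cdot> snd z \<in> U} (\<lambda>z. \<phi> (fst z \<cdot> snd z) i)"
      by (rule smap_coord[OF mul chart i])
    then have "msmooth ?P Q (\<lambda>z. \<phi> (fst z \<cdot> snd z) i)"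
      by (rule msmooth_subset[OF PM _ Q]) (use VV VU in \<open>auto simp: Q_def\<close>)
    from msmoothD[OF this pchart] show "smooth_on (n + n) Z (F i)"
      by (simp add: Z_def F_def[abs_def])
    show "F i (join n base y) = y i" if y: "y \<in> euc n" "join n base y \<in> Z" for y
      using Zparts[OF y(2) baseE] FQ(2)[OF oneV] VA by auto
    show "F i (join n x base) = x i" if x: "x \<in> euc n" "join n x base \<in> Z" for x
      using Zparts[OF x(2,1)] FQ(2)[OF _ oneV] VA by auto
  qed
  then obtain R1 where R1: "R1 > 0" "ebox (n + n) (join n base base) R1 \<subseteq> Z"
    "\<And>x e i. x \<in> ebox n base R1 \<Longrightarrow> e \<in> euc n \<Longrightarrow> (\<And>j. j < n \<Longrightarrow> \<bar>e j\<bar> < R1) \<Longrightarrow> i < n \<Longrightarrow>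
      \<bar>F i (join n x (\<lambda>j. base j + e j)) - x i - e i\<bar> \<le> \<epsilon> * (\<Sum>j<n. \<bar>e j\<bar>)"
    by blast
  define a where "a k x = \<rho> (pt x) k" for k x
  have a: "a k (\<phi> p) = \<rho> p k" if "p \<in> V" for k p
    using chart_inv[OF Am chart] that VU by (auto simp: a_def)
  have ca: "continuous_on (\<phi> ` V) (a k)" if "k < N * N" for k
    unfolding a_def by (rule smooth_on_continuous[OF coords_open rho_coord_smooth[OF that]])
  have "\<exists>d>0. \<exists>K\<ge>0. ebox n base d \<subseteq> \<phi> ` V \<and> (\<forall>f\<in>a ` {..<N * N}. \<forall>y\<in>ebox n base d. \<bar>f y\<bar> \<le> K)"
    by (rule locally_bounded_family[OF _ coords_open imageI[OF oneV]]) (use ca in auto)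
  then obtain R2 B where R2: "R2 > 0" "B \<ge> 0" "ebox n base R2 \<subseteq> \<phi> ` V" "\<And>k y. k < N * N \<Longrightarrow> y \<in> ebox n base R2 \<Longrightarrow> \<bar>a k y\<bar> \<le> B"
    by auto
  define R where "R = min R1 R2"
  have R: "R > 0" "R \<le> R1" "R \<le> R2"
    using R1(1) R2(1) by (auto simp: R_def)
  have aB: "\<bar>a k x\<bar> \<le> B" if "x \<in> ebox n base R" "k < N * N" for k x
    using R2(4)[OF that(2)] that(1) ebox_mono[OF R(3)] by blast
  \<comment> \<open>The powers drift by at most \<open>2 * T * S = R / 2\<close> in each coordinate,
    so all of them remain in the cube where the estimates hold.\<close>
  define T where "T = R / (4 * S)"
  have T: "T > 0" "T * S = R / 4"
    using R(1) S0 by (auto simp: T_def)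
  \<comment> \<open>The compact region in which the last power must end up. It excludes the unit, so
    by injectivity the distance \<open>f\<close> of the image from the unit matrix has a positive
    minimum there.\<close>
  define K where "K = {x \<in> cebox n base (R / 2). T * \<bar>c j0\<bar> / 2 \<le> \<bar>x j0 - base j0\<bar>}"
  define f where "f x = (\<Sum>k<N * N. \<bar>a k x - mone N k\<bar>)" for x
  have KR: "K \<subseteq> ebox n base R"
    using cebox_subset_ebox[of "R / 2" R n base] R(1) by (auto simp: K_def)
  have KD: "K \<subseteq> \<phi> ` V"
    using KR ebox_mono[OF R(3)] R2(3) by blast
  have "compact (cebox n base (R / 2))"
    using compact_cebox[of n base "R / 2"] by (simp add: Euclidean_space_eq compactin_subtopology)
  moreover have "closed {x :: nat \<Rightarrow> real. T * \<bar>c j0\<bar> / 2 \<le> \<bar>x j0 - base j0\<bar>}"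
    by (intro closed_Collect_le continuous_intros) auto
  moreover have "K = cebox n base (R / 2) \<inter> {x. T * \<bar>c j0\<bar> / 2 \<le> \<bar>x j0 - base j0\<bar>}"
    by (auto simp: K_def)
  ultimately have cK: "compact K"
    using compact_Int_closed by metis
  have cf: "continuous_on K f"
    unfolding f_def by (intro continuous_intros continuous_on_subset[OF ca KD]) auto
  have fpos: "f x > 0" if x: "x \<in> K" for x
  proof (rule ccontr)
    assume "\<not> f x > 0"
    moreover have "f x \<ge> 0"
      unfolding f_def by (intro sum_nonneg) auto
    ultimately have "f x = 0"
      by simp
    then have eq: "\<And>k. k < N * N \<Longrightarrow> a k x = mone N k"
      unfolding f_def by (subst (asm) sum_nonneg_eq_0_iff) auto
    obtain p where p: "p \<in> V" "x = \<phi> p"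
      using x KD by blast
    have "\<rho> p k = mone N k" for k
      using eq[of k] a[OF p(1)] p(2) GM_euc[of "\<rho> p"] mone_in_euc[of N] smap_into[OF \<rho> p(1)] points
      by (cases "k < N * N") (auto simp: euc_def)
    then have "\<rho> p = \<rho> \<e>"
      by (simp add: \<rho>_one one fun_eq_iff)
    then have "p = \<e>"
      using inj p(1) oneV by (auto dest: inj_onD)
    then show False
      using x p(2) T(1) cj0 by (auto simp: K_def mult_le_0_iff)
  qed
  obtain \<mu> where \<mu>: "\<mu> > 0" "\<And>x. x \<in> K \<Longrightarrow> \<mu> \<le> f x"
  proof (cases "K = {}")
    case True
    then show thesis
      using that[of 1] by simp
  next
    case False
    then show thesis
      using continuous_attains_inf[OF cK _ cf] that fpos by blast
  qed
  define q where "q = real (N * N) * (T * (N * B))"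
  \<comment> \<open>The accuracy of the linear approximation for which the total deviation of the
    matrix entries, at most \<open>q * \<eta>\<close>, stays below that minimum.\<close>
  define \<eta> where "\<eta> = \<mu> / (q + 1)"
  have q0: "q \<ge> 0"
    unfolding q_def using T(1) R2(2) by simp
  have \<eta>: "\<eta> > 0" "q * \<eta> < \<mu>"
    using \<mu>(1) q0 by (auto simp: \<eta>_def field_simps)
  define c' where "c' j = (if j < n then c j else 0)" for j
  define y where "y s = (\<lambda>j. base j + s * c' j)" for s
  have yeuc: "y s \<in> euc n" for s
    using baseE by (auto simp: y_def c'_def euc_def)
  have y0: "y 0 = base"
    by (simp add: y_def)
  \<comment> \<open>Along the line in direction \<open>c\<close> the derivative of every matrix
    entry vanishes at the base point, so the increment is smaller than any prescribed multiple of
    \<open>\<bar>s\<bar>\<close>.\<close>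
  have "eventually (\<lambda>s. \<forall>k\<in>{..<N * N}. \<bar>a k (y s) - a k base\<bar> \<le> \<eta> * \<bar>s\<bar>) (nhds 0)"
  proof (intro eventually_ball_finite ballI)
    fix k assume k: "k \<in> {..<N * N}"
    have "((\<lambda>s. a k (y s)) has_real_derivative (\<Sum>j<n. pderiv_at j (a k) (y 0) * c' j)) (at 0)"
    proof (rule chain_rule[OF coords_open])
      have sa: "smooth_on n (\<phi> ` V) (a k)"
        unfolding a_def using k rho_coord_smooth by simp
      show "has_pderiv j (a k) x (pderiv_at j (a k) x)" if "j < n" "x \<in> \<phi> ` V" for j x
        by (rule smooth_on_has_pderiv[OF coords_open sa that])
      show "continuous_on (\<phi> ` V) (pderiv_at j (a k))" if "j < n" for j
        by (rule smooth_on_continuous[OF coords_open smooth_on_pderiv_at[OF coords_open sa that]])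
      show "((\<lambda>s. y s j) has_real_derivative c' j) (at 0)" for j
        unfolding y_def by (auto intro!: derivative_eq_intros)
    qed (use yeuc y0 oneV in auto)
    moreover have "(\<Sum>j<n. pderiv_at j (a k) (y 0) * c' j) = 0"
      using c0[of k] k unfolding cpd_def a_def[abs_def] y0 by (simp add: c'_def mult.commute)
    ultimately have "((\<lambda>s. a k (y s)) has_derivative (\<lambda>h. 0)) (at 0)"
      by (simp add: has_field_derivative_def lambda_zero)
    then show "eventually (\<lambda>s. \<bar>a k (y s) - a k base\<bar> \<le> \<eta> * \<bar>s\<bar>) (nhds 0)"
      using \<eta>(1) unfolding has_derivative_at_alt eventually_nhds_metric by (simp add: y0 dist_real_def)
  qed simp
  then obtain \<delta> where \<delta>: "\<delta> > 0" "\<And>s k. \<bar>s\<bar> < \<delta> \<Longrightarrow> k < N * N \<Longrightarrow> \<bar>a k (y s) - a k base\<bar> \<le> \<eta> * \<bar>s\<bar>"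
    unfolding eventually_nhds_metric by (auto simp: dist_real_def)
  obtain M0 :: nat where M0: "T / \<delta> < M0"
    using reals_Archimedean2 by blast
  \<comment> \<open>With this many steps the step length \<open>T / M\<close> is below
    \<open>\<delta>\<close>; the successor also keeps \<open>M\<close> positive.\<close>
  define M where "M = Suc M0"
  define s where "s = T / M"
  have s: "s > 0" "M * s = T" "s < \<delta>"
    using T(1) \<delta>(1) M0 by (auto simp: s_def M_def field_simps)
  have sT: "s \<le> T"
    using T(1) by (simp add: s_def M_def field_simps)
  have sS: "s * S < R"
    using mult_right_mono[OF sT, of S] S0 T(2) R(1) by linarith
  have e: "(\<lambda>j. s * c' j) \<in> euc n" "\<And>j. j < n \<Longrightarrow> \<bar>s * c' j\<bar> < R"
  proof -
    show "(\<lambda>j. s * c' j) \<in> euc n"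
      by (simp add: euc_def c'_def)
    show "\<bar>s * c' j\<bar> < R" if "j < n" for j
    proof -
      have "s * \<bar>c j\<bar> \<le> s * S"
        using cS[OF that] s(1) by (intro mult_left_mono) auto
      then have "s * \<bar>c j\<bar> < R"
        using sS by linarith
      then show ?thesis
        using s(1) that by (simp add: c'_def abs_mult)
    qed
  qed
  have ybox: "y s \<in> ebox n base R"
    using e(2) yeuc by (simp add: ebox_def y_def)
  have "y s \<in> \<phi> ` V"
    using ybox ebox_mono[OF R(3)] R2(3) by blast
  then obtain g where g: "g \<in> V" "y s = \<phi> g"
    by blast
  define p where "p k = g [^]\<^bsub>\<A>\<^esub> (k :: nat)" for k
  have pA: "p k \<in> carrier \<A>" for k
    using VA[OF g(1)] by (simp add: p_def)
  have bound: "k * s * (\<bar>c i\<bar> + \<epsilon> * S) \<le> R / 2" if "k \<le> M" "i < n" for k i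
  proof -
    have "k * s \<le> T"
      using that(1) s by (metis mult_right_mono of_nat_le_iff less_imp_le)
    moreover have "\<bar>c i\<bar> + \<epsilon> * S \<le> 2 * S"
      using cS[OF that(2)] cS[OF j0] \<epsilon>(2) S0 by linarith
    ultimately have "k * s * (\<bar>c i\<bar> + \<epsilon> * S) \<le> T * (2 * S)"
      using T(1) \<epsilon>(1) S0 by (intro mult_mono) auto
    then show ?thesis
      using T(2) by simp
  qed
  \<comment> \<open>One further factor \<open>g\<close> adds \<open>s * c i\<close> to the
    coordinate up to an error \<open>s * (\<epsilon> * S)\<close>, but changes each matrix entry by
    at most \<open>s * (N * B * \<eta>)\<close>. Both bounds are proved together because the latter
    needs the power to be in the cube.\<close>
  have inv: "p k \<in> V \<and> (\<forall>i<n. \<bar>\<phi> (p k) i - base i - k * s * c i\<bar> \<le> k * s * (\<epsilon> * S))"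
    and rho: "\<forall>l<N * N. \<bar>\<rho> (p k) l - mone N l\<bar> \<le> k * s * (N * B * \<eta>)" if "k \<le> M" for k
  proof -
    have box: "\<phi> (p k) \<in> cebox n base (R / 2)"
      if "k \<le> M" "p k \<in> V" "\<forall>i<n. \<bar>\<phi> (p k) i - base i - k * s * c i\<bar> \<le> k * s * (\<epsilon> * S)" for k
    proof -
      have "\<bar>\<phi> (p k) i - base i\<bar> \<le> R / 2" if i: "i < n" for i
      proof -
        have "\<bar>\<phi> (p k) i - base i\<bar> \<le> k * s * (\<epsilon> * S) + \<bar>k * s * c i\<bar>"
          using that \<open>\<forall>i<n. _\<close> by (smt (verit))
        then show ?thesis
          using bound[OF \<open>k \<le> M\<close> i] s(1) by (simp add: abs_mult algebra_simps)
      qed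
      then show ?thesis
        using chart_in_euc[OF Am chart] that(2) VU by (auto simp: cebox_def)
    qed
    note rb = box
    have "p k \<in> V \<and> (\<forall>i<n. \<bar>\<phi> (p k) i - base i - k * s * c i\<bar> \<le> k * s * (\<epsilon> * S)) \<and>
        (\<forall>l<N * N. \<bar>\<rho> (p k) l - mone N l\<bar> \<le> k * s * (N * B * \<eta>))"
      using that
    proof (induction k)
      case 0
      then show ?case
        using oneV by (simp add: p_def \<rho>_one one)
    next
      case (Suc k)
      then have IH: "p k \<in> V" "\<forall>i<n. \<bar>\<phi> (p k) i - base i - k * s * c i\<bar> \<le> k * s * (\<epsilon> * S)"
        "\<forall>l<N * N. \<bar>\<rho> (p k) l - mone N l\<bar> \<le> k * s * (N * B * \<eta>)"
        by auto
      have pk: "p (Suc k) = p k \<cdot> g"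
        by (simp add: p_def)
      have xb: "\<phi> (p k) \<in> ebox n base R"
        using box[OF _ IH(1,2)] Suc.prems cebox_subset_ebox[of "R / 2" R n base] R(1) by auto
      have "join n (\<phi> (p k)) (y s) \<in> ebox (n + n) (join n base base) R"
        using xb ybox baseE join_in_euc ebox_subset by (simp add: ebox_parts subset_iff)
      then have "join n (\<phi> (p k)) (\<phi> g) \<in> Z"
        using R1(2) ebox_mono[OF R(2)] g(2) by auto
      then have pV: "p (Suc k) \<in> V"
        using FQ(1)[OF IH(1) g(1)] pk by simp
      moreover have "\<bar>\<phi> (p (Suc k)) i - base i - Suc k * s * c i\<bar> \<le> Suc k * s * (\<epsilon> * S)" if i: "i < n" for i
      proof -
        have "\<phi> (p (Suc k)) i = F i (join n (\<phi> (p k)) (\<lambda>j. base j + s * c' j))"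
          using FQ(2)[OF IH(1) g(1)] g(2) pk by (simp add: y_def)
        then have "\<bar>\<phi> (p (Suc k)) i - \<phi> (p k) i - s * c' i\<bar> \<le> \<epsilon> * (\<Sum>j<n. \<bar>s * c' j\<bar>)"
          using R1(3)[of "\<phi> (p k)" "\<lambda>j. s * c' j" i] xb ebox_mono[OF R(2)] e R(2) i by force
        moreover have "(\<Sum>j<n. \<bar>s * c' j\<bar>) = s * S"
          using s(1) by (simp add: S_def c'_def abs_mult sum_distrib_left)
        ultimately have "\<bar>\<phi> (p (Suc k)) i - \<phi> (p k) i - s * c i\<bar> \<le> s * (\<epsilon> * S)"
          using i by (simp add: c'_def mult.left_commute)
        moreover have "\<bar>\<phi> (p k) i - base i - k * s * c i\<bar> \<le> k * s * (\<epsilon> * S)"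
          using IH(2) i by blast
        moreover have "Suc k * s * c i = k * s * c i + s * c i" "Suc k * s * (\<epsilon> * S) = k * s * (\<epsilon> * S) + s * (\<epsilon> * S)"
          by (simp_all add: algebra_simps)
        ultimately show ?thesis
          by linarith
      qed
      moreover have "\<bar>\<rho> (p (Suc k)) l - mone N l\<bar> \<le> Suc k * s * (N * B * \<eta>)" if l: "l < N * N" for l
      proof -
        let ?i = "l div N" and ?j = "l mod N"
        note ij = div_mod_less[OF l]
        have "\<rho> (p (Suc k)) = mmul N (\<rho> (p k)) (\<rho> g)"
          using hom[OF IH(1) g(1)] pV pk mult by simp
        moreover have "\<rho> (p k) = mmul N (\<rho> (p k)) (mone N)"
          using mmul_mone_right GM_euc smap_into[OF \<rho> IH(1)] points by metis
        ultimately have "\<rho> (p (Suc k)) l - \<rho> (p k) l = mmul N (\<rho> (p k)) (\<rho> g) l - mmul N (\<rho> (p k)) (mone N) l"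
          by metis
        also have "\<dots> = (\<Sum>m<N. ent N (\<rho> (p k)) ?i m * (ent N (\<rho> g) m ?j - ent N (mone N) m ?j))"
          using l by (simp add: mmul_def enc_def sum_subtractf right_diff_distrib)
        finally have "\<bar>\<rho> (p (Suc k)) l - \<rho> (p k) l\<bar> \<le>
            (\<Sum>m<N. \<bar>ent N (\<rho> (p k)) ?i m * (ent N (\<rho> g) m ?j - ent N (mone N) m ?j)\<bar>)"
          by (simp only: sum_abs)
        also have "\<dots> \<le> (\<Sum>m<N. B * (\<eta> * s))"
        proof (rule sum_mono)
          fix m assume m: "m \<in> {..<N}"
          have "\<bar>ent N (\<rho> (p k)) ?i m\<bar> \<le> B"
            using aB[OF xb] index_bound ij m by (simp add: ent_def a[OF IH(1)])
          moreover have "\<bar>ent N (\<rho> g) m ?j - ent N (mone N) m ?j\<bar> \<le> \<eta> * s"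
            using \<delta>(2)[of s "m * N + ?j"] index_bound[of m N ?j] ij m s a[OF g(1)] a[OF oneV]
            by (simp add: ent_def g(2) \<rho>_one one)
          ultimately show "\<bar>ent N (\<rho> (p k)) ?i m * (ent N (\<rho> g) m ?j - ent N (mone N) m ?j)\<bar> \<le> B * (\<eta> * s)"
            unfolding abs_mult using R2(2) by (intro mult_mono) auto
        qed
        finally have "\<bar>\<rho> (p (Suc k)) l - \<rho> (p k) l\<bar> \<le> s * (N * B * \<eta>)"
          by (simp add: mult.assoc mult.commute mult.left_commute)
        moreover have "\<bar>\<rho> (p k) l - mone N l\<bar> \<le> k * s * (N * B * \<eta>)"
          using IH(3) l by blast
        moreover have "Suc k * s * (N * B * \<eta>) = k * s * (N * B * \<eta>) + s * (N * B * \<eta>)"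
          by (simp add: algebra_simps)
        ultimately show ?thesis
          by linarith
      qed
      ultimately show ?case
        by blast
    qed
    then show "p k \<in> V \<and> (\<forall>i<n. \<bar>\<phi> (p k) i - base i - k * s * c i\<bar> \<le> k * s * (\<epsilon> * S))"
      and "\<forall>l<N * N. \<bar>\<rho> (p k) l - mone N l\<bar> \<le> k * s * (N * B * \<eta>)"
      by auto
  qed
  have pM: "p M \<in> V" "\<And>i. i < n \<Longrightarrow> \<bar>\<phi> (p M) i - base i - T * c i\<bar> \<le> T * (\<epsilon> * S)"
    "\<And>l. l < N * N \<Longrightarrow> \<bar>\<rho> (p M) l - mone N l\<bar> \<le> T * (N * B * \<eta>)"
    using inv[of M] rho[of M] s(2) by auto
  have "\<phi> (p M) \<in> K"
  proof -
    have "\<bar>\<phi> (p M) i - base i\<bar> \<le> R / 2" if i: "i < n" for i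
    proof -
      have "\<bar>T * c i\<bar> + T * (\<epsilon> * S) \<le> R / 2"
        using bound[of M i, unfolded s(2)] i T(1) by (simp add: abs_mult algebra_simps)
      then show ?thesis
        using pM(2)[OF i] by linarith
    qed
    moreover have "T * \<bar>c j0\<bar> / 2 \<le> \<bar>\<phi> (p M) j0 - base j0\<bar>"
    proof -
      have "T * (\<epsilon> * S) = T * \<bar>c j0\<bar> / 2" "\<bar>T * c j0\<bar> = T * \<bar>c j0\<bar>"
        using \<epsilon>(2) T(1) by (simp_all add: abs_mult)
      then show ?thesis
        using pM(2)[OF j0] by linarith
    qed
    ultimately show ?thesis
      using chart_in_euc[OF Am chart] pM(1) VU by (auto simp: K_def cebox_def)
  qed
  then have "\<mu> \<le> f (\<phi> (p M))"
    by (rule \<mu>(2))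
  also have "\<dots> \<le> (\<Sum>l<N * N. T * (N * B * \<eta>))"
    unfolding f_def a[OF pM(1)] using pM(3) by (intro sum_mono) auto
  also have "\<dots> = q * \<eta>"
    by (simp add: q_def)
  finally show False
    using \<eta>(2) by simp
qed

text \<open>Read in the chart at \<open>h\<close>, the matrix entries of
  \<open>invg h \<star> x\<close> are those of \<open>\<rho>\<close> near the unit. If two tangent
  vectors at \<open>h\<close> have the same image, the differences of their coordinates satisfy the
  equations of \<open>rho_rank\<close>.\<close>

lemma immersion_incl: "immersion HM GM (\<lambda>h. h)"
  unfolding immersion_def
proof (intro conjI ballI)
  show "smooth_map HM GM (\<lambda>h. h)"
    using smap_incl smooth_map_iff_smap[OF HM_manifold Gm] by (simp add: HM_points)
  fix h assume "h \<in> mpoints HM"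
  then have h: "h \<in> H" and hG: "h \<in> carrier \<G>"
    using HM_points H_carrier by auto
  let ?\<psi> = "\<lambda>g. \<phi> (R h g)"
  note chH = HM_chart[OF h]
  have Wc: "W = carrier \<G>"
    using points lie_group_points[OF lieG] by simp
  obtain \<xi> P where \<xi>: "mopen HM P" "h \<in> P" "P \<subseteq> L h ` V" "\<And>i. i < n \<Longrightarrow> \<xi> i \<in> smooth_funs HM"
    "\<And>i g. i < n \<Longrightarrow> g \<in> P \<Longrightarrow> \<xi> i g = ?\<psi> g i"
  proof -
    obtain \<eta> P C where *: "\<eta> \<in> smooth_funs HM" "mopen HM P" "h \<in> P" "P \<subseteq> C" "\<And>q. q \<in> P \<Longrightarrow> \<eta> q = 1"
      "closedin (mtop HM) C" "C \<subseteq> L h ` V" "\<And>q. q \<notin> C \<Longrightarrow> \<eta> q = 0"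
      by (rule bump_exists[OF HM_manifold LV_open[OF h] mem_LV[OF h]]) blast
    show thesis
      by (rule that[of P "\<lambda>i. cut_ext \<eta> (L h ` V) (\<lambda>g. ?\<psi> g i)"])
        (use * cut_ext_smooth[OF HM_manifold *(1,6,7,8) msmooth_chart_coord[OF HM_manifold chH]] in \<open>auto simp: cut_ext_def\<close>)
  qed
  have "\<exists>g\<in>smooth_funs GM. \<exists>P. mopen GM P \<and> h \<in> P \<and> (\<forall>x\<in>P. g x = mmul N (invg h) x k)" if k: "k < N * N" for k
  proof -
    have op: "mopen GM W"
      using points openin_topspace by metis
    have "smap GM GM W (\<lambda>x. invg h \<star> x)"
      using hG Wc points by (intro smap_mult[OF lieG Gm] smap_const[OF Gm op] smap_id[OF Gm op]) auto
    from smap_GM_coord[OF this k] have "msmooth GM W (\<lambda>x. mmul N (invg h) x k)"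
      by (simp add: mult)
    then show ?thesis
      by (rule smooth_extension[OF Gm _, of _ _ h]) (use hG Wc in blast)+
  qed
  then obtain g P' where g: "\<And>k. k < N * N \<Longrightarrow> g k \<in> smooth_funs GM \<and> mopen GM (P' k) \<and> h \<in> P' k \<and>
      (\<forall>x\<in>P' k. g k x = mmul N (invg h) x k)"
    by metis
  have pb: "pullback HM (\<lambda>h. h) f \<in> smooth_funs HM" if "f \<in> smooth_funs GM" for f
    using pullback_smooth[OF HM_manifold Gm _ that] smap_incl by (simp add: HM_points)
  have cpd_g: "cpd (L h ` V) ?\<psi> i (pullback HM (\<lambda>h. h) (g k)) h = cpd U \<phi> i (\<lambda>x. \<rho> x k) \<e>"
    if k: "k < N * N" and i: "i < n" for k i
  proof (rule cpd_eqI)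
    have sL: "smap A GM V (L h)"
      unfolding L_def using hG lie_group_points[OF lieG] by (intro smap_mult[OF lieG Am] smap_const[OF Am Vopen] \<rho>) simp
    define O' where "O' = {x \<in> V. L h x \<in> P' k}"
    have O': "mopen A O'" "\<e> \<in> O'" "O' \<subseteq> V"
      using smap_preimage[OF sL] g[OF k] oneV L_one[OF h] by (auto simp: O'_def)
    have eO: "eopen n (\<phi> ` O')"
      using chart_image_open[OF Am chart O'(1)] O'(3) VU by (simp add: Int_absorb1)
    have "has_pderiv i (\<lambda>x. pullback HM (\<lambda>h. h) (g k) (inv_into (L h ` V) ?\<psi> x)) base (cpd U \<phi> i (\<lambda>x. \<rho> x k) \<e>)"
    proof (rule has_pderiv_cong[OF eO imageI[OF O'(2)] i])
      show "has_pderiv i (\<lambda>x. \<rho> (pt x) k) base (cpd U \<phi> i (\<lambda>x. \<rho> x k) \<e>)"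
        using cpd_has_pderiv[OF Am chart smap_GM_coord[OF \<rho> k] _ oneV i] oneV VU by blast
      fix z assume "z \<in> \<phi> ` O'"
      then obtain x where x: "x \<in> V" "L h x \<in> P' k" "z = \<phi> x"
        by (auto simp: O'_def)
      have "inv_into (L h ` V) ?\<psi> z = L h x"
        using chart_inv[OF HM_manifold chH, of "L h x"] x R_L[OF h] by simp
      moreover have "mmul N (invg h) (L h x) = \<rho> x"
        using hG \<rho>G[OF x(1)] by (simp add: mult[symmetric] L_def G.m_assoc[symmetric])
      moreover have "pt z = x"
        using chart_inv[OF Am chart] x VU by auto
      ultimately show "\<rho> (pt z) k = pullback HM (\<lambda>h. h) (g k) (inv_into (L h ` V) ?\<psi> z)"
        using g[OF k] x L_H[OF h x(1)] by (simp add: pullback_def HM_points)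
    qed
    then show "has_pderiv i (\<lambda>x. pullback HM (\<lambda>h. h) (g k) (inv_into (L h ` V) ?\<psi> x)) (?\<psi> h) (cpd U \<phi> i (\<lambda>x. \<rho> x k) \<e>)"
      using R_self[OF h] by simp
  qed
  show "inj_on (differential HM GM (\<lambda>h. h)) (tangent_space HM h)"
  proof (rule inj_onI)
    fix v w assume v: "v \<in> tangent_space HM h" and w: "w \<in> tangent_space HM h"
      and eq: "differential HM GM (\<lambda>h. h) v = differential HM GM (\<lambda>h. h) w"
    have coord: "u f = (\<Sum>i<n. u (\<xi> i) * cpd (L h ` V) ?\<psi> i f h)" if "u \<in> tangent_space HM h" "f \<in> smooth_funs HM" for u f
      using tangent_coord[OF HM_manifold chH that(1) \<xi>(1,2,3), of \<xi> f] \<xi>(4,5) that(2) by simp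
    have "v (\<xi> i) - w (\<xi> i) = 0" if "i < n" for i
    proof (rule rho_rank[OF _ that])
      fix k assume k: "k < N * N"
      have "v (pullback HM (\<lambda>h. h) (g k)) = w (pullback HM (\<lambda>h. h) (g k))"
        using fun_cong[OF eq, of "g k"] g[OF k] by (simp add: differential_def)
      then show "(\<Sum>i<n. (v (\<xi> i) - w (\<xi> i)) * cpd U \<phi> i (\<lambda>x. \<rho> x k) \<e>) = 0"
        using coord[OF v pb] coord[OF w pb] g[OF k] cpd_g[OF k] by (simp add: left_diff_distrib sum_subtractf)
    qed
    then have "v f = w f" if "f \<in> smooth_funs HM" for f
      using coord[OF v that] coord[OF w that] by simp
    moreover have "v f = w f" if "f \<notin> smooth_funs HM" for f
      using v w that by (simp add: tangent_space_def)
    ultimately show "v = w"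
      by blast
  qed
qed

lemma H_lie_subgroup: "lie_subgroup H HM \<G> GM"
  unfolding lie_subgroup_def using H_subgroup H_lie_group immersion_incl by blast

end

section \<open>The flat connection of an open subset of Euclidean space\<close>

definition open_mfd :: "nat \<Rightarrow> (nat \<Rightarrow> real) set \<Rightarrow> (nat \<Rightarrow> real) mfd"
  where "open_mfd d W = \<lparr>mtop = subtopology (Euclidean_space d) W, mdim = d, matlas = {(W, \<lambda>x. x)}\<rparr>"

locale open_euclidean =
  fixes d W
  assumes W: "eopen d W"
begin

abbreviation M where "M \<equiv> open_mfd d W"

lemma M_simps [simp]: "mdim M = d" "matlas M = {(W, \<lambda>x. x)}" "mpoints M = W"
  using eopen_subset[OF W] by (auto simp: open_mfd_def Int_absorb1)

lemma M_open: "mopen M S \<longleftrightarrow> eopen d S \<and> S \<subseteq> W"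
  by (simp add: open_mfd_def openin_open_subtopology[OF W])

lemma inv_id: "x \<in> W \<Longrightarrow> inv_into W (\<lambda>x. x) x = x"
  by (rule inv_into_f_f[of "\<lambda>x. x"]) (simp_all add: inj_on_def)

lemma M: "smooth_manifold M"
proof (rule smooth_manifoldI)
  have "Hausdorff_space (Euclidean_space d)"
    unfolding Euclidean_space_eq by (intro Hausdorff_space_subtopology) simp
  then show "Hausdorff_space (mtop M)"
    by (simp add: open_mfd_def Hausdorff_space_subtopology)
  show "mopen M {p \<in> U. \<phi> p \<in> V}" if "(U, \<phi>) \<in> matlas M" "eopen (mdim M) V" for U \<phi> V
    using that W openin_Int[OF W, of V] by (auto simp: M_open Int_def)
  show "smooth_on (mdim M) (\<phi> ` (U \<inter> V)) (\<lambda>x. \<psi> (inv_into U \<phi> x) i)"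
    if "(U, \<phi>) \<in> matlas M" "(V, \<psi>) \<in> matlas M" "i < mdim M" for U \<phi> V \<psi> i
    using that by (auto intro!: smooth_on_cong[OF W _ smooth_on_coord[OF W, of i]] simp: inv_id)
qed (use W M_open in auto)

lemma msmoothI_open: "smooth_on d S f \<Longrightarrow> eopen d S \<Longrightarrow> S \<subseteq> W \<Longrightarrow> msmooth M S f"
  by (auto simp: msmooth_def M_open Int_absorb1 subset_iff inv_id intro!: smooth_on_cong[of d S f])

lemma smapI_coords:
  assumes L: "smooth_manifold L" and P: "mopen L P" and F: "F ` P \<subseteq> W" and s: "\<And>k. k < d \<Longrightarrow> msmooth L P (\<lambda>p. F p k)"
  shows "smap L M P F"
  by (rule smapI_local[OF L M P], rule exI[of _ W], rule exI[of _ "\<lambda>x. x"], rule exI[of _ P]) (use assms in auto)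

definition xc :: "nat \<Rightarrow> (nat \<Rightarrow> real) \<Rightarrow> real"
  where "xc k p = (if p \<in> W then p k else 0)"

definition E :: "nat \<Rightarrow> (nat \<Rightarrow> real) vfield"
  where "E k f p = (if f \<in> smooth_funs M \<and> p \<in> W then cpd W (\<lambda>x. x) k f p else 0)"

text \<open>The standard flat connection: the components \<open>Y (xc k)\<close> of \<open>Y\<close>
  are differentiated along \<open>X\<close>.\<close>

definition nab :: "(nat \<Rightarrow> real) connection"
  where "nab X Y = (\<lambda>f p. \<Sum>k<d. X (Y (xc k)) p * E k f p)"

lemma xc_smooth: "xc k \<in> smooth_funs M"
proof -
  have "msmooth M W (xc k)"
    by (rule msmoothI_open[OF smooth_on_cong[OF W _ smooth_on_coord[OF W, of k]] W]) (simp_all add: xc_def)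
  then show ?thesis
    by (simp add: smooth_funs_iff[OF M] xc_def)
qed

lemma E_vf: "k < d \<Longrightarrow> E k \<in> vector_fields M"
proof (rule vfI[OF _ _ _ M])
  assume k: "k < d"
  show "E k f \<in> smooth_funs M" if f: "f \<in> smooth_funs M" for f
  proof -
    have "msmooth M W f"
      using f smooth_funs_iff[OF M] by simp
    from cpd_msmooth[OF M _ this] have "msmooth M W (cpd W (\<lambda>x. x) k f)"
      using k by simp
    then have "msmooth M W (E k f)"
      by (rule msmooth_cong[OF M, rotated]) (simp add: E_def f)
    then show ?thesis
      by (simp add: smooth_funs_iff[OF M] E_def)
  qed
  show "(\<lambda>f. E k f p) \<in> tangent_space M p" if "p \<in> mpoints M" for p
    using cpd_tangent[OF M, of W "\<lambda>x. x" p k] that k by (simp add: E_def cong: if_cong)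
qed (simp add: E_def)

lemma E_xc: "k < d \<Longrightarrow> E k (xc j) p = (if k = j \<and> p \<in> W then 1 else 0)"
  using cpd_coord[OF M, of W "\<lambda>x. x" W p k "xc j" j] W xc_smooth[of j] by (auto simp: E_def M_open xc_def)

lemma vf_expand: "X \<in> vector_fields M \<Longrightarrow> X f p = (\<Sum>k<d. X (xc k) p * E k f p)"
proof (cases "f \<in> smooth_funs M \<and> p \<in> W")
  case True
  assume "X \<in> vector_fields M"
  then show ?thesis
    using tangent_coord[OF M _ vf_tangent, of W "\<lambda>x. x" X W p xc f] True W xc_smooth by (simp add: M_open xc_def E_def)
next
  case False
  assume "X \<in> vector_fields M"
  then show ?thesis
    using False smooth_funs_outside[of "X f" M p] vf_junk[of X M f] vf_smooth[of X M f] by (cases "f \<in> smooth_funs M") (auto simp: E_def)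
qed

lemma nab_xc:
  assumes "j < d" "X \<in> vector_fields M" "Y \<in> vector_fields M"
  shows "nab X Y (xc j) = X (Y (xc j))"
proof
  fix p
  have "nab X Y (xc j) p = (\<Sum>k<d. if k = j then (if p \<in> W then X (Y (xc j)) p else 0) else 0)"
    unfolding nab_def by (rule sum.cong) (auto simp: E_xc)
  also have "\<dots> = X (Y (xc j)) p"
    using assms smooth_funs_outside[OF vf_smooth[OF assms(2) vf_smooth[OF assms(3) xc_smooth]], of p] by simp
  finally show "nab X Y (xc j) p = X (Y (xc j)) p" .
qed

lemma nab_vf:
  assumes X: "X \<in> vector_fields M" and Y: "Y \<in> vector_fields M"
  shows "nab X Y \<in> vector_fields M"
  unfolding nab_def
proof (rule vf_sum[OF M, of "{..<d}" "\<lambda>k h p. X (Y (xc k)) p * E k h p"])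
  show "(\<lambda>h p. X (Y (xc k)) p * E k h p) \<in> vector_fields M" if "k \<in> {..<d}" for k
    using that by (intro vf_scale[OF M E_vf vf_smooth[OF X vf_smooth[OF Y xc_smooth]]]) simp
qed

lemma vf_eqI:
  assumes X: "X \<in> vector_fields M" and Y: "Y \<in> vector_fields M" and eq: "\<And>k p. k < d \<Longrightarrow> p \<in> W \<Longrightarrow> X (xc k) p = Y (xc k) p"
  shows "X = Y"
proof (intro ext)
  fix f p
  show "X f p = Y f p"
    unfolding vf_expand[OF X, of f] vf_expand[OF Y, of f] using eq by (intro sum.cong) (auto simp: E_def)
qed

text \<open>The components of \<open>nab X Y\<close> are \<open>X (Y (xc k))\<close>, so vanishing
  torsion and curvature both reduce to the definition of the bracket.\<close>

lemma flat_affine_nab: "flat_affine M nab"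
  unfolding flat_affine_def linear_connection_def
proof (intro conjI ballI)
  fix X Y Z assume V: "X \<in> vector_fields M" "Y \<in> vector_fields M" "Z \<in> vector_fields M"
  show "nab X Y \<in> vector_fields M"
    by (rule nab_vf[OF V(1,2)])
  show "nab (\<lambda>h p. f p * X h p + g p * Y h p) Z = (\<lambda>h p. f p * nab X Z h p + g p * nab Y Z h p)" for f g
    by (intro ext) (simp add: nab_def distrib_right sum.distrib sum_distrib_left mult.assoc)
  have "X (\<lambda>p. Y (xc k) p + Z (xc k) p) p = X (Y (xc k)) p + X (Z (xc k)) p" for k p
    by (rule tangent_add[OF vf_tangent[OF V(1)]]) (intro vf_smooth[OF _ xc_smooth] V)+
  then show "nab X (\<lambda>h p. Y h p + Z h p) = (\<lambda>h p. nab X Y h p + nab X Z h p)"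
    by (intro ext) (simp add: nab_def distrib_right sum.distrib)
  show "nab X (\<lambda>h p. f p * Y h p) = (\<lambda>h p. X f p * Y h p + f p * nab X Y h p)" if f: "f \<in> smooth_funs M" for f
  proof (intro ext)
    fix h p
    have "X (\<lambda>p. f p * Y (xc k) p) p = X f p * Y (xc k) p + f p * X (Y (xc k)) p" for k
      by (rule tangent_mult[OF vf_tangent[OF V(1)] f vf_smooth[OF V(2) xc_smooth]])
    then show "nab X (\<lambda>h p. f p * Y h p) h p = X f p * Y h p + f p * nab X Y h p"
      by (simp add: nab_def vf_expand[OF V(2), of h] distrib_right sum.distrib sum_distrib_left mult.assoc)
  qed
  have br: "lie_bracket X Y (xc k) p = X (Y (xc k)) p - Y (X (xc k)) p" for k p
    by (simp add: lie_bracket_def)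
  show "torsion nab X Y = (\<lambda>h p. 0)"
  proof (intro ext)
    fix h p
    show "torsion nab X Y h p = 0"
      by (simp add: torsion_def nab_def vf_expand[OF vf_lie_bracket[OF M V(1,2)], of h] br left_diff_distrib sum_subtractf)
  qed
  have "nab X (nab Y Z) h p = (\<Sum>k<d. X (Y (Z (xc k))) p * E k h p)"
    "nab Y (nab X Z) h p = (\<Sum>k<d. Y (X (Z (xc k))) p * E k h p)" for h p
    unfolding nab_def[of _ "nab _ _"] using nab_xc V by simp_all
  moreover have "nab (lie_bracket X Y) Z h p = (\<Sum>k<d. (X (Y (Z (xc k))) p - Y (X (Z (xc k))) p) * E k h p)" for h p
    by (simp add: nab_def lie_bracket_def)
  ultimately show "curvature nab X Y Z = (\<lambda>h p. 0)"
    by (intro ext) (simp add: curvature_def left_diff_distrib sum_subtractf)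
qed

text \<open>A linear map pulls coordinates back to combinations with constant coefficients, which
  pass through both derivatives in \<open>nab\<close>. The sum over \<open>m\<close> terms with
  selected positions \<open>b k j\<close> fits matrix multiplication, where each entry involves only
  \<open>N\<close> of the \<open>N * N\<close> coordinates.\<close>

lemma linear_affine:
  assumes F: "F \<in> diffeos M" and lin: "\<And>p k. p \<in> W \<Longrightarrow> k < d \<Longrightarrow> F p k = (\<Sum>j<m. a k j * p (b k j))"
    and b: "\<And>k j. k < d \<Longrightarrow> j < m \<Longrightarrow> b k j < d"
  shows "F \<in> affine_transformations M nab"
proof -
  have "pushforward M F (nab X Y) = nab (pushforward M F X) (pushforward M F Y)"
    if V: "X \<in> vector_fields M" "Y \<in> vector_fields M" for X Y
  proof (rule vf_eqI)
    note pf = pushforward_vf[OF M F]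
    show "pushforward M F (nab X Y) \<in> vector_fields M" "nab (pushforward M F X) (pushforward M F Y) \<in> vector_fields M"
      by (intro pf nab_vf V)+
    fix k q assume k: "k < d" and "q \<in> W"
    then obtain p where p: "p \<in> W" "q = F p"
      using diffeo_onto[OF M F] by auto
    have pb: "pullback M F (xc k) = (\<lambda>p. \<Sum>j<m. a k j * xc (b k j) p)"
      using lin k diffeo_into[OF M F] by (auto simp: pullback_def xc_def)
    have lin_vf: "X (\<lambda>p. \<Sum>j<m. a k j * f j p) = (\<lambda>p. \<Sum>j<m. a k j * X (f j) p)"
      if "X \<in> vector_fields M" "\<And>j. f j \<in> smooth_funs M" for X f
    proof
      fix p
      show "X (\<lambda>p. \<Sum>j<m. a k j * f j p) p = (\<Sum>j<m. a k j * X (f j) p)"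
        using tangent_sum[OF M vf_tangent[OF that(1)], of "{..<m}" "\<lambda>j p. a k j * f j p" p]
          tangent_cmult[OF M vf_tangent[OF that(1)] that(2)] smooth_funs_cmult[OF M that(2)] by simp
    qed
    have "pullback M F (pushforward M F Y (xc k)) = (\<lambda>p. \<Sum>j<m. a k j * Y (xc (b k j)) p)"
    proof
      fix p
      show "pullback M F (pushforward M F Y (xc k)) p = (\<Sum>j<m. a k j * Y (xc (b k j)) p)"
        using pushforward_at[OF M F xc_smooth, of p Y k] lin_vf[OF V(2) xc_smooth]
          smooth_funs_outside[OF vf_smooth[OF V(2) xc_smooth], of p] by (simp add: pullback_def[of M F "pushforward M F Y (xc k)"] pb)
    qed
    then have "nab (pushforward M F X) (pushforward M F Y) (xc k) q = (\<Sum>j<m. a k j * X (Y (xc (b k j))) p)"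
      using nab_xc[OF k pf[OF V(1)] pf[OF V(2)]] pushforward_at[OF M F vf_smooth[OF pf[OF V(2)] xc_smooth], of p X] p
        lin_vf[OF V(1) vf_smooth[OF V(2) xc_smooth]] by simp
    moreover have "pushforward M F (nab X Y) (xc k) q = (\<Sum>j<m. a k j * nab X Y (xc (b k j)) p)"
      using pushforward_at[OF M F xc_smooth, of p "nab X Y" k] p lin_vf[OF nab_vf[OF V] xc_smooth] by (simp add: pb)
    ultimately show "pushforward M F (nab X Y) (xc k) q = nab (pushforward M F X) (pushforward M F Y) (xc k) q"
      using nab_xc[OF b[OF k]] V by simp
  qed
  then show ?thesis
    using F by (simp add: affine_transformations_def)
qed

end

section \<open>The identity component of the general linear group\<close>

text \<open>Right translations are the left translations of the opposite group, which is a Lie group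
  on the same manifold.\<close>

lemma right_translation_diffeo:
  fixes G (structure)
  assumes G: "lie_group G M" and g: "g \<in> carrier G"
  shows "right_translation G g \<in> diffeos M"
proof -
  define G' where "G' = \<lparr>carrier = carrier G, mult = (\<lambda>x y. y \<otimes> x), one = \<one>\<rparr>"
  interpret group G
    by (rule lie_group_group[OF G])
  note M = lie_group_mfd[OF G] and pts = lie_group_points[OF G]
  have G': "group G'"
    by (rule groupI) (auto simp: G'_def m_assoc intro: exI[of _ "inv x" for x] r_inv)
  have inv: "inv\<^bsub>G'\<^esub> x = inv x" if "x \<in> carrier G" for x
    using that by (intro group.inv_equality[OF G']) (auto simp: G'_def)
  note P = smooth_manifold_prod[OF M M]
  have op: "mopen (prod_mfd M M) (carrier G \<times> carrier G)"
    by (metis pts prod_mfd_simps(1) topspace_prod_topology openin_topspace)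
  have "smap (prod_mfd M M) M (carrier G \<times> carrier G) (\<lambda>z. snd z \<otimes> fst z)"
    by (intro smap_mult[OF G P] smap_fst[OF M M op] smap_snd[OF M M op])
  moreover have "smap M M (carrier G) (\<lambda>x. inv\<^bsub>G'\<^esub> x)"
    by (rule smap_cong[OF M lie_group_inv[OF G]]) (simp add: inv)
  ultimately have "lie_group G' M"
    using G' M smooth_map_iff_smap[OF P M] smooth_map_iff_smap[OF M M]
    by (simp add: lie_group_def pts case_prod_beta' G'_def)
  then have "left_translation G' g \<in> diffeos M"
    using g by (intro left_translation_diffeo(1)) (auto simp: G'_def)
  then show ?thesis
    by (simp add: left_translation_def right_translation_def G'_def)
qed

definition mat_of :: "nat \<Rightarrow> (nat \<Rightarrow> real) \<Rightarrow> real mat"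
  where "mat_of N x = Matrix.mat N N (\<lambda>(i, j). ent N x i j)"

definition mdet :: "nat \<Rightarrow> (nat \<Rightarrow> real) \<Rightarrow> real"
  where "mdet N x = Determinant.det (mat_of N x)"

text \<open>The adjugate divided by the determinant, which exhibits the entries as smooth functions
  wherever the determinant does not vanish.\<close>

definition minv :: "nat \<Rightarrow> (nat \<Rightarrow> real) \<Rightarrow> nat \<Rightarrow> real"
  where "minv N x = enc N (\<lambda>i j. inverse (mdet N x) * adj_mat (mat_of N x) $$ (i, j))"

definition GL :: "nat \<Rightarrow> (nat \<Rightarrow> real) set"
  where "GL N = {x \<in> euc (N * N). mdet N x \<noteq> 0}"

lemma mat_of_carrier [simp]: "mat_of N x \<in> carrier_mat N N"
  by (simp add: mat_of_def)

lemma mat_of_mmul: "mat_of N (mmul N x y) = mat_of N x * mat_of N y"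
  by (rule eq_matI) (auto simp: mat_of_def mmul_def scalar_prod_def lessThan_atLeast0)

lemma mat_of_mone: "mat_of N (mone N) = 1\<^sub>m N"
  by (rule eq_matI) (auto simp: mat_of_def mone_def)

lemma mat_of_inj: "x \<in> euc (N * N) \<Longrightarrow> y \<in> euc (N * N) \<Longrightarrow> mat_of N x = mat_of N y \<Longrightarrow> x = y"
proof (rule ent_eqI)
  fix i j assume "mat_of N x = mat_of N y" "i < N" "j < N"
  then have "mat_of N x $$ (i, j) = mat_of N y $$ (i, j)" "i < N" "j < N"
    by auto
  then show "ent N x i j = ent N y i j"
    by (simp add: mat_of_def)
qed

lemma mdet_mmul: "mdet N (mmul N x y) = mdet N x * mdet N y"
  by (simp add: mdet_def mat_of_mmul det_mult[of _ N])

lemma mdet_mone: "mdet N (mone N) = 1"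
  by (simp add: mdet_def mat_of_mone)

lemma GL_mmul: "x \<in> GL N \<Longrightarrow> y \<in> GL N \<Longrightarrow> mmul N x y \<in> GL N"
  by (simp add: GL_def mdet_mmul) (simp add: mmul_def)

lemma GL_mone: "mone N \<in> GL N"
  by (simp add: GL_def mdet_mone mone_in_euc)

lemma minv:
  assumes x: "x \<in> GL N"
  shows minv_right: "mmul N x (minv N x) = mone N" and minv_left: "mmul N (minv N x) x = mone N" and minv_GL: "minv N x \<in> GL N"
proof -
  have d: "mdet N x \<noteq> 0"
    using x by (simp add: GL_def)
  note adj = adj_mat[OF mat_of_carrier[of N x]]
  have mi: "mat_of N (minv N x) = inverse (mdet N x) \<cdot>\<^sub>m adj_mat (mat_of N x)"
    using adj(1) by (intro eq_matI) (auto simp: mat_of_def minv_def)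
  have one: "inverse (mdet N x) \<cdot>\<^sub>m (mdet N x \<cdot>\<^sub>m 1\<^sub>m N) = 1\<^sub>m N"
    using d by (intro eq_matI) auto
  have "mat_of N (mmul N x (minv N x)) = 1\<^sub>m N"
    using adj(2) one by (simp add: mat_of_mmul mi mult_smult_distrib[OF mat_of_carrier adj(1)] mdet_def)
  moreover have "mat_of N (mmul N (minv N x) x) = 1\<^sub>m N"
    using adj(3) one by (simp add: mat_of_mmul mi mult_smult_assoc_mat[OF adj(1) mat_of_carrier] mdet_def)
  ultimately show 1: "mmul N x (minv N x) = mone N" and "mmul N (minv N x) x = mone N"
    by (auto intro!: mat_of_inj[of _ N] simp: mat_of_mone mone_in_euc mmul_def[of N "_ :: nat \<Rightarrow> real"])
  have "mdet N x * mdet N (minv N x) = 1"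
    using mdet_mmul[of N x "minv N x"] 1 mdet_mone by simp
  then show "minv N x \<in> GL N"
    by (auto simp: GL_def) (simp add: minv_def)
qed

lemma smooth_on_det:
  assumes U: "eopen n U" and m: "\<And>i j. i < K \<Longrightarrow> j < K \<Longrightarrow> smooth_on n U (\<lambda>x. m x i j)"
  shows "smooth_on n U (\<lambda>x. Determinant.det (Matrix.mat K K (\<lambda>(i, j). m x i j)))"
proof -
  have "smooth_on n U (\<lambda>x. \<Sum>p | p permutes {0..<K}. signof p * (\<Prod>i = 0..<K. m x i (p i)))"
    using m by (intro smooth_on_sum[OF U] smooth_on_mult[OF U] smooth_on_prod[OF U] smooth_on_const[OF U])
      (auto simp: permutes_in_image)
  moreover have "Determinant.det (Matrix.mat K K (\<lambda>(i, j). m x i j)) = (\<Sum>p | p permutes {0..<K}. signof p * (\<Prod>i = 0..<K. m x i (p i)))" for x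
    unfolding det_def by (auto simp: permutes_in_image intro!: sum.cong prod.cong)
  ultimately show ?thesis
    by simp
qed

lemma smooth_on_mdet: "eopen (N * N) U \<Longrightarrow> smooth_on (N * N) U (mdet N)"
  unfolding mdet_def mat_of_def by (rule smooth_on_det) (simp_all add: ent_def smooth_on_coord)

lemma GL_open: "eopen (N * N) (GL N)"
proof -
  have c: "continuous_on (euc (N * N)) (mdet N)"
    by (rule smooth_on_continuous[OF eopen_euc smooth_on_mdet[OF eopen_euc]])
  show ?thesis
    unfolding eopen_iff
  proof (intro conjI ballI)
    fix x assume x: "x \<in> GL N"
    then obtain r where "r > 0" "ebox (N * N) x r \<subseteq> euc (N * N)" "\<And>y. y \<in> ebox (N * N) x r \<Longrightarrow> \<bar>mdet N y - mdet N x\<bar> < \<bar>mdet N x\<bar>"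
      using continuous_on_box[OF eopen_euc c, of x "\<bar>mdet N x\<bar>"] by (auto simp: GL_def)
    then show "\<exists>r>0. ebox (N * N) x r \<subseteq> GL N"
      by (intro exI[of _ r]) (fastforce simp: GL_def)
  qed (auto simp: GL_def)
qed

lemma smooth_on_minv:
  assumes U: "eopen (N * N) U" "U \<subseteq> GL N"
  shows "smooth_on (N * N) U (\<lambda>x. minv N x k)"
proof (cases "k < N * N")
  case True
  let ?i = "k div N" and ?j = "k mod N"
  note ij = div_mod_less[OF True]
  have del: "mat_delete (mat_of N x) ?j ?i =
      Matrix.mat (N - 1) (N - 1) (\<lambda>(i, j). ent N x (if i < ?j then i else Suc i) (if j < ?i then j else Suc j))" for x
    by (rule eq_matI) (auto simp: mat_delete_def mat_of_def)
  have "smooth_on (N * N) U (\<lambda>x. cofactor (mat_of N x) ?j ?i)"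
    unfolding cofactor_def del
    by (intro smooth_on_mult[OF U(1)] smooth_on_const[OF U(1)] smooth_on_det[OF U(1)]) (simp add: ent_def smooth_on_coord[OF U(1)])
  then have "smooth_on (N * N) U (\<lambda>x. inverse (mdet N x) * cofactor (mat_of N x) ?j ?i)"
    using U(2) by (intro smooth_on_mult[OF U(1)] smooth_on_inverse[OF U(1) _ smooth_on_mdet[OF U(1)]]) (auto simp: GL_def)
  then show ?thesis
    using True ij by (simp add: minv_def enc_def adj_mat_def) (simp add: mat_of_def)
qed (simp add: minv_def enc_def smooth_on_const[OF U(1)])

lemma segment_in_ebox:
  assumes y: "y \<in> ebox n x r" and x: "x \<in> euc n"
  shows "connected_component (ebox n x r) x y"
proof -
  let ?c = "\<lambda>t::real. \<lambda>i. x i + t * (y i - x i)"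
  have "continuous_on {0..1} ?c"
    by (intro continuous_on_coordinatewise_then_product continuous_intros)
  then have "connected (?c ` {0..1})"
    by (rule connected_continuous_image) simp
  moreover have "x \<in> ebox n x r"
    using x y by (auto simp: ebox_def intro: le_less_trans[OF abs_ge_zero])
  then have "?c ` {0..1} \<subseteq> ebox n x r"
    using ebox_segment[OF _ y] by auto
  moreover have "x \<in> ?c ` {0..1}"
    by (rule image_eqI[of _ _ 0]) auto
  moreover have "y \<in> ?c ` {0..1}"
    by (rule image_eqI[of _ _ 1]) auto
  ultimately show ?thesis
    unfolding connected_component_def by blast
qed

definition GL0 :: "nat \<Rightarrow> (nat \<Rightarrow> real) set"
  where "GL0 N = connected_component_set (GL N) (mone N)"

definition GLG :: "nat \<Rightarrow> (nat \<Rightarrow> real) monoid"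
  where "GLG N = \<lparr>carrier = GL0 N, mult = mmul N, one = mone N\<rparr>"

lemma GL0_GL: "x \<in> GL0 N \<Longrightarrow> x \<in> GL N"
  using connected_component_subset by (auto simp: GL0_def)

lemma GL0_euc: "x \<in> GL0 N \<Longrightarrow> x \<in> euc (N * N)"
  using GL0_GL by (auto simp: GL_def)

lemma GL0_mone: "mone N \<in> GL0 N"
  using GL_mone by (simp add: GL0_def connected_component_refl)

lemma GL0_open: "eopen (N * N) (GL0 N)"
  unfolding eopen_iff
proof (intro conjI ballI)
  fix x assume x: "x \<in> GL0 N"
  obtain r where r: "r > 0" "ebox (N * N) x r \<subseteq> GL N"
    using GL_open GL0_GL[OF x] unfolding eopen_iff by blast
  have "y \<in> GL0 N" if "y \<in> ebox (N * N) x r" for y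
  proof -
    have "connected_component (GL N) x y"
      using segment_in_ebox[OF that GL0_euc[OF x]] r(2) connected_component_of_subset by blast
    then show ?thesis
      using x connected_component_trans by (fastforce simp: GL0_def)
  qed
  then show "\<exists>r>0. ebox (N * N) x r \<subseteq> GL0 N"
    using r(1) by blast
qed (use GL0_euc in auto)

text \<open>Left multiplication by \<open>g\<close> is continuous and maps the connected set
  \<open>GL0 N\<close> into \<open>GL N\<close>. With \<open>g\<close> in \<open>GL0 N\<close> this
  yields closure under products, with \<open>g\<close> an inverse it yields closure under
  inverses.\<close>

lemma GL0_translate:
  assumes g: "g \<in> GL N" and y: "y \<in> GL0 N" and z: "z \<in> GL0 N"
  shows "connected_component (GL N) (mmul N g y) (mmul N g z)"
  unfolding connected_component_def
proof (intro exI conjI)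
  have "continuous_on (GL0 N) (mmul N g)"
  proof (rule continuous_on_coordinatewise_then_product)
    show "continuous_on (GL0 N) (\<lambda>x. mmul N g x k)" for k
      by (cases "k < N * N") (auto simp: mmul_def enc_def ent_def
          intro!: continuous_intros continuous_on_subset[OF continuous_on_product_coordinates])
  qed
  then show "connected (mmul N g ` GL0 N)"
    by (rule connected_continuous_image) (simp add: GL0_def)
  show "mmul N g ` GL0 N \<subseteq> GL N"
    using GL_mmul[OF g GL0_GL] by auto
qed (use y z in auto)

lemma GL0_mmul:
  assumes x: "x \<in> GL0 N" and y: "y \<in> GL0 N"
  shows "mmul N x y \<in> GL0 N"
proof -
  have "connected_component (GL N) x (mmul N x y)"
    using GL0_translate[OF GL0_GL[OF x] GL0_mone y] mmul_mone_right[OF GL0_euc[OF x]] by simp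
  then show ?thesis
    using x connected_component_trans by (fastforce simp: GL0_def)
qed

lemma GL0_minv:
  assumes x: "x \<in> GL0 N"
  shows "minv N x \<in> GL0 N"
proof -
  have "connected_component (GL N) (mone N) (minv N x)"
    using GL0_translate[OF minv_GL[OF GL0_GL[OF x]] x GL0_mone] minv_left[OF GL0_GL[OF x]]
      mmul_mone_right[of "minv N x" N] minv_GL[OF GL0_GL[OF x]] by (simp add: GL_def)
  then show ?thesis
    by (simp add: GL0_def)
qed

lemma GLG_group: "group (GLG N)"
proof (rule groupI)
  show "\<exists>y\<in>carrier (GLG N). y \<otimes>\<^bsub>GLG N\<^esub> x = \<one>\<^bsub>GLG N\<^esub>" if "x \<in> carrier (GLG N)" for x
    using that minv_left[OF GL0_GL] GL0_minv by (intro bexI[of _ "minv N x"]) (auto simp: GLG_def)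
qed (auto simp: GLG_def GL0_mmul GL0_mone mmul_assoc mmul_mone_left[OF GL0_euc])

interpretation GLM: open_euclidean "N * N" "GL0 N" for N
  by unfold_locales (rule GL0_open)

lemma GLG_lie_group: "lie_group (GLG N) (open_mfd (N * N) (GL0 N))"
proof -
  let ?M = "open_mfd (N * N) (GL0 N)"
  note M = GLM.M[of N]
  note P = smooth_manifold_prod[OF M M]
  have op: "mopen ?M (GL0 N)"
    by (metis GLM.M_simps(3) openin_topspace)
  have op2: "mopen (prod_mfd ?M ?M) (GL0 N \<times> GL0 N)"
    using op by (simp add: openin_prod_Times_iff)
  have c: "msmooth (prod_mfd ?M ?M) (GL0 N \<times> GL0 N) (\<lambda>z. fst z k)" "msmooth (prod_mfd ?M ?M) (GL0 N \<times> GL0 N) (\<lambda>z. snd z k)"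
    if k: "k < N * N" for k
    using smap_coord[OF smap_fst[OF M M op2], of "GL0 N" "\<lambda>x. x" k] smap_coord[OF smap_snd[OF M M op2], of "GL0 N" "\<lambda>x. x" k]
      smap_into[OF smap_fst[OF M M op2]] smap_into[OF smap_snd[OF M M op2]] k by (simp_all add: conj_absorb cong: conj_cong)
  have "smap (prod_mfd ?M ?M) ?M (GL0 N \<times> GL0 N) (\<lambda>z. mmul N (fst z) (snd z))"
  proof (rule GLM.smapI_coords[OF P op2])
    fix k assume k: "k < N * N"
    note ij = div_mod_less[OF k]
    have "msmooth (prod_mfd ?M ?M) (GL0 N \<times> GL0 N) (\<lambda>z. \<Sum>j<N. ent N (fst z) (k div N) j * ent N (snd z) j (k mod N))"
      unfolding ent_def using ij by (intro msmooth_sum[OF P op2] msmooth_mult[OF P] c index_bound) auto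
    then show "msmooth (prod_mfd ?M ?M) (GL0 N \<times> GL0 N) (\<lambda>z. mmul N (fst z) (snd z) k)"
      using k by (simp add: mmul_def enc_def)
  qed (use GL0_mmul in auto)
  moreover have "smap ?M ?M (GL0 N) (\<lambda>x. inv\<^bsub>GLG N\<^esub> x)"
  proof (rule smap_cong[OF M, of _ _ "minv N"])
    show "smap ?M ?M (GL0 N) (minv N)"
      using GL0_minv GL0_GL by (intro GLM.smapI_coords[OF M op] GLM.msmoothI_open smooth_on_minv GL0_open) auto
    show "minv N x = inv\<^bsub>GLG N\<^esub> x" if "x \<in> GL0 N" for x
      using that GL0_minv minv_left[OF GL0_GL] by (intro group.inv_equality[OF GLG_group, symmetric]) (auto simp: GLG_def)
  qed
  ultimately show ?thesis
    using GLG_group M smooth_map_iff_smap[OF P M] smooth_map_iff_smap[OF M M]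
    by (simp add: lie_group_def case_prod_beta' GLG_def)
qed

lemma GLG_connected: "connected_space (mtop (open_mfd (N * N) (GL0 N)))"
proof -
  have "connectedin (Euclidean_space (N * N)) (GL0 N)"
    using GL0_euc by (auto simp: Euclidean_space_eq connectedin_subtopology GL0_def)
  then show ?thesis
    by (simp add: open_mfd_def connectedin_def)
qed

text \<open>Each entry of a product with \<open>g\<close>, on either side, is a sum of
  \<open>N\<close> entries of the other factor with coefficients from \<open>g\<close>. The index
  functions are the row-major positions of these entries.\<close>

lemma GLG_biinvariant: "flat_affine_biinvariant (GLG N) (open_mfd (N * N) (GL0 N)) (GLM.nab N)"
  unfolding flat_affine_biinvariant_def
proof (intro conjI ballI GLM.flat_affine_nab)
  fix g assume g: "g \<in> carrier (GLG N)"
  show "left_translation (GLG N) g \<in> affine_transformations (open_mfd (N * N) (GL0 N)) (GLM.nab N)"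
    by (rule GLM.linear_affine[OF left_translation_diffeo(1)[OF GLG_lie_group g],
          of "\<lambda>k j. ent N g (k div N) j" "\<lambda>k j. j * N + k mod N" N])
      (auto simp: left_translation_def GLG_def mmul_def enc_def ent_def div_mod_less intro: index_bound)
  show "right_translation (GLG N) g \<in> affine_transformations (open_mfd (N * N) (GL0 N)) (GLM.nab N)"
    by (rule GLM.linear_affine[OF right_translation_diffeo[OF GLG_lie_group g],
          of "\<lambda>k j. ent N g j (k mod N)" "\<lambda>k j. k div N * N + j" N])
      (auto simp: right_translation_def GLG_def mmul_def enc_def ent_def div_mod_less mult.commute[of "g _"] intro: index_bound)
qed

section \<open>The generated subgroup compared with the affine group\<close>

text \<open>At the unit of \<open>H\<close>, the chart parametrisation \<open>L\<close> is
  \<open>\<rho>\<close> itself and \<open>R\<close> is its smooth local inverse. The local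
  isomorphism is then reversed to obtain the stated direction.\<close>

lemma (in local_hom) locally_isomorphic_H: "locally_isomorphic (\<G>\<lparr>carrier := H\<rparr>) HM \<A> A"
proof -
  let ?L = "L \<one>\<^bsub>\<G>\<^esub>"
  have L1: "?L x = \<rho> x" if "x \<in> V" for x
    using \<rho>G[OF that] by (simp add: L_def)
  interpret I: local_iso \<A> A "\<G>\<lparr>carrier := H\<rparr>" HM V ?L "R \<one>\<^bsub>\<G>\<^esub>"
    by unfold_locales
      (use lieA H_lie_group Vopen oneV smap_L[OF H_one] smap_R[OF H_one] R_L[OF H_one] L1 hom in auto)
  obtain P where "local_iso (\<G>\<lparr>carrier := H\<rparr>) HM \<A> A (?L ` P) (R \<one>\<^bsub>\<G>\<^esub>) ?L"
    using I.inverse_local_iso .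
  then show ?thesis
    by (rule local_iso.locally_isomorphic)
qed

lemma connected_neighbourhood:
  assumes M: "smooth_manifold M" and c: "(U, \<phi>) \<in> matlas M" and O: "mopen M O'" "p \<in> O'" "p \<in> U"
  obtains V where "mopen M V" "connectedin (mtop M) V" "p \<in> V" "V \<subseteq> U \<inter> O'"
proof -
  obtain r where r: "r > 0" "ebox (mdim M) (\<phi> p) r \<subseteq> \<phi> ` (U \<inter> O')"
    using chart_box[OF M c O] .
  let ?B = "ebox (mdim M) (\<phi> p) r"
  define V where "V = {q \<in> U. \<phi> q \<in> ?B}"
  have p: "\<phi> p \<in> ?B"
    using chart_in_euc[OF M c O(3)] r(1) by (rule ebox_self)
  have V: "V \<subseteq> U \<inter> O'"
    using r(2) inj_on_image_mem_iff[OF chart_inj[OF M c], of _ "U \<inter> O'"] by (auto simp: V_def)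
  have im: "\<phi> ` V = ?B"
    using r(2) by (auto simp: V_def)
  have "connected_component_set ?B (\<phi> p) = ?B"
    using segment_in_ebox[OF _ chart_in_euc[OF M c O(3)]] connected_component_subset by fast
  then have "connected ?B"
    by (metis connected_connected_component)
  then have "connectedin (subtopology (Euclidean_space (mdim M)) (\<phi> ` U)) (\<phi> ` V)"
    using ebox_subset im by (auto simp: Euclidean_space_eq connectedin_subtopology V_def)
  moreover have "homeomorphic_map (subtopology (mtop M) U) (subtopology (Euclidean_space (mdim M)) (\<phi> ` U)) \<phi>"
    using M c by (auto simp: smooth_manifold_def)
  moreover have "V \<subseteq> topspace (subtopology (mtop M) U)"
    using openin_subset[OF chart_open[OF M c]] by (auto simp: V_def)
  ultimately have "connectedin (subtopology (mtop M) U) V"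
    using homeomorphic_map_connectedness by blast
  then have "connectedin (mtop M) V"
    by (simp add: connectedin_subtopology)
  moreover have "mopen M V"
    unfolding V_def by (rule chart_preimage_open[OF M c eopen_ebox])
  ultimately show thesis
    using that[of V] V p O(3) by (simp add: V_def)
qed

theorem theorem3p2:
  fixes M :: "'a mfd" and nabla :: "'a connection" and A :: "('a \<Rightarrow> 'a) mfd"
  assumes "smooth_manifold M" and "connected_space (mtop M)" and "paracompact_space (mtop M)"
    and "flat_affine M nabla"
    and "affine_lie_group M nabla A"
  shows "\<exists>(G :: (nat \<Rightarrow> real) monoid) GM D H HM.
    lie_group G GM \<and> connected_space (mtop GM) \<and> flat_affine_biinvariant G GM D \<and>
    lie_subgroup H HM G GM \<and> connected_space (mtop HM) \<and>
    locally_isomorphic (G\<lparr>carrier := H\<rparr>) HM (affine_group M nabla) A"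
proof -
  let ?\<A> = "affine_group M nabla"
  have lieA: "lie_group ?\<A> A"
    using assms(5) by (simp add: affine_lie_group_def)
  note Am = lie_group_mfd[OF lieA]
  interpret A: group ?\<A>
    by (rule lie_group_group[OF lieA])
  obtain N W \<rho> where W: "mopen A W" "\<one>\<^bsub>?\<A>\<^esub> \<in> W" and euc: "\<And>F. \<rho> F \<in> euc (N * N)"
    and sm: "\<And>i. msmooth A W (\<lambda>F. \<rho> F i)" and inj: "inj_on \<rho> W" and one: "\<rho> \<one>\<^bsub>?\<A>\<^esub> = mone N"
    and hom: "\<And>F H. F \<in> W \<Longrightarrow> H \<in> W \<Longrightarrow> F \<otimes>\<^bsub>?\<A>\<^esub> H \<in> W \<Longrightarrow> \<rho> (F \<otimes>\<^bsub>?\<A>\<^esub> H) = mmul N (\<rho> F) (\<rho> H)"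
    by (rule local_representation[OF assms(1,2,4,5)]) blast
  let ?GM = "open_mfd (N * N) (GL0 N)"
  \<comment> \<open>As a map into the whole matrix space, \<open>\<rho>\<close> is continuous for
    the manifold topology of \<open>A\<close>. The transformations with image in the identity
    component therefore form an open set, inside which \<open>V\<close> is chosen.\<close>
  interpret E: open_euclidean "N * N" "euc (N * N)"
    by unfold_locales (rule eopen_euc)
  have "smap A E.M W \<rho>"
    using W euc sm by (intro E.smapI_coords[OF Am]) auto
  from smap_preimage[OF this, of "GL0 N"]
  have W': "mopen A {F \<in> W. \<rho> F \<in> GL0 N}"
    using GL0_open GL0_euc by (auto simp: E.M_open)
  have "\<one>\<^bsub>?\<A>\<^esub> \<in> mpoints A"
    by (simp add: lie_group_points[OF lieA])
  then obtain U \<phi> where c: "(U, \<phi>) \<in> matlas A" "\<one>\<^bsub>?\<A>\<^esub> \<in> U"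
    using chart_at[OF Am] by blast
  obtain V where V: "mopen A V" "connectedin (mtop A) V" "\<one>\<^bsub>?\<A>\<^esub> \<in> V" "V \<subseteq> U \<inter> {F \<in> W. \<rho> F \<in> GL0 N}"
    by (rule connected_neighbourhood[OF Am c(1) W' _ c(2)]) (use W(2) one GL0_mone in auto)
  interpret GLG: group "GLG N"
    by (rule GLG_group)
  interpret local_matrix_hom ?\<A> "GLG N" A ?GM U \<phi> V \<rho> N "GL0 N"
  proof
    show "lie_group (GLG N) ?GM"
      by (rule GLG_lie_group)
    show "smap A ?GM V \<rho>"
      using V msmooth_subset[OF Am sm V(1)] by (intro GLM.smapI_coords[OF Am V(1)]) auto
    show "inj_on \<rho> V"
      by (rule inj_on_subset[OF inj]) (use V(4) in auto)
    show "\<rho> (F \<otimes>\<^bsub>?\<A>\<^esub> H) = \<rho> F \<otimes>\<^bsub>GLG N\<^esub> \<rho> H" if "F \<in> V" "H \<in> V" "F \<otimes>\<^bsub>?\<A>\<^esub> H \<in> V" for F H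
      using that V(4) hom[of F H] by (auto simp: GLG_def)
  qed (use lieA c V in \<open>auto simp: open_mfd_def GL0_open GLG_def\<close>)
  show ?thesis
    using GLG_lie_group GLG_connected GLG_biinvariant H_lie_subgroup HM_connected locally_isomorphic_H by blast
qed

end
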